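(* Let $m_1,m_2>0$ and $m_3\ge0$ be arbitrary integers. Fix any $\epsilon>0$ and $\sigma_1,\sigma_2\in\{-1,1\}$. Assume that $a:\mathbb N^{m_1}\to\mathbb C$, $b:\mathbb N^{m_2}\to\mathbb C$ and $c:\mathbb N^{m_3}\to\mathbb C$ are arbitrary functions bounded by $1$ in modulus. For any real numbers $x_1,\ldots,x_{m_1},y_1,\ldots,y_{m_2},z_1,\ldots,z_{m_3},z\ge1$ we have $$\sum_{\substack{\forall i,\ 1\le s_i\le x_i\\ \forall i,\ 1\le t_i\le y_i\\ \forall i,\ 1\le r_i\le z_i}}\delta_{\mathrm{rand}}\Big(\sigma_1\prod_{i=1}^{m_1}s_i\prod_{i=1}^{m_3}r_i,\ \sigma_2\prod_{i=1}^{m_2}t_i\prod_{i=1}^{m_3}r_i\Big)a(\mathbf s)b(\mathbf t)c(\mathbf r)$$ $$\ll(\mathcal X\mathcal Y\mathcal Z)^{1+\epsilon}\left(\frac1{z^{1/9}}+\frac{z^{1/9}}{\sqrt{\min\{\mathcal X,\mathcal Y,\mathcal Z\}}}+\frac{z}{\sqrt{\mathcal X\mathcal Y\mathcal Z}}+\frac{\mathbf 1_{m_3=0}\,z^{4/9}}{\min\{\mathcal X,\mathcal Y\}}\right),$$ where $\mathcal X=\prod_{i=1}^{m_1}x_i$, $\mathcal Y=\prod_{i=1}^{m_2}y_i$, $\mathcal Z=\prod_{i=1}^{m_3}z_i$, the implied constant depends only on $m_1,m_2,m_3$ and $\epsilon$, and $\mathcal Z$ is to be ignored in case $m_3=0$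.
   Context: $\mathbb N=\{1,2,\dots\}$; the variables $s_i,t_i,r_i$ are positive integers; empty products are $1$; $\mathbf 1_{m_3=0}$ equals $1$ if $m_3=0$ and $0$ otherwise. $A\ll B$ means $|A|\le cB$ for a constant $c$. Analytic Hilbert symbol: for a local field $k$ and $a,b\in k^\times$, the Hilbert symbol $(a,b)_k\in\{\pm1\}$ is $1$ if the plane conic $z^2=ax^2+by^2$ has a $k$-rational point and $-1$ otherwise. For a prime $p$ and $t_1,t_2\in\mathbb Q_p$ define $(t_1,t_2)'_p\in\{-1,0,1\}$ to be: $0$ if $t_1=0$ or $t_2=0$; $0$ if $p$ is odd and $v_p(t_1),v_p(t_2)$ are both even; $0$ if $p=2$, $v_2(t_1),v_2(t_2)$ are both even and $t_1/2^{v_2(t_1)}\not\equiv t_2/2^{v_2(t_2)}\bmod4$; and $(t_1,t_2)_{\mathbb Q_p}$ otherwise. For $t_1,t_2\in\mathbb R$ let $(t_1,t_2)'_\infty=0$ if $t_1t_2=0$ and $(t_1,t_2)'_\infty=(t_1,t_2)_{\mathbb R}$ otherwise. For $\mathbf t=(t_1,t_2)\in\mathbb Z^2$ and $z\ge1$ put $$\delta(\mathbf t)=\prod_{p\text{ prime}}\big(1+(t_1,t_2)'_p\big),\qquad \delta_{\det}(\mathbf t)=\big(1+(t_1,t_2)'_\infty\big)\sum_{\substack{1\le s\le z\\ s\text{ square-free}}}\ \prod_{p\mid s}(t_1,t_2)'_p,$$ $$\delta_{\mathrm{rand}}(\mathbf t)=\delta(\mathbf t)-\delta_{\det}(\mathbf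 t)$$ (the product defining $\delta$ has only finitely many factors different from $1$). Thus $\delta_{\mathrm{rand}}$ depends on $z$, which is the same $z$ as in the claim. *)

theory Defs
  imports
    Complex_Main
    "HOL-Library.FuncSet"
    "HOL-Computational_Algebra.Squarefree"
    "HOL-Number_Theory.Cong"
    "HOL-Algebra.QuotRing"
    "HOL-Algebra.Algebraic_Closure_Type"
begin

section \<open>The field of $p$-adic numbers\<close>

text \<open>
  $\mathbb{Q}_p$ is the completion of the rationals with respect to the $p$-adic absolute value:
  the ring of $p$-adic Cauchy sequences of rationals modulo the ideal of null sequences.
\<close>

definition padic_val :: "nat \<Rightarrow> rat \<Rightarrow> int" where
  "padic_val p x = int (multiplicity (int p) (fst (quotient_of x)))
                 - int (multiplicity (int p) (snd (quotient_of x)))"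

definition padic_abs :: "nat \<Rightarrow> rat \<Rightarrow> real" where
  "padic_abs p x = (if x = 0 then 0 else real p powi (- padic_val p x))"

definition padic_Cauchy :: "nat \<Rightarrow> (nat \<Rightarrow> rat) \<Rightarrow> bool" where
  "padic_Cauchy p s \<longleftrightarrow> (\<forall>e>0. \<exists>N. \<forall>m\<ge>N. \<forall>n\<ge>N. padic_abs p (s m - s n) < e)"

definition padic_Cauchy_ring :: "nat \<Rightarrow> (nat \<Rightarrow> rat) ring" where
  "padic_Cauchy_ring p = \<lparr>carrier = {s. padic_Cauchy p s},
     mult = (\<lambda>s t n. s n * t n), one = (\<lambda>_. 1), zero = (\<lambda>_. 0), add = (\<lambda>s t n. s n + t n)\<rparr>"

definition padic_null :: "nat \<Rightarrow> (nat \<Rightarrow> rat) set" where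
  "padic_null p = {s. (\<lambda>n. padic_abs p (s n)) \<longlonglongrightarrow> 0}"

definition padic_field :: "nat \<Rightarrow> (nat \<Rightarrow> rat) set ring" where
  "padic_field p = padic_Cauchy_ring p Quot padic_null p"

context
  fixes p :: nat
  assumes p: "Factorial_Ring.prime p"
begin

lemma padic_val_frac:
  assumes "a \<noteq> 0" "b \<noteq> 0"
  shows "padic_val p (of_int a / of_int b)
       = int (multiplicity (int p) a) - int (multiplicity (int p) b)"
proof -
  define n d where "n = fst (quotient_of (of_int a / of_int b))"
    and "d = snd (quotient_of (of_int a / of_int b))"
  have q: "quotient_of (of_int a / of_int b) = (n, d)"
    by (simp add: n_def d_def)
  have d: "d > 0" using quotient_of_denom_pos[OF q] .
  have e: "(of_int a / of_int b :: rat) = of_int n / of_int d" by (rule quotient_of_div[OF q])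
  then have n: "n \<noteq> 0" using assms d by auto
  from e have "(of_int (a * d) :: rat) = of_int (n * b)"
    using assms d by (simp add: field_simps)
  then have "a * d = n * b" by (simp only: of_int_eq_iff)
  moreover have "prime_elem (int p)" using p by auto
  ultimately have "multiplicity (int p) a + multiplicity (int p) d
      = multiplicity (int p) n + multiplicity (int p) b"
    using assms n d by (metis less_irrefl prime_elem_multiplicity_mult_distrib)
  then show ?thesis unfolding padic_val_def q by simp
qed

lemma rat_frac: obtains a b where "(x :: rat) = of_int a / of_int b" "b \<noteq> 0"
proof -
  obtain n d where q: "quotient_of x = (n, d)" by (cases "quotient_of x") auto
  then show ?thesis using that[of n d] quotient_of_div[OF q] quotient_of_denom_pos[OF q] by simp
qed

lemma padic_val_mult:
  assumes "x \<noteq> 0" "y \<noteq> 0"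
  shows "padic_val p (x * y) = padic_val p x + padic_val p y"
proof -
  obtain a b where x: "x = of_int a / of_int b" "b \<noteq> 0" by (rule rat_frac)
  obtain c d where y: "y = of_int c / of_int d" "d \<noteq> 0" by (rule rat_frac)
  have nz: "a \<noteq> 0" "c \<noteq> 0" using assms x y by auto
  have xy: "x * y = of_int (a * c) / of_int (b * d)" using x y by simp
  have "prime_elem (int p)" using p by auto
  then show ?thesis unfolding xy unfolding x y
    using nz x y padic_val_frac[of "a * c" "b * d"] padic_val_frac[of a b] padic_val_frac[of c d]
    by (simp add: prime_elem_multiplicity_mult_distrib del: of_int_mult)
qed

lemma padic_val_add:
  assumes "x \<noteq> 0" "y \<noteq> 0" "x + y \<noteq> 0"
  shows "min (padic_val p x) (padic_val p y) \<le> padic_val p (x + y)"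
proof -
  obtain a b where x: "x = of_int a / of_int b" "b \<noteq> 0" by (rule rat_frac)
  obtain c d where y: "y = of_int c / of_int d" "d \<noteq> 0" by (rule rat_frac)
  define u v w where "u = a * d" and "v = c * b" and "w = b * d"
  have w: "w \<noteq> 0" using x y by (simp add: w_def)
  have xu: "x = of_int u / of_int w" "y = of_int v / of_int w"
    using x y by (simp_all add: u_def v_def w_def)
  have s: "x + y = of_int (u + v) / of_int w" using xu by (simp add: add_divide_distrib)
  have nz: "u \<noteq> 0" "v \<noteq> 0" "u + v \<noteq> 0" using assms xu s by auto
  have "\<not> is_unit (int p)" using p by auto
  moreover have "int p ^ min (multiplicity (int p) u) (multiplicity (int p) v) dvd u + v"
    by (intro dvd_add multiplicity_dvd') auto
  ultimately have "min (multiplicity (int p) u) (multiplicity (int p) v) \<le> multiplicity (int p) (u + v)"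
    using nz by (intro multiplicity_geI) auto
  then show ?thesis unfolding s unfolding xu
    using padic_val_frac[OF nz(1) w] padic_val_frac[OF nz(2) w] padic_val_frac[OF nz(3) w]
    by linarith
qed

lemma p_gt1: "real p > 1" using prime_gt_1_nat[OF p] by simp

lemma padic_abs_nonneg: "padic_abs p x \<ge> 0" by (simp add: padic_abs_def)

lemma padic_abs_0: "padic_abs p 0 = 0" by (simp add: padic_abs_def)

lemma padic_abs_eq_0: "padic_abs p x = 0 \<longleftrightarrow> x = 0"
  using p_gt1 by (simp add: padic_abs_def power_int_eq_0_iff)

lemma padic_abs_mult: "padic_abs p (x * y) = padic_abs p x * padic_abs p y"
  using p_gt1 by (auto simp: padic_abs_def padic_val_mult power_int_add[symmetric])

lemma padic_abs_1: "padic_abs p 1 = 1"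
  using padic_abs_mult[of 1 1] padic_abs_eq_0[of 1] by simp

lemma padic_abs_uminus: "padic_abs p (- x) = padic_abs p x"
proof -
  have "padic_abs p (-1) * padic_abs p (-1) = 1"
    using padic_abs_mult[of "-1" "-1"] padic_abs_1 by simp
  then have "padic_abs p (-1) = 1"
    using padic_abs_nonneg[of "-1"] by (simp add: square_eq_1_iff)
  then show ?thesis using padic_abs_mult[of "-1" x] by simp
qed

lemma padic_abs_add: "padic_abs p (x + y) \<le> max (padic_abs p x) (padic_abs p y)"
proof (cases "x = 0 \<or> y = 0 \<or> x + y = 0")
  case True
  then show ?thesis using padic_abs_nonneg by (auto simp: padic_abs_0 le_max_iff_disj)
next
  case False
  then have "min (padic_val p x) (padic_val p y) \<le> padic_val p (x + y)"
    by (intro padic_val_add) auto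
  then have "- padic_val p (x + y) \<le> - padic_val p x \<or> - padic_val p (x + y) \<le> - padic_val p y"
    by linarith
  then show ?thesis using False p_gt1
    by (auto simp: padic_abs_def le_max_iff_disj intro: power_int_increasing)
qed

lemma padic_abs_add_less:
  "padic_abs p x < e \<Longrightarrow> padic_abs p y < e \<Longrightarrow> padic_abs p (x + y) < e"
  using padic_abs_add[of x y] by linarith

lemma padic_abs_diff: "padic_abs p (x - y) \<le> max (padic_abs p x) (padic_abs p y)"
  using padic_abs_add[of x "-y"] padic_abs_uminus[of y] by simp

lemma padic_abs_diff_commute: "padic_abs p (x - y) = padic_abs p (y - x)"
  using padic_abs_uminus[of "x - y"] by simp

lemma padic_nullD: "s \<in> padic_null p \<Longrightarrow> e > 0 \<Longrightarrow> \<exists>N. \<forall>n\<ge>N. padic_abs p (s n) < e"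
  using padic_abs_nonneg by (auto simp: padic_null_def LIMSEQ_def)

lemma padic_nullI:
  "(\<And>e. e > 0 \<Longrightarrow> \<exists>N. \<forall>n\<ge>N. padic_abs p (s n) < e) \<Longrightarrow> s \<in> padic_null p"
  using padic_abs_nonneg by (auto simp: padic_null_def LIMSEQ_def)

lemma padic_null_Cauchy: assumes "s \<in> padic_null p" shows "padic_Cauchy p s"
  unfolding padic_Cauchy_def
proof (intro allI impI)
  fix e :: real assume "e > 0"
  then obtain N where N: "\<forall>n\<ge>N. padic_abs p (s n) < e" using padic_nullD[OF assms] by blast
  show "\<exists>N. \<forall>m\<ge>N. \<forall>n\<ge>N. padic_abs p (s m - s n) < e"
  proof (intro exI allI impI)
    fix m n assume "N \<le> m" "N \<le> n"
    then show "padic_abs p (s m - s n) < e" using N padic_abs_diff[of "s m" "s n"]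
      by (smt (verit))
  qed
qed

lemma padic_Cauchy_bounded:
  assumes "padic_Cauchy p s"
  obtains B where "B > 0" "\<And>n. padic_abs p (s n) \<le> B"
proof -
  obtain N where N: "\<forall>m\<ge>N. \<forall>n\<ge>N. padic_abs p (s m - s n) < 1"
    using assms unfolding padic_Cauchy_def by (meson zero_less_one)
  define B where "B = 1 + (\<Sum>i\<le>N. padic_abs p (s i))"
  have B1: "B \<ge> 1" unfolding B_def by (simp add: sum_nonneg padic_abs_nonneg)
  have le: "padic_abs p (s i) \<le> B" if "i \<le> N" for i
  proof -
    have "padic_abs p (s i) \<le> (\<Sum>i\<le>N. padic_abs p (s i))"
      using that by (intro member_le_sum) (auto simp: padic_abs_nonneg)
    then show ?thesis by (simp add: B_def)
  qed
  have "padic_abs p (s n) \<le> B" for n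
  proof (cases "n \<le> N")
    case False
    then have "padic_abs p (s n - s N) < 1" using N by auto
    then show ?thesis
      using padic_abs_add[of "s n - s N" "s N"] le[of N] B1 by simp
  qed (rule le)
  then show ?thesis using that[of B] B1 by auto
qed

lemma padic_Cauchy_const: "padic_Cauchy p (\<lambda>_. x)"
  unfolding padic_Cauchy_def by (auto simp: padic_abs_0)

lemma padic_Cauchy_add:
  assumes "padic_Cauchy p s" "padic_Cauchy p t"
  shows "padic_Cauchy p (\<lambda>n. s n + t n)"
  unfolding padic_Cauchy_def
proof (intro allI impI)
  fix e :: real assume e: "e > 0"
  obtain N where N: "\<forall>m\<ge>N. \<forall>n\<ge>N. padic_abs p (s m - s n) < e"
    using assms e unfolding padic_Cauchy_def by meson
  obtain M where M: "\<forall>m\<ge>M. \<forall>n\<ge>M. padic_abs p (t m - t n) < e"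
    using assms e unfolding padic_Cauchy_def by meson
  show "\<exists>N. \<forall>m\<ge>N. \<forall>n\<ge>N. padic_abs p ((s m + t m) - (s n + t n)) < e"
  proof (intro exI[of _ "max N M"] allI impI)
    fix m n assume "max N M \<le> m" "max N M \<le> n"
    then have "padic_abs p (s m - s n) < e" "padic_abs p (t m - t n) < e" using N M by auto
    then have "padic_abs p ((s m - s n) + (t m - t n)) < e" by (rule padic_abs_add_less)
    then show "padic_abs p ((s m + t m) - (s n + t n)) < e" by (simp add: algebra_simps)
  qed
qed

lemma padic_Cauchy_mult:
  assumes "padic_Cauchy p s" "padic_Cauchy p t"
  shows "padic_Cauchy p (\<lambda>n. s n * t n)"
  unfolding padic_Cauchy_def
proof (intro allI impI)
  fix e :: real assume e: "e > 0"
  obtain A where A: "A > 0" "\<And>n. padic_abs p (s n) \<le> A" using padic_Cauchy_bounded[OF assms(1)] by blast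
  obtain B where B: "B > 0" "\<And>n. padic_abs p (t n) \<le> B" using padic_Cauchy_bounded[OF assms(2)] by blast
  have eB: "e / B > 0" "e / A > 0" using e A B by auto
  obtain N where N: "\<forall>m\<ge>N. \<forall>n\<ge>N. padic_abs p (s m - s n) < e / B"
    using assms eB unfolding padic_Cauchy_def by meson
  obtain M where M: "\<forall>m\<ge>M. \<forall>n\<ge>M. padic_abs p (t m - t n) < e / A"
    using assms eB unfolding padic_Cauchy_def by meson
  show "\<exists>N. \<forall>m\<ge>N. \<forall>n\<ge>N. padic_abs p (s m * t m - s n * t n) < e"
  proof (intro exI[of _ "max N M"] allI impI)
    fix m n assume "max N M \<le> m" "max N M \<le> n"
    then have "padic_abs p (s m - s n) < e / B" "padic_abs p (t m - t n) < e / A" using N M by auto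
    then have "padic_abs p (s m - s n) * B < e" "A * padic_abs p (t m - t n) < e"
      using A B by (auto simp: field_simps)
    moreover have "padic_abs p ((s m - s n) * t m) \<le> padic_abs p (s m - s n) * B"
      "padic_abs p (s n * (t m - t n)) \<le> A * padic_abs p (t m - t n)"
      unfolding padic_abs_mult using A B
      by (auto intro!: mult_left_mono mult_right_mono padic_abs_nonneg)
    ultimately have "padic_abs p ((s m - s n) * t m + s n * (t m - t n)) < e"
      by (intro padic_abs_add_less) linarith+
    then show "padic_abs p (s m * t m - s n * t n) < e" by (simp add: algebra_simps)
  qed
qed

lemma padic_Cauchy_uminus: "padic_Cauchy p s \<Longrightarrow> padic_Cauchy p (\<lambda>n. - s n)"
  using padic_Cauchy_mult[OF padic_Cauchy_const[of "-1"], of s] by simp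

lemma padic_null_add:
  assumes "s \<in> padic_null p" "t \<in> padic_null p"
  shows "(\<lambda>n. s n + t n) \<in> padic_null p"
proof (rule padic_nullI)
  fix e :: real assume e: "e > 0"
  obtain N where N: "\<forall>n\<ge>N. padic_abs p (s n) < e" using padic_nullD[OF assms(1) e] by blast
  obtain M where M: "\<forall>n\<ge>M. padic_abs p (t n) < e" using padic_nullD[OF assms(2) e] by blast
  show "\<exists>N. \<forall>n\<ge>N. padic_abs p (s n + t n) < e"
  proof (intro exI[of _ "max N M"] allI impI)
    fix n assume "max N M \<le> n"
    then show "padic_abs p (s n + t n) < e"
      using N M by (intro padic_abs_add_less) auto
  qed
qed

lemma padic_null_mult:
  assumes "padic_Cauchy p s" "t \<in> padic_null p"
  shows "(\<lambda>n. s n * t n) \<in> padic_null p"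
proof (rule padic_nullI)
  fix e :: real assume e: "e > 0"
  obtain A where A: "A > 0" "\<And>n. padic_abs p (s n) \<le> A" using padic_Cauchy_bounded[OF assms(1)] by blast
  obtain N where N: "\<forall>n\<ge>N. padic_abs p (t n) < e / A"
    using padic_nullD[OF assms(2), of "e / A"] e A by auto
  have "padic_abs p (s n * t n) < e" if "n \<ge> N" for n
  proof -
    have "padic_abs p (s n * t n) \<le> A * padic_abs p (t n)"
      unfolding padic_abs_mult using A by (intro mult_right_mono padic_abs_nonneg)
    also have "\<dots> < A * (e / A)" using N that A by (intro mult_strict_left_mono) auto
    finally show ?thesis using A by simp
  qed
  then show "\<exists>N. \<forall>n\<ge>N. padic_abs p (s n * t n) < e" by blast
qed

lemma padic_Cauchy_inverse:
  assumes s: "padic_Cauchy p s" and ns: "s \<notin> padic_null p"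
  shows "padic_Cauchy p (\<lambda>n. inverse (s n))"
    and "(\<lambda>n. 1 - inverse (s n) * s n) \<in> padic_null p"
proof -
  obtain e where e: "e > 0" "\<And>N. \<exists>n\<ge>N. padic_abs p (s n) \<ge> e"
    using padic_nullI[of s] ns unfolding not_less[symmetric] by blast
  obtain N where N: "\<forall>m\<ge>N. \<forall>n\<ge>N. padic_abs p (s m - s n) < e"
    using s e unfolding padic_Cauchy_def by meson
  obtain k where k: "k \<ge> N" "padic_abs p (s k) \<ge> e" using e by blast
  have low: "padic_abs p (s n) \<ge> e" if "n \<ge> N" for n
  proof (rule ccontr)
    assume "\<not> e \<le> padic_abs p (s n)"
    moreover have "padic_abs p (s k - s n) < e" using N k that by blast
    ultimately have "padic_abs p ((s k - s n) + s n) < e" by (intro padic_abs_add_less) auto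
    then show False using k by simp
  qed
  then have nz: "s n \<noteq> 0" if "n \<ge> N" for n using that e padic_abs_0 by (metis not_le)
  have "1 - inverse (s n) * s n = 0" if "n \<ge> N" for n using nz[OF that] by simp
  then show "(\<lambda>n. 1 - inverse (s n) * s n) \<in> padic_null p"
    by (intro padic_nullI exI[of _ N] allI impI) (simp only: padic_abs_0)
  show "padic_Cauchy p (\<lambda>n. inverse (s n))"
    unfolding padic_Cauchy_def
  proof (intro allI impI)
    fix d :: real assume d: "d > 0"
    then have "d * (e * e) > 0" using e by simp
    then obtain M where M: "\<forall>m\<ge>M. \<forall>n\<ge>M. padic_abs p (s m - s n) < d * (e * e)"
      using s unfolding padic_Cauchy_def by meson
    show "\<exists>N. \<forall>m\<ge>N. \<forall>n\<ge>N. padic_abs p (inverse (s m) - inverse (s n)) < d"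
    proof (intro exI[of _ "max N M"] allI impI)
      fix m n assume mn: "max N M \<le> m" "max N M \<le> n"
      let ?D = "padic_abs p (inverse (s m) - inverse (s n))"
      have z: "s m \<noteq> 0" "s n \<noteq> 0" using nz mn by auto
      then have "s n - s m = (inverse (s m) - inverse (s n)) * (s m * s n)"
        by (simp add: field_simps)
      then have "?D * (padic_abs p (s m) * padic_abs p (s n)) = padic_abs p (s n - s m)"
        by (simp only: padic_abs_mult)
      moreover have "e * e \<le> padic_abs p (s m) * padic_abs p (s n)"
        using low[of m] low[of n] mn e by (intro mult_mono) (auto simp: padic_abs_nonneg)
      ultimately have "?D * (e * e) \<le> padic_abs p (s n - s m)"
        using mult_left_mono[OF _ padic_abs_nonneg, of "e * e"
            "padic_abs p (s m) * padic_abs p (s n)" "inverse (s m) - inverse (s n)"] by simp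
      also have "\<dots> < d * (e * e)" using M mn by auto
      finally show "?D < d" by (rule mult_right_less_imp_less) simp
    qed
  qed
qed

lemma cring_padic_Cauchy_ring: "cring (padic_Cauchy_ring p)"
proof (rule cringI)
  show "abelian_group (padic_Cauchy_ring p)"
  proof (rule abelian_groupI)
    fix s assume "s \<in> carrier (padic_Cauchy_ring p)"
    then show "\<exists>t\<in>carrier (padic_Cauchy_ring p). t \<oplus>\<^bsub>padic_Cauchy_ring p\<^esub> s = \<zero>\<^bsub>padic_Cauchy_ring p\<^esub>"
      by (intro bexI[of _ "\<lambda>n. - s n"]) (auto simp: padic_Cauchy_ring_def padic_Cauchy_uminus)
  qed (auto simp: padic_Cauchy_ring_def padic_Cauchy_add padic_Cauchy_const algebra_simps)
  show "Group.comm_monoid (padic_Cauchy_ring p)"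
    by (rule comm_monoidI)
       (auto simp: padic_Cauchy_ring_def padic_Cauchy_mult padic_Cauchy_const algebra_simps)
qed (auto simp: padic_Cauchy_ring_def algebra_simps)

lemma ideal_padic_null: "ideal (padic_null p) (padic_Cauchy_ring p)"
proof -
  interpret R: cring "padic_Cauchy_ring p" by (rule cring_padic_Cauchy_ring)
  have inv: "\<ominus>\<^bsub>padic_Cauchy_ring p\<^esub> s = (\<lambda>n. - s n)" if "s \<in> carrier (padic_Cauchy_ring p)" for s
    using that by (intro R.minus_equality)
      (auto simp: padic_Cauchy_ring_def padic_Cauchy_uminus)
  show ?thesis
  proof (rule idealI)
    show "subgroup (padic_null p) (add_monoid (padic_Cauchy_ring p))"
    proof (rule R.add.subgroupI)
      show "padic_null p \<subseteq> carrier (padic_Cauchy_ring p)"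
        using padic_null_Cauchy by (auto simp: padic_Cauchy_ring_def)
      have "(\<lambda>_. 0) \<in> padic_null p" by (rule padic_nullI) (auto simp: padic_abs_0)
      then show "padic_null p \<noteq> {}" by blast
      fix s assume s: "s \<in> padic_null p"
      then have "s \<in> carrier (padic_Cauchy_ring p)"
        using padic_null_Cauchy by (auto simp: padic_Cauchy_ring_def)
      then show "\<ominus>\<^bsub>padic_Cauchy_ring p\<^esub> s \<in> padic_null p"
        using s by (simp add: inv padic_null_def padic_abs_uminus)
      fix t assume "t \<in> padic_null p"
      then show "s \<oplus>\<^bsub>padic_Cauchy_ring p\<^esub> t \<in> padic_null p"
        using padic_null_add[OF s] by (simp add: padic_Cauchy_ring_def)
    qed
  next
    fix s t assume st: "s \<in> padic_null p" "t \<in> carrier (padic_Cauchy_ring p)"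
    then show "t \<otimes>\<^bsub>padic_Cauchy_ring p\<^esub> s \<in> padic_null p"
      using padic_null_mult[of t s] by (simp add: padic_Cauchy_ring_def)
    from st show "s \<otimes>\<^bsub>padic_Cauchy_ring p\<^esub> t \<in> padic_null p"
      using padic_null_mult[of t s] by (simp add: padic_Cauchy_ring_def mult.commute)
  qed (rule R.ring_axioms)
qed

lemma maximalideal_padic_null: "maximalideal (padic_null p) (padic_Cauchy_ring p)"
proof (rule maximalidealI[OF ideal_padic_null])
  have "(\<lambda>_. 1) \<notin> padic_null p"
    by (auto simp: padic_null_def padic_abs_1 LIMSEQ_const_iff)
  moreover have "(\<lambda>_. 1) \<in> carrier (padic_Cauchy_ring p)"
    by (simp add: padic_Cauchy_ring_def padic_Cauchy_const)
  ultimately show "carrier (padic_Cauchy_ring p) \<noteq> padic_null p" by blast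
next
  fix J assume J: "ideal J (padic_Cauchy_ring p)" "padic_null p \<subseteq> J"
    "J \<subseteq> carrier (padic_Cauchy_ring p)"
  interpret J: ideal J "padic_Cauchy_ring p" by (rule J)
  show "J = padic_null p \<or> J = carrier (padic_Cauchy_ring p)"
  proof (cases "J = padic_null p")
    case False
    then obtain s where s: "s \<in> J" "s \<notin> padic_null p" using J by blast
    then have cs: "padic_Cauchy p s" using J by (auto simp: padic_Cauchy_ring_def)
    let ?i = "\<lambda>n. inverse (s n)"
    have "?i \<otimes>\<^bsub>padic_Cauchy_ring p\<^esub> s \<in> J"
      using s padic_Cauchy_inverse(1)[OF cs s(2)]
      by (intro J.I_l_closed) (auto simp: padic_Cauchy_ring_def)
    moreover have "(\<lambda>n. 1 - ?i n * s n) \<in> J"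
      using padic_Cauchy_inverse(2)[OF cs s(2)] J by blast
    ultimately have "(?i \<otimes>\<^bsub>padic_Cauchy_ring p\<^esub> s) \<oplus>\<^bsub>padic_Cauchy_ring p\<^esub> (\<lambda>n. 1 - ?i n * s n) \<in> J"
      by (rule additive_subgroup.a_closed[OF J.additive_subgroup_axioms])
    then have "\<one>\<^bsub>padic_Cauchy_ring p\<^esub> \<in> J" by (simp add: padic_Cauchy_ring_def)
    then show ?thesis using J.one_imp_carrier by blast
  qed simp
qed

lemma field_padic_field: "field (padic_field p)"
  unfolding padic_field_def
  by (rule maximalideal.quotient_is_field[OF maximalideal_padic_null cring_padic_Cauchy_ring])

end


section \<open>Hilbert symbols\<close>

text \<open>
  A rational point of the plane conic is a nonzero triple of homogeneous coordinates; the symbol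
  is used for fields \<open>K\<close> and nonzero \<open>a\<close>, \<open>b\<close> only.
\<close>

definition hilbert_symbol :: "('a, 'm) ring_scheme \<Rightarrow> 'a \<Rightarrow> 'a \<Rightarrow> int" where
  "hilbert_symbol K a b =
     (if \<exists>x\<in>carrier K. \<exists>y\<in>carrier K. \<exists>z\<in>carrier K.
           (x, y, z) \<noteq> (\<zero>\<^bsub>K\<^esub>, \<zero>\<^bsub>K\<^esub>, \<zero>\<^bsub>K\<^esub>) \<and>
           z [^]\<^bsub>K\<^esub> (2::nat) = (a \<otimes>\<^bsub>K\<^esub> x [^]\<^bsub>K\<^esub> (2::nat)) \<oplus>\<^bsub>K\<^esub> (b \<otimes>\<^bsub>K\<^esub> y [^]\<^bsub>K\<^esub> (2::nat))
      then 1 else - 1)"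

definition int_embed :: "('a, 'm) ring_scheme \<Rightarrow> int \<Rightarrow> 'a" where
  "int_embed K n = [n] \<cdot>\<^bsub>K\<^esub> \<one>\<^bsub>K\<^esub>"

text \<open>The modified symbols are only needed at integers; all divisions below are exact.\<close>

definition hilbert' :: "nat \<Rightarrow> int \<Rightarrow> int \<Rightarrow> int" where
  "hilbert' p t1 t2 =
     (let v1 = multiplicity (int p) t1; v2 = multiplicity (int p) t2 in
      if t1 = 0 \<or> t2 = 0 then 0
      else if odd p \<and> even v1 \<and> even v2 then 0
      else if p = 2 \<and> even v1 \<and> even v2 \<and> \<not> [t1 div 2 ^ v1 = t2 div 2 ^ v2] (mod 4) then 0
      else hilbert_symbol (padic_field p) (int_embed (padic_field p) t1) (int_embed (padic_field p) t2))"

definition hilbert'_infty :: "int \<Rightarrow> int \<Rightarrow> int" where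
  "hilbert'_infty t1 t2 =
     (if t1 * t2 = 0 then 0
      else hilbert_symbol (ring_of_type_algebra :: real ring) (of_int t1) (of_int t2))"

lemma finite_hilbert'_nonzero: "finite {p. Factorial_Ring.prime p \<and> hilbert' p t1 t2 \<noteq> 0}"
proof (cases "t1 = 0 \<or> t2 = 0")
  case True
  then show ?thesis by (auto simp: hilbert'_def Let_def)
next
  case False
  have "p \<le> max 2 (nat \<bar>t1 * t2\<bar>)" if p: "Factorial_Ring.prime p" "hilbert' p t1 t2 \<noteq> 0" for p :: nat
  proof (cases "p = 2")
    case p2: False
    then have "p > 2" using prime_ge_2_nat[OF p(1)] by simp
    then have "odd p" using p(1) by (intro prime_odd_nat)
    then have "odd (multiplicity (int p) t1) \<or> odd (multiplicity (int p) t2)"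
      using p by (auto simp: hilbert'_def Let_def split: if_splits)
    then have "int p dvd t1 \<or> int p dvd t2"
      using not_dvd_imp_multiplicity_0[of "int p" t1] not_dvd_imp_multiplicity_0[of "int p" t2]
      by (metis even_zero)
    then have "int p dvd t1 * t2" by auto
    then have "int p \<le> \<bar>t1 * t2\<bar>" using False dvd_imp_le_int[of "t1 * t2" "int p"] by simp
    then show ?thesis by linarith
  qed simp
  then have "{p. Factorial_Ring.prime p \<and> hilbert' p t1 t2 \<noteq> 0} \<subseteq> {..max 2 (nat \<bar>t1 * t2\<bar>)}"
    by blast
  then show ?thesis by (rule finite_subset[OF _ finite_atMost])
qed


section \<open>The detector function and its random part\<close>

text \<open>
  The product over all primes is written as the finite product over the primes with
  factor different from 1; there are finitely many by \<open>finite_hilbert'_nonzero\<close>.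
\<close>

definition delta :: "int \<Rightarrow> int \<Rightarrow> int" where
  "delta t1 t2 = (\<Prod>p | Factorial_Ring.prime p \<and> hilbert' p t1 t2 \<noteq> 0. 1 + hilbert' p t1 t2)"

definition delta_det :: "real \<Rightarrow> int \<Rightarrow> int \<Rightarrow> int" where
  "delta_det z t1 t2 = (1 + hilbert'_infty t1 t2) *
     (\<Sum>s | 1 \<le> s \<and> real s \<le> z \<and> squarefree s.
        \<Prod>p | Factorial_Ring.prime p \<and> p dvd s. hilbert' p t1 t2)"

definition delta_rand :: "real \<Rightarrow> int \<Rightarrow> int \<Rightarrow> int" where
  "delta_rand z t1 t2 = delta t1 t2 - delta_det z t1 t2"


section \<open>Index ranges\<close>

text \<open>
  A tuple of length \<open>m\<close> is an extensional function on \<open>{..<m}\<close>; for \<open>m = 0\<close> there is exactly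
  one (the empty tuple).
\<close>

definition nat_tuples :: "nat \<Rightarrow> (nat \<Rightarrow> nat) set" where
  "nat_tuples m = ({..<m} \<rightarrow>\<^sub>E {1..})"

definition tuples_upto :: "nat \<Rightarrow> (nat \<Rightarrow> real) \<Rightarrow> (nat \<Rightarrow> nat) set" where
  "tuples_upto m x = {s \<in> nat_tuples m. \<forall>i<m. real (s i) \<le> x i}"

end

theory Submission
  imports Defs "HOL-Number_Theory.Number_Theory" "HOL-Analysis.L2_Norm" "HOL-Analysis.Harmonic_Numbers" "HOL-Library.Discrete_Functions"
begin

text \<open>
  Let \<open>n\<close> be the product of the odd primes at which the exponents of \<open>S\<close>, \<open>T\<close>, \<open>R\<close> are not all of the
  same parity. Expanding the product \<open>delta\<close> over the factorisations \<open>n = d e\<close>, and using Hilbert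
  reciprocity to exchange \<open>d\<close> with \<open>e\<close> in the part of \<open>delta_det\<close> coming from the real place, turns
  \<open>delta_rand\<close> into a sum of the symbols \<open>(t1, t2)\<close> at the primes of \<open>d\<close> with \<open>d\<close> and \<open>e\<close> both large,
  minus the same sum with both small. In the second sum \<open>n \<le> z\<^sup>2\<close>, and counting suffices. In the first
  one all variables are frozen except \<open>m1\<close>, \<open>n1\<close> (the primes dividing only \<open>S\<close> and lying in \<open>d\<close>,
  respectively \<open>e\<close>) and \<open>m2\<close>, \<open>n2\<close> (likewise for \<open>T\<close>). By bilinearity and quadratic reciprocity what
  remains is \<open>(n2 / m1) (n1 / m2)\<close> times factors depending on one side only, and a quadratic large sieve
  (Gauss sums, the additive large sieve and one squaring) saves \<open>(min m1 n2 * min m2 n1) powr (1 / 4)\<close>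
  on dyadic ranges. The same holds for the other two pairs of variables, and the best of the three
  savings is always enough.
\<close>

text \<open>The sieve sees only squarefree parts, and these may be short: if \<open>S\<close> is
  nearly a square, then \<open>m1\<close> and \<open>n1\<close> are small and cancellation in
  \<open>S\<close> saves nothing. Such \<open>S\<close> are rare, so each box is weighed by its
  density \<open>q\<close> as well: the square root of the product of the three private squarefree
  parts over \<open>Nx * Ny * Nz\<close>. Write \<open>d\<close> and \<open>e\<close> for the dyadic
  sizes of the parts of such a private product inside and outside \<open>D\<close>. Either some pair
  of variables saves at least \<open>t powr (- 1 / 4)\<close> for a variable whose
  \<open>d * e\<close> is \<open>t\<close>, and then \<open>q \<le> sqrt (t / M)\<close>; cutting at
  \<open>t = z powr (4 / 9)\<close> yields \<open>z powr (- 1 / 9)\<close> and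
  \<open>z powr (1 / 9) / sqrt M\<close>. Or some pair is governed by two parts on the same side of
  \<open>D\<close>; as both divisors are large, the best pair then saves
  \<open>z powr (- 1 / 8)\<close> up to the primes shared by two variables, whose scarcity pays for
  them. The thresholds on the divisors, coprimality and the symbol at 2 tie rows to columns. Each
  enters as a Schur multiplier costing less than any fixed power.\<close>

hide_const (open) Divisibility.prime Divisibility.irreducible

section \<open>Conics over the $p$-adic numbers\<close>

text \<open>The conic pulled back to Cauchy sequences: being null replaces vanishing in the
  quotient, so valuations can be used term by term.\<close>

definition padic_conic :: "nat \<Rightarrow> int \<Rightarrow> int \<Rightarrow> bool" where
  "padic_conic p a b \<longleftrightarrow> (\<exists>x y z. padic_Cauchy p x \<and> padic_Cauchy p y \<and> padic_Cauchy p z \<and>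
     \<not> (x \<in> padic_null p \<and> y \<in> padic_null p \<and> z \<in> padic_null p) \<and>
     (\<lambda>n. z n ^ 2 - (of_int a * x n ^ 2 + of_int b * y n ^ 2)) \<in> padic_null p)"

text \<open>The quotient map is a surjective ring homomorphism whose kernel is the ideal of null
  sequences, and it sends the constant sequence \<open>k\<close> to \<open>int_embed\<close>. The
  existence of a point therefore transfers to representatives.\<close>

lemma hilbert_symbol_padic:
  assumes p: "prime p"
  shows "hilbert_symbol (padic_field p) (int_embed (padic_field p) a) (int_embed (padic_field p) b)
    = (if padic_conic p a b then 1 else -1)"
proof -
  let ?R = "padic_Cauchy_ring p" and ?I = "padic_null p" and ?K = "padic_field p"
  interpret R: cring ?R by (rule cring_padic_Cauchy_ring[OF p])
  interpret I: ideal ?I ?R by (rule ideal_padic_null[OF p])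
  define \<phi> where "\<phi> = (+>\<^bsub>?R\<^esub>) ?I"
  have K: "?K = ?R Quot ?I" by (simp add: padic_field_def)
  interpret h: ring_hom_ring ?R ?K \<phi> unfolding \<phi>_def K by (rule I.rcos_ring_hom_ring)
  have carrier: "carrier ?K = \<phi> ` carrier ?R"
    by (auto simp: K FactRing_def A_RCOSETS_defs a_r_coset_def \<phi>_def)
  have eq: "\<phi> s = \<phi> t \<longleftrightarrow> s \<ominus>\<^bsub>?R\<^esub> t \<in> ?I" if "s \<in> carrier ?R" "t \<in> carrier ?R" for s t
    using R.quotient_eq_iff_same_a_r_cos[OF I.ideal_axioms that] by (simp add: \<phi>_def)
  have zero: "\<phi> s = \<zero>\<^bsub>?K\<^esub> \<longleftrightarrow> s \<in> ?I" if "s \<in> carrier ?R" for s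
    using eq[OF that, of "\<zero>\<^bsub>?R\<^esub>"] that by (simp add: R.minus_eq)
  have carr: "s \<in> carrier ?R \<longleftrightarrow> padic_Cauchy p s" for s by (simp add: padic_Cauchy_ring_def)
  have uminus: "\<ominus>\<^bsub>?R\<^esub> s = (\<lambda>n. - s n)" if "s \<in> carrier ?R" for s
    using that by (intro R.minus_equality) (auto simp: padic_Cauchy_ring_def padic_Cauchy_uminus[OF p])
  have nat: "[k] \<cdot>\<^bsub>?R\<^esub> \<one>\<^bsub>?R\<^esub> = (\<lambda>_. of_nat k)" for k :: nat
  proof (induction k)
    case (Suc k)
    then show ?case by (simp add: R.add.nat_pow_Suc) (simp add: padic_Cauchy_ring_def add.commute)
  qed (simp add: R.add.nat_pow_0, simp add: padic_Cauchy_ring_def)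
  have int: "[k] \<cdot>\<^bsub>?R\<^esub> \<one>\<^bsub>?R\<^esub> = (\<lambda>_. of_int k)" for k :: int
  proof (cases "k \<ge> 0")
    case True
    then show ?thesis by (simp add: add_pow_int_ge nat)
  next
    case False
    then show ?thesis using uminus[of "\<lambda>_. of_nat (nat (-k))"]
      by (simp add: add_pow_int_lt nat carr padic_Cauchy_const[OF p])
  qed
  have emb: "int_embed ?K k = \<phi> (\<lambda>_. of_int k)" for k
  proof -
    interpret g: group_hom "add_monoid ?R" "add_monoid ?K" \<phi> by (rule h.a_group_hom)
    have "\<phi> ([k] \<cdot>\<^bsub>?R\<^esub> \<one>\<^bsub>?R\<^esub>) = [k] \<cdot>\<^bsub>?K\<^esub> \<phi> \<one>\<^bsub>?R\<^esub>"
      using g.hom_int_pow[of "\<one>\<^bsub>?R\<^esub>" k] by (simp add: add_pow_def)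
    then show ?thesis by (simp add: int_embed_def int)
  qed
  have sq: "\<phi> s [^]\<^bsub>?K\<^esub> (2::nat) = \<phi> (\<lambda>n. s n ^ 2)" if "s \<in> carrier ?R" for s
  proof -
    have "(\<lambda>n. s n ^ 2) = s \<otimes>\<^bsub>?R\<^esub> s" by (simp add: padic_Cauchy_ring_def power2_eq_square)
    then show ?thesis using that by (simp add: numeral_2_eq_2)
  qed
  have conv: "\<phi> z [^]\<^bsub>?K\<^esub> (2::nat) = (int_embed ?K a \<otimes>\<^bsub>?K\<^esub> \<phi> x [^]\<^bsub>?K\<^esub> (2::nat)) \<oplus>\<^bsub>?K\<^esub>
      (int_embed ?K b \<otimes>\<^bsub>?K\<^esub> \<phi> y [^]\<^bsub>?K\<^esub> (2::nat))
    \<longleftrightarrow> (\<lambda>n. z n ^ 2 - (of_int a * x n ^ 2 + of_int b * y n ^ 2)) \<in> ?I"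
    if "x \<in> carrier ?R" "y \<in> carrier ?R" "z \<in> carrier ?R" for x y z
  proof -
    have c2: "(\<lambda>n. s n ^ 2) \<in> carrier ?R" if "s \<in> carrier ?R" for s
      using that padic_Cauchy_mult[OF p, of s s] by (simp add: carr power2_eq_square)
    have cc: "(\<lambda>n. of_int c * s n ^ 2) \<in> carrier ?R" if "s \<in> carrier ?R" for s c
      using padic_Cauchy_mult[OF p padic_Cauchy_const[OF p, of "of_int c"]] c2[OF that] by (simp add: carr)
    have m: "int_embed ?K c \<otimes>\<^bsub>?K\<^esub> \<phi> s [^]\<^bsub>?K\<^esub> (2::nat) = \<phi> (\<lambda>n. of_int c * s n ^ 2)"
      if s: "s \<in> carrier ?R" for s c
    proof -
      have "(\<lambda>n. of_int c * s n ^ 2) = (\<lambda>_. of_int c) \<otimes>\<^bsub>?R\<^esub> (\<lambda>n. s n ^ 2)"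
        by (simp add: padic_Cauchy_ring_def)
      moreover have "(\<lambda>_. of_int c) \<in> carrier ?R" by (simp add: carr padic_Cauchy_const[OF p])
      ultimately show ?thesis using s c2[OF s] by (simp add: emb sq)
    qed
    have s: "\<phi> (\<lambda>n. of_int a * x n ^ 2) \<oplus>\<^bsub>?K\<^esub> \<phi> (\<lambda>n. of_int b * y n ^ 2)
      = \<phi> (\<lambda>n. of_int a * x n ^ 2 + of_int b * y n ^ 2)"
    proof -
      have "(\<lambda>n. of_int a * x n ^ 2 + of_int b * y n ^ 2)
        = (\<lambda>n. of_int a * x n ^ 2) \<oplus>\<^bsub>?R\<^esub> (\<lambda>n. of_int b * y n ^ 2)" by (simp add: padic_Cauchy_ring_def)
      then show ?thesis using that cc by simp
    qed
    have ca: "(\<lambda>n. of_int a * x n ^ 2 + of_int b * y n ^ 2) \<in> carrier ?R"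
      using cc[OF that(1)] cc[OF that(2)] by (simp add: carr padic_Cauchy_add[OF p])
    have "(\<lambda>n. z n ^ 2) \<ominus>\<^bsub>?R\<^esub> (\<lambda>n. of_int a * x n ^ 2 + of_int b * y n ^ 2)
      = (\<lambda>n. z n ^ 2 - (of_int a * x n ^ 2 + of_int b * y n ^ 2))"
      using ca by (simp add: R.minus_eq uminus) (simp add: padic_Cauchy_ring_def fun_eq_iff)
    then show ?thesis
      unfolding m[OF that(1)] m[OF that(2)] s sq[OF that(3)] using eq[OF c2[OF that(3)] ca] by simp
  qed
  have ex: "(\<exists>x\<in>carrier ?K. Q x) \<longleftrightarrow> (\<exists>s. padic_Cauchy p s \<and> Q (\<phi> s))" for Q
    by (auto simp: carrier carr)
  have key: "((\<phi> x, \<phi> y, \<phi> z) \<noteq> (\<zero>\<^bsub>?K\<^esub>, \<zero>\<^bsub>?K\<^esub>, \<zero>\<^bsub>?K\<^esub>) \<and>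
      \<phi> z [^]\<^bsub>?K\<^esub> (2::nat) = (int_embed ?K a \<otimes>\<^bsub>?K\<^esub> \<phi> x [^]\<^bsub>?K\<^esub> (2::nat)) \<oplus>\<^bsub>?K\<^esub>
        (int_embed ?K b \<otimes>\<^bsub>?K\<^esub> \<phi> y [^]\<^bsub>?K\<^esub> (2::nat))) \<longleftrightarrow>
      (\<not> (x \<in> ?I \<and> y \<in> ?I \<and> z \<in> ?I) \<and>
       (\<lambda>n. z n ^ 2 - (of_int a * x n ^ 2 + of_int b * y n ^ 2)) \<in> ?I)"
    if "padic_Cauchy p x" "padic_Cauchy p y" "padic_Cauchy p z" for x y z
  proof -
    have c: "x \<in> carrier ?R" "y \<in> carrier ?R" "z \<in> carrier ?R" using that by (simp_all add: carr)
    show ?thesis unfolding conv[OF c] prod.inject using zero[OF c(1)] zero[OF c(2)] zero[OF c(3)] by blast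
  qed
  show ?thesis
    unfolding hilbert_symbol_def padic_conic_def ex
    by (intro if_cong refl) (use key in meson)
qed

section \<open>From points of the conic to congruences between integers\<close>

lemma padic_abs_of_int_le:
  assumes p: "prime p" and "padic_abs p (of_int m) \<le> 1 / real p ^ k"
  shows "int p ^ k dvd m"
proof (cases "m = 0")
  case False
  have p1: "real p > 1" using prime_gt_1_nat[OF p] by simp
  have "padic_val p (of_int m) = int (multiplicity (int p) m)"
    using padic_val_frac[OF p False, of 1] by simp
  then have "real p powi (- int (multiplicity (int p) m)) \<le> real p powi (- int k)"
    using assms False by (simp add: padic_abs_def power_int_minus field_simps)
  then have "k \<le> multiplicity (int p) m"
    using p1 power_int_strict_increasing[of "- int k" "- int (multiplicity (int p) m)" "real p"]
    by linarith
  then show ?thesis by (simp add: multiplicity_dvd')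
qed simp

lemma padic_abs_of_int_dvd:
  assumes p: "prime p" and d: "int p ^ k dvd m"
  shows "padic_abs p (of_int m) \<le> 1 / real p ^ k"
proof (cases "m = 0")
  case False
  have p1: "real p > 1" using prime_gt_1_nat[OF p] by simp
  have "\<not> is_unit (int p)" using p by auto
  then have "k \<le> multiplicity (int p) m" using d False by (intro multiplicity_geI) auto
  moreover have "padic_val p (of_int m) = int (multiplicity (int p) m)"
    using padic_val_frac[OF p False, of 1] by simp
  ultimately have "padic_abs p (of_int m) \<le> real p powi (- int k)"
    using False p1 by (simp add: padic_abs_def power_int_increasing)
  then show ?thesis by (simp add: power_int_minus field_simps)
qed (simp add: padic_abs_0[OF p])

text \<open>Clear denominators with \<open>m\<close>, then divide by the common gcd
  \<open>g\<close>. If \<open>p\<close> still divided all three quotients, \<open>g * p\<close>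
  would divide \<open>g\<close>.\<close>

lemma rat_primitive_scaling:
  fixes x y z :: rat
  assumes p: "prime p" and nz: "\<not> (x = 0 \<and> y = 0 \<and> z = 0)"
  obtains l :: rat and U V W :: int where "l * x = of_int U" "l * y = of_int V" "l * z = of_int W"
    "\<not> (int p dvd U \<and> int p dvd V \<and> int p dvd W)" "l \<noteq> 0"
proof -
  obtain a1 b1 where x: "x = of_int a1 / of_int b1" "b1 \<noteq> 0" by (rule rat_frac[OF p])
  obtain a2 b2 where y: "y = of_int a2 / of_int b2" "b2 \<noteq> 0" by (rule rat_frac[OF p])
  obtain a3 b3 where z: "z = of_int a3 / of_int b3" "b3 \<noteq> 0" by (rule rat_frac[OF p])
  define A B C where "A = a1 * b2 * b3" and "B = a2 * b1 * b3" and "C = a3 * b1 * b2"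
  define m :: rat where "m = of_int (b1 * b2 * b3)"
  have m: "m \<noteq> 0" "m * x = of_int A" "m * y = of_int B" "m * z = of_int C"
    using x y z by (auto simp: m_def A_def B_def C_def field_simps)
  define g where "g = gcd A (gcd B C)"
  have g: "g \<noteq> 0" using nz m unfolding g_def by auto
  have "g dvd A" "g dvd B" "g dvd C" by (auto simp: g_def intro: dvd_trans)
  then obtain U V W where XYZ: "A = g * U" "B = g * V" "C = g * W" by (metis dvdE)
  have "\<not> (int p dvd U \<and> int p dvd V \<and> int p dvd W)"
  proof
    assume "int p dvd U \<and> int p dvd V \<and> int p dvd W"
    then have "g * int p dvd A" "g * int p dvd B" "g * int p dvd C" unfolding XYZ by auto
    then have "g * int p dvd g" unfolding g_def by simp
    then have "int p dvd 1" using g by (metis dvd_mult_cancel_left mult.right_neutral)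
    then show False using p prime_gt_1_nat by fastforce
  qed
  moreover have "(m / of_int g) * x = of_int U" "(m / of_int g) * y = of_int V" "(m / of_int g) * z = of_int W"
    using m g XYZ by (simp_all add: field_simps)
  ultimately show ?thesis using that[of "m / of_int g" U V W] m g by auto
qed

text \<open>A point over the completion is only a limit. It is truncated at an index where some
  coordinate has size at least \<open>e\<close> and the equation holds to high precision. Making the
  triple primitive multiplies by an \<open>l\<close> of size at most \<open>1 / e\<close>, so
  precision survives.\<close>

lemma padic_conic_primitive:
  assumes p: "prime p" and "padic_conic p a b"
  obtains U V W where "int p ^ k dvd W ^ 2 - (a * U ^ 2 + b * V ^ 2)"
    "\<not> (int p dvd U \<and> int p dvd V \<and> int p dvd W)"
proof -
  obtain x y z where c: "padic_Cauchy p x" "padic_Cauchy p y" "padic_Cauchy p z"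
    and nn: "\<not> (x \<in> padic_null p \<and> y \<in> padic_null p \<and> z \<in> padic_null p)"
    and nl: "(\<lambda>n. z n ^ 2 - (of_int a * x n ^ 2 + of_int b * y n ^ 2)) \<in> padic_null p"
    using assms unfolding padic_conic_def by auto
  have big: "\<exists>e>0. \<forall>N. \<exists>n\<ge>N. padic_abs p (s n) \<ge> e" if "s \<notin> padic_null p" for s
    using that padic_nullI[OF p, of s] by (meson linorder_not_less)
  have "\<exists>e>0. \<forall>N. \<exists>n\<ge>N. padic_abs p (x n) \<ge> e \<or> padic_abs p (y n) \<ge> e \<or> padic_abs p (z n) \<ge> e"
    using nn big[of x] big[of y] big[of z] by meson
  then obtain e where e: "e > 0"
    "\<And>N. \<exists>n\<ge>N. padic_abs p (x n) \<ge> e \<or> padic_abs p (y n) \<ge> e \<or> padic_abs p (z n) \<ge> e" by meson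
  have p1: "real p > 1" using prime_gt_1_nat[OF p] by simp
  \<comment> \<open>The equation is quadratic, so rescaling by \<open>l\<close> costs a factor
    \<open>1 / e ^ 2\<close>; what remains is the precision \<open>1 / p ^ k\<close>.\<close>
  define \<epsilon> where "\<epsilon> = e ^ 2 / real p ^ k"
  have "\<epsilon> > 0" using e p1 by (simp add: \<epsilon>_def)
  then obtain N where N: "\<And>n. n \<ge> N \<Longrightarrow>
      padic_abs p (z n ^ 2 - (of_int a * x n ^ 2 + of_int b * y n ^ 2)) < \<epsilon>"
    using padic_nullD[OF p nl] by meson
  obtain n where n: "n \<ge> N" "padic_abs p (x n) \<ge> e \<or> padic_abs p (y n) \<ge> e \<or> padic_abs p (z n) \<ge> e"
    using e by meson
  have "\<not> (x n = 0 \<and> y n = 0 \<and> z n = 0)" using n e by (auto simp: padic_abs_0[OF p])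
  then obtain l U V W where l: "l * x n = of_int U" "l * y n = of_int V" "l * z n = of_int W"
    and prim: "\<not> (int p dvd U \<and> int p dvd V \<and> int p dvd W)" and "l \<noteq> 0"
    by (rule rat_primitive_scaling[OF p])
  have int1: "padic_abs p (of_int m) \<le> 1" for m using padic_abs_of_int_dvd[OF p, of 0 m] by simp
  have "padic_abs p l * e \<le> 1"
  proof -
    have "padic_abs p l * padic_abs p s \<le> 1" if "l * s = of_int m" for s m
      using int1[of m] that by (metis padic_abs_mult[OF p])
    from this[OF l(1)] this[OF l(2)] this[OF l(3)] n(2) show ?thesis
      by (meson mult_left_mono order_trans padic_abs_nonneg[OF p])
  qed
  then have le: "padic_abs p l \<le> 1 / e" using e by (simp add: field_simps)
  have "(of_int (W ^ 2 - (a * U ^ 2 + b * V ^ 2)) :: rat)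
    = l * l * (z n ^ 2 - (of_int a * x n ^ 2 + of_int b * y n ^ 2))"
    by (simp add: l[symmetric] algebra_simps power2_eq_square)
  then have "padic_abs p (of_int (W ^ 2 - (a * U ^ 2 + b * V ^ 2)))
    = padic_abs p l * padic_abs p l * padic_abs p (z n ^ 2 - (of_int a * x n ^ 2 + of_int b * y n ^ 2))"
    by (simp only: padic_abs_mult[OF p])
  also have "\<dots> \<le> (1 / e) * (1 / e) * \<epsilon>"
    using le N[OF n(1)] e padic_abs_nonneg[OF p] by (intro mult_mono) auto
  also have "\<dots> = 1 / real p ^ k" using e by (simp add: \<epsilon>_def power2_eq_square)
  finally show ?thesis using that padic_abs_of_int_le[OF p] prim by blast
qed

lemma padic_null_scale: "prime p \<Longrightarrow> s \<in> padic_null p \<Longrightarrow> (\<lambda>n. c * s n) \<in> padic_null p"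
  using padic_null_mult[OF _ padic_Cauchy_const[of p c]] by simp

lemma padic_null_const: "prime p \<Longrightarrow> (\<lambda>_. c) \<in> padic_null p \<longleftrightarrow> c = 0"
  by (auto simp: padic_null_def LIMSEQ_const_iff padic_abs_eq_0)

lemma padic_null_scale_iff:
  assumes p: "prime p" and "c \<noteq> 0"
  shows "(\<lambda>n. c * s n) \<in> padic_null p \<longleftrightarrow> s \<in> padic_null p"
  using padic_null_scale[OF p, of s c] padic_null_scale[OF p, of "\<lambda>n. c * s n" "1 / c"] assms by auto

lemma padic_Cauchy_scale: "prime p \<Longrightarrow> padic_Cauchy p s \<Longrightarrow> padic_Cauchy p (\<lambda>n. c * s n)"
  using padic_Cauchy_mult[OF _ padic_Cauchy_const[of p c]] by simp

section \<open>Square roots by Hensel lifting\<close>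

definition padic_square :: "nat \<Rightarrow> int \<Rightarrow> bool" where
  "padic_square p u \<longleftrightarrow> (\<exists>s. padic_Cauchy p s \<and> (\<lambda>n. s n ^ 2 - of_int u) \<in> padic_null p)"

text \<open>Congruence modulo \<open>p ^ n\<close> is closeness in the metric, so coherent
  approximate roots form a Cauchy sequence whose square tends to \<open>u\<close>.\<close>

lemma padic_squareI:
  assumes p: "prime p" and s: "\<And>n. [s n ^ 2 = u] (mod int p ^ n)" "\<And>n. [s (Suc n) = s n] (mod int p ^ n)"
  shows "padic_square p u"
proof -
  have p1: "real p > 1" using prime_gt_1_nat[OF p] by simp
  have small: "\<exists>N. 1 / real p ^ N < e" if "e > 0" for e :: real
    using real_arch_pow_inv[of e "1 / real p"] that p1 by (auto simp: power_one_over)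
  have le: "1 / real p ^ n \<le> 1 / real p ^ N" if "n \<ge> N" for n N
    using that p1 by (intro divide_left_mono power_increasing mult_pos_pos) auto
  have far: "[s n = s N] (mod int p ^ N)" if "n \<ge> N" for n N
    using that
  proof (induction n rule: dec_induct)
    case (step n)
    then show ?case using s(2)[of n]
      by (meson cong_dvd_modulus cong_trans le_imp_power_dvd)
  qed simp
  have "padic_Cauchy p (\<lambda>n. of_int (s n))"
    unfolding padic_Cauchy_def
  proof (intro allI impI)
    fix e :: real assume "e > 0"
    then obtain N where N: "1 / real p ^ N < e" using small by blast
    have "padic_abs p (of_int (s m) - of_int (s n)) < e" if "m \<ge> N" "n \<ge> N" for m n
    proof -
      have "[s m = s n] (mod int p ^ N)" using far[OF that(1)] far[OF that(2)] cong_sym cong_trans by blast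
      then have "int p ^ N dvd s m - s n" by (simp add: cong_iff_dvd_diff)
      from padic_abs_of_int_dvd[OF p this] N show ?thesis by simp
    qed
    then show "\<exists>N. \<forall>m\<ge>N. \<forall>n\<ge>N. padic_abs p (of_int (s m) - of_int (s n)) < e" by blast
  qed
  moreover have "(\<lambda>n. of_int (s n) ^ 2 - of_int u) \<in> padic_null p"
  proof (rule padic_nullI[OF p])
    fix e :: real assume "e > 0"
    then obtain N where N: "1 / real p ^ N < e" using small by blast
    have "padic_abs p (of_int (s n) ^ 2 - of_int u) < e" if "n \<ge> N" for n
    proof -
      have "int p ^ n dvd s n ^ 2 - u" using s(1)[of n] by (simp add: cong_iff_dvd_diff)
      from padic_abs_of_int_dvd[OF p this] N le[OF that] show ?thesis by simp
    qed
    then show "\<exists>N. \<forall>n\<ge>N. padic_abs p (of_int (s n) ^ 2 - of_int u) < e" by blast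
  qed
  ultimately show ?thesis unfolding padic_square_def by blast
qed

text \<open>Newton iteration: \<open>2 * s\<close> is invertible modulo \<open>p\<close>, so the
  linear congruence \<open>k + 2 * s * t = 0\<close> for the next digit \<open>t\<close> is
  solvable.\<close>

lemma padic_square_odd:
  assumes p: "prime p" "odd p" and u: "\<not> int p dvd u" "QuadRes (int p) u"
  shows "padic_square p u"
proof -
  have ip: "prime (int p)" using p by simp
  obtain y where y: "[y ^ 2 = u] (mod int p)" using u(2) by (auto simp: QuadRes_def)
  have "\<exists>s. \<forall>n. [s n ^ 2 = u] (mod int p ^ Suc n) \<and> [s (Suc n) = s n] (mod int p ^ Suc n)"
  proof (rule dependent_nat_choice)
    show "\<exists>s. [s ^ 2 = u] (mod int p ^ Suc 0)" using y by auto
    fix s n assume s: "[s ^ 2 = u] (mod int p ^ Suc n)"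
    then obtain k where k: "s ^ 2 - u = int p ^ Suc n * k" by (auto simp: cong_iff_dvd_diff)
    have "\<not> int p dvd s"
    proof
      assume "int p dvd s"
      then have "int p dvd s ^ 2" "int p dvd s ^ 2 - u" using k by (auto simp: power2_eq_square)
      then show False using u(1) by (metis dvd_diff_right_iff)
    qed
    moreover have "\<not> int p dvd 2"
    proof
      assume "int p dvd 2"
      then have "p dvd 2" by presburger
      then have "p = 2" using primes_dvd_imp_eq[OF p(1) two_is_prime_nat] by blast
      then show False using p by simp
    qed
    ultimately have "\<not> int p dvd 2 * s" using ip by (simp add: prime_dvd_mult_iff)
    then have "coprime (2 * s) (int p)" using ip by (subst coprime_commute) (rule prime_imp_coprime)
    then obtain w where w: "[2 * s * w = 1] (mod int p)" using cong_solve_coprime_int by blast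
    define t where "t = - k * w"
    have "[k + 2 * s * t = k + 2 * s * w * (- k)] (mod int p)" by (simp add: t_def algebra_simps)
    also have "[k + 2 * s * w * (- k) = k + 1 * (- k)] (mod int p)"
      using w by (intro cong_add cong_mult cong_refl)
    finally have "int p dvd k + 2 * s * t" by (simp add: cong_0_iff)
    then obtain l where l: "k + 2 * s * t = int p * l" by blast
    have "(s + int p ^ Suc n * t) ^ 2 - u = (s ^ 2 - u) + int p ^ Suc n * (2 * s * t) + (int p ^ Suc n * t) ^ 2"
      by (simp add: power2_sum algebra_simps)
    also have "\<dots> = int p ^ Suc n * (k + 2 * s * t) + (int p ^ Suc n * t) ^ 2"
      unfolding k by (simp add: algebra_simps)
    also have "\<dots> = int p ^ Suc (Suc n) * (l + int p ^ n * t ^ 2)"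
      unfolding l by (simp add: algebra_simps power2_eq_square)
    finally have "[(s + int p ^ Suc n * t) ^ 2 = u] (mod int p ^ Suc (Suc n))"
      by (simp add: cong_iff_dvd_diff)
    moreover have "[s + int p ^ Suc n * t = s] (mod int p ^ Suc n)" by (simp add: cong_iff_dvd_diff)
    ultimately show "\<exists>s'. [s' ^ 2 = u] (mod int p ^ Suc (Suc n)) \<and> [s' = s] (mod int p ^ Suc n)" by blast
  qed
  then obtain s where s: "\<And>n. [s n ^ 2 = u] (mod int p ^ Suc n)" "\<And>n. [s (Suc n) = s n] (mod int p ^ Suc n)"
    by blast
  show ?thesis
  proof (rule padic_squareI[OF p(1), of s])
    fix n show "[s n ^ 2 = u] (mod int p ^ n)" "[s (Suc n) = s n] (mod int p ^ n)"
      using cong_dvd_modulus[OF s(1)[of n], of "int p ^ n"] cong_dvd_modulus[OF s(2)[of n], of "int p ^ n"]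
      by simp_all
  qed
qed

text \<open>The derivative \<open>2 * s\<close> is even, so the root lags one binary digit behind
  its square: squares are right modulo \<open>2 ^ (n + 3)\<close> while successive roots agree
  modulo \<open>2 ^ (n + 2)\<close> only. The error term \<open>k\<close> itself serves as the next
  digit, because \<open>k + s * k\<close> is even for odd \<open>s\<close>.\<close>

lemma padic_square_2:
  assumes u: "u mod 8 = 1"
  shows "padic_square 2 u"
proof -
  have "\<exists>s. \<forall>n. [s n ^ 2 = u] (mod 2 ^ (n + 3)) \<and> [s (Suc n) = s n] (mod 2 ^ (n + 2))"
  proof (rule dependent_nat_choice)
    show "\<exists>s. [s ^ 2 = u] (mod 2 ^ (0 + 3))" using u by (intro exI[of _ 1]) (simp add: cong_def)
    fix s n assume s: "[s ^ 2 = u] (mod 2 ^ (n + 3))"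
    then obtain k where k: "s ^ 2 - u = 2 ^ (n + 3) * k" by (auto simp: cong_iff_dvd_diff)
    have "odd u" using u by presburger
    moreover have "even (s ^ 2 - u)" unfolding k by simp
    ultimately have "odd s" by simp
    then have ev: "even (k + s * k)" by simp
    then obtain l where l: "k + s * k = 2 * l" by blast
    have "(s + 2 ^ (n + 2) * k) ^ 2 - u = (s ^ 2 - u) + 2 ^ (n + 3) * (s * k) + (2 ^ (n + 2) * k) ^ 2"
      by (simp add: power2_sum algebra_simps power_add)
    also have "\<dots> = 2 ^ (n + 3) * (k + s * k) + (2 ^ (n + 2) * k) ^ 2"
      unfolding k by (simp add: algebra_simps)
    also have "\<dots> = 2 ^ (Suc n + 3) * (l + 2 ^ n * k ^ 2)"
      unfolding l by (simp add: algebra_simps power_add power2_eq_square)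
    finally have "[(s + 2 ^ (n + 2) * k) ^ 2 = u] (mod 2 ^ (Suc n + 3))"
      by (simp add: cong_iff_dvd_diff)
    moreover have "[s + 2 ^ (n + 2) * k = s] (mod 2 ^ (n + 2))" by (simp add: cong_iff_dvd_diff)
    ultimately show "\<exists>s'. [s' ^ 2 = u] (mod 2 ^ (Suc n + 3)) \<and> [s' = s] (mod 2 ^ (n + 2))" by blast
  qed
  then obtain s where s: "\<And>n. [s n ^ 2 = u] (mod 2 ^ (n + 3))" "\<And>n. [s (Suc n) = s n] (mod 2 ^ (n + 2))"
    by blast
  show ?thesis
  proof (rule padic_squareI[OF two_is_prime_nat, of s])
    fix n show "[s n ^ 2 = u] (mod int 2 ^ n)" "[s (Suc n) = s n] (mod int 2 ^ n)"
      using cong_dvd_modulus[OF s(1)[of n], of "2 ^ n"] cong_dvd_modulus[OF s(2)[of n], of "2 ^ n"]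
      by (simp_all add: le_imp_power_dvd)
  qed
qed

lemma padic_conic_squareI:
  assumes p: "prime p" and s: "padic_square p (a * x ^ 2 + b * y ^ 2)" and nz: "x \<noteq> 0 \<or> y \<noteq> 0"
  shows "padic_conic p a b"
proof -
  obtain s where s: "padic_Cauchy p s" "(\<lambda>n. s n ^ 2 - of_int (a * x ^ 2 + b * y ^ 2)) \<in> padic_null p"
    using s by (auto simp: padic_square_def)
  show ?thesis unfolding padic_conic_def
    using s nz
    by (intro exI[of _ "\<lambda>_. of_int x"] exI[of _ "\<lambda>_. of_int y"] exI[of _ s])
       (auto simp: padic_null_const[OF p] padic_Cauchy_const[OF p])
qed

section \<open>Symmetries of the conic\<close>

lemma padic_conic_commute: "padic_conic p a b \<longleftrightarrow> padic_conic p b a"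
  unfolding padic_conic_def by (subst ex_comm) (simp add: add.commute conj_ac cong: conj_cong)

lemma padic_conic_mult_square:
  assumes p: "prime p" and c: "c \<noteq> 0"
  shows "padic_conic p (a * c ^ 2) b \<longleftrightarrow> padic_conic p a b"
proof
  assume "padic_conic p (a * c ^ 2) b"
  then obtain x y z where h: "padic_Cauchy p x" "padic_Cauchy p y" "padic_Cauchy p z"
    "\<not> (x \<in> padic_null p \<and> y \<in> padic_null p \<and> z \<in> padic_null p)"
    "(\<lambda>n. z n ^ 2 - (of_int (a * c ^ 2) * x n ^ 2 + of_int b * y n ^ 2)) \<in> padic_null p"
    unfolding padic_conic_def by auto
  then show "padic_conic p a b" unfolding padic_conic_def using c
    by (intro exI[of _ "\<lambda>n. of_int c * x n"] exI[of _ y] exI[of _ z])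
       (auto simp: padic_null_scale_iff[OF p] padic_Cauchy_scale[OF p] power_mult_distrib algebra_simps)
next
  assume "padic_conic p a b"
  then obtain x y z where h: "padic_Cauchy p x" "padic_Cauchy p y" "padic_Cauchy p z"
    "\<not> (x \<in> padic_null p \<and> y \<in> padic_null p \<and> z \<in> padic_null p)"
    "(\<lambda>n. z n ^ 2 - (of_int a * x n ^ 2 + of_int b * y n ^ 2)) \<in> padic_null p"
    unfolding padic_conic_def by auto
  then show "padic_conic p (a * c ^ 2) b" unfolding padic_conic_def using c padic_null_scale_iff[OF p, of "1 / of_int c" x]
    padic_Cauchy_scale[OF p, of x "1 / of_int c"]
    by (intro exI[of _ "\<lambda>n. 1 / of_int c * x n"] exI[of _ y] exI[of _ z])
       (auto simp: power_mult_distrib power_divide)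
qed

text \<open>Multiplying $z^2 - a x^2 = b y^2$ by the norm $-a$ of $\sqrt a$.\<close>

lemma padic_conic_twist:
  assumes p: "prime p" and a: "a \<noteq> 0"
  shows "padic_conic p a (- a * b) \<longleftrightarrow> padic_conic p a b"
proof -
  have one: "padic_conic p a (- a * b)" if "padic_conic p a b" for b
  proof -
    obtain x y z where h: "padic_Cauchy p x" "padic_Cauchy p y" "padic_Cauchy p z"
      "\<not> (x \<in> padic_null p \<and> y \<in> padic_null p \<and> z \<in> padic_null p)"
      "(\<lambda>n. z n ^ 2 - (of_int a * x n ^ 2 + of_int b * y n ^ 2)) \<in> padic_null p"
      using \<open>padic_conic p a b\<close> unfolding padic_conic_def by auto
    have "(\<lambda>n. (of_int a * x n) ^ 2 - (of_int a * z n ^ 2 + of_int (- a * b) * y n ^ 2)) =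
      (\<lambda>n. of_int (- a) * (z n ^ 2 - (of_int a * x n ^ 2 + of_int b * y n ^ 2)))"
      by (simp add: fun_eq_iff algebra_simps power2_eq_square)
    then have "(\<lambda>n. (of_int a * x n) ^ 2 - (of_int a * z n ^ 2 + of_int (- a * b) * y n ^ 2)) \<in> padic_null p"
      by (simp only: padic_null_scale[OF p h(5)])
    then show ?thesis unfolding padic_conic_def using h a
      by (intro exI[of _ z] exI[of _ y] exI[of _ "\<lambda>n. of_int a * x n"])
         (auto simp: padic_null_scale_iff[OF p] padic_Cauchy_scale[OF p])
  qed
  \<comment> \<open>Twisting twice multiplies \<open>b\<close> by the square
    \<open>a ^ 2\<close>.\<close>
  have "padic_conic p a b" if "padic_conic p a (- a * b)"
  proof -
    have "padic_conic p a (b * a ^ 2)" using one[OF that] by (simp add: power2_eq_square mult_ac)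
    then show ?thesis using padic_conic_mult_square[OF p a] padic_conic_commute by blast
  qed
  with one show ?thesis by blast
qed

section \<open>Explicit local symbols\<close>

definition sign4 :: "int \<Rightarrow> int" where "sign4 u = (if u mod 4 = 1 then 1 else -1)"

definition sign8 :: "int \<Rightarrow> int" where "sign8 u = (if u mod 8 = 1 \<or> u mod 8 = 7 then 1 else -1)"

definition upart :: "nat \<Rightarrow> int \<Rightarrow> int" where "upart p a = a div int p ^ multiplicity (int p) a"

text \<open>The classical closed formula for the Hilbert symbol in terms of exponents and unit
  parts; on odd \<open>u\<close>, \<open>sign4\<close> and \<open>sign8\<close> are (-1)^((u-1)/2)
  and (-1)^((u^2-1)/8). In contrast to \<open>hilbert'\<close>, it takes the value 1 on two even
  exponents at odd \<open>p\<close>, which makes it bimultiplicative on nonzero integers.\<close>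

definition local_sym :: "nat \<Rightarrow> int \<Rightarrow> int \<Rightarrow> int" where
  "local_sym p a b =
    (let i = multiplicity (int p) a; j = multiplicity (int p) b; u = upart p a; v = upart p b in
     if p = 2 then (if sign4 u = -1 \<and> sign4 v = -1 then -1 else 1) *
       (if odd i then sign8 v else 1) * (if odd j then sign8 u else 1)
     else (if odd i then Legendre v (int p) else 1) * (if odd j then Legendre u (int p) else 1) *
       (if odd i \<and> odd j then Legendre (-1) (int p) else 1))"

lemma upart:
  assumes "prime p" "a \<noteq> 0"
  shows "a = int p ^ multiplicity (int p) a * upart p a" "\<not> int p dvd upart p a" "upart p a \<noteq> 0"
proof -
  show e: "a = int p ^ multiplicity (int p) a * upart p a"
    by (simp add: upart_def multiplicity_dvd)
  then show "upart p a \<noteq> 0" using assms by auto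
  have "\<not> is_unit (int p)" using assms by auto
  then show "\<not> int p dvd upart p a" using assms unfolding upart_def
    by (metis multiplicity_decompose)
qed

text \<open>Modulo \<open>p\<close> the equation makes \<open>u\<close> the square of
  \<open>W / U\<close>. The precision \<open>p ^ 2\<close> rules out \<open>p\<close> dividing
  \<open>U\<close>: then \<open>p\<close> divides \<open>W\<close>, so \<open>p ^ 2\<close> divides
  \<open>p * v * V ^ 2\<close>, and the triple is not primitive.\<close>

lemma padic_conic_odd_unit_prime:
  assumes p: "prime p" "odd p" and u: "\<not> int p dvd u" and v: "\<not> int p dvd v"
  shows "padic_conic p u (int p * v) \<longleftrightarrow> QuadRes (int p) u"
proof
  assume "QuadRes (int p) u"
  then show "padic_conic p u (int p * v)"
    using padic_conic_squareI[OF p(1), of u 1 "int p * v" 0] padic_square_odd[OF p u] by simp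
next
  assume "padic_conic p u (int p * v)"
  then obtain U V W where d: "int p ^ 2 dvd W ^ 2 - (u * U ^ 2 + int p * v * V ^ 2)"
    and prim: "\<not> (int p dvd U \<and> int p dvd V \<and> int p dvd W)"
    by (rule padic_conic_primitive[OF p(1)])
  have ip: "prime (int p)" using p by simp
  have d1: "int p dvd W ^ 2 - u * U ^ 2"
  proof -
    have "int p dvd W ^ 2 - (u * U ^ 2 + int p * v * V ^ 2)" using d by (rule dvd_trans[rotated]) simp
    then have "int p dvd (W ^ 2 - (u * U ^ 2 + int p * v * V ^ 2)) + int p * (v * V ^ 2)"
      by (rule dvd_add) (rule dvd_triv_left)
    then show ?thesis by (simp add: algebra_simps)
  qed
  show "QuadRes (int p) u"
  proof (cases "int p dvd U")
    case True
    then have "int p dvd (W ^ 2 - u * U ^ 2) + u * U ^ 2"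
      using d1 by (intro dvd_add) (simp_all add: power2_eq_square)
    then have "int p dvd W ^ 2" by simp
    then have W: "int p dvd W" using ip prime_dvd_power by blast
    have "int p ^ 2 dvd W ^ 2" "int p ^ 2 dvd U ^ 2" using W True by (auto intro: dvd_power_same)
    then have "int p ^ 2 dvd W ^ 2 - u * U ^ 2" by (intro dvd_diff dvd_mult)
    then have "int p ^ 2 dvd (W ^ 2 - u * U ^ 2) - (W ^ 2 - (u * U ^ 2 + int p * v * V ^ 2))"
      using d by (rule dvd_diff)
    then have "int p * int p dvd int p * (v * V ^ 2)" by (simp add: power2_eq_square algebra_simps)
    then have "int p dvd v * V ^ 2" using prime_gt_0_nat[OF p(1)] by simp
    then have "int p dvd V" using v ip prime_dvd_power[of "int p" V 2] prime_dvd_mult_iff[OF ip, of v "V ^ 2"] by blast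
    then show ?thesis using prim W True by blast
  next
    case False
    then have "coprime U (int p)" using ip by (subst coprime_commute) (rule prime_imp_coprime)
    then obtain w where w: "[U * w = 1] (mod int p)" using cong_solve_coprime_int by blast
    have "[W ^ 2 = u * U ^ 2] (mod int p)" using d1 by (simp add: cong_iff_dvd_diff)
    then have "[W ^ 2 * w ^ 2 = u * U ^ 2 * w ^ 2] (mod int p)" by (rule cong_scalar_right)
    moreover have "[u * (U * w) ^ 2 = u * 1 ^ 2] (mod int p)" using w by (intro cong_mult cong_pow cong_refl)
    moreover have "W ^ 2 * w ^ 2 = (W * w) ^ 2" "u * U ^ 2 * w ^ 2 = u * (U * w) ^ 2" "u * 1 ^ 2 = u"
      by (simp_all add: power_mult_distrib)
    ultimately have "[(W * w) ^ 2 = u * (U * w) ^ 2] (mod int p)" "[u * (U * w) ^ 2 = u] (mod int p)"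
      by simp_all
    then have "[(W * w) ^ 2 = u] (mod int p)" by (rule cong_trans)
    then show ?thesis unfolding QuadRes_def by blast
  qed
qed

lemma odd_mod8_cases: "odd (x::int) \<Longrightarrow> (x mod 8 = 1 \<and> x mod 4 = 1) \<or> (x mod 8 = 3 \<and> x mod 4 = 3) \<or>
  (x mod 8 = 5 \<and> x mod 4 = 1) \<or> (x mod 8 = 7 \<and> x mod 4 = 3)"
proof -
  assume "odd x"
  define r q where "r = x mod 8" and "q = x div 8"
  have x: "x = 8 * q + r" by (simp add: r_def q_def)
  have 8: "x mod 8 = r" by (simp add: r_def)
  have 4: "x mod 4 = r mod 4" using mod_mult_self4[of 4 "2 * q" r] by (simp add: x)
  have "0 \<le> r" "r < 8" by (simp_all add: r_def)
  then have "r = 0 \<or> r = 1 \<or> r = 2 \<or> r = 3 \<or> r = 4 \<or> r = 5 \<or> r = 6 \<or> r = 7" by linarith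
  moreover have "odd r" using \<open>odd x\<close> by (simp add: x)
  ultimately show ?thesis unfolding 8 4 by (elim disjE) simp_all
qed
lemma mod8_reps:
  assumes "odd (x::int)"
  obtains k i where "x = 8 * k + i" "i = 1 \<or> i = 3 \<or> i = 5 \<or> i = 7"
proof (rule that)
  show "x = 8 * (x div 8) + x mod 8" by (rule mult_div_mod_eq[symmetric])
  show "x mod 8 = 1 \<or> x mod 8 = 3 \<or> x mod 8 = 5 \<or> x mod 8 = 7" using odd_mod8_cases[OF assms] by blast
qed

lemma sign_mod8: "sign4 (8 * k + i) = sign4 i" "sign8 (8 * k + i) = sign8 i"
proof -
  have "(8 * k + i) mod 8 = i mod 8" by simp
  then show "sign8 (8 * k + i) = sign8 i" by (simp add: sign8_def)
  have "(8 * k + i) mod 4 = i mod 4" using mod_mult_self4[of 4 "2 * k" i] by simp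
  then show "sign4 (8 * k + i) = sign4 i" by (simp add: sign4_def)
qed

lemma sign_mult:
  assumes "odd u" "odd v"
  shows "sign4 (u * v) = sign4 u * sign4 v" "sign8 (u * v) = sign8 u * sign8 v"
proof -
  obtain k i where u: "u = 8 * k + i" "i = 1 \<or> i = 3 \<or> i = 5 \<or> i = 7" using mod8_reps[OF assms(1)] .
  obtain l j where v: "v = 8 * l + j" "j = 1 \<or> j = 3 \<or> j = 5 \<or> j = 7" using mod8_reps[OF assms(2)] .
  have uv: "u * v = 8 * (8 * k * l + k * j + l * i) + i * j" by (simp add: u(1) v(1) algebra_simps)
  have "sign4 (i * j) = sign4 i * sign4 j" "sign8 (i * j) = sign8 i * sign8 j"
    using u(2) v(2) by (elim disjE; simp add: sign4_def sign8_def)+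
  moreover have "sign4 (u * v) = sign4 (i * j)" "sign8 (u * v) = sign8 (i * j)" by (simp_all only: uv sign_mod8)
  moreover have "sign4 u = sign4 i" "sign8 u = sign8 i" "sign4 v = sign4 j" "sign8 v = sign8 j"
    by (simp_all only: u(1) v(1) sign_mod8)
  ultimately show "sign4 (u * v) = sign4 u * sign4 v" "sign8 (u * v) = sign8 u * sign8 v" by simp_all
qed

lemma sign_uminus:
  assumes "odd u"
  shows "sign4 (- u) = - sign4 u" "sign8 (- u) = sign8 u"
proof -
  obtain k i where u: "u = 8 * k + i" "i = 1 \<or> i = 3 \<or> i = 5 \<or> i = 7" using mod8_reps[OF assms] .
  have m: "- u = 8 * (- k) + (- i)" by (simp add: u(1))
  have "sign4 (- i) = - sign4 i" "sign8 (- i) = sign8 i"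
    using u(2) by (elim disjE; simp add: sign4_def sign8_def)+
  moreover have "sign4 (- u) = sign4 (- i)" "sign8 (- u) = sign8 (- i)" by (simp_all only: m sign_mod8)
  moreover have "sign4 u = sign4 i" "sign8 u = sign8 i" by (simp_all only: u(1) sign_mod8)
  ultimately show "sign4 (- u) = - sign4 u" "sign8 (- u) = sign8 u" by simp_all
qed

lemma sign_values: "sign4 u = 1 \<or> sign4 u = -1" "sign8 u = 1 \<or> sign8 u = -1"
  by (auto simp: sign4_def sign8_def)

text \<open>Both sides depend only on the classes of \<open>u\<close> and \<open>v\<close> modulo 8,
  which leaves sixteen cases.\<close>

lemma unit_even_criterion:
  assumes "odd u" "odd v"
  shows "u mod 8 = 1 \<or> (u + 2 * v) mod 8 = 1 \<longleftrightarrow>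
    (if sign4 u = -1 \<and> sign4 v = -1 then -1 else 1) * sign8 u = 1"
proof -
  obtain k i where u: "u = 8 * k + i" "i = 1 \<or> i = 3 \<or> i = 5 \<or> i = 7" using mod8_reps[OF assms(1)] .
  obtain l j where v: "v = 8 * l + j" "j = 1 \<or> j = 3 \<or> j = 5 \<or> j = 7" using mod8_reps[OF assms(2)] .
  have "u + 2 * v = 8 * (k + 2 * l) + (i + 2 * j)" by (simp add: u(1) v(1))
  then have m: "(u + 2 * v) mod 8 = (i + 2 * j) mod 8" by (simp only: mod_mult_self4)
  have m': "u mod 8 = i mod 8" by (simp add: u(1))
  show ?thesis unfolding m m' unfolding u(1) v(1) sign_mod8
    using u(2) v(2) by (elim disjE; simp add: sign4_def sign8_def)
qed

lemma add_mod8_eq_1: "8 dvd 8 * b + 1 - (x::int) \<Longrightarrow> x mod 8 = 1"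
proof -
  assume "8 dvd 8 * b + 1 - x"
  then obtain k where "8 * b + 1 - x = 8 * k" by blast
  then have "x = 8 * (b - k) + 1" by simp
  then show ?thesis by (simp only: mod_mult_self4) simp
qed

lemma odd_square_mod8: "odd (x::int) \<Longrightarrow> \<exists>k. x ^ 2 = 8 * k + 1"
proof -
  assume "odd x"
  then obtain m where m: "x = 2 * m + 1" by (auto elim: oddE)
  have "even (m * (m + 1))" by simp
  then obtain k where "m * (m + 1) = 2 * k" by blast
  then have "x ^ 2 = 8 * k + 1" by (simp add: m power2_eq_square algebra_simps)
  then show ?thesis by blast
qed

lemma even_square_mod4: "even (x::int) \<Longrightarrow> \<exists>k. x ^ 2 = 4 * k"
  proof -
  assume "even x"
  then obtain m where "x = 2 * m" by blast
  then have "x ^ 2 = 4 * m ^ 2" by (simp add: power_mult_distrib)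
  then show ?thesis by blast
qed

text \<open>If \<open>u\<close> is 1 modulo 8 it is a square itself; if it is 5, then
  \<open>u + 4 * v\<close> is 1 modulo 8 and hence a square. Conversely, if both are 3 modulo 4, the
  equation reads \<open>W ^ 2 + U ^ 2 + V ^ 2 = 0\<close> modulo 4, which forces all three to be
  even.\<close>

lemma padic_conic_2_unit_unit:
  assumes "odd u" "odd v"
  shows "padic_conic 2 u v \<longleftrightarrow> u mod 4 = 1 \<or> v mod 4 = 1"
proof
  have main: "padic_conic 2 u v" if "u mod 4 = 1" and "odd v" for u v
  proof (cases "u mod 8 = 1")
    case True
    then show ?thesis
      using padic_conic_squareI[OF two_is_prime_nat, of u 1 v 0] padic_square_2[of u] by simp
  next
    case False
    have "odd u" using that(1) by presburger
    then have "u mod 8 = 5" using odd_mod8_cases[of u] that False by auto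
    then have "u = 8 * (u div 8) + 5" using mult_div_mod_eq[of 8 u] by simp
    moreover obtain k where "v = 2 * k + 1" using \<open>odd v\<close> by (auto elim: oddE)
    ultimately have "u + 4 * v = 8 * (u div 8 + k + 1) + 1" by simp
    then have "(u + 4 * v) mod 8 = 1" by (simp only: mod_mult_self4) simp
    then show ?thesis
      using padic_conic_squareI[OF two_is_prime_nat, of u 1 v 2] padic_square_2[of "u + 4 * v"] by (simp add: mult.commute)
  qed
  assume "u mod 4 = 1 \<or> v mod 4 = 1"
  then show "padic_conic 2 u v" using main[of u v] main[of v u] assms padic_conic_commute by blast
next
  assume "padic_conic 2 u v"
  then obtain U V W where d: "int 2 ^ 2 dvd W ^ 2 - (u * U ^ 2 + v * V ^ 2)"
    and prim: "\<not> (int 2 dvd U \<and> int 2 dvd V \<and> int 2 dvd W)"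
    by (rule padic_conic_primitive[OF two_is_prime_nat])
  show "u mod 4 = 1 \<or> v mod 4 = 1"
  proof (rule ccontr)
    assume "\<not> (u mod 4 = 1 \<or> v mod 4 = 1)"
    then have "u mod 4 = 3" "v mod 4 = 3" using assms by presburger+
    then have "\<exists>k. u = 4 * k - 1" "\<exists>l. v = 4 * l - 1" by presburger+
    then obtain k l where kl: "u = 4 * k - 1" "v = 4 * l - 1" by blast
    have "4 dvd (W ^ 2 - (u * U ^ 2 + v * V ^ 2)) + 4 * (k * U ^ 2 + l * V ^ 2)" using d by simp
    then have s: "4 dvd W ^ 2 + U ^ 2 + V ^ 2" by (simp add: kl algebra_simps)
    have c: "(\<exists>k. x ^ 2 = 4 * k) \<and> even x \<or> (\<exists>k. x ^ 2 = 8 * k + 1) \<and> odd x" for x :: int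
      using odd_square_mod8[of x] even_square_mod4[of x] by blast
    show False using c[of U] c[of V] c[of W] s prim
      by (elim disjE conjE exE) (simp_all, presburger+)
  qed
qed

text \<open>In a primitive solution modulo 8 both \<open>U\<close> and \<open>W\<close> are odd,
  with squares 1 modulo 8; the parity of \<open>V\<close> then decides whether \<open>u\<close> or
  \<open>u + 2 * v\<close> is 1 modulo 8.\<close>

lemma padic_conic_2_unit_even:
  assumes "odd u" "odd v"
  shows "padic_conic 2 u (2 * v) \<longleftrightarrow> u mod 8 = 1 \<or> (u + 2 * v) mod 8 = 1"
proof
  assume "u mod 8 = 1 \<or> (u + 2 * v) mod 8 = 1"
  then show "padic_conic 2 u (2 * v)"
    using padic_conic_squareI[OF two_is_prime_nat, of u 1 "2 * v" 0] padic_square_2[of u]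
      padic_conic_squareI[OF two_is_prime_nat, of u 1 "2 * v" 1] padic_square_2[of "u + 2 * v"] by auto
next
  assume "padic_conic 2 u (2 * v)"
  then obtain U V W where d: "int 2 ^ 3 dvd W ^ 2 - (u * U ^ 2 + 2 * v * V ^ 2)"
    and prim: "\<not> (int 2 dvd U \<and> int 2 dvd V \<and> int 2 dvd W)"
    by (rule padic_conic_primitive[OF two_is_prime_nat])
  have d8: "8 dvd W ^ 2 - (u * U ^ 2 + 2 * v * V ^ 2)" using d by simp
  then have "even (W ^ 2 - (u * U ^ 2 + 2 * v * V ^ 2))" by (rule dvd_trans[rotated]) simp
  then have ev: "even W \<longleftrightarrow> even U" using assms by auto
  have oU: "odd U"
  proof
    assume U: "even U"
    then obtain a b where ab: "U ^ 2 = 4 * a" "W ^ 2 = 4 * b" using U ev even_square_mod4[of U] even_square_mod4[of W] by auto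
    have "8 dvd 4 * b - (u * (4 * a) + 2 * v * V ^ 2)" using d8 by (simp add: ab)
    then have "4 dvd 4 * b - (u * (4 * a) + 2 * v * V ^ 2)" by (rule dvd_trans[rotated]) simp
    then have "4 dvd (4 * b - (u * (4 * a) + 2 * v * V ^ 2)) - 4 * (b - u * a)"
      by (rule dvd_diff) (rule dvd_triv_left)
    then have "4 dvd 2 * (v * V ^ 2)" by (simp add: algebra_simps)
    then obtain k where "2 * (v * V ^ 2) = 4 * k" by blast
    then have "v * V ^ 2 = 2 * k" by simp
    then have "even (v * V ^ 2)" by simp
    then show False using assms prim U ev by auto
  qed
  obtain a b where ab: "U ^ 2 = 8 * a + 1" "W ^ 2 = 8 * b + 1" using oU ev odd_square_mod8[of U] odd_square_mod8[of W] by auto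
  have e: "8 dvd (8 * b + 1) - (u * (8 * a + 1) + 2 * v * V ^ 2)" using d8 by (simp add: ab)
  show "u mod 8 = 1 \<or> (u + 2 * v) mod 8 = 1"
  proof (cases "even V")
    case True
    then obtain c where c: "V ^ 2 = 4 * c" using even_square_mod4 by blast
    have "8 dvd ((8 * b + 1) - (u * (8 * a + 1) + 2 * v * V ^ 2)) + 8 * (u * a + v * c)" using e by simp
    then have "8 dvd 8 * b + 1 - u" by (simp add: c algebra_simps)
    then show ?thesis using add_mod8_eq_1 by blast
  next
    case False
    then obtain c where c: "V ^ 2 = 8 * c + 1" using odd_square_mod8 by blast
    have "8 dvd ((8 * b + 1) - (u * (8 * a + 1) + 2 * v * V ^ 2)) + 8 * (u * a + 2 * v * c)" using e by simp
    then have "8 dvd 8 * b + 1 - (u + 2 * v)" by (simp add: c algebra_simps)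
    then show ?thesis using add_mod8_eq_1 by blast
  qed
qed

lemma padic_conic_reduce:
  assumes p: "prime p" and nz: "a \<noteq> 0" "b \<noteq> 0"
  shows "padic_conic p a b \<longleftrightarrow> padic_conic p
    ((if odd (multiplicity (int p) a) then int p else 1) * upart p a)
    ((if odd (multiplicity (int p) b) then int p else 1) * upart p b)"
proof -
  have sq: "\<exists>c. c \<noteq> 0 \<and> a = (if odd (multiplicity (int p) a) then int p else 1) * upart p a * c ^ 2"
    if "a \<noteq> 0" for a
  proof (intro exI conjI)
    let ?m = "multiplicity (int p) a"
    show "int p ^ (?m div 2) \<noteq> 0" using p by auto
    have "int p ^ ?m = (if odd ?m then int p else 1) * (int p ^ (?m div 2)) ^ 2"
      by (cases "even ?m") (auto elim!: evenE oddE simp: power_mult[symmetric] mult.commute)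
    then show "a = (if odd ?m then int p else 1) * upart p a * (int p ^ (?m div 2)) ^ 2"
      using upart(1)[OF p that] by (simp add: mult_ac)
  qed
  obtain c d where cd: "c \<noteq> 0" "d \<noteq> 0"
    "a = (if odd (multiplicity (int p) a) then int p else 1) * upart p a * c ^ 2"
    "b = (if odd (multiplicity (int p) b) then int p else 1) * upart p b * d ^ 2"
    using sq[OF nz(1)] sq[OF nz(2)] by blast
  let ?a = "(if odd (multiplicity (int p) a) then int p else 1) * upart p a"
  let ?b = "(if odd (multiplicity (int p) b) then int p else 1) * upart p b"
  have "padic_conic p a b \<longleftrightarrow> padic_conic p (?a * c ^ 2) (?b * d ^ 2)" using cd by simp
  also have "\<dots> \<longleftrightarrow> padic_conic p ?a ?b"
    using padic_conic_mult_square[OF p cd(1), of ?a "?b * d ^ 2"] padic_conic_mult_square[OF p cd(2), of ?b ?a]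
      padic_conic_commute[of p ?a "?b * d ^ 2"] padic_conic_commute[of p ?a ?b] by blast
  finally show ?thesis .
qed

text \<open>Euler's criterion gives the congruence modulo \<open>p\<close>. Both sides lie between
  -1 and 1, and \<open>p > 2\<close>, so it is an equality.\<close>

lemma Legendre_mult:
  assumes p: "prime p" "odd p"
  shows "Legendre (a * b) (int p) = Legendre a (int p) * Legendre b (int p)"
proof -
  have p2: "p > 2" using p prime_ge_2_nat[OF p(1)] by (cases "p = 2") auto
  have "[Legendre (a * b) (int p) = (a * b) ^ ((p - 1) div 2)] (mod int p)"
    by (rule euler_criterion[OF p(1) p2])
  moreover have "[Legendre a (int p) * Legendre b (int p) = a ^ ((p - 1) div 2) * b ^ ((p - 1) div 2)] (mod int p)"
    by (intro cong_mult euler_criterion[OF p(1) p2])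
  ultimately have "[Legendre (a * b) (int p) = Legendre a (int p) * Legendre b (int p)] (mod int p)"
    by (simp add: power_mult_distrib cong_def)
  then have d: "int p dvd Legendre (a * b) (int p) - Legendre a (int p) * Legendre b (int p)"
    by (simp add: cong_iff_dvd_diff)
  have "\<bar>Legendre (a * b) (int p) - Legendre a (int p) * Legendre b (int p)\<bar> < int p"
    using p2 by (auto simp: Legendre_def)
  with d show ?thesis using zdvd_not_zless[of "\<bar>Legendre (a * b) (int p) - Legendre a (int p) * Legendre b (int p)\<bar>" "int p"] by force
qed

lemma Legendre_unit: "\<not> int p dvd u \<Longrightarrow> Legendre u (int p) = (if QuadRes (int p) u then 1 else -1)"
  by (simp add: Legendre_def cong_0_iff)

text \<open>Removing squares leaves units and \<open>p\<close> times units. Two arguments of odd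
  exponent are reduced by the twist to a unit against \<open>p\<close> times a unit. Two even
  exponents at an odd prime are left out because \<open>hilbert'\<close> is 0 there.\<close>

lemma padic_conic_iff_local_sym:
  assumes p: "prime p" and nz: "a \<noteq> 0" "b \<noteq> 0"
    and "p = 2 \<or> odd (multiplicity (int p) a) \<or> odd (multiplicity (int p) b)"
  shows "padic_conic p a b \<longleftrightarrow> local_sym p a b = 1"
proof -
  define u v where "u = upart p a" and "v = upart p b"
  have uv: "\<not> int p dvd u" "\<not> int p dvd v" "u \<noteq> 0" "v \<noteq> 0"
    using upart[OF p nz(1)] upart[OF p nz(2)] by (auto simp: u_def v_def)
  have ip: "prime (int p)" using p by simp
  have uv': "\<not> int p dvd - (u * v)" using uv ip by (simp add: prime_dvd_mult_iff)
  have both: "padic_conic p (int p * u) (int p * v) \<longleftrightarrow> padic_conic p (- (u * v)) (int p * u)"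
  proof -
    have "padic_conic p (int p * u) (int p * v) \<longleftrightarrow> padic_conic p (int p * u) (- (int p * u) * (int p * v))"
      using padic_conic_twist[OF p, of "int p * u" "int p * v"] uv p by auto
    also have "- (int p * u) * (int p * v) = - (u * v) * int p ^ 2" by (simp add: power2_eq_square)
    finally show ?thesis
      using padic_conic_mult_square[OF p, of "int p" "- (u * v)" "int p * u"] padic_conic_commute p by auto
  qed
  define i j where "i = multiplicity (int p) a" and "j = multiplicity (int p) b"
  have red: "padic_conic p a b \<longleftrightarrow> padic_conic p ((if odd i then int p else 1) * u) ((if odd j then int p else 1) * v)"
    unfolding i_def j_def u_def v_def by (rule padic_conic_reduce[OF p nz])
  have ls: "local_sym p a b =
    (if p = 2 then (if sign4 u = -1 \<and> sign4 v = -1 then -1 else 1) *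
       (if odd i then sign8 v else 1) * (if odd j then sign8 u else 1)
     else (if odd i then Legendre v (int p) else 1) * (if odd j then Legendre u (int p) else 1) *
       (if odd i \<and> odd j then Legendre (-1) (int p) else 1))"
    by (simp only: local_sym_def Let_def i_def j_def u_def v_def)
  show ?thesis
  proof (cases "p = 2")
    case True
    have o: "odd u" "odd v" "odd (u * v)" using uv True by auto
    have ev: "padic_conic 2 u v \<longleftrightarrow> (if sign4 u = -1 \<and> sign4 v = -1 then -1 else (1::int)) = 1"
      using padic_conic_2_unit_unit[OF o(1,2)] by (auto simp: sign4_def)
    have one: "padic_conic 2 u (2 * v) \<longleftrightarrow> (if sign4 u = -1 \<and> sign4 v = -1 then -1 else 1) * sign8 u = 1"
      if "odd u" "odd v" for u v
      using padic_conic_2_unit_even[OF that] unit_even_criterion[OF that] by simp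
    have two: "padic_conic 2 (- (u * v)) (2 * u) \<longleftrightarrow>
      (if sign4 u = -1 \<and> sign4 v = -1 then -1 else 1) * sign8 v * sign8 u = 1"
    proof -
      have "odd (- (u * v))" using o by simp
      moreover have "sign4 (- (u * v)) = - (sign4 u * sign4 v)" "sign8 (- (u * v)) = sign8 u * sign8 v"
        using o sign_uminus[of "u * v"] sign_mult[of u v] by simp_all
      ultimately show ?thesis
        using one[of "- (u * v)" u] o(1) sign_values(1)[of u] sign_values(1)[of v] sign_values(2)[of u] sign_values(2)[of v]
        by auto
    qed
    have ls2: "local_sym 2 a b = (if sign4 u = -1 \<and> sign4 v = -1 then -1 else 1) *
       (if odd i then sign8 v else 1) * (if odd j then sign8 u else 1)"
      using ls unfolding True by simp
    have com: "padic_conic 2 (2 * u) v \<longleftrightarrow> padic_conic 2 v (2 * u)" by (rule padic_conic_commute)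
    show ?thesis
      using red ev one[OF o(1,2)] one[OF o(2,1)] two both com
      by (cases "odd i"; cases "odd j") (simp_all add: ls2 True mult_ac conj_commute)
  next
    case False
    then have odd: "odd p" using p prime_odd_nat[of p] prime_ge_2_nat[of p] by simp
    have one: "padic_conic p u (int p * v) \<longleftrightarrow> Legendre u (int p) = 1"
      if "\<not> int p dvd u" "\<not> int p dvd v" for u v
      using padic_conic_odd_unit_prime[OF p odd that] that by (simp add: Legendre_unit)
    have "Legendre (- (u * v)) (int p) = Legendre (-1) (int p) * (Legendre u (int p) * Legendre v (int p))"
      using Legendre_mult[OF p odd, of "-1" "u * v"] Legendre_mult[OF p odd, of u v] by simp
    moreover have "padic_conic p (int p * u) v \<longleftrightarrow> padic_conic p v (int p * u)" by (rule padic_conic_commute)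
    moreover have "odd i \<or> odd j" using assms(4) False by (simp add: i_def j_def)
    ultimately show ?thesis
      using red False one[OF uv(1,2)] one[OF uv(2,1)] one[OF uv' uv(1)] both
      by (cases "odd i"; cases "odd j") (simp_all add: ls mult_ac)
  qed
qed

lemma local_sym_values:
  assumes p: "prime p" and nz: "a \<noteq> 0" "b \<noteq> 0"
  shows "local_sym p a b = 1 \<or> local_sym p a b = -1"
proof -
  let ?S = "{1, -1 :: int}"
  have m: "x * y \<in> ?S" if "x \<in> ?S" "y \<in> ?S" for x y using that by auto
  have i: "(if P then x else y) \<in> ?S" if "x \<in> ?S" "y \<in> ?S" for P x y using that by simp
  have s: "sign8 x \<in> ?S" "1 \<in> ?S" "-1 \<in> ?S" for x by (auto simp: sign8_def)
  have "\<not> int p dvd -1" using p by auto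
  then have L: "Legendre (upart p a) (int p) \<in> ?S" "Legendre (upart p b) (int p) \<in> ?S" "Legendre (-1) (int p) \<in> ?S"
    using upart(2)[OF p nz(1)] upart(2)[OF p nz(2)] by (simp_all add: Legendre_unit)
  have "local_sym p a b \<in> ?S"
    unfolding local_sym_def Let_def
    by (intro m i s L)
  then show ?thesis by blast
qed

lemma hilbert'_eq_local_sym:
  assumes p: "prime p" and nz: "a \<noteq> 0" "b \<noteq> 0"
  shows "hilbert' p a b =
    (if odd p \<and> even (multiplicity (int p) a) \<and> even (multiplicity (int p) b) then 0
     else if p = 2 \<and> even (multiplicity 2 a) \<and> even (multiplicity 2 b) \<and> \<not> [upart 2 a = upart 2 b] (mod 4) then 0
     else local_sym p a b)"
proof -
  have p2: "p = 2 \<or> odd p" using p prime_odd_nat[of p] prime_ge_2_nat[of p] by force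
  show ?thesis
    using padic_conic_iff_local_sym[OF assms] local_sym_values[OF assms] p2 nz
    by (auto simp: hilbert'_def Let_def hilbert_symbol_padic[OF p] upart_def)
qed

section \<open>Hilbert reciprocity\<close>

lemma local_sym_commute: "local_sym p a b = local_sym p b a"
  unfolding local_sym_def Let_def by (simp add: mult_ac conj_commute)

lemma upart_mult:
  assumes p: "prime p" and nz: "a \<noteq> 0" "b \<noteq> 0"
  shows "multiplicity (int p) (a * b) = multiplicity (int p) a + multiplicity (int p) b"
    "upart p (a * b) = upart p a * upart p b"
proof -
  have "prime_elem (int p)" using p by simp
  then show m: "multiplicity (int p) (a * b) = multiplicity (int p) a + multiplicity (int p) b"
    using nz by (rule prime_elem_multiplicity_mult_distrib)
  have "int p ^ multiplicity (int p) (a * b) \<noteq> 0" using p by auto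
  moreover have "int p ^ multiplicity (int p) (a * b) * upart p (a * b)
    = int p ^ multiplicity (int p) (a * b) * (upart p a * upart p b)"
    proof -
    have "int p ^ multiplicity (int p) (a * b) * (upart p a * upart p b)
      = (int p ^ multiplicity (int p) a * upart p a) * (int p ^ multiplicity (int p) b * upart p b)"
      by (simp add: m power_add mult_ac)
    also have "\<dots> = a * b" by (simp only: upart(1)[OF p nz(1), symmetric] upart(1)[OF p nz(2), symmetric])
    also have "\<dots> = int p ^ multiplicity (int p) (a * b) * upart p (a * b)"
      using upart(1)[OF p, of "a * b"] nz by simp
    finally show ?thesis by (rule sym)
  qed
  ultimately show "upart p (a * b) = upart p a * upart p b" using prime_gt_0_nat[OF p] by simp
qed

text \<open>Read off the closed formula: exponents enter through their parity, units through
  multiplicative characters.\<close>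

lemma local_sym_mult:
  assumes p: "prime p" and nz: "a \<noteq> 0" "b \<noteq> 0" "c \<noteq> 0"
  shows "local_sym p (a * b) c = local_sym p a c * local_sym p b c"
proof -
  define i i' j where "i = multiplicity (int p) a" and "i' = multiplicity (int p) b" and "j = multiplicity (int p) c"
  define u u' v where "u = upart p a" and "u' = upart p b" and "v = upart p c"
  have units: "\<not> int p dvd u" "\<not> int p dvd u'" "\<not> int p dvd v"
    using upart(2)[OF p] nz by (simp_all add: u_def u'_def v_def)
  have par: "x * x = 1" if "x = 1 \<or> x = (-1::int)" for x using that by auto
  have ite: "(if odd (i + i') then x else 1) = (if odd i then x else 1) * (if odd i' then x else 1)"
    if "x = 1 \<or> x = (-1::int)" for x using par[OF that] by (cases "odd i"; cases "odd i'") simp_all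
  show ?thesis
  proof (cases "p = 2")
    case True
    have o: "odd u" "odd u'" using units True by auto
    have s: "(if sign4 (u * u') = -1 \<and> sign4 v = -1 then -1 else (1::int)) =
      (if sign4 u = -1 \<and> sign4 v = -1 then -1 else 1) * (if sign4 u' = -1 \<and> sign4 v = -1 then -1 else 1)"
      using sign_mult(1)[OF o] sign_values(1)[of u] sign_values(1)[of u'] by auto
    show ?thesis
      unfolding local_sym_def Let_def upart_mult[OF p nz(1,2)]
        i_def[symmetric] i'_def[symmetric] j_def[symmetric] u_def[symmetric] u'_def[symmetric] v_def[symmetric]
        s ite[OF sign_values(2)]
      by (cases "odd j") (simp_all add: True sign_mult[OF o])
  next
    case False
    then have odd: "odd p" using p prime_odd_nat[of p] prime_ge_2_nat[of p] by simp
    have Lv: "Legendre v (int p) = 1 \<or> Legendre v (int p) = -1" using units by (simp add: Legendre_unit)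
    have "\<not> int p dvd -1" using p by auto
    then have L1: "Legendre (-1) (int p) = 1 \<or> Legendre (-1) (int p) = -1" by (simp add: Legendre_unit)
    have c: "(if odd (i + i') \<and> odd j then Legendre (-1) (int p) else 1) =
      (if odd i \<and> odd j then Legendre (-1) (int p) else 1) * (if odd i' \<and> odd j then Legendre (-1) (int p) else 1)"
      using ite[OF L1] by (cases "odd j") simp_all
    show ?thesis
      unfolding local_sym_def Let_def upart_mult[OF p nz(1,2)]
        i_def[symmetric] i'_def[symmetric] j_def[symmetric] u_def[symmetric] u'_def[symmetric] v_def[symmetric]
        c ite[OF Lv]
      by (cases "odd j") (simp_all add: False Legendre_mult[OF p odd])
  qed
qed

lemma local_sym_mult_right:
  assumes "prime p" "a \<noteq> 0" "b \<noteq> 0" "c \<noteq> 0"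
  shows "local_sym p c (a * b) = local_sym p c a * local_sym p c b"
  using local_sym_mult[OF assms] by (simp add: local_sym_commute[of p c])

lemma local_sym_1: "prime p \<Longrightarrow> a \<noteq> 0 \<Longrightarrow> local_sym p 1 a = 1"
  using local_sym_mult[of p 1 1 a] local_sym_values[of p 1 a] by auto

lemma local_sym_even:
  "p \<noteq> 2 \<Longrightarrow> even (multiplicity (int p) a) \<Longrightarrow> even (multiplicity (int p) b) \<Longrightarrow> local_sym p a b = 1"
  by (simp add: local_sym_def)

lemma local_sym_unit_left:
  assumes "prime p" "p \<noteq> 2" "\<not> int p dvd a"
  shows "local_sym p a b = (if odd (multiplicity (int p) b) then Legendre a (int p) else 1)"
  using assms by (simp add: local_sym_def upart_def not_dvd_imp_multiplicity_0)

lemma Legendre_minus_one: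
  assumes p: "prime p" "p \<noteq> 2"
  shows "Legendre (-1) (int p) = sign4 (int p)"
proof -
  have p2: "p > 2" using p prime_ge_2_nat[of p] by simp
  have odd: "odd p" using prime_odd_nat[OF p(1) p2] .
  have "(-1::int) ^ ((p - 1) div 2) = sign4 (int p)"
  proof -
    have "p mod 4 = 1 \<or> p mod 4 = 3" using odd by presburger
    then show ?thesis
    proof
      assume m: "p mod 4 = 1"
      define k where "k = p div 4"
      have "p = 4 * k + 1" using mult_div_mod_eq[of 4 p] m by (simp add: k_def)
      then show ?thesis by (simp add: sign4_def)
    next
      assume m: "p mod 4 = 3"
      define k where "k = p div 4"
      have "p = 4 * k + 3" using mult_div_mod_eq[of 4 p] m by (simp add: k_def)
      then show ?thesis by (simp add: sign4_def)
    qed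
  qed
  then have "[Legendre (-1) (int p) = sign4 (int p)] (mod int p)"
    using euler_criterion[OF p(1) p2, of "-1"] by simp
  then have d: "int p dvd Legendre (-1) (int p) - sign4 (int p)" by (simp add: cong_iff_dvd_diff)
  have "\<not> int p dvd -1" using p by auto
  then have "\<bar>Legendre (-1) (int p) - sign4 (int p)\<bar> < int p"
    using p2 by (auto simp: Legendre_unit sign4_def)
  with d show ?thesis
    using zdvd_not_zless[of "\<bar>Legendre (-1) (int p) - sign4 (int p)\<bar>" "int p"] by force
qed

text \<open>Gauss's lemma with multiplier 2: among the numbers \<open>2 * x\<close> with
  \<open>0 < x \<le> h\<close>, where \<open>h = (p - 1) div 2\<close>, those exceeding
  \<open>h\<close> come from \<open>x > h div 2\<close>. Their number is \<open>h - h div 2\<close>,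
  and its parity depends on \<open>p\<close> modulo 8.\<close>

lemma Legendre_two:
  assumes p: "prime p" "p \<noteq> 2"
  shows "Legendre 2 (int p) = sign8 (int p)"
proof -
  have p2: "p > 2" using p prime_ge_2_nat[of p] by simp
  have odd: "odd p" using prime_odd_nat[OF p(1) p2] .
  interpret G: GAUSS p 2
    using p p2 by unfold_locales (auto simp: cong_0_iff dest: zdvd_imp_le)
  define h where "h = (int p - 1) div 2"
  have ph: "int p = 2 * h + 1" using G.p_eq2 by (simp add: h_def)
  have h0: "h \<ge> 0" using ph p2 by simp
  have E: "G.E = (\<lambda>x. x * 2) ` {h div 2 <.. h}"
  proof -
    have "G.C = (\<lambda>x. x * 2) ` {0 <.. h}"
      unfolding G.C_def G.B_def G.A_def image_image h_def[symmetric]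
      by (intro image_cong refl mod_pos_pos_trivial) (auto simp: ph)
    then have "G.E = (\<lambda>x. x * 2) ` {0 <.. h} \<inter> {h <..}" by (simp add: G.E_def h_def)
    also have "\<dots> = (\<lambda>x. x * 2) ` {h div 2 <.. h}" using h0 by auto
    finally show ?thesis .
  qed
  have "card G.E = nat (h - h div 2)"
    unfolding E by (subst card_image) (auto simp: inj_on_def)
  then have L: "Legendre 2 (int p) = (-1) ^ nat (h - h div 2)" using G.gauss_lemma by simp
  obtain k i where ki: "int p = 8 * k + i" "i = 1 \<or> i = 3 \<or> i = 5 \<or> i = 7"
    using mod8_reps[of "int p"] odd by auto
  have k0: "k \<ge> 0" using ki p2 by auto
  have "(-1) ^ nat (h - h div 2) = sign8 (8 * k + i)"
  proof -
    have "sign8 (8 * k + i) = sign8 i" by (rule sign_mod8)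
    moreover have "(-1::int) ^ nat (2 * k) = 1" "(-1::int) ^ nat (2 * k + 1) = -1" "(-1::int) ^ nat (2 * k + 2) = 1"
      using k0 by (simp_all add: nat_add_distrib nat_mult_distrib)
    \<comment> \<open>With \<open>i = 2 * j + 1\<close> one has \<open>h = 4 * k + j\<close>, and
      \<open>j\<close> takes only the values 0 to 3.\<close>
    moreover have "h - h div 2 = 2 * k + (i + 1) div 4"
      proof -
      have "2 * h + 1 = 8 * k + i" using ph ki(1) by simp
      then obtain j where j: "h = 2 * (2 * k) + j" "i = 2 * j + 1" "j = 0 \<or> j = 1 \<or> j = 2 \<or> j = 3"
        using ki(2) that[of "h - 4 * k"] by (elim disjE) simp_all
      have "h div 2 = 2 * k + j div 2" unfolding j(1) by simp
      then show ?thesis using j by (elim disjE) simp_all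
    qed
    ultimately show ?thesis using ki(2) by (elim disjE) (simp_all add: sign8_def)
  qed
  with L show ?thesis by (simp only: ki(1))
qed

lemma multiplicity_int_prime:
  assumes "prime p" "prime q"
  shows "multiplicity (int p) (int q) = (if p = q then 1 else 0)"
proof (cases "p = q")
  case True
  then show ?thesis using assms by simp
next
  case False
  then have "\<not> p dvd q" using assms primes_dvd_imp_eq by blast
  then have "\<not> int p dvd int q" by simp
  then show ?thesis using False by (simp add: not_dvd_imp_multiplicity_0)
qed

lemma upart_int_prime:
  assumes "prime p" "prime q"
  shows "upart p (int q) = (if p = q then 1 else int q)"
  using assms prime_gt_0_nat[of q] by (simp add: upart_def multiplicity_int_prime)

definition infty_sym :: "int \<Rightarrow> int \<Rightarrow> int" where
  "infty_sym a b = (if a < 0 \<and> b < 0 then -1 else 1)"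

lemma infty_sym_mult: "a \<noteq> 0 \<Longrightarrow> b \<noteq> 0 \<Longrightarrow> infty_sym (a * b) c = infty_sym a c * infty_sym b c"
  by (auto simp: infty_sym_def mult_less_0_iff)

lemma infty_sym_commute: "infty_sym a b = infty_sym b a"
  by (auto simp: infty_sym_def)

context
  fixes P :: "nat set"
  assumes fin: "finite P" and primes: "\<And>p. p \<in> P \<Longrightarrow> prime p" and two: "2 \<in> P"
begin

lemma prod_two_primes:
  fixes f :: "nat \<Rightarrow> int"
  assumes "S \<subseteq> P" "\<And>p. p \<in> P \<Longrightarrow> p \<notin> S \<Longrightarrow> f p = 1"
  shows "prod f P = prod f S"
  using assms fin by (intro prod.mono_neutral_right) auto

text \<open>Only the places 2, \<open>p\<close> and \<open>q\<close> contribute, so this is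
  quadratic reciprocity and the supplementary law for 2; for \<open>p = q\<close> odd it is the law
  for -1.\<close>

lemma reciprocity_primes:
  assumes p: "p \<in> P" and q: "q \<in> P"
  shows "(\<Prod>r\<in>P. local_sym r (int p) (int q)) = 1"
proof -
  note pr = primes[OF p] primes[OF q]
  have ls: "local_sym r (int p) (int q) =
    (if r = 2 then (if sign4 (if r = p then 1 else int p) = -1 \<and> sign4 (if r = q then 1 else int q) = -1 then -1 else 1) *
       (if r = p then sign8 (if r = q then 1 else int q) else 1) * (if r = q then sign8 (if r = p then 1 else int p) else 1)
     else (if r = p then Legendre (if r = q then 1 else int q) (int r) else 1) *
       (if r = q then Legendre (if r = p then 1 else int p) (int r) else 1) *
       (if r = p \<and> r = q then Legendre (-1) (int r) else 1))" if "r \<in> P" for r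
    unfolding local_sym_def Let_def multiplicity_int_prime[OF primes[OF that] pr(1)]
      multiplicity_int_prime[OF primes[OF that] pr(2)] upart_int_prime[OF primes[OF that] pr(1)]
      upart_int_prime[OF primes[OF that] pr(2)] by simp
  have "(\<Prod>r\<in>P. local_sym r (int p) (int q)) = (\<Prod>r\<in>{2, p, q}. local_sym r (int p) (int q))"
    using two p q by (intro prod_two_primes) (auto simp: ls)
  also have "\<dots> = 1"
  proof -
    have L1: "Legendre 1 (int r) = 1" if "prime r" for r
      using that by (auto simp: Legendre_def cong_0_iff QuadRes_def intro!: exI[of _ 1])
    have s1: "sign4 1 = 1" "sign8 1 = 1" by (simp_all add: sign4_def sign8_def)
    have sq: "sign4 x * sign4 x = 1" "sign8 x * sign8 x = 1" for x
      using sign_values(1)[of x] sign_values(2)[of x] by auto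
    consider "p = 2" "q = 2" | "p = 2" "q \<noteq> 2" | "p \<noteq> 2" "q = 2" | "p \<noteq> 2" "p = q" | "p \<noteq> 2" "q \<noteq> 2" "p \<noteq> q"
      by blast
    then show ?thesis
    proof cases
      case 1 then show ?thesis using two ls[of 2] by (simp add: s1)
    next
      case 2 then show ?thesis using ls[of 2] ls[of q] p q two pr L1 by (simp add: s1 Legendre_two sq)
    next
      case 3 then show ?thesis using ls[of 2] ls[of p] p q two pr L1 by (simp add: s1 Legendre_two sq insert_commute)
    next
      case 4
      then show ?thesis using ls[of 2] ls[of q] q two pr L1 sign_values(1)[of "int q"]
        by (auto simp: s1 Legendre_minus_one)
    next
      case 5
      have "p > 2" "q > 2" using 5 pr prime_ge_2_nat[of p] prime_ge_2_nat[of q] by simp_all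
      then have "Legendre (int p) (int q) * Legendre (int q) (int p) = (-1) ^ ((p - 1) div 2 * ((q - 1) div 2))"
        using Quadratic_Reciprocity[of p q] pr 5 by simp
      also have "\<dots> = (if sign4 (int p) = -1 \<and> sign4 (int q) = -1 then -1 else 1)"
      proof -
        have par: "even ((r - 1) div 2) \<longleftrightarrow> sign4 (int r) = 1" if "prime r" "r \<noteq> 2" for r
        proof -
          have "odd r" using that prime_ge_2_nat[of r] prime_odd_nat[of r] by simp
          then obtain k where k: "r = 2 * k + 1" by (auto elim: oddE)
          have "(1 + 2 * int k) mod 4 = 1 \<longleftrightarrow> even k"
            by (cases "even k") (auto elim!: evenE oddE)
          then show ?thesis by (simp add: k sign4_def add.commute)
        qed
        have "(-1::int) ^ n = (if even n then 1 else -1)" for n by simp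
        then show ?thesis using par[OF pr(1) 5(1)] par[OF pr(2) 5(2)]
          sign_values(1)[of "int p"] sign_values(1)[of "int q"] by auto
      qed
      finally show ?thesis using 5 p q two by (simp add: ls mult.commute)
    qed
  qed
  finally show ?thesis .
qed

lemma reciprocity_minus_one:
  assumes q: "q \<in> P"
  shows "(\<Prod>r\<in>P. local_sym r (-1) (int q)) = 1"
proof -
  have unit: "multiplicity (int r) (-1) = 0" "upart r (-1) = -1" if "prime r" for r
  proof -
    have "\<not> int r dvd -1" using that by auto
    then show "multiplicity (int r) (-1) = 0" by (rule not_dvd_imp_multiplicity_0)
    then show "upart r (-1) = -1" by (simp add: upart_def)
  qed
  have ls: "local_sym r (-1) (int q) =
    (if r = 2 then (if sign4 (if r = q then 1 else int q) = -1 then -1 else 1)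
     else (if r = q then Legendre (-1) (int r) else 1))" if "r \<in> P" for r
    unfolding local_sym_def Let_def multiplicity_int_prime[OF primes[OF that] primes[OF q]]
      upart_int_prime[OF primes[OF that] primes[OF q]] unit[OF primes[OF that]]
    by (simp add: sign4_def sign8_def)
  have "(\<Prod>r\<in>P. local_sym r (-1) (int q)) = (\<Prod>r\<in>{2, q}. local_sym r (-1) (int q))"
    using two q by (intro prod_two_primes) (auto simp: ls)
  also have "\<dots> = 1"
  proof (cases "q = 2")
    case True
    then show ?thesis using two ls[of 2] by (simp add: sign4_def)
  next
    case False
    then show ?thesis using two q primes[OF q] sign_values(1)[of "int q"] by (auto simp: ls Legendre_minus_one)
  qed
  finally show ?thesis .
qed

text \<open>Only the place 2 contributes; the value -1 is what the real place compensates.\<close>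

lemma reciprocity_minus_one_minus_one: "(\<Prod>r\<in>P. local_sym r (-1) (-1)) = -1"
proof -
  have unit: "multiplicity (int r) (-1) = 0" "upart r (-1) = -1" if "prime r" for r
  proof -
    have "\<not> int r dvd -1" using that by auto
    then show "multiplicity (int r) (-1) = 0" by (rule not_dvd_imp_multiplicity_0)
    then show "upart r (-1) = -1" by (simp add: upart_def)
  qed
  have ls: "local_sym r (-1) (-1) = (if r = 2 then -1 else 1)" if "r \<in> P" for r
    unfolding local_sym_def Let_def unit[OF primes[OF that]] by (simp add: sign4_def)
  have "(\<Prod>r\<in>P. local_sym r (-1) (-1)) = (\<Prod>r\<in>{2}. local_sym r (-1) (-1))"
    using two by (intro prod_two_primes) (auto simp: ls)
  then show ?thesis using two by (simp add: ls)
qed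

lemma int_prime_factor_induct:
  assumes "a \<noteq> 0" "\<And>p. prime p \<Longrightarrow> int p dvd a \<Longrightarrow> p \<in> P"
    and "Q 1" "Q (-1)" "\<And>p x. p \<in> P \<Longrightarrow> x \<noteq> 0 \<Longrightarrow> Q x \<Longrightarrow> Q (int p * x)"
  shows "Q (a :: int)"
proof -
  have "a \<noteq> 0 \<Longrightarrow> (\<forall>p. prime p \<longrightarrow> int p dvd a \<longrightarrow> p \<in> P) \<Longrightarrow> Q a"
  proof (induction a rule: prime_divisors_induct)
    case (unit x)
    then have "x = 1 \<or> x = -1" by (metis abs_eq_iff' zdvd1_eq abs_1)
    then show ?case using assms by auto
  next
    case (factor q x)
    have q: "q = int (nat q)" "prime (nat q)" using factor(1) by (auto simp: prime_ge_0_int)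
    then have "nat q \<in> P" using factor(4) by (metis dvd_triv_left)
    moreover have "x \<noteq> 0" using factor(3) by auto
    moreover have "Q x" using factor by auto
    ultimately show ?case using assms(5)[of "nat q" x] q by simp
  qed simp
  then show ?thesis using assms by blast
qed

text \<open>The product including the real place is symmetric and bimultiplicative, so it is enough
  to know it on -1 and on primes.\<close>

theorem hilbert_reciprocity_local_sym:
  assumes nz: "a \<noteq> 0" "b \<noteq> 0"
    and P: "\<And>p. prime p \<Longrightarrow> int p dvd a \<Longrightarrow> p \<in> P" "\<And>p. prime p \<Longrightarrow> int p dvd b \<Longrightarrow> p \<in> P"
  shows "(\<Prod>p\<in>P. local_sym p a b) * infty_sym a b = 1"
proof -
  define R where "R a b = (\<Prod>p\<in>P. local_sym p a b) * infty_sym a b" for a b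
  have mult: "R (a * b) c = R a c * R b c" if "a \<noteq> 0" "b \<noteq> 0" "c \<noteq> 0" for a b c
  proof -
    have "(\<Prod>p\<in>P. local_sym p (a * b) c) = (\<Prod>p\<in>P. local_sym p a c * local_sym p b c)"
      using primes that by (intro prod.cong refl local_sym_mult) auto
    then show ?thesis using that by (simp add: R_def infty_sym_mult prod.distrib)
  qed
  have com: "R a b = R b a" for a b by (simp add: R_def local_sym_commute[of _ a] infty_sym_commute[of a])
  have one: "R 1 b = 1" if "b \<noteq> 0" for b
    using primes that by (simp add: R_def local_sym_1 infty_sym_def)
  have pq: "R (int p) (int q) = 1" if "p \<in> P" "q \<in> P" for p q
    using reciprocity_primes[OF that] by (simp add: R_def infty_sym_def)
  have mq: "R (-1) (int q) = 1" if "q \<in> P" for q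
    using reciprocity_minus_one[OF that] by (simp add: R_def infty_sym_def)
  have mm: "R (-1) (-1) = 1"
    using reciprocity_minus_one_minus_one by (simp add: R_def infty_sym_def)
  have nzp: "int p \<noteq> 0" if "p \<in> P" for p using primes[OF that] by auto
  have p: "R (int p) b = 1" if "p \<in> P" for p
  proof (rule int_prime_factor_induct[OF nz(2) P(2), where Q = "\<lambda>b. R (int p) b = 1"])
    show "R (int p) 1 = 1" "R (int p) (-1) = 1"
      using one[OF nzp[OF that]] mq[OF that] com[of "int p"] by simp_all
    fix q x assume "q \<in> P" "x \<noteq> 0" "R (int p) x = 1"
    then show "R (int p) (int q * x) = 1"
      using mult[of "int q" x "int p"] pq[OF that, of q] nzp that com[of "int p"] by simp
  qed
  have m: "R (-1) b = 1"
  proof (rule int_prime_factor_induct[OF nz(2) P(2), where Q = "\<lambda>b. R (-1) b = 1"])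
    show "R (-1) 1 = 1" "R (-1) (-1) = 1" using one[of "-1"] mm com[of "-1" 1] by simp_all
    fix q x assume "q \<in> P" "x \<noteq> 0" "R (-1) x = 1"
    then show "R (-1) (int q * x) = 1"
      using mult[of "int q" x "-1"] mq[of q] nzp com[of "-1"] by simp
  qed
  have "R a b = 1"
  proof (rule int_prime_factor_induct[OF nz(1) P(1), where Q = "\<lambda>a. R a b = 1"])
    show "R 1 b = 1" "R (-1) b = 1" using one[OF nz(2)] m by simp_all
    fix q x assume "q \<in> P" "x \<noteq> 0" "R x b = 1"
    then show "R (int q * x) b = 1" using mult[of "int q" x b] p[of q] nzp nz(2) by simp
  qed
  then show ?thesis by (simp add: R_def)
qed

end

section \<open>Bilinear forms with a bounded \<open>L\<^sup>2\<close> norm\<close>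

lemma Cauchy_Schwarz_complex_sum:
  fixes f g :: "'i \<Rightarrow> complex"
  shows "cmod (\<Sum>i\<in>I. f i * g i) \<le> sqrt (\<Sum>i\<in>I. cmod (f i) ^ 2) * sqrt (\<Sum>i\<in>I. cmod (g i) ^ 2)"
proof -
  have "cmod (\<Sum>i\<in>I. f i * g i) \<le> (\<Sum>i\<in>I. \<bar>cmod (f i)\<bar> * \<bar>cmod (g i)\<bar>)"
    by (intro order_trans[OF norm_sum]) (simp add: norm_mult)
  also have "\<dots> \<le> L2_set (\<lambda>i. cmod (f i)) I * L2_set (\<lambda>i. cmod (g i)) I" by (rule L2_set_mult_ineq)
  finally show ?thesis by (simp add: L2_set_def)
qed

lemma Cauchy_Schwarz_real_sum:
  fixes f g :: "'i \<Rightarrow> real"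
  shows "(\<Sum>i\<in>I. f i * g i) \<le> sqrt (\<Sum>i\<in>I. f i ^ 2) * sqrt (\<Sum>i\<in>I. g i ^ 2)"
proof -
  have "(\<Sum>i\<in>I. f i * g i) \<le> (\<Sum>i\<in>I. \<bar>f i\<bar> * \<bar>g i\<bar>)"
    by (intro sum_mono) (metis abs_ge_self abs_mult)
  also have "\<dots> \<le> L2_set f I * L2_set g I" by (rule L2_set_mult_ineq)
  finally show ?thesis by (simp add: L2_set_def)
qed

text \<open>A bound \<open>c\<close> for the operator norm of the matrix \<open>A\<close> between
  the square-summable vectors on \<open>J\<close> and on \<open>I\<close>. Writing it without
  conjugation is harmless, since \<open>u\<close> ranges over all vectors.\<close>

definition bilin :: "('i \<Rightarrow> 'j \<Rightarrow> complex) \<Rightarrow> 'i set \<Rightarrow> 'j set \<Rightarrow> real \<Rightarrow> bool" where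
  "bilin A I J c \<longleftrightarrow> (\<forall>u v. cmod (\<Sum>i\<in>I. \<Sum>j\<in>J. u i * v j * A i j)
      \<le> c * sqrt (\<Sum>i\<in>I. cmod (u i) ^ 2) * sqrt (\<Sum>j\<in>J. cmod (v j) ^ 2))"

lemma bilinD: "bilin A I J c \<Longrightarrow> cmod (\<Sum>i\<in>I. \<Sum>j\<in>J. u i * v j * A i j)
      \<le> c * sqrt (\<Sum>i\<in>I. cmod (u i) ^ 2) * sqrt (\<Sum>j\<in>J. cmod (v j) ^ 2)"
  by (simp add: bilin_def)

lemma bilin_mono: "bilin A I J c \<Longrightarrow> c \<le> c' \<Longrightarrow> bilin A I J c'"
  unfolding bilin_def
  by (meson mult_right_mono order_trans real_sqrt_ge_zero sum_nonneg zero_le_power2 mult_nonneg_nonneg)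

lemma bilin_cong:
  assumes "bilin A I J c" "\<And>i j. i \<in> I \<Longrightarrow> j \<in> J \<Longrightarrow> A i j = B i j"
  shows "bilin B I J c"
proof -
  have "(\<Sum>i\<in>I. \<Sum>j\<in>J. u i * v j * B i j) = (\<Sum>i\<in>I. \<Sum>j\<in>J. u i * v j * A i j)" for u v
    using assms(2) by (intro sum.cong refl) auto
  then show ?thesis using assms(1) by (simp add: bilin_def)
qed

lemma bilin_transpose: "bilin A I J c \<Longrightarrow> bilin (\<lambda>j i. A i j) J I c"
  proof -
  assume b: "bilin A I J c"
  have sw: "(\<Sum>j\<in>J. \<Sum>i\<in>I. u j * v i * A i j) = (\<Sum>i\<in>I. \<Sum>j\<in>J. v i * u j * A i j)" for u v
    by (subst sum.swap) (simp add: mult_ac)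
  then show ?thesis
    unfolding bilin_def
  proof (intro allI)
    fix u v
    show "cmod (\<Sum>j\<in>J. \<Sum>i\<in>I. u j * v i * A i j)
      \<le> c * sqrt (\<Sum>j\<in>J. cmod (u j) ^ 2) * sqrt (\<Sum>i\<in>I. cmod (v i) ^ 2)"
      unfolding \<open>(\<Sum>j\<in>J. \<Sum>i\<in>I. u j * v i * A i j) = (\<Sum>i\<in>I. \<Sum>j\<in>J. v i * u j * A i j)\<close>
      using bilinD[OF b, of v u] by (simp add: mult_ac)
  qed
qed

lemma bilin_subset:
  assumes b: "bilin A I J c" and fin: "finite I" "finite J" and sub: "I' \<subseteq> I" "J' \<subseteq> J"
  shows "bilin A I' J' c"
  unfolding bilin_def
proof (intro allI)
  fix u v :: "_ \<Rightarrow> complex"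
  define u' where "u' i = (if i \<in> I' then u i else 0)" for i
  define v' where "v' j = (if j \<in> J' then v j else 0)" for j
  have J: "(\<Sum>j\<in>J. u' i * v' j * A i j) = (\<Sum>j\<in>J'. u' i * v' j * A i j)" for i
    using fin sub by (intro sum.mono_neutral_right) (auto simp: v'_def)
  have "(\<Sum>i\<in>I. \<Sum>j\<in>J. u' i * v' j * A i j) = (\<Sum>i\<in>I'. \<Sum>j\<in>J'. u' i * v' j * A i j)"
    unfolding J using fin sub by (intro sum.mono_neutral_right) (auto simp: u'_def)
  also have "\<dots> = (\<Sum>i\<in>I'. \<Sum>j\<in>J'. u i * v j * A i j)"
    by (intro sum.cong refl) (simp add: u'_def v'_def)
  finally have e: "(\<Sum>i\<in>I. \<Sum>j\<in>J. u' i * v' j * A i j) = (\<Sum>i\<in>I'. \<Sum>j\<in>J'. u i * v j * A i j)" .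
  have "(\<Sum>i\<in>I. cmod (u' i) ^ 2) = (\<Sum>i\<in>I'. cmod (u' i) ^ 2)"
    using fin sub by (intro sum.mono_neutral_right) (auto simp: u'_def)
  then have eu: "(\<Sum>i\<in>I. cmod (u' i) ^ 2) = (\<Sum>i\<in>I'. cmod (u i) ^ 2)" by (simp add: u'_def)
  have "(\<Sum>i\<in>J. cmod (v' i) ^ 2) = (\<Sum>i\<in>J'. cmod (v' i) ^ 2)"
    using fin sub by (intro sum.mono_neutral_right) (auto simp: v'_def)
  then have ev: "(\<Sum>i\<in>J. cmod (v' i) ^ 2) = (\<Sum>i\<in>J'. cmod (v i) ^ 2)" by (simp add: v'_def)
  show "cmod (\<Sum>i\<in>I'. \<Sum>j\<in>J'. u i * v j * A i j)
      \<le> c * sqrt (\<Sum>i\<in>I'. cmod (u i) ^ 2) * sqrt (\<Sum>j\<in>J'. cmod (v j) ^ 2)"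
    using bilinD[OF b, of u' v'] by (simp add: e eu ev)
qed

text \<open>Duality: test the form against the conjugate of the image of \<open>v\<close>. Together
  with the converse below, this lets any bound be transposed.\<close>

lemma bilin_L2:
  assumes b: "bilin A I J c" and c: "c \<ge> 0"
  shows "(\<Sum>i\<in>I. cmod (\<Sum>j\<in>J. v j * A i j) ^ 2) \<le> c ^ 2 * (\<Sum>j\<in>J. cmod (v j) ^ 2)"
proof -
  define F where "F i = (\<Sum>j\<in>J. v j * A i j)" for i
  define S where "S = (\<Sum>i\<in>I. cmod (F i) ^ 2)"
  have S0: "S \<ge> 0" by (simp add: S_def sum_nonneg)
  have "(\<Sum>i\<in>I. \<Sum>j\<in>J. cnj (F i) * v j * A i j) = (\<Sum>i\<in>I. of_real (cmod (F i) ^ 2))"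
    proof (intro sum.cong refl)
    fix i
    have "(\<Sum>j\<in>J. cnj (F i) * v j * A i j) = cnj (F i) * F i"
      unfolding F_def by (simp add: sum_distrib_left mult.assoc)
    then show "(\<Sum>j\<in>J. cnj (F i) * v j * A i j) = of_real (cmod (F i) ^ 2)"
      by (simp add: complex_norm_square mult.commute del: of_real_power)
  qed
  also have "\<dots> = of_real S" by (simp add: S_def)
  finally have "S = cmod (\<Sum>i\<in>I. \<Sum>j\<in>J. cnj (F i) * v j * A i j)" using S0 by simp
  also have "\<dots> \<le> c * sqrt S * sqrt (\<Sum>j\<in>J. cmod (v j) ^ 2)"
    using bilinD[OF b, of "\<lambda>i. cnj (F i)" v] by (simp add: S_def)
  finally have le: "S \<le> c * sqrt (\<Sum>j\<in>J. cmod (v j) ^ 2) * sqrt S" by (simp add: mult_ac)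
  have "sqrt S \<le> c * sqrt (\<Sum>j\<in>J. cmod (v j) ^ 2)"
  proof (cases "S = 0")
    case True
    then show ?thesis using c by (simp add: sum_nonneg)
  next
    case False
    then have "sqrt S > 0" using S0 by simp
    moreover have "sqrt S * sqrt S \<le> c * sqrt (\<Sum>j\<in>J. cmod (v j) ^ 2) * sqrt S" using le S0 by simp
    ultimately show ?thesis by (rule mult_right_le_imp_le[rotated])
  qed
  then have "sqrt S ^ 2 \<le> (c * sqrt (\<Sum>j\<in>J. cmod (v j) ^ 2)) ^ 2" using S0 by (intro power_mono) auto
  then show ?thesis using S0 by (simp add: power_mult_distrib sum_nonneg S_def F_def)
qed

lemma bilinI_L2:
  assumes c: "c \<ge> 0"
    and le: "\<And>v. (\<Sum>i\<in>I. cmod (\<Sum>j\<in>J. v j * A i j) ^ 2) \<le> c ^ 2 * (\<Sum>j\<in>J. cmod (v j) ^ 2)"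
  shows "bilin A I J c"
  unfolding bilin_def
proof (intro allI)
  fix u v
  have "(\<Sum>i\<in>I. \<Sum>j\<in>J. u i * v j * A i j) = (\<Sum>i\<in>I. u i * (\<Sum>j\<in>J. v j * A i j))"
    by (simp add: sum_distrib_left mult.assoc)
  then have "cmod (\<Sum>i\<in>I. \<Sum>j\<in>J. u i * v j * A i j)
    \<le> sqrt (\<Sum>i\<in>I. cmod (u i) ^ 2) * sqrt (\<Sum>i\<in>I. cmod (\<Sum>j\<in>J. v j * A i j) ^ 2)"
    by (simp add: Cauchy_Schwarz_complex_sum)
  also have "\<dots> \<le> sqrt (\<Sum>i\<in>I. cmod (u i) ^ 2) * sqrt (c ^ 2 * (\<Sum>j\<in>J. cmod (v j) ^ 2))"
    by (intro mult_left_mono real_sqrt_le_mono le) (simp add: sum_nonneg)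
  finally show "cmod (\<Sum>i\<in>I. \<Sum>j\<in>J. u i * v j * A i j)
    \<le> c * sqrt (\<Sum>i\<in>I. cmod (u i) ^ 2) * sqrt (\<Sum>j\<in>J. cmod (v j) ^ 2)"
    using c by (simp add: real_sqrt_mult mult_ac)
qed

text \<open>Apply the bound for \<open>A\<close> with the second row index fixed, then the bound for
  \<open>B\<close> on each slice.\<close>

lemma bilin_tensor:
  assumes a: "bilin A I J c" "c \<ge> 0" and b: "bilin B I' J' d" "d \<ge> 0"
  shows "bilin (\<lambda>i j. A (fst i) (fst j) * B (snd i) (snd j)) (I \<times> I') (J \<times> J') (c * d)"
proof (rule bilinI_L2)
  show "c * d \<ge> 0" using a b by simp
  fix v :: "'b \<times> 'd \<Rightarrow> complex"
  define G where "G i' j = (\<Sum>j'\<in>J'. v (j, j') * B i' j')" for i' j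
  have "(\<Sum>i\<in>I \<times> I'. cmod (\<Sum>j\<in>J \<times> J'. v j * (A (fst i) (fst j) * B (snd i) (snd j))) ^ 2)
    = (\<Sum>i'\<in>I'. \<Sum>i\<in>I. cmod (\<Sum>j\<in>J. G i' j * A i j) ^ 2)"
    by (subst sum.swap)
       (simp add: sum.cartesian_product' sum_distrib_right sum_distrib_left G_def mult_ac)
  also have "\<dots> \<le> (\<Sum>i'\<in>I'. c ^ 2 * (\<Sum>j\<in>J. cmod (G i' j) ^ 2))"
    by (intro sum_mono bilin_L2 a)
  also have "\<dots> = c ^ 2 * (\<Sum>j\<in>J. \<Sum>i'\<in>I'. cmod (G i' j) ^ 2)"
    by (subst sum.swap) (simp add: sum_distrib_left)
  also have "\<dots> \<le> c ^ 2 * (\<Sum>j\<in>J. d ^ 2 * (\<Sum>j'\<in>J'. cmod (v (j, j')) ^ 2))"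
    unfolding G_def by (intro mult_left_mono sum_mono bilin_L2 b) simp
  also have "\<dots> = (c * d) ^ 2 * (\<Sum>j\<in>J \<times> J'. cmod (v j) ^ 2)"
    by (simp add: sum.cartesian_product' sum_distrib_left power_mult_distrib mult_ac)
  finally show "(\<Sum>i\<in>I \<times> I'. cmod (\<Sum>j\<in>J \<times> J'. v j * (A (fst i) (fst j) * B (snd i) (snd j))) ^ 2)
    \<le> (c * d) ^ 2 * (\<Sum>j\<in>J \<times> J'. cmod (v j) ^ 2)" .
qed

text \<open>A Schur multiplier: the entries are multiplied by products of vectors
  \<open>\<phi>\<close> and \<open>\<psi>\<close> of norm at most \<open>sqrt K\<close> and
  \<open>sqrt L\<close>. Each \<open>h\<close> gives the original form at rescaled vectors, and
  Cauchy-Schwarz in \<open>h\<close> reassembles the norms. All conditions that link rows to columns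
  are inserted through this lemma.\<close>

lemma bilin_schur:
  assumes b: "bilin A I J c" "c \<ge> 0"
    and W: "\<And>i j. i \<in> I \<Longrightarrow> j \<in> J \<Longrightarrow> W i j = (\<Sum>h\<in>H. \<phi> h i * \<psi> h j)"
    and \<phi>: "\<And>i. i \<in> I \<Longrightarrow> (\<Sum>h\<in>H. cmod (\<phi> h i) ^ 2) \<le> K"
    and \<psi>: "\<And>j. j \<in> J \<Longrightarrow> (\<Sum>h\<in>H. cmod (\<psi> h j) ^ 2) \<le> L"
    and KL: "K \<ge> 0" "L \<ge> 0"
  shows "bilin (\<lambda>i j. W i j * A i j) I J (c * (sqrt K * sqrt L))"
  unfolding bilin_def
proof (intro allI)
  fix u v
  define p where "p h = sqrt (\<Sum>i\<in>I. cmod (u i * \<phi> h i) ^ 2)" for h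
  define q where "q h = sqrt (\<Sum>j\<in>J. cmod (v j * \<psi> h j) ^ 2)" for h
  have bound: "(\<Sum>h\<in>H. \<Sum>i\<in>S. cmod (w i * f h i) ^ 2) \<le> K' * (\<Sum>i\<in>S. cmod (w i) ^ 2)"
    if "\<And>i. i \<in> S \<Longrightarrow> (\<Sum>h\<in>H. cmod (f h i) ^ 2) \<le> K'" for S :: "'z set" and w f K'
  proof -
    have "(\<Sum>h\<in>H. \<Sum>i\<in>S. cmod (w i * f h i) ^ 2) = (\<Sum>i\<in>S. cmod (w i) ^ 2 * (\<Sum>h\<in>H. cmod (f h i) ^ 2))"
      by (subst sum.swap) (simp add: norm_mult power_mult_distrib sum_distrib_left)
    also have "\<dots> \<le> (\<Sum>i\<in>S. cmod (w i) ^ 2 * K')" using that by (intro sum_mono mult_left_mono) auto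
    finally show ?thesis by (simp add: sum_distrib_left mult_ac)
  qed
  have "(\<Sum>i\<in>I. \<Sum>j\<in>J. u i * v j * (W i j * A i j))
    = (\<Sum>i\<in>I. \<Sum>j\<in>J. \<Sum>h\<in>H. (u i * \<phi> h i) * (v j * \<psi> h j) * A i j)"
    by (intro sum.cong refl) (simp add: W sum_distrib_left sum_distrib_right mult_ac)
  also have "\<dots> = (\<Sum>h\<in>H. \<Sum>i\<in>I. \<Sum>j\<in>J. (u i * \<phi> h i) * (v j * \<psi> h j) * A i j)"
    by (simp only: sum.swap[of _ H J]) (rule sum.swap)
  finally have "cmod (\<Sum>i\<in>I. \<Sum>j\<in>J. u i * v j * (W i j * A i j))
    \<le> (\<Sum>h\<in>H. cmod (\<Sum>i\<in>I. \<Sum>j\<in>J. (u i * \<phi> h i) * (v j * \<psi> h j) * A i j))"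
    by (simp add: norm_sum)
  also have "\<dots> \<le> (\<Sum>h\<in>H. c * p h * q h)"
    unfolding p_def q_def by (intro sum_mono bilinD[OF b(1)])
  also have "\<dots> = c * (\<Sum>h\<in>H. p h * q h)" by (simp add: sum_distrib_left mult_ac)
  also have "\<dots> \<le> c * (sqrt (\<Sum>h\<in>H. p h ^ 2) * sqrt (\<Sum>h\<in>H. q h ^ 2))"
    by (intro mult_left_mono Cauchy_Schwarz_real_sum b)
  also have "\<dots> \<le> c * (sqrt (K * (\<Sum>i\<in>I. cmod (u i) ^ 2)) * sqrt (L * (\<Sum>j\<in>J. cmod (v j) ^ 2)))"
    using bound[of I \<phi> K u, OF \<phi>] bound[of J \<psi> L v, OF \<psi>] KL
    by (intro mult_left_mono mult_mono real_sqrt_le_mono b) (auto simp: p_def q_def sum_nonneg)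
  finally show "cmod (\<Sum>i\<in>I. \<Sum>j\<in>J. u i * v j * (W i j * A i j))
    \<le> c * (sqrt K * sqrt L) * sqrt (\<Sum>i\<in>I. cmod (u i) ^ 2) * sqrt (\<Sum>j\<in>J. cmod (v j) ^ 2)"
    by (simp add: real_sqrt_mult mult_ac)
qed

section \<open>The additive large sieve\<close>

text \<open>Since \<open>x < 2\<close>, the cubic Taylor remainder \<open>x ^ 3 / 6\<close> is at
  most \<open>2 * x / 3\<close>.\<close>

lemma sin_ge_third:
  assumes "0 \<le> x" "x \<le> pi / 2"
  shows "sin x \<ge> x / 3"
proof -
  have "\<bar>sin x - (\<Sum>m<3. sin_coeff m * x ^ m)\<bar> \<le> inverse (fact 3) * \<bar>x\<bar> ^ 3"
    by (rule Maclaurin_sin_bound)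
  moreover have "(\<Sum>m<3. sin_coeff m * x ^ m) = x"
    by (simp add: sin_coeff_def numeral_3_eq_3)
  ultimately have "\<bar>sin x - x\<bar> \<le> x ^ 3 / 6" using assms by (simp add: fact_numeral field_simps)
  moreover have "x ^ 2 \<le> 2 ^ 2" using assms pi_half_less_two by (intro power_mono) auto
  then have "x * x ^ 2 \<le> x * 4" using assms by (intro mult_left_mono) auto
  then have "x ^ 3 \<le> 4 * x" by (simp add: power3_eq_cube power2_eq_square mult_ac)
  ultimately show ?thesis by linarith
qed

lemma one_minus_cis_ge:
  assumes "0 < f" "f < 1"
  shows "cmod (1 - cis (2 * pi * f)) \<ge> min f (1 - f)"
proof -
  have s: "sin (pi * f) \<ge> min f (1 - f) / 2"
  proof -
    define g where "g = min f (1 - f)"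
    have "sin (pi * f) = sin (pi * g)"
    proof (cases "f \<le> 1 - f")
      case False
      have "sin (pi * (1 - f)) = sin (pi - pi * f)" by (simp add: algebra_simps)
      then show ?thesis using False by (simp add: g_def)
    qed (simp add: g_def)
    moreover have "g \<ge> 0" "g \<le> 1 / 2" using assms by (auto simp: g_def min_def)
    then have "pi * g / 3 \<le> sin (pi * g)" by (intro sin_ge_third) auto
    moreover have "g * 2 \<le> g * pi" using \<open>g \<ge> 0\<close> pi_ge_two by (intro mult_left_mono) auto
    ultimately show ?thesis using \<open>g \<ge> 0\<close> by (simp add: g_def[symmetric] field_simps)
  qed
  have "cmod (1 - cis (2 * pi * f)) ^ 2 = (1 - cos (2 * (pi * f))) ^ 2 + sin (2 * (pi * f)) ^ 2"
    by (simp add: cmod_power2 mult.assoc)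
  also have "\<dots> = 2 - 2 * cos (2 * (pi * f))"
    using sin_cos_squared_add[of "2 * (pi * f)"] by (simp add: power2_diff)
  also have "\<dots> = (2 * sin (pi * f)) ^ 2" by (simp add: cos_double_sin power_mult_distrib)
  finally have sq: "cmod (1 - cis (2 * pi * f)) ^ 2 = (2 * sin (pi * f)) ^ 2" .
  have "0 \<le> min f (1 - f) / 2" using assms by simp
  then have "0 \<le> 2 * sin (pi * f)" using s by linarith
  with sq have "cmod (1 - cis (2 * pi * f)) = 2 * sin (pi * f)"
    by (rule power2_eq_imp_eq[OF _ norm_ge_zero])
  then show ?thesis using s by simp
qed

lemma cis_geometric_sum_le:
  assumes "0 < f" "f < 1"
  shows "cmod (\<Sum>n<N. cis (2 * pi * f * real n)) \<le> 2 / min f (1 - f)"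
proof -
  define z where "z = cis (2 * pi * f)"
  have pos: "min f (1 - f) > 0" using assms by simp
  have z: "cmod (1 - z) \<ge> min f (1 - f)" unfolding z_def by (rule one_minus_cis_ge[OF assms])
  then have z1: "z \<noteq> 1" using pos by auto
  have "cis (2 * pi * f * real n) = z ^ n" for n by (simp add: z_def Complex.DeMoivre mult_ac)
  then have "(\<Sum>n<N. cis (2 * pi * f * real n)) = (\<Sum>n<N. z ^ n)" by (simp only:)
  also have "\<dots> = (1 - z ^ N) / (1 - z)" using z1 by (simp add: sum_gp_strict)
  finally have "cmod (\<Sum>n<N. cis (2 * pi * f * real n)) = cmod (1 - z ^ N) / cmod (1 - z)"
    by (simp add: norm_divide)
  also have "cmod (1 - z ^ N) \<le> 2"
    using norm_triangle_ineq4[of 1 "z ^ N"] by (simp add: z_def norm_power)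
  finally have "cmod (\<Sum>n<N. cis (2 * pi * f * real n)) \<le> 2 / cmod (1 - z)"
    using z pos by (simp add: divide_right_mono)
  also have "\<dots> \<le> 2 / min f (1 - f)" using z pos by (intro divide_left_mono mult_pos_pos) auto
  finally show ?thesis .
qed

lemma cis_2pi_int: "cis (2 * pi * of_int k) = 1"
  by (simp add: cis.code complex_eq_iff sin_int_2pin cos_int_2pin)

lemma cis_frac: "cis (2 * pi * x * real n) = cis (2 * pi * frac x * real n)"
proof -
  have "2 * pi * x * real n = 2 * pi * frac x * real n + 2 * pi * of_int (\<lfloor>x\<rfloor> * int n)"
    by (simp add: frac_def algebra_simps)
  then have "cis (2 * pi * x * real n) = cis (2 * pi * frac x * real n) * cis (2 * pi * of_int (\<lfloor>x\<rfloor> * int n))"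
    by (simp only: cis_mult)
  then show ?thesis by (simp only: cis_2pi_int mult_1_right)
qed

text \<open>A weighted form of \<open>2 * a r * a s \<le> a r ^ 2 + a s ^ 2\<close>; symmetry of
  \<open>g\<close> makes row and column sums equal.\<close>

lemma schur_test:
  fixes g :: "'r \<Rightarrow> 'r \<Rightarrow> real"
  assumes fin: "finite R" and g: "\<And>r s. r \<in> R \<Longrightarrow> s \<in> R \<Longrightarrow> g r s \<ge> 0"
    "\<And>r s. r \<in> R \<Longrightarrow> s \<in> R \<Longrightarrow> g r s = g s r"
    and B: "\<And>r. r \<in> R \<Longrightarrow> (\<Sum>s\<in>R. g r s) \<le> B"
  shows "(\<Sum>r\<in>R. \<Sum>s\<in>R. a r * a s * g r s) \<le> B * (\<Sum>r\<in>R. a r ^ 2)"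
proof -
  have "(\<Sum>r\<in>R. \<Sum>s\<in>R. a r * a s * g r s) \<le> (\<Sum>r\<in>R. \<Sum>s\<in>R. (a r ^ 2 * g r s) / 2 + (a s ^ 2 * g s r) / 2)"
  proof (intro sum_mono)
    fix r s assume rs: "r \<in> R" "s \<in> R"
    have "0 \<le> (a r - a s) ^ 2 * g r s" using g(1)[OF rs] by simp
    then show "a r * a s * g r s \<le> (a r ^ 2 * g r s) / 2 + (a s ^ 2 * g s r) / 2"
      using g(2)[OF rs] by (simp add: power2_diff algebra_simps)
  qed
  also have "\<dots> = (\<Sum>r\<in>R. \<Sum>s\<in>R. (a r ^ 2 * g r s) / 2) + (\<Sum>r\<in>R. \<Sum>s\<in>R. (a s ^ 2 * g s r) / 2)"
    by (simp add: sum.distrib)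
  also have "(\<Sum>r\<in>R. \<Sum>s\<in>R. (a s ^ 2 * g s r) / 2) = (\<Sum>r\<in>R. \<Sum>s\<in>R. (a r ^ 2 * g r s) / 2)"
    by (rule sum.swap)
  also have "(\<Sum>r\<in>R. \<Sum>s\<in>R. (a r ^ 2 * g r s) / 2) + (\<Sum>r\<in>R. \<Sum>s\<in>R. (a r ^ 2 * g r s) / 2)
    = (\<Sum>r\<in>R. a r ^ 2 * (\<Sum>s\<in>R. g r s))"
    by (simp only: sum.distrib[symmetric] field_sum_of_halves sum_distrib_left)
  also have "\<dots> \<le> (\<Sum>r\<in>R. a r ^ 2 * B)" using B by (intro sum_mono mult_left_mono) auto
  finally show ?thesis by (simp add: sum_distrib_left mult_ac)
qed

text \<open>Separation makes the bucket index \<open>k r\<close>, the integer part of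
  \<open>K * f r\<close>, injective. The points are thus compared with the grid of step
  \<open>1 / K\<close>, and the sum with a harmonic sum.\<close>

lemma separated_sum_le:
  fixes f :: "'r \<Rightarrow> real"
  assumes fin: "finite R" and K: "K \<ge> 1"
    and f: "\<And>r. r \<in> R \<Longrightarrow> 1 / real K \<le> f r \<and> f r \<le> 1 - 1 / real K"
    and sep: "\<And>r s. r \<in> R \<Longrightarrow> s \<in> R \<Longrightarrow> r \<noteq> s \<Longrightarrow> \<bar>f r - f s\<bar> \<ge> 1 / real K"
  shows "(\<Sum>r\<in>R. 2 / min (f r) (1 - f r)) \<le> 6 * real K * harm K"
proof -
  define k where "k r = nat \<lfloor>real K * f r\<rfloor>" for r
  have K0: "real K > 0" using K by simp
  have k: "k r \<ge> 1" "k r < K" "real (k r) \<le> real K * f r" "real K * f r < real (k r) + 1"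
    "real K * f r \<le> real K - 1" if r: "r \<in> R" for r
  proof -
    have 1: "1 \<le> real K * f r" "real K * f r \<le> real K - 1" using f[OF r] K0 by (auto simp: field_simps)
    then show "real K * f r \<le> real K - 1" by simp
    have "\<lfloor>real K * f r\<rfloor> \<ge> 1" using 1 by simp
    then have e: "real (k r) = of_int \<lfloor>real K * f r\<rfloor>" by (simp add: k_def)
    then show "real (k r) \<le> real K * f r" "real K * f r < real (k r) + 1" by linarith+
    then have "real (k r) < real K" using 1 by linarith
    then show "k r < K" by simp
    show "k r \<ge> 1" using \<open>\<lfloor>real K * f r\<rfloor> \<ge> 1\<close> by (simp add: k_def le_nat_iff)
  qed
  have inj: "inj_on k R"
  proof (rule inj_onI, rule ccontr)
    fix r s assume rs: "r \<in> R" "s \<in> R" "k r = k s" "r \<noteq> s"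
    have "\<bar>real K * f r - real K * f s\<bar> < 1" using k(3,4)[OF rs(1)] k(3,4)[OF rs(2)] rs(3) by linarith
    then have "real K * \<bar>f r - f s\<bar> < 1" using K0 by (simp add: abs_mult right_diff_distrib[symmetric])
    then show False using sep[OF rs(1,2,4)] K0 by (simp add: field_simps)
  qed
  have bd: "2 / min (f r) (1 - f r) \<le> 2 * real K / real (k r) + 4 * real K / real (K - k r)"
    if r: "r \<in> R" for r
  proof -
    have pos: "f r > 0" "1 - f r > 0" using f[OF r] K0 by (smt (verit) divide_pos_pos)+
    have m: "2 / min (f r) (1 - f r) \<le> 2 / f r + 2 / (1 - f r)"
      using pos by (auto simp: min_def)
    have m1: "2 / f r \<le> 2 * real K / real (k r)"
      using k[OF r] pos K0 by (simp add: field_simps)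
    have m2: "2 / (1 - f r) \<le> 4 * real K / real (K - k r)"
    proof -
      \<comment> \<open>Rounding down adds less than 1, and \<open>K - K * f r\<close> is at least
        1; hence the factor 2.\<close>
      have "real (K - k r) \<le> 2 * (real K - real K * f r)" using k[OF r] by (simp add: of_nat_diff)
      then show ?thesis using pos k(2)[OF r] by (simp add: field_simps)
    qed
    show ?thesis by (rule order_trans[OF m add_mono[OF m1 m2]])
  qed
  have "(\<Sum>r\<in>R. 2 / min (f r) (1 - f r)) \<le> (\<Sum>r\<in>R. 2 * real K / real (k r) + 4 * real K / real (K - k r))"
    by (intro sum_mono bd)
  also have "\<dots> = (\<Sum>j\<in>k ` R. 2 * real K / real j + 4 * real K / real (K - j))"
    using inj by (simp add: sum.reindex)
  also have "\<dots> \<le> (\<Sum>j\<in>{1..<K}. 2 * real K / real j + 4 * real K / real (K - j))"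
    using k fin by (intro sum_mono2) auto
  also have "\<dots> = 2 * real K * (\<Sum>j\<in>{1..<K}. 1 / real j) + 4 * real K * (\<Sum>j\<in>{1..<K}. 1 / real (K - j))"
    by (simp add: sum.distrib sum_distrib_left)
  also have "(\<Sum>j\<in>{1..<K}. 1 / real (K - j)) = (\<Sum>j\<in>{1..<K}. 1 / real j)"
    by (rule sum.reindex_bij_witness[of _ "\<lambda>j. K - j" "\<lambda>j. K - j"]) auto
  also have "2 * real K * (\<Sum>j\<in>{1..<K}. 1 / real j) + 4 * real K * (\<Sum>j\<in>{1..<K}. 1 / real j)
    = 6 * real K * (\<Sum>j\<in>{1..<K}. 1 / real j)" by simp
  also have "\<dots> \<le> 6 * real K * harm K"
    unfolding harm_def inverse_eq_divide by (intro mult_left_mono sum_mono2) auto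
  finally show ?thesis .
qed

text \<open>Expanding the square produces a Gram matrix of geometric sums. The diagonal gives
  \<open>N\<close>, separation modulo 1 bounds the other entries of a row, and the Schur test
  concludes. The harmonic factor is absorbed later by the \<open>\<epsilon>\<close> in the
  exponent.\<close>

lemma additive_large_sieve_dual:
  fixes \<theta> :: "'r \<Rightarrow> real"
  assumes fin: "finite R" and K: "K \<ge> 1"
    and sep: "\<And>r s. r \<in> R \<Longrightarrow> s \<in> R \<Longrightarrow> r \<noteq> s \<Longrightarrow>
      1 / real K \<le> frac (\<theta> r - \<theta> s) \<and> frac (\<theta> r - \<theta> s) \<le> 1 - 1 / real K"
  shows "(\<Sum>n<N. cmod (\<Sum>r\<in>R. c r * cis (2 * pi * \<theta> r * real n)) ^ 2)
    \<le> (real N + 6 * real K * harm K) * (\<Sum>r\<in>R. cmod (c r) ^ 2)"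
proof -
  define G where "G r s = (\<Sum>n<N. cis (2 * pi * (\<theta> r - \<theta> s) * real n))" for r s
  define E where "E r n = cis (2 * pi * \<theta> r * real n)" for r n
  have EE: "E r n * cnj (E s n) = cis (2 * pi * (\<theta> r - \<theta> s) * real n)" for r s n
    unfolding E_def cis_cnj cis_mult by (rule arg_cong[of _ _ cis]) (simp add: algebra_simps)
  have sq: "of_real (cmod (\<Sum>r\<in>R. c r * E r n) ^ 2) =
      (\<Sum>r\<in>R. \<Sum>s\<in>R. c r * cnj (c s) * (E r n * cnj (E s n)))" for n
    by (simp add: complex_norm_square cnj_sum sum_product mult_ac del: of_real_power)
  have "of_real (\<Sum>n<N. cmod (\<Sum>r\<in>R. c r * E r n) ^ 2) =
      (\<Sum>n<N. \<Sum>r\<in>R. \<Sum>s\<in>R. c r * cnj (c s) * (E r n * cnj (E s n)))"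
    by (simp only: of_real_sum sq)
  also have "\<dots> = (\<Sum>r\<in>R. \<Sum>s\<in>R. \<Sum>n<N. c r * cnj (c s) * (E r n * cnj (E s n)))"
    by (simp only: sum.swap[of _ R "{..<N}"])
  also have "\<dots> = (\<Sum>r\<in>R. \<Sum>s\<in>R. c r * cnj (c s) * G r s)"
    by (simp only: EE G_def sum_distrib_left)
  finally have e: "of_real (\<Sum>n<N. cmod (\<Sum>r\<in>R. c r * E r n) ^ 2) = (\<Sum>r\<in>R. \<Sum>s\<in>R. c r * cnj (c s) * G r s)" .
  have "(\<Sum>n<N. cmod (\<Sum>r\<in>R. c r * E r n) ^ 2) = cmod (of_real (\<Sum>n<N. cmod (\<Sum>r\<in>R. c r * E r n) ^ 2))"
    by (simp add: sum_nonneg del: of_real_sum)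
  also have "\<dots> \<le> (\<Sum>r\<in>R. \<Sum>s\<in>R. cmod (c r) * cmod (c s) * cmod (G r s))"
    unfolding e by (intro order_trans[OF norm_sum] sum_mono) (simp add: norm_mult)
  also have "\<dots> \<le> (real N + 6 * real K * harm K) * (\<Sum>r\<in>R. cmod (c r) ^ 2)"
  proof (rule schur_test[OF fin])
    fix r s
    show "cmod (G r s) \<ge> 0" by simp
    have "G s r = cnj (G r s)"
      by (simp add: G_def cnj_sum cis_cnj algebra_simps)
    then show "cmod (G r s) = cmod (G s r)" by simp
  next
    fix r assume r: "r \<in> R"
    define f where "f s = frac (\<theta> r - \<theta> s)" for s
    have "(\<Sum>s\<in>R. cmod (G r s)) = cmod (G r r) + (\<Sum>s\<in>R - {r}. cmod (G r s))"
      using fin r by (rule sum.remove)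
    also have "cmod (G r r) = real N" by (simp add: G_def)
    also have "(\<Sum>s\<in>R - {r}. cmod (G r s)) \<le> (\<Sum>s\<in>R - {r}. 2 / min (f s) (1 - f s))"
    proof (rule sum_mono)
      fix s assume s: "s \<in> R - {r}"
      then have "1 / real K \<le> f s" "f s \<le> 1 - 1 / real K" using sep[OF r, of s] by (auto simp: f_def)
      moreover have "1 / real K > 0" using K by simp
      ultimately have "0 < f s" "f s < 1" by linarith+
      from cis_geometric_sum_le[OF this, of N] show "cmod (G r s) \<le> 2 / min (f s) (1 - f s)"
        by (simp add: G_def f_def cis_frac[of "\<theta> r - \<theta> s"])
    qed
    also have "\<dots> \<le> 6 * real K * harm K"
    proof (rule separated_sum_le)
      fix s t assume st: "s \<in> R - {r}" "t \<in> R - {r}" "s \<noteq> t"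
      have fs: "1 / real K \<le> frac (\<theta> s - \<theta> t)" "frac (\<theta> s - \<theta> t) \<le> 1 - 1 / real K" using sep[of s t] st by auto
      show "\<bar>f s - f t\<bar> \<ge> 1 / real K"
      proof (rule ccontr)
        assume "\<not> ?thesis"
        then have lt: "\<bar>f t - f s\<bar> < 1 / real K" by linarith
        \<comment> \<open>\<open>d\<close> equals \<open>\<theta> s - \<theta> t\<close> up to an
          integer, so a small \<open>d\<close> would push that fractional part too close to 0 or to
          1.\<close>
        define d where "d = f t - f s"
        define k where "k = \<lfloor>\<theta> r - \<theta> t\<rfloor> - \<lfloor>\<theta> r - \<theta> s\<rfloor>"
        have "\<theta> s - \<theta> t = d + of_int k"
          by (simp add: d_def f_def frac_def k_def)
        then have fd: "frac (\<theta> s - \<theta> t) = frac d" by (simp add: frac_def)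
        show False
        proof (cases "d \<ge> 0")
          case True
          have "d < 1" using lt d_def fs frac_lt_1[of "\<theta> s - \<theta> t"] by linarith
          then have "frac d = d" using True by (simp add: frac_eq)
          then show ?thesis using fs fd lt d_def by linarith
        next
          case False
          have "d > -1" using lt d_def fs frac_lt_1[of "\<theta> s - \<theta> t"] by linarith
          then have "\<lfloor>d\<rfloor> = -1" using False by (simp add: floor_eq_iff)
          then have "frac d = d + 1" by (simp add: frac_def)
          then show ?thesis using fs fd lt d_def by linarith
        qed
      qed
    next
      fix s assume "s \<in> R - {r}"
      then show "1 / real K \<le> f s \<and> f s \<le> 1 - 1 / real K" using sep[OF r, of s] by (auto simp: f_def)
    qed (use fin K in auto)
    finally show "(\<Sum>s\<in>R. cmod (G r s)) \<le> real N + 6 * real K * harm K" by simp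
  qed
  finally show ?thesis by (simp add: E_def)
qed

section \<open>Jacobi symbols of odd squarefree modulus\<close>

text \<open>The Jacobi symbol when \<open>m\<close> is odd and squarefree; repeated prime factors of
  \<open>m\<close> would be counted once.\<close>

definition jac :: "int \<Rightarrow> nat \<Rightarrow> int" where
  "jac n m = (\<Prod>p\<in>prime_factors m. Legendre n (int p))"

lemma jac_1_right [simp]: "jac n 1 = 1" and jac_Suc_0 [simp]: "jac n (Suc 0) = 1"
  by (simp_all add: jac_def)

lemma odd_prime_factors: "odd m \<Longrightarrow> p \<in> prime_factors m \<Longrightarrow> prime p \<and> odd p \<and> p dvd m" for m p :: nat
  by (auto simp: in_prime_factors_iff)

lemma Legendre_cong: "[a = b] (mod p) \<Longrightarrow> Legendre a p = Legendre b p"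
  proof -
  assume "[a = b] (mod p)"
  then have "[y = a] (mod p) \<longleftrightarrow> [y = b] (mod p)" for y by (simp add: cong_def)
  moreover have "[a = 0] (mod p) \<longleftrightarrow> [b = 0] (mod p)" using \<open>[a = b] (mod p)\<close> by (simp add: cong_def)
  ultimately show ?thesis by (simp add: Legendre_def QuadRes_def)
qed

lemma jac_mult_left: "odd m \<Longrightarrow> jac (a * b) m = jac a m * jac b m"
  unfolding jac_def prod.distrib[symmetric]
  by (intro prod.cong refl Legendre_mult) (auto dest: odd_prime_factors)

lemma jac_mult_right:
  assumes "coprime m m'" "m > 0" "m' > 0"
  shows "jac n (m * m') = jac n m * jac n m'"
proof -
  have "prime_factors (m * m') = prime_factors m \<union> prime_factors m'"
    using assms by (intro prime_factors_product) auto
  moreover have "prime_factors m \<inter> prime_factors m' = {}"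
    using assms(1) by (auto simp: in_prime_factors_iff dest: coprime_common_divisor)
  ultimately show ?thesis unfolding jac_def by (simp add: prod.union_disjoint)
qed

lemma jac_cong:
  assumes "[a = b] (mod int m)"
  shows "jac a m = jac b m"
  unfolding jac_def
proof (intro prod.cong refl Legendre_cong)
  fix p assume "p \<in> prime_factors m"
  then have "int p dvd int m" by (simp add: in_prime_factors_iff)
  then show "[a = b] (mod int p)" using assms cong_dvd_modulus by blast
qed

lemma jac_eq_0_iff: "m > 0 \<Longrightarrow> jac a m = 0 \<longleftrightarrow> \<not> coprime a (int m)"
proof
  assume m: "m > 0"
  {
    assume "jac a m = 0"
    then obtain p where p: "p \<in> prime_factors m" "Legendre a (int p) = 0" by (auto simp: jac_def)
    then have "int p dvd a" by (auto simp: Legendre_def cong_0_iff split: if_splits)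
    moreover have "int p dvd int m" "\<not> is_unit (int p)" using p by (auto simp: in_prime_factors_iff)
    ultimately show "\<not> coprime a (int m)" using coprime_common_divisor by blast
  }
  assume "\<not> coprime a (int m)"
  then have "gcd a (int m) \<noteq> 1" by (simp add: coprime_iff_gcd_eq_1)
  moreover have "gcd a (int m) \<ge> 0" by simp
  ultimately have "nat (gcd a (int m)) \<noteq> 1" by linarith
  then obtain p where p: "prime p" "p dvd nat (gcd a (int m))" using prime_factor_nat by blast
  then have "int p dvd int (nat (gcd a (int m)))" by (simp only: int_dvd_int_iff)
  then have d: "int p dvd gcd a (int m)" by simp
  then have "int p dvd a" "int p dvd int m" by simp_all
  then have "int p dvd a" "p dvd m" by (simp_all only: int_dvd_int_iff)
  then have "p \<in> prime_factors m" "Legendre a (int p) = 0"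
    using p m by (auto simp: in_prime_factors_iff Legendre_def cong_0_iff)
  then show "jac a m = 0" unfolding jac_def by (intro prod_zero) auto
qed

lemma jac_values: "jac a m = 0 \<or> jac a m = 1 \<or> jac a m = -1"
proof -
  have "(\<Prod>p\<in>S. Legendre a (int p)) \<in> {0, 1, -1}" if "finite S" for S
    using that
  proof induction
    case (insert p F)
    have m: "x * y \<in> {0, 1, -1}" if "x \<in> {0, 1, -1}" "y \<in> {0, 1, -1}" for x y :: int using that by auto
    have "Legendre a (int p) \<in> {0, 1, -1}" by (simp add: Legendre_def)
    from m[OF this insert.IH] show ?case using insert by simp
  qed simp
  then have "jac a m \<in> {0, 1, -1}" unfolding jac_def by simp
  then show ?thesis by blast
qed

lemma jac_1_left: "m > 0 \<Longrightarrow> odd m \<Longrightarrow> jac 1 m = 1"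
  proof -
  assume m: "m > 0" "odd m"
  have "jac 1 m = jac 1 m * jac 1 m" using jac_mult_left[OF m(2), of 1 1] by simp
  moreover have "jac 1 m \<noteq> 0" using jac_eq_0_iff[OF m(1), of 1] by simp
  ultimately show ?thesis by simp
qed

text \<open>Squaring identifies 1 and -1, so it is not injective on the finite set of residues and
  therefore not surjective.\<close>

lemma exists_nonresidue:
  assumes p: "prime p" "odd p"
  obtains r where "Legendre r (int p) = -1"
proof -
  have p2: "p > 2" using p prime_ge_2_nat[OF p(1)] by (cases "p = 2") auto
  define f where "f x = x ^ 2 mod int p" for x :: int
  have "f ` {0..<int p} \<noteq> {0..<int p}"
  proof
    assume s: "f ` {0..<int p} = {0..<int p}"
    have "inj_on f {0..<int p}" by (rule finite_surj_inj) (simp_all add: s)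
    moreover have "f 1 = f (int p - 1)"
    proof -
      have "(int p - 1) ^ 2 = 1 + int p * (int p - 2)" by (simp add: power2_eq_square algebra_simps)
      then show ?thesis by (simp only: f_def mod_mult_self2) simp
    qed
    ultimately have "1 = int p - 1" using p2 by (auto dest!: inj_onD)
    then show False using p2 by simp
  qed
  moreover have "f ` {0..<int p} \<subseteq> {0..<int p}" using p2 by (auto simp: f_def)
  ultimately obtain r where r: "r \<in> {0..<int p}" "r \<notin> f ` {0..<int p}" by blast
  have "\<not> QuadRes (int p) r"
  proof
    assume "QuadRes (int p) r"
    then obtain y where "[y ^ 2 = r] (mod int p)" by (auto simp: QuadRes_def)
    then have "f (y mod int p) = r" using r(1) by (simp add: f_def cong_def power_mod)
    moreover have "y mod int p \<in> {0..<int p}" using p2 by simp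
    ultimately show False using r(2) by blast
  qed
  moreover have "\<not> [r = 0] (mod int p)"
  proof
    assume "[r = 0] (mod int p)"
    then have "r = 0" using r(1) by (simp add: cong_def)
    moreover have "f 0 = 0" by (simp add: f_def)
    ultimately show False using r(2) p2 by (metis atLeastLessThan_iff image_eqI order_refl of_nat_0_less_iff zero_less_numeral order_less_trans)
  qed
  ultimately show ?thesis using that[of r] by (simp add: Legendre_def)
qed

text \<open>Quadratic reciprocity is multiplied over all pairs of primes. The resulting signs
  collapse because the sign \<open>e\<close> is multiplicative in each argument on odd
  numbers.\<close>

lemma jac_reciprocity:
  assumes m: "odd m" "squarefree m" and n: "odd n" "squarefree n" and co: "coprime m n"
  shows "jac (int n) m * jac (int m) n = (if m mod 4 = 3 \<and> n mod 4 = 3 then -1 else 1)"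
proof -
  have m0: "m > 0" "n > 0" using m n by (auto intro: Nat.gr0I)
  define e where "e u v = (if sign4 u = -1 \<and> sign4 v = -1 then -1 else (1::int))" for u v
  have e_mult: "e (int a) v * e (int b) v = e (int (a * b)) v" if "odd a" "odd b" for a b v
    using sign_mult(1)[of "int a" "int b"] that sign_values(1)[of "int a"] sign_values(1)[of "int b"]
    by (auto simp: e_def)
  have e1: "e 1 v = 1" "e v 1 = 1" for v by (simp_all add: e_def sign4_def)
  have e_com: "e u v = e v u" for u v by (simp add: e_def conj_commute)
  have prodP: "(\<Prod>p\<in>prime_factors k. int p) = int k" if "squarefree k" for k :: nat
  proof -
    have "k \<noteq> 0" using that by (metis not_squarefree_0)
    have "(\<Prod>p\<in>prime_factors k. p) = (\<Prod>p\<in>prime_factors k. p ^ multiplicity p k)"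
      proof (intro prod.cong refl)
      fix p assume "p \<in> prime_factors k"
      then have "multiplicity p k = 1" using that squarefree_factorial_semiring'[OF \<open>k \<noteq> 0\<close>] by blast
      then show "p = p ^ multiplicity p k" by simp
    qed
    also have "\<dots> = k" using \<open>k \<noteq> 0\<close> by (intro prime_factorization_nat[symmetric]) simp
    finally show ?thesis by (simp flip: of_nat_prod)
  qed
  have e_prod: "(\<Prod>p\<in>S. e (int p) v) = e (int (\<Prod>p\<in>S. p)) v" if "finite S" "\<And>p. p \<in> S \<Longrightarrow> odd p" for S v
    using that
  proof induction
    case (insert p S)
    have "odd (\<Prod>p\<in>S. p)" using insert by (simp add: even_prod_iff)
    then show ?case using insert e_mult[of p "\<Prod>p\<in>S. p" v] by simp
  qed (simp add: e1)
  have L: "Legendre a (int p) = jac a p" if "prime p" for a p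
    using that by (simp add: jac_def prime_factorization_prime)
  have one: "jac (\<Prod>q\<in>S. int q) k = (\<Prod>q\<in>S. jac (int q) k)" if "odd k" "finite S" for S k
    using that(2)
  proof induction
    case empty
    then show ?case using that jac_1_left[of k] by (simp add: odd_pos)
  next
    case (insert q S)
    then show ?case using jac_mult_left[OF that(1)] by simp
  qed
  have fin: "finite (prime_factors k)" for k :: nat by simp
  have "jac (int n) m = (\<Prod>p\<in>prime_factors m. \<Prod>q\<in>prime_factors n. Legendre (int q) (int p))"
  proof -
    have "Legendre (int n) (int p) = (\<Prod>q\<in>prime_factors n. Legendre (int q) (int p))"
      if "p \<in> prime_factors m" for p
      using one[of p "prime_factors n"] odd_prime_factors[OF m(1) that] L[of p] by (simp add: prodP[OF n(2)])
    then show ?thesis unfolding jac_def by simp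
  qed
  moreover have "jac (int m) n = (\<Prod>p\<in>prime_factors m. \<Prod>q\<in>prime_factors n. Legendre (int p) (int q))"
  proof -
    have "Legendre (int m) (int q) = (\<Prod>p\<in>prime_factors m. Legendre (int p) (int q))"
      if "q \<in> prime_factors n" for q
      using one[of q "prime_factors m"] odd_prime_factors[OF n(1) that] L[of q] by (simp add: prodP[OF m(2)])
    then show ?thesis unfolding jac_def by (subst prod.swap) simp
  qed
  ultimately have "jac (int n) m * jac (int m) n =
    (\<Prod>p\<in>prime_factors m. \<Prod>q\<in>prime_factors n. Legendre (int q) (int p) * Legendre (int p) (int q))"
    by (simp add: prod.distrib)
  also have "\<dots> = (\<Prod>p\<in>prime_factors m. \<Prod>q\<in>prime_factors n. e (int p) (int q))"
  proof (intro prod.cong refl)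
    fix p q assume pq: "p \<in> prime_factors m" "q \<in> prime_factors n"
    note P = odd_prime_factors[OF m(1) pq(1)] and Q = odd_prime_factors[OF n(1) pq(2)]
    have "p \<noteq> q"
    proof
      assume "p = q"
      then have "is_unit p" using P Q co coprime_common_divisor by blast
      then show False using P by auto
    qed
    moreover have "p \<noteq> 2" "q \<noteq> 2" using P Q by auto
    then have "p > 2" "q > 2" using P Q prime_ge_2_nat[of p] prime_ge_2_nat[of q] by simp_all
    ultimately have qr: "Legendre (int q) (int p) * Legendre (int p) (int q) = (-1) ^ ((p - 1) div 2 * ((q - 1) div 2))"
      using Quadratic_Reciprocity[of p q] P Q by (simp add: mult.commute)
    have par: "even ((r - 1) div 2) \<longleftrightarrow> sign4 (int r) = 1" if "odd r" for r :: nat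
    proof -
      obtain k where k: "r = 2 * k + 1" using \<open>odd r\<close> by (rule oddE)
      have "(1 + 2 * int k) mod 4 = 1 \<longleftrightarrow> even k"
        by (cases "even k") (auto elim!: evenE oddE)
      then show ?thesis by (simp add: k sign4_def add.commute)
    qed
    have "(-1::int) ^ k = (if even k then 1 else -1)" for k :: nat by simp
    then have "(-1::int) ^ ((p - 1) div 2 * ((q - 1) div 2)) =
      (if sign4 (int p) = 1 \<or> sign4 (int q) = 1 then 1 else -1)" using par[of p] par[of q] P Q by simp
    then show "Legendre (int q) (int p) * Legendre (int p) (int q) = e (int p) (int q)"
      unfolding qr e_def using sign_values(1)[of "int p"] sign_values(1)[of "int q"] by auto
  qed
  also have "\<dots> = (\<Prod>p\<in>prime_factors m. e (int p) (int n))"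
  proof (intro prod.cong refl)
    fix p
    have "(\<Prod>q\<in>prime_factors n. e (int p) (int q)) = (\<Prod>q\<in>prime_factors n. e (int q) (int p))"
      by (intro prod.cong refl e_com)
    also have "\<dots> = e (int (\<Prod>q\<in>prime_factors n. q)) (int p)"
      by (rule e_prod) (auto dest: odd_prime_factors[OF n(1)])
    also have "int (\<Prod>q\<in>prime_factors n. q) = int n" using prodP[OF n(2)] by simp
    finally show "(\<Prod>q\<in>prime_factors n. e (int p) (int q)) = e (int p) (int n)" by (simp only: e_com[of "int p"])
  qed
  also have "\<dots> = e (int (\<Prod>p\<in>prime_factors m. p)) (int n)"
    by (rule e_prod) (auto dest: odd_prime_factors[OF m(1)])
  also have "int (\<Prod>p\<in>prime_factors m. p) = int m" using prodP[OF m(2)] by simp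
  also have "e (int m) (int n) = (if m mod 4 = 3 \<and> n mod 4 = 3 then -1 else 1)"
  proof -
    have s: "sign4 (int r) = -1 \<longleftrightarrow> r mod 4 = 3" if "odd r" for r :: nat
    proof -
      have "r mod 4 = 1 \<or> r mod 4 = 3" using that by presburger
      moreover have "int r mod 4 = 1 \<longleftrightarrow> r mod 4 = 1"
        using of_nat_eq_iff[of "r mod 4" 1, where ?'a = int] by (simp add: of_nat_mod)
      ultimately show ?thesis unfolding sign4_def by (elim disjE) simp_all
    qed
    show ?thesis using s m n by (simp add: e_def)
  qed
  finally show ?thesis .
qed

section \<open>Gauss sums and the quadratic large sieve\<close>

definition em :: "nat \<Rightarrow> int \<Rightarrow> complex" where
  "em m a = cis (2 * pi * (of_int a / of_nat m))"

lemma em_add: "em m (a + b) = em m a * em m b"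
  by (simp add: em_def cis_mult add_divide_distrib distrib_left)

lemma em_cnj: "cnj (em m a) = em m (- a)"
  by (simp add: em_def cis_cnj)

lemma em_period: "m > 0 \<Longrightarrow> em m (int m * k) = 1"
  using cis_2pi_int[of k] by (simp add: em_def)

lemma em_cong: "m > 0 \<Longrightarrow> [a = b] (mod int m) \<Longrightarrow> em m a = em m b"
proof -
  assume m: "m > 0" and "[a = b] (mod int m)"
  then obtain k where "a - b = int m * k" by (auto simp: cong_iff_dvd_diff)
  then have "a = b + int m * k" by simp
  then show ?thesis by (simp only: em_add em_period[OF m] mult_1_right)
qed

lemma em_orthogonal:
  assumes m: "m > 0"
  shows "(\<Sum>n\<in>{0..<int m}. em m (d * n)) = (if int m dvd d then of_nat m else 0)"
proof (cases "int m dvd d")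
  case True
  then obtain k where k: "d = int m * k" by blast
  have "em m (d * n) = 1" for n using em_period[OF m, of "k * n"] by (simp add: k mult.assoc)
  then show ?thesis using True by simp
next
  case False
  define z where "z = em m d"
  define x where "x = (of_int d / of_nat m :: real)"
  have "frac x \<noteq> 0"
  proof
    assume "frac x = 0"
    then have "x \<in> \<int>" by (simp add: frac_eq_0_iff)
    then obtain k where "x = of_int k" by (elim Ints_cases)
    then have "(of_int d :: real) = of_int (int m * k)" using m by (simp add: x_def field_simps)
    then have "d = int m * k" by (simp only: of_int_eq_iff)
    then show False using False by simp
  qed
  then have f: "0 < frac x" "frac x < 1" using frac_ge_0[of x] frac_lt_1[of x] by linarith+
  have zf: "z = cis (2 * pi * frac x)" using cis_frac[of x 1] by (simp add: z_def em_def x_def)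
  have "cmod (1 - z) > 0" using one_minus_cis_ge[OF f] f unfolding zf by linarith
  then have z1: "z \<noteq> 1" by auto
  have pw: "em m (d * int n) = z ^ n" for n
  proof (induction n)
    case (Suc n)
    have "d * int (Suc n) = d + d * int n" by (simp add: algebra_simps)
    then show ?case using Suc by (simp only: em_add power_Suc z_def[symmetric])
  qed (simp add: em_def)
  have "(\<Sum>n\<in>{0..<int m}. em m (d * n)) = (\<Sum>n<m. em m (d * int n))"
    by (rule sum.reindex_bij_witness[of _ int nat]) auto
  also have "\<dots> = (\<Sum>n<m. z ^ n)" by (simp only: pw)
  also have "\<dots> = (1 - z ^ m) / (1 - z)" using z1 by (simp add: sum_gp_strict)
  also have "z ^ m = 1" using pw[of m] em_period[OF m, of d] by (simp add: mult.commute)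
  finally show ?thesis using False by simp
qed

lemma sum_residues_mult:
  fixes f :: "int \<Rightarrow> complex"
  assumes m: "m > 0" and u: "coprime u (int m)" and f: "\<And>a b. [a = b] (mod int m) \<Longrightarrow> f a = f b"
  shows "(\<Sum>a\<in>{0..<int m}. f (u * a)) = (\<Sum>a\<in>{0..<int m}. f a)"
proof -
  define g where "g a = (u * a) mod int m" for a
  have inj: "inj_on g {0..<int m}"
  proof (rule inj_onI)
    fix a b assume ab: "a \<in> {0..<int m}" "b \<in> {0..<int m}" "g a = g b"
    then have "[u * a = u * b] (mod int m)" by (simp add: g_def cong_def)
    then have "[a = b] (mod int m)" using u by (simp add: cong_mult_lcancel)
    then show "a = b" using ab by (simp add: cong_def)
  qed
  moreover have "g ` {0..<int m} \<subseteq> {0..<int m}" using m by (auto simp: g_def)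
  ultimately have img: "g ` {0..<int m} = {0..<int m}" by (intro endo_inj_surj) auto
  have "(\<Sum>a\<in>{0..<int m}. f a) = (\<Sum>a\<in>g ` {0..<int m}. f a)" by (simp only: img)
  also have "\<dots> = (\<Sum>a\<in>{0..<int m}. f (g a))" using inj by (simp add: sum.reindex)
  also have "\<dots> = (\<Sum>a\<in>{0..<int m}. f (u * a))"
    by (intro sum.cong refl f) (simp add: g_def cong_def)
  finally show ?thesis by simp
qed

definition gauss :: "nat \<Rightarrow> int \<Rightarrow> complex" where
  "gauss m n = (\<Sum>a\<in>{0..<int m}. of_int (jac a m) * em m (a * n))"

lemma jac_em_cong:
  assumes "m > 0" "[a = b] (mod int m)"
  shows "of_int (jac a m) * em m (a * n) = of_int (jac b m) * em m (b * n)"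
  using jac_cong[OF assms(2)] em_cong[OF assms(1) cong_mult[OF assms(2) cong_refl[of n]]] by simp

lemma gauss_coprime:
  assumes m: "m > 0" "odd m" and n: "coprime n (int m)"
  shows "gauss m n = of_int (jac n m) * gauss m 1"
proof -
  have sq: "jac n m * jac n m = 1" using jac_values[of n m] jac_eq_0_iff[OF m(1), of n] n by auto
  have "gauss m 1 = (\<Sum>a\<in>{0..<int m}. of_int (jac (n * a) m) * em m (n * a * 1))"
    unfolding gauss_def by (rule sum_residues_mult[OF m(1) n, symmetric]) (rule jac_em_cong[OF m(1)])
  also have "\<dots> = of_int (jac n m) * gauss m n"
    unfolding gauss_def sum_distrib_left
    by (intro sum.cong refl) (simp add: jac_mult_left[OF m(2)] mult_ac)
  finally have "of_int (jac n m) * gauss m 1 = of_int (jac n m * jac n m) * gauss m n" by simp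
  then show ?thesis by (simp add: sq)
qed

text \<open>Choose \<open>u\<close> to be a nonresidue modulo a common prime \<open>p\<close> and 1
  modulo the cofactor, which squarefreeness makes coprime to \<open>p\<close>. Substituting
  \<open>u * a\<close> for \<open>a\<close> changes the sign of the symbol and, as \<open>p\<close>
  divides \<open>n\<close>, leaves the exponential fixed.\<close>

lemma gauss_not_coprime:
  assumes m: "m > 0" "odd m" "squarefree m" and n: "\<not> coprime n (int m)"
  shows "gauss m n = 0"
proof -
  obtain p where p: "p \<in> prime_factors m" "Legendre n (int p) = 0"
    using jac_eq_0_iff[OF m(1), of n] n by (auto simp: jac_def)
  then have pn: "int p dvd n" by (auto simp: Legendre_def cong_0_iff split: if_splits)
  have pp: "prime p" "odd p" "p dvd m" using odd_prime_factors[OF m(2) p(1)] by auto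
  obtain m' where m': "m = p * m'" using pp(3) by blast
  have m'0: "m' > 0" "odd m'" using m m' by (auto intro: Nat.gr0I)
  have co: "coprime p m'"
  proof (rule prime_imp_coprime[OF pp(1)])
    show "\<not> p dvd m'"
    proof
      assume "p dvd m'"
      then have "p ^ 2 dvd m" by (simp add: m' power2_eq_square)
      then have "is_unit p" using m(3) squarefreeD by blast
      then show False using pp(1) by simp
    qed
  qed
  obtain r where r: "Legendre r (int p) = -1" using exists_nonresidue[OF pp(1,2)] .
  have "coprime (int p) (int m')" using co by simp
  then obtain u where u: "[u = r] (mod int p)" "[u = 1] (mod int m')"
    using binary_chinese_remainder_int by blast
  have "jac u p = Legendre u (int p)" using pp(1) by (simp add: jac_def prime_factorization_prime)
  then have "jac u p = -1" using Legendre_cong[OF u(1)] r by simp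
  moreover have "jac u m' = 1" using jac_cong[OF u(2)] jac_1_left[OF m'0] by simp
  ultimately have ju: "jac u m = -1" unfolding m' using jac_mult_right[OF co, of u] m'0 prime_gt_0_nat[OF pp(1)] by simp
  then have cu: "coprime u (int m)" using jac_eq_0_iff[OF m(1), of u] by auto
  have "gauss m n = (\<Sum>a\<in>{0..<int m}. of_int (jac (u * a) m) * em m (u * a * n))"
    unfolding gauss_def by (rule sum_residues_mult[OF m(1) cu, symmetric]) (rule jac_em_cong[OF m(1)])
  also have "\<dots> = (\<Sum>a\<in>{0..<int m}. - (of_int (jac a m) * em m (a * n)))"
  proof (intro sum.cong refl)
    fix a
    have "int m dvd u * a * n - a * n"
    proof -
      obtain k where k: "u - 1 = int m' * k" using u(2) by (auto simp: cong_iff_dvd_diff)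
      obtain l where l: "n = int p * l" using pn by blast
      have "u * a * n - a * n = (u - 1) * a * n" by (simp add: algebra_simps)
      also have "\<dots> = int m * (k * a * l)" by (simp add: k l m')
      finally show ?thesis by simp
    qed
    then have "em m (u * a * n) = em m (a * n)" by (intro em_cong m) (simp add: cong_iff_dvd_diff)
    then show "of_int (jac (u * a) m) * em m (u * a * n) = - (of_int (jac a m) * em m (a * n))"
      by (simp add: jac_mult_left[OF m(2)] ju)
  qed
  also have "\<dots> = - gauss m n" by (simp add: gauss_def sum_negf)
  finally show ?thesis by simp
qed

lemma gauss_eq:
  assumes "m > 0" "odd m" "squarefree m"
  shows "gauss m n = of_int (jac n m) * gauss m 1"
  using gauss_coprime[OF assms(1,2), of n] gauss_not_coprime[OF assms, of n] jac_eq_0_iff[OF assms(1), of n]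
  by (cases "coprime n (int m)") simp_all

text \<open>The mean square of \<open>gauss m n\<close> over all residues \<open>n\<close> is
  computed twice: orthogonality gives \<open>m * \<Phi>\<close>, while \<open>gauss_eq\<close> gives
  \<open>\<Phi>\<close> times the squared modulus of \<open>gauss m 1\<close>, with
  \<open>\<Phi>\<close> the number of units.\<close>

lemma gauss_norm:
  assumes m: "m > 0" "odd m" "squarefree m"
  shows "cmod (gauss m 1) ^ 2 = real m"
proof -
  let ?R = "{0..<int m}"
  define \<Phi> where "\<Phi> = (\<Sum>a\<in>?R. jac a m * jac a m)"
  have "1 mod int m \<in> ?R" using m by simp
  moreover have "jac (1 mod int m) m = 1"
    using jac_cong[of "1 mod int m" 1 m] jac_1_left[OF m(1,2)] by (simp add: cong_def)
  ultimately have "(1::int) \<le> \<Phi>"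
    unfolding \<Phi>_def by (intro order_trans[OF _ member_le_sum[of "1 mod int m"]]) auto
  have "(\<Sum>n\<in>?R. gauss m n * cnj (gauss m n)) =
    (\<Sum>n\<in>?R. \<Sum>a\<in>?R. \<Sum>b\<in>?R. of_int (jac a m) * of_int (jac b m) * em m ((a - b) * n))"
  proof (intro sum.cong refl)
    fix n
    have t: "of_int (jac a m) * em m (a * n) * cnj (of_int (jac b m) * em m (b * n)) =
      of_int (jac a m) * of_int (jac b m) * em m ((a - b) * n)" for a b
    proof -
      have "(a - b) * n = a * n + - (b * n)" by (simp add: algebra_simps)
      then show ?thesis by (simp only: em_add complex_cnj_mult complex_cnj_of_int em_cnj mult_ac)
    qed
    show "gauss m n * cnj (gauss m n) =
      (\<Sum>a\<in>?R. \<Sum>b\<in>?R. of_int (jac a m) * of_int (jac b m) * em m ((a - b) * n))"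
      unfolding gauss_def cnj_sum sum_product t ..
  qed
  also have "\<dots> = (\<Sum>a\<in>?R. \<Sum>b\<in>?R. of_int (jac a m) * of_int (jac b m) * (\<Sum>n\<in>?R. em m ((a - b) * n)))"
    proof -
    have "(\<Sum>n\<in>?R. \<Sum>a\<in>?R. \<Sum>b\<in>?R. f n a b) = (\<Sum>a\<in>?R. \<Sum>b\<in>?R. \<Sum>n\<in>?R. f n a b)"
      for f :: "int \<Rightarrow> int \<Rightarrow> int \<Rightarrow> complex"
      by (rule trans[OF sum.swap]) (intro sum.cong refl sum.swap)
    then show ?thesis by (simp only: sum_distrib_left)
  qed
  also have "\<dots> = (\<Sum>a\<in>?R. \<Sum>b\<in>?R. if b = a then of_int (jac a m * jac a m) * of_nat m else 0)"
  proof (intro sum.cong refl)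
    fix a b assume ab: "a \<in> ?R" "b \<in> ?R"
    have "int m dvd a - b \<longleftrightarrow> b = a"
    proof
      assume "int m dvd a - b"
      then have "[a = b] (mod int m)" by (simp add: cong_iff_dvd_diff)
      then show "b = a" using ab by (simp add: cong_def)
    qed simp
    then show "of_int (jac a m) * of_int (jac b m) * (\<Sum>n\<in>?R. em m ((a - b) * n)) =
      (if b = a then of_int (jac a m * jac a m) * of_nat m else 0)"
      by (simp add: em_orthogonal[OF m(1)])
  qed
  also have "\<dots> = of_nat m * of_int \<Phi>" by (simp add: \<Phi>_def sum_distrib_left mult_ac)
  finally have 1: "(\<Sum>n\<in>?R. gauss m n * cnj (gauss m n)) = of_nat m * of_int \<Phi>" .
  have "(\<Sum>n\<in>?R. gauss m n * cnj (gauss m n)) = (\<Sum>n\<in>?R. of_int (jac n m * jac n m) * (gauss m 1 * cnj (gauss m 1)))"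
  proof (intro sum.cong refl)
    fix n
    have "gauss m n * cnj (gauss m n) = (of_int (jac n m) * gauss m 1) * cnj (of_int (jac n m) * gauss m 1)"
      by (simp only: gauss_eq[OF m, of n])
    then show "gauss m n * cnj (gauss m n) = of_int (jac n m * jac n m) * (gauss m 1 * cnj (gauss m 1))"
      by simp
  qed
  also have "\<dots> = of_int \<Phi> * of_real (cmod (gauss m 1) ^ 2)"
    by (simp only: sum_distrib_right[symmetric] \<Phi>_def of_int_sum complex_norm_square)
  finally have "(of_real (of_int \<Phi> * cmod (gauss m 1) ^ 2) :: complex) = of_real (real m * of_int \<Phi>)"
    using 1 by (metis of_int_of_nat_eq of_real_mult of_real_of_int_eq of_real_of_nat_eq)
  then have "of_int \<Phi> * cmod (gauss m 1) ^ 2 = real m * of_int \<Phi>" by (simp only: of_real_eq_iff)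
  then show ?thesis using \<open>1 \<le> \<Phi>\<close> by simp
qed

text \<open>The symbol is expanded into additive characters by its Gauss sum. Cauchy-Schwarz over at
  most \<open>m\<close> unit residues loses a factor \<open>m\<close>, which cancels the squared
  modulus of the Gauss sum exactly.\<close>

lemma jac_sum_le_farey:
  assumes m: "m > 0" "odd m" "squarefree m"
  shows "cmod (\<Sum>n\<in>S. \<beta> n * of_int (jac (int n) m)) ^ 2
    \<le> (\<Sum>a\<in>{a\<in>{0..<int m}. coprime a (int m)}. cmod (\<Sum>n\<in>S. \<beta> n * em m (a * int n)) ^ 2)"
proof -
  let ?R = "{0..<int m}" and ?C = "{a\<in>{0..<int m}. coprime a (int m)}"
  define F where "F a = (\<Sum>n\<in>S. \<beta> n * em m (a * int n))" for a
  have "gauss m 1 * (\<Sum>n\<in>S. \<beta> n * of_int (jac (int n) m)) = (\<Sum>n\<in>S. \<beta> n * gauss m (int n))"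
    by (simp add: sum_distrib_left gauss_eq[OF m, of "int _"] mult_ac)
  also have "\<dots> = (\<Sum>a\<in>?R. of_int (jac a m) * F a)"
    unfolding gauss_def F_def sum_distrib_left by (subst sum.swap) (simp add: mult_ac)
  also have "\<dots> = (\<Sum>a\<in>?C. of_int (jac a m) * F a)"
    proof (rule sum.mono_neutral_right)
    show "\<forall>a\<in>?R - ?C. of_int (jac a m) * F a = 0" using jac_eq_0_iff[OF m(1)] by simp
  qed auto
  finally have e: "gauss m 1 * (\<Sum>n\<in>S. \<beta> n * of_int (jac (int n) m)) = (\<Sum>a\<in>?C. of_int (jac a m) * F a)" .
  have "(\<Sum>a\<in>?C. cmod (of_int (jac a m)) ^ 2) \<le> (\<Sum>a\<in>?R. 1)"
  proof (rule order_trans[OF sum_mono sum_mono2])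
    show "cmod (of_int (jac a m)) ^ 2 \<le> 1" for a using jac_values[of a m] by (elim disjE) simp_all
    show "?C \<subseteq> ?R" by blast
  qed simp_all
  then have J: "(\<Sum>a\<in>?C. cmod (of_int (jac a m)) ^ 2) \<le> real m" by simp
  have "sqrt (real m) * cmod (\<Sum>n\<in>S. \<beta> n * of_int (jac (int n) m)) =
     cmod (gauss m 1 * (\<Sum>n\<in>S. \<beta> n * of_int (jac (int n) m)))"
    using gauss_norm[OF m] real_sqrt_unique[of "cmod (gauss m 1)" "real m"] by (simp add: norm_mult)
  also have "\<dots> \<le> sqrt (\<Sum>a\<in>?C. cmod (of_int (jac a m)) ^ 2) * sqrt (\<Sum>a\<in>?C. cmod (F a) ^ 2)"
    unfolding e by (rule Cauchy_Schwarz_complex_sum)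
  also have "\<dots> \<le> sqrt (real m) * sqrt (\<Sum>a\<in>?C. cmod (F a) ^ 2)"
    using J by (intro mult_right_mono real_sqrt_le_mono) (auto intro: sum_nonneg)
  finally have "cmod (\<Sum>n\<in>S. \<beta> n * of_int (jac (int n) m)) \<le> sqrt (\<Sum>a\<in>?C. cmod (F a) ^ 2)"
    using m by simp
  then have "cmod (\<Sum>n\<in>S. \<beta> n * of_int (jac (int n) m)) ^ 2 \<le> sqrt (\<Sum>a\<in>?C. cmod (F a) ^ 2) ^ 2"
    by (intro power_mono) auto
  then show ?thesis by (simp add: F_def sum_nonneg)
qed

text \<open>A difference of distinct reduced fractions in the unit interval is, modulo 1, a nonzero
  multiple of \<open>1 / (m * m')\<close>.\<close>

lemma farey_separated:
  assumes m: "m > 0" "m' > 0" "m \<le> Q" "m' \<le> Q" and ab: "0 \<le> a" "a < int m" "0 \<le> b" "b < int m'"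
    and co: "coprime a (int m)" "coprime b (int m')" and ne: "(m, a) \<noteq> (m', b)"
  defines "x \<equiv> real_of_int a / real m - real_of_int b / real m'"
  shows "1 / real (Q ^ 2) \<le> frac x \<and> frac x \<le> 1 - 1 / real (Q ^ 2)"
proof -
  define D where "D = m * m'"
  define c where "c = a * int m' - b * int m"
  have D: "D > 0" "D \<le> Q ^ 2" using m by (auto simp: D_def power2_eq_square intro: mult_mono)
  have x: "x = of_int c / real D" using m by (simp add: x_def c_def D_def field_simps)
  define r where "r = c mod int D"
  have fr: "frac x = of_int r / real D"
  proof -
    define k where "k = c div int D"
    have "c = int D * k + r" by (simp add: r_def k_def)
    then have "real_of_int c = real D * of_int k + of_int r" by simp
    then have "x = (real D * of_int k + of_int r) / real D" by (simp only: x)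
    also have "\<dots> = of_int k + of_int r / real D" using D by (simp add: add_divide_distrib)
    finally have "x = of_int k + of_int r / real D" .
    moreover have "r < int D" using D by (simp add: r_def)
    then have "real_of_int r < real D" by linarith
    then have "0 \<le> of_int r / real D" "of_int r / real D < 1"
      using D by (simp_all add: r_def pos_divide_less_eq)
    ultimately show ?thesis by (simp add: frac_unique_iff)
  qed
  have "r \<noteq> 0"
  proof
    assume "r = 0"
    then have "frac x = 0" using fr by simp
    moreover have "\<bar>x\<bar> < 1"
    proof -
      have "0 \<le> real_of_int a / real m" "real_of_int a / real m < 1"
        "0 \<le> real_of_int b / real m'" "real_of_int b / real m' < 1"
        using ab m by (simp_all add: divide_less_eq)
      then show ?thesis unfolding x_def by linarith
    qed
    ultimately have "x = 0"
    proof -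
      assume "frac x = 0" "\<bar>x\<bar> < 1"
      then obtain k where k: "x = of_int k" by (auto simp: frac_eq_0_iff elim: Ints_cases)
      with \<open>\<bar>x\<bar> < 1\<close> have "\<bar>k\<bar> < 1" by linarith
      then show ?thesis by (simp add: k)
    qed
    then have "real_of_int c = 0" using D by (simp add: x)
    then have "c = 0" by (simp only: of_int_eq_0_iff)
    then have e: "a * int m' = b * int m" by (simp add: c_def)
    have "int m dvd a * int m'" unfolding e by simp
    then have 1: "int m dvd int m'" using co(1) by (simp add: coprime_dvd_mult_right_iff coprime_commute)
    have "int m' dvd b * int m" unfolding e[symmetric] by simp
    then have "int m' dvd int m" using co(2) by (simp add: coprime_dvd_mult_right_iff coprime_commute)
    with 1 have "m = m'" by (simp add: dvd_antisym)
    then show False using e ne m by simp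
  qed
  moreover have "0 \<le> r" "r < int D" using D by (simp_all add: r_def)
  ultimately have "1 \<le> r" "r \<le> int D - 1" by linarith+
  then have "1 \<le> real_of_int r" "real_of_int r \<le> real D - 1" by linarith+
  then have "1 / real D \<le> frac x" "frac x \<le> 1 - 1 / real D" using D unfolding fr by (simp_all add: field_simps)
  moreover have "0 < real D" "real D \<le> real (Q ^ 2)" using D by (simp_all only: of_nat_0_less_iff of_nat_le_iff)
  then have "1 / real (Q ^ 2) \<le> 1 / real D" by (intro frac_le) auto
  ultimately show ?thesis by linarith
qed

definition oddsf :: "nat \<Rightarrow> nat set" where
  "oddsf Q = {m. 0 < m \<and> m \<le> Q \<and> odd m \<and> squarefree m}"

lemma finite_oddsf [simp]: "finite (oddsf Q)"
  by (rule finite_subset[of _ "{..Q}"]) (auto simp: oddsf_def)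

text \<open>The additive large sieve is available in dual form; transposing its operator norm bound
  moves the outer sum to the Farey fractions, which dominate the symbol sums. The integers
  \<open>n\<close> are arbitrary, which is what permits squaring the sum afterwards.\<close>

theorem quadratic_large_sieve:
  assumes "Q > 0"
  shows "(\<Sum>m\<in>oddsf Q. cmod (\<Sum>n<N. \<beta> n * of_int (jac (int n) m)) ^ 2)
    \<le> (real N + 6 * real (Q ^ 2) * harm (Q ^ 2)) * (\<Sum>n<N. cmod (\<beta> n) ^ 2)"
proof -
  define R where "R = (SIGMA m:oddsf Q. {a\<in>{0..<int m}. coprime a (int m)})"
  define \<theta> where "\<theta> r = real_of_int (snd r) / real (fst r)" for r :: "nat \<times> int"
  define B where "B = real N + 6 * real (Q ^ 2) * harm (Q ^ 2)"
  have fin1: "finite {a\<in>{0..<int m}. coprime a (int m)}" for m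
    by (rule finite_subset[of _ "{0..<int m}"]) auto
  have finR: "finite R" unfolding R_def using fin1 by (intro finite_SigmaI) auto
  have "harm (Q ^ 2) \<ge> (0::real)" unfolding harm_def by (intro sum_nonneg) simp
  then have B0: "B \<ge> 0" by (simp add: B_def)
  have sep: "1 / real (Q ^ 2) \<le> frac (\<theta> r - \<theta> s) \<and> frac (\<theta> r - \<theta> s) \<le> 1 - 1 / real (Q ^ 2)"
    if "r \<in> R" "s \<in> R" "r \<noteq> s" for r s
  proof -
    obtain m a m' b where rs: "r = (m, a)" "s = (m', b)" by (cases r, cases s) auto
    show ?thesis using that unfolding rs R_def \<theta>_def fst_conv snd_conv
      by (intro farey_separated) (auto simp: oddsf_def)
  qed
  have "bilin (\<lambda>n r. cis (2 * pi * \<theta> r * real n)) {..<N} R (sqrt B)"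
  proof (rule bilinI_L2)
    fix c
    show "(\<Sum>n<N. cmod (\<Sum>r\<in>R. c r * cis (2 * pi * \<theta> r * real n)) ^ 2) \<le> sqrt B ^ 2 * (\<Sum>r\<in>R. cmod (c r) ^ 2)"
      using additive_large_sieve_dual[OF finR _ sep, where N = N and c = c] assms B0 by (simp add: B_def)
  qed (use B0 in simp)
  then have "bilin (\<lambda>r n. cis (2 * pi * \<theta> r * real n)) R {..<N} (sqrt B)" by (rule bilin_transpose)
  from bilin_L2[OF this, of \<beta>] B0
  have 1: "(\<Sum>r\<in>R. cmod (\<Sum>n<N. \<beta> n * cis (2 * pi * \<theta> r * real n)) ^ 2) \<le> B * (\<Sum>n<N. cmod (\<beta> n) ^ 2)" by simp
  have "(\<Sum>m\<in>oddsf Q. cmod (\<Sum>n<N. \<beta> n * of_int (jac (int n) m)) ^ 2)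
    \<le> (\<Sum>m\<in>oddsf Q. \<Sum>a\<in>{a\<in>{0..<int m}. coprime a (int m)}. cmod (\<Sum>n<N. \<beta> n * em m (a * int n)) ^ 2)"
    by (intro sum_mono jac_sum_le_farey) (auto simp: oddsf_def)
  also have "\<dots> = (\<Sum>r\<in>R. cmod (\<Sum>n<N. \<beta> n * cis (2 * pi * \<theta> r * real n)) ^ 2)"
    unfolding R_def using fin1 by (subst sum.Sigma) (auto simp: em_def \<theta>_def mult_ac intro!: sum.cong)
  finally show ?thesis using 1 by (simp add: B_def)
qed

section \<open>The divisor bound\<close>

lemma divisor_set_prime_power_mult:
  fixes n k :: nat
  assumes p: "prime p" and n: "n > 0"
  shows "card {d. d dvd p ^ k * n} \<le> (k + 1) * card {d. d dvd n}"
proof -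
  have "{d. d dvd p ^ k * n} \<subseteq> (\<lambda>(i, d). p ^ i * d) ` ({..k} \<times> {d. d dvd n})"
  proof
    fix d assume "d \<in> {d. d dvd p ^ k * n}"
    then obtain u v where uv: "d = u * v" "u dvd p ^ k" "v dvd n" by (auto elim: dvd_productE)
    then obtain i where "i \<le> k" "u = p ^ i" using p by (auto simp: divides_primepow_nat)
    then show "d \<in> (\<lambda>(i, d). p ^ i * d) ` ({..k} \<times> {d. d dvd n})" using uv by auto
  qed
  moreover have fin: "finite ({..k} \<times> {d. d dvd n})" using n by simp
  ultimately have "card {d. d dvd p ^ k * n} \<le> card ({..k} \<times> {d. d dvd n})"
    by (meson card_image_le card_mono finite_imageI order_trans)
  then show ?thesis by (simp add: card_cartesian_product)
qed

text \<open>The factor \<open>k + 1\<close> of a prime power is at most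
  \<open>p powr (\<epsilon> * k)\<close> once \<open>p\<close> exceeds
  \<open>2 powr (1 / \<epsilon>)\<close>. The finitely many smaller primes cost a constant
  \<open>A\<close> each, so \<open>A ^ P\<close> suffices.\<close>

theorem divisor_bound:
  assumes \<epsilon>: "\<epsilon> > 0"
  shows "\<exists>C\<ge>1. \<forall>n\<ge>1. real (card {d. d dvd n}) \<le> C * real n powr \<epsilon>"
proof -
  \<comment> \<open>Chosen so that \<open>1 + x \<le> exp x\<close> yields
    \<open>k + 1 \<le> A * p powr (\<epsilon> * k)\<close> for every prime.\<close>
  define A where "A = max 1 (1 / (\<epsilon> * ln 2))"
  define P where "P = nat \<lceil>2 powr (1 / \<epsilon>)\<rceil>"
  have A1: "A \<ge> 1" by (simp add: A_def)
  have small: "real (k + 1) \<le> A * real p powr (\<epsilon> * real k)" if "p \<ge> 2" for p k :: nat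
  proof -
    have "1 + \<epsilon> * real k * ln 2 \<le> exp (\<epsilon> * real k * ln 2)" by (rule exp_ge_add_one_self)
    also have "\<dots> = 2 powr (\<epsilon> * real k)" by (simp add: powr_def)
    also have "\<dots> \<le> real p powr (\<epsilon> * real k)" using that \<epsilon> by (intro powr_mono2) auto
    finally have le: "1 + \<epsilon> * real k * ln 2 \<le> real p powr (\<epsilon> * real k)" .
    have pos: "\<epsilon> * ln 2 > 0" using \<epsilon> by simp
    have "1 = 1 / (\<epsilon> * ln 2) * (\<epsilon> * ln 2)" using \<epsilon> by simp
    also have "\<dots> \<le> A * (\<epsilon> * ln 2)" using pos by (intro mult_right_mono) (auto simp: A_def)
    finally have "1 \<le> A * (\<epsilon> * ln 2)" .
    then have "real k * 1 \<le> real k * (A * (\<epsilon> * ln 2))" by (intro mult_left_mono) auto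
    then have "real (k + 1) \<le> A * (1 + \<epsilon> * real k * ln 2)" using A1 by (simp add: algebra_simps)
    also have "\<dots> \<le> A * real p powr (\<epsilon> * real k)" using le A1 by (intro mult_left_mono) auto
    finally show ?thesis .
  qed
  have large: "real (k + 1) \<le> real p powr (\<epsilon> * real k)" if "p \<ge> P" "p \<ge> 2" for p k :: nat
  proof -
    have "2 powr (1 / \<epsilon>) \<le> real p" using that(1) unfolding P_def by linarith
    then have "(2 powr (1 / \<epsilon>)) powr (\<epsilon> * real k) \<le> real p powr (\<epsilon> * real k)"
      using \<epsilon> by (intro powr_mono2) auto
    moreover have "(2 powr (1 / \<epsilon>)) powr (\<epsilon> * real k) = 2 ^ k"
      using \<epsilon> by (simp add: powr_powr powr_realpow)
    moreover have "real (k + 1) \<le> 2 ^ k"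
    proof -
      have "k + 1 \<le> 2 ^ k" by (induction k) auto
      then have "real (k + 1) \<le> real (2 ^ k)" by (simp only: of_nat_le_iff)
      then show ?thesis by simp
    qed
    ultimately show ?thesis by linarith
  qed
  have main: "real (card {d. d dvd n}) \<le> A ^ card {p \<in> prime_factors n. p < P} * real n powr \<epsilon>" if "n \<ge> 1" for n
    using that
  proof (induction n rule: less_induct)
    case (less n)
    show ?case
    proof (cases "n = 1")
      case True
      then show ?thesis by simp
    next
      case False
      then obtain p where p: "prime p" "p dvd n" using prime_factor_nat by blast
      have p2: "p \<ge> 2" using p(1) prime_ge_2_nat by blast
      define k where "k = multiplicity p n"
      obtain m where m: "n = p ^ k * m" "\<not> p dvd m"
        using multiplicity_decompose'[of n p] less.prems p(1) unfolding k_def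
        by (metis not_prime_unit not_one_le_zero)
      have m0: "m \<ge> 1" using m(1) less.prems by (cases "m = 0") auto
      have "k \<noteq> 0" using m p(2) by (intro notI) simp
      then have pk: "p ^ k > 1" using p2 by (intro one_less_power) auto
      have lt: "m < n" using m0 pk by (simp add: m(1))
      have pf: "prime_factors n = insert p (prime_factors m)"
      proof -
        have "prime_factors n = prime_factors (p ^ k) \<union> prime_factors m"
          unfolding m(1) using m0 p2 by (intro prime_factors_product) auto
        moreover have "prime_factors (p ^ k) = {p}"
          using p(1) \<open>k \<noteq> 0\<close> by (simp add: prime_factors_power prime_prime_factors)
        ultimately show ?thesis by simp
      qed
      have np: "p \<notin> prime_factors m" using m(2) by (simp add: in_prime_factors_iff)
      have IH: "real (card {d. d dvd m}) \<le> A ^ card {p \<in> prime_factors m. p < P} * real m powr \<epsilon>"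
        by (rule less.IH[OF lt m0])
      have np': "real n powr \<epsilon> = real p powr (\<epsilon> * real k) * real m powr \<epsilon>"
        using p2 by (simp add: m(1) powr_mult powr_powr powr_realpow[symmetric] mult.commute)
      have "card {d. d dvd n} \<le> (k + 1) * card {d. d dvd m}"
        unfolding m(1) by (rule divisor_set_prime_power_mult) (use p(1) m0 in auto)
      then have "real (card {d. d dvd n}) \<le> real (k + 1) * real (card {d. d dvd m})"
        by (metis of_nat_le_iff of_nat_mult)
      also have "\<dots> \<le> real (k + 1) * (A ^ card {p \<in> prime_factors m. p < P} * real m powr \<epsilon>)"
        using IH by (intro mult_left_mono) auto
      also have "\<dots> \<le> A ^ card {p \<in> prime_factors n. p < P} * real n powr \<epsilon>"
      proof (cases "p < P")
        case True
        have "{q \<in> prime_factors n. q < P} = insert p {q \<in> prime_factors m. q < P}" using True by (auto simp: pf)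
        then have "card {q \<in> prime_factors n. q < P} = Suc (card {q \<in> prime_factors m. q < P})"
          using np by simp
        moreover have "real (k + 1) * (A ^ card {p \<in> prime_factors m. p < P} * real m powr \<epsilon>)
          \<le> (A * real p powr (\<epsilon> * real k)) * (A ^ card {p \<in> prime_factors m. p < P} * real m powr \<epsilon>)"
          using A1 by (intro mult_right_mono small p2) auto
        ultimately show ?thesis by (simp add: np' mult_ac)
      next
        case False
        have "{q \<in> prime_factors n. q < P} = {q \<in> prime_factors m. q < P}" using False by (auto simp: pf)
        moreover have "real (k + 1) * (A ^ card {p \<in> prime_factors m. p < P} * real m powr \<epsilon>)
          \<le> real p powr (\<epsilon> * real k) * (A ^ card {p \<in> prime_factors m. p < P} * real m powr \<epsilon>)"
          using A1 False p2 by (intro mult_right_mono large) auto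
        ultimately show ?thesis by (simp add: np' mult_ac)
      qed
      finally show ?thesis .
    qed
  qed
  show ?thesis
  proof (intro exI[of _ "A ^ P"] conjI allI impI)
    show "1 \<le> A ^ P" using A1 by simp
    fix n :: nat assume n: "1 \<le> n"
    have "card {p \<in> prime_factors n. p < P} \<le> card {..<P}" by (intro card_mono) auto
    then have "A ^ card {p \<in> prime_factors n. p < P} \<le> A ^ P" using A1 by (intro power_increasing) auto
    then have "A ^ card {p \<in> prime_factors n. p < P} * real n powr \<epsilon> \<le> A ^ P * real n powr \<epsilon>"
      by (intro mult_right_mono) auto
    with main[OF n] show "real (card {d. d dvd n}) \<le> A ^ P * real n powr \<epsilon>" by linarith
  qed
qed

lemma harm_le_powr:
  assumes \<epsilon>: "\<epsilon> > 0" and n: "n \<ge> 1"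
  shows "harm n \<le> (1 + 1 / \<epsilon>) * real n powr \<epsilon>"
proof -
  have "harm n \<le> 1 + ln (real n)"
    using n
  proof (induction n rule: dec_induct)
    case (step n)
    have "ln (real n / real (Suc n)) \<le> real n / real (Suc n) - 1" using step by (intro ln_le_minus_one) auto
    also have "\<dots> = - 1 / real (Suc n)" by (simp add: field_simps)
    finally have "inverse (real (Suc n)) \<le> ln (real (Suc n)) - ln (real n)"
      using step by (simp add: ln_div field_simps)
    then show ?case using step.IH by (simp add: harm_Suc del: of_nat_Suc)
  qed (simp add: harm_def)
  also have "\<epsilon> * ln (real n) = ln (real n powr \<epsilon>)" using n by (simp add: ln_powr)
  have "ln (real n) \<le> real n powr \<epsilon> / \<epsilon>"
  proof -
    have "ln (real n powr \<epsilon>) \<le> real n powr \<epsilon> - 1" using n by (intro ln_le_minus_one) auto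
    then have "\<epsilon> * ln (real n) \<le> real n powr \<epsilon>" using n by (simp add: ln_powr)
    then show ?thesis using \<epsilon> by (simp add: field_simps)
  qed
  then have "1 + ln (real n) \<le> real n powr \<epsilon> + real n powr \<epsilon> / \<epsilon>"
    using n \<epsilon> ge_one_powr_ge_zero[of "real n" \<epsilon>] by (intro add_mono) auto
  finally show ?thesis by (simp add: algebra_simps)
qed

section \<open>The bilinear Jacobi sum\<close>

text \<open>The sieve is efficient only if the sum over \<open>n\<close> is about as long as
  \<open>Q ^ 2\<close>. The sum is therefore squared: its square is a symbol sum over
  \<open>\<nu> \<le> N ^ 2\<close> whose coefficient \<open>b \<nu>\<close> collects at most
  \<open>T\<close> pairs. This bounds a fourth moment, and Cauchy-Schwarz in \<open>m\<close>
  returns to the second moment; hence the two nested square roots.\<close>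

lemma bilin_jac_direct:
  assumes Q: "Q \<ge> 1" and N: "N \<ge> 1" and S: "S \<subseteq> {1..N}"
    and T: "\<And>\<nu>. 1 \<le> \<nu> \<Longrightarrow> \<nu> \<le> N ^ 2 \<Longrightarrow> real (card {d. d dvd \<nu>}) \<le> T"
  defines "B \<equiv> real (N ^ 2 + 1) + 6 * real (Q ^ 2) * harm (Q ^ 2)"
  shows "bilin (\<lambda>m n. of_int (jac (int n) m)) (oddsf Q) S (sqrt (sqrt (real Q * B * T)))"
proof (rule bilinI_L2)
  have finS: "finite S" using S finite_subset by blast
  have "harm (Q ^ 2) \<ge> (0::real)" unfolding harm_def by (intro sum_nonneg) simp
  then have B0: "B \<ge> 0" by (simp add: B_def)
  have T0: "T \<ge> 0" using T[of 1] N by (meson of_nat_0_le_iff order_trans one_le_power order_refl)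
  show "sqrt (sqrt (real Q * B * T)) \<ge> 0" using B0 T0 by simp
  fix v :: "nat \<Rightarrow> complex"
  define F where "F m = (\<Sum>n\<in>S. v n * of_int (jac (int n) m))" for m
  define b where "b \<nu> = (\<Sum>p\<in>{p\<in>S \<times> S. fst p * snd p = \<nu>}. v (fst p) * v (snd p))" for \<nu>
  define V where "V = (\<Sum>n\<in>S. cmod (v n) ^ 2)"
  have V0: "V \<ge> 0" by (simp add: V_def sum_nonneg)
  have rng: "fst p * snd p \<in> {..<N ^ 2 + 1}" if "p \<in> S \<times> S" for p
  proof -
    have "fst p \<le> N" "snd p \<le> N" using that S by auto
    then have "fst p * snd p \<le> N * N" by (intro mult_mono) auto
    then show ?thesis by (simp add: power2_eq_square)
  qed
  have F2: "F m * F m = (\<Sum>\<nu><N ^ 2 + 1. b \<nu> * of_int (jac (int \<nu>) m))" if "m \<in> oddsf Q" for m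
  proof -
    have odd: "odd m" using that by (simp add: oddsf_def)
    have "F m * F m = (\<Sum>p\<in>S \<times> S. v (fst p) * v (snd p) * of_int (jac (int (fst p * snd p)) m))"
      unfolding F_def sum_product sum.cartesian_product'
      by (intro sum.cong refl) (simp add: jac_mult_left[OF odd] mult_ac)
    also have "\<dots> = (\<Sum>\<nu><N ^ 2 + 1. \<Sum>p\<in>{p\<in>S \<times> S. fst p * snd p = \<nu>}.
        v (fst p) * v (snd p) * of_int (jac (int (fst p * snd p)) m))"
      using finS rng by (intro sum.group[symmetric]) auto
    also have "\<dots> = (\<Sum>\<nu><N ^ 2 + 1. b \<nu> * of_int (jac (int \<nu>) m))"
      unfolding b_def sum_distrib_right by (intro sum.cong refl) auto
    finally show ?thesis .
  qed
  have "(\<Sum>m\<in>oddsf Q. cmod (F m * F m) ^ 2) \<le> B * (\<Sum>\<nu><N ^ 2 + 1. cmod (b \<nu>) ^ 2)"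
    using quadratic_large_sieve[where Q = Q and N = "N ^ 2 + 1" and \<beta> = b] Q F2 by (simp add: B_def)
  also have "(\<Sum>\<nu><N ^ 2 + 1. cmod (b \<nu>) ^ 2) \<le> (\<Sum>\<nu><N ^ 2 + 1. T * (\<Sum>p\<in>{p\<in>S \<times> S. fst p * snd p = \<nu>}. cmod (v (fst p) * v (snd p)) ^ 2))"
  proof (rule sum_mono)
    fix \<nu> assume \<nu>: "\<nu> \<in> {..<N ^ 2 + 1}"
    define A where "A = {p\<in>S \<times> S. fst p * snd p = \<nu>}"
    have "real (card A) \<le> T"
    proof (cases "\<nu> = 0")
      case True
      then have "A = {}" using S by (auto simp: A_def)
      then show ?thesis using T0 by simp
    next
      case False
      have "inj_on fst A"
      proof (rule inj_onI)
        fix p q assume pq: "p \<in> A" "q \<in> A" "fst p = fst q"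
        then have "fst p * snd p = fst p * snd q" by (simp add: A_def)
        moreover have "fst p > 0" using pq(1) S by (auto simp: A_def)
        ultimately show "p = q" using pq(3) by (simp add: prod_eq_iff)
      qed
      then have "card A = card (fst ` A)" by (simp add: card_image)
      also have "\<dots> \<le> card {d. d dvd \<nu>}" using False by (intro card_mono) (auto simp: A_def)
      finally have "real (card A) \<le> real (card {d. d dvd \<nu>})" by simp
      also have "\<dots> \<le> T" using False \<nu> by (intro T) auto
      finally show ?thesis .
    qed
    have "cmod (b \<nu>) ^ 2 \<le> (sqrt (\<Sum>p\<in>A. cmod (1::complex) ^ 2) * sqrt (\<Sum>p\<in>A. cmod (v (fst p) * v (snd p)) ^ 2)) ^ 2"
      using Cauchy_Schwarz_complex_sum[of "\<lambda>_. 1" "\<lambda>p. v (fst p) * v (snd p)" A]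
      by (intro power_mono) (simp_all add: b_def A_def)
    also have "\<dots> = real (card A) * (\<Sum>p\<in>A. cmod (v (fst p) * v (snd p)) ^ 2)"
      by (simp add: power_mult_distrib sum_nonneg)
    also have "\<dots> \<le> T * (\<Sum>p\<in>A. cmod (v (fst p) * v (snd p)) ^ 2)"
      using \<open>real (card A) \<le> T\<close> by (intro mult_right_mono sum_nonneg) auto
    finally show "cmod (b \<nu>) ^ 2 \<le> T * (\<Sum>p\<in>{p\<in>S \<times> S. fst p * snd p = \<nu>}. cmod (v (fst p) * v (snd p)) ^ 2)"
      by (simp add: A_def)
  qed
  also have "\<dots> = T * (\<Sum>p\<in>S \<times> S. cmod (v (fst p) * v (snd p)) ^ 2)"
    unfolding sum_distrib_left[symmetric] using finS rng by (subst sum.group) auto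
  also have "(\<Sum>p\<in>S \<times> S. cmod (v (fst p) * v (snd p)) ^ 2) = V ^ 2"
    unfolding V_def power2_eq_square[of "sum _ _"] sum_product sum.cartesian_product'
    by (simp add: norm_mult power_mult_distrib)
  finally have F4: "(\<Sum>m\<in>oddsf Q. (cmod (F m) ^ 2) ^ 2) \<le> B * (T * V ^ 2)"
    using B0 by (simp add: norm_mult power2_eq_square mult_left_mono)
  have "(\<Sum>m\<in>oddsf Q. cmod (F m) ^ 2) = (\<Sum>m\<in>oddsf Q. 1 * cmod (F m) ^ 2)" by simp
  also have "\<dots> \<le> sqrt (\<Sum>m\<in>oddsf Q. 1 ^ 2) * sqrt (\<Sum>m\<in>oddsf Q. (cmod (F m) ^ 2) ^ 2)"
    by (rule Cauchy_Schwarz_real_sum)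
  also have "\<dots> \<le> sqrt (real Q) * sqrt (B * (T * V ^ 2))"
  proof (intro mult_mono real_sqrt_le_mono F4)
    have "card (oddsf Q) \<le> card {1..Q}" by (intro card_mono) (auto simp: oddsf_def)
    then show "(\<Sum>m\<in>oddsf Q. 1 ^ 2) \<le> real Q" by simp
  qed (auto intro: sum_nonneg)
  also have "\<dots> = sqrt (real Q * B * T) * V" using V0 by (simp add: real_sqrt_mult mult_ac)
  also have "sqrt (real Q * B * T) = sqrt (sqrt (real Q * B * T)) ^ 2" using B0 T0 by simp
  finally show "(\<Sum>m\<in>oddsf Q. cmod (\<Sum>n\<in>S. v n * of_int (jac (int n) m)) ^ 2)
    \<le> sqrt (sqrt (real Q * B * T)) ^ 2 * (\<Sum>n\<in>S. cmod (v n) ^ 2)"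
    by (simp add: F_def V_def)
qed

text \<open>For \<open>Q \<le> N\<close> the fourth root of \<open>Q * N ^ 2\<close> is
  \<open>(Q * N) powr (1 / 2) * Q powr (- 1 / 4)\<close>. For \<open>Q > N\<close> reciprocity
  exchanges the roles; its sign does not split into a function of \<open>m\<close> times a function
  of \<open>n\<close>, but is a multiplier of rank two.\<close>

theorem bilin_jac:
  assumes \<epsilon>: "\<epsilon> > 0"
  shows "\<exists>C\<ge>1. \<forall>Q\<ge>1. \<forall>N\<ge>1. bilin (\<lambda>m n. of_int (jac (int n) m)) (oddsf Q) (oddsf N)
    (C * (real Q * real N) powr (1 / 2 + \<epsilon>) * min (real Q) (real N) powr (- 1 / 4))"
proof -
  obtain C1 where C1: "C1 \<ge> 1" "\<And>n. n \<ge> 1 \<Longrightarrow> real (card {d. d dvd n}) \<le> C1 * real n powr (2 * \<epsilon>)"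
    using divisor_bound[of "2 * \<epsilon>"] \<epsilon> by auto
  define K where "K = 1 + 1 / (2 * \<epsilon>)"
  have K1: "K \<ge> 1" using \<epsilon> by (simp add: K_def)
  define C0 where "C0 = (2 + 6 * K) * C1"
  have C0: "C0 \<ge> 1" unfolding C0_def using K1 C1(1) mult_mono[of 1 "2 + 6 * K" 1 C1] by simp
  define G where "G Q N = C0 * (real Q * real N) powr (1 / 2 + \<epsilon>) * real Q powr (- 1 / 4)" for Q N :: nat
  have direct: "bilin (\<lambda>m n. of_int (jac (int n) m)) (oddsf Q) (oddsf N) (G Q N)"
    if QN: "1 \<le> Q" "Q \<le> N" for Q N
  proof -
    define T where "T = C1 * real (N ^ 2) powr (2 * \<epsilon>)"
    define B where "B = real (N ^ 2 + 1) + 6 * real (Q ^ 2) * harm (Q ^ 2)"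
    have N1: "1 \<le> N" using QN by simp
    have T: "real (card {d. d dvd \<nu>}) \<le> T" if "1 \<le> \<nu>" "\<nu> \<le> N ^ 2" for \<nu>
    proof -
      have "real \<nu> \<le> real (N ^ 2)" using that(2) by (simp only: of_nat_le_iff)
      then have "real \<nu> powr (2 * \<epsilon>) \<le> real (N ^ 2) powr (2 * \<epsilon>)" using \<epsilon> by (intro powr_mono2) auto
      then show ?thesis using C1(2)[OF that(1)] C1(1) unfolding T_def
        by (meson mult_left_mono order_trans zero_le_one)
    qed
    have "bilin (\<lambda>m n. of_int (jac (int n) m)) (oddsf Q) (oddsf N) (sqrt (sqrt (real Q * B * T)))"
      unfolding B_def by (rule bilin_jac_direct[OF QN(1) N1 _ T]) (auto simp: oddsf_def)
    moreover have "sqrt (sqrt (real Q * B * T)) \<le> G Q N"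
    proof -
      have q: "real Q > 0" "real N > 0" "real Q \<ge> 1" "real N \<ge> 1" "real Q \<le> real N" using QN by auto
      have pw: "real (k ^ 2) powr (2 * \<epsilon>) = (real k powr (2 * \<epsilon>)) ^ 2" for k :: nat
        by (simp add: power2_eq_square powr_mult)
      have q1: "real Q powr (2 * \<epsilon>) \<ge> 1" using q \<epsilon> by (intro ge_one_powr_ge_zero) auto
      then have q2: "(real Q powr (2 * \<epsilon>)) ^ 2 \<ge> 1" by (rule one_le_power)
      have "harm (Q ^ 2) \<le> K * real (Q ^ 2) powr (2 * \<epsilon>)"
        unfolding K_def using QN \<epsilon> by (intro harm_le_powr) auto
      then have h: "harm (Q ^ 2) \<le> K * (real Q powr (2 * \<epsilon>)) ^ 2" by (simp only: pw)
      have h0: "harm (Q ^ 2) \<ge> (0::real)" unfolding harm_def by (intro sum_nonneg) simp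
      have QN2: "real Q ^ 2 \<le> real N ^ 2" using q by (intro power_mono) auto
      have "B \<le> 2 * real N ^ 2 + 6 * (real N ^ 2) * (K * (real Q powr (2 * \<epsilon>)) ^ 2)"
      proof -
        have "real (N ^ 2 + 1) \<le> 2 * real N ^ 2" using q by (simp add: one_le_power)
        moreover have "6 * real (Q ^ 2) * harm (Q ^ 2) \<le> 6 * real N ^ 2 * (K * (real Q powr (2 * \<epsilon>)) ^ 2)"
          using QN2 h h0 by (intro mult_mono) auto
        ultimately show ?thesis unfolding B_def by linarith
      qed
      also have "\<dots> \<le> (2 + 6 * K) * real N ^ 2 * (real Q powr (2 * \<epsilon>)) ^ 2"
        using mult_left_mono[OF q2, of "2 * real N ^ 2"] by (simp add: algebra_simps)
      finally have "real Q * B * T \<le> real Q * ((2 + 6 * K) * real N ^ 2 * (real Q powr (2 * \<epsilon>)) ^ 2) * T"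
        using C1(1) by (intro mult_right_mono mult_left_mono) (auto simp: T_def)
      also have "\<dots> = C0 * (real Q * real N ^ 2 * ((real Q * real N) powr (2 * \<epsilon>)) ^ 2)"
        proof -
        have "T = C1 * (real N powr (2 * \<epsilon>)) ^ 2" by (simp only: T_def pw)
        then show ?thesis by (simp add: C0_def powr_mult power_mult_distrib mult_ac)
      qed
      also have "\<dots> \<le> C0 ^ 4 * (real Q * real N ^ 2 * ((real Q * real N) powr (2 * \<epsilon>)) ^ 2)"
        using C0 self_le_power[of C0 4] by (intro mult_right_mono) auto
      also have "\<dots> = G Q N ^ 4"
      proof -
        have e1: "((real Q * real N) powr (1 / 2 + \<epsilon>)) ^ 4 = (real Q * real N) ^ 2 * ((real Q * real N) powr (2 * \<epsilon>)) ^ 2"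
        proof -
          have pos: "real Q * real N > 0" using q by simp
          have "((real Q * real N) powr (1 / 2 + \<epsilon>)) ^ 4 = (real Q * real N) powr (2 + 2 * (2 * \<epsilon>))"
            proof -
            have "((real Q * real N) powr (1 / 2 + \<epsilon>)) ^ 4 = (real Q * real N) powr (of_nat 4 * (1 / 2 + \<epsilon>))"
              using q by (intro powr_power) auto
            also have "of_nat 4 * (1 / 2 + \<epsilon>) = 2 + 2 * (2 * \<epsilon>)" by simp
            finally show ?thesis .
          qed
          also have "\<dots> = (real Q * real N) powr 2 * ((real Q * real N) powr (2 * \<epsilon>)) ^ 2"
            using pos by (simp add: powr_add power2_eq_square powr_add[symmetric])
          finally show ?thesis using pos by simp
        qed
        have e2: "(real Q powr (- 1 / 4)) ^ 4 = 1 / real Q"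
          proof -
          have "(real Q powr (- 1 / 4)) ^ 4 = real Q powr (of_nat 4 * (- 1 / 4))"
            using q by (intro powr_power) auto
          also have "of_nat 4 * (- 1 / 4) = (- 1 :: real)" by simp
          finally show ?thesis using q by (simp add: powr_minus_divide)
        qed
        show ?thesis unfolding G_def power_mult_distrib[of "C0 * _"] power_mult_distrib[of C0] e1 e2
          using q by (simp add: power2_eq_square field_simps)
      qed
      finally have "real Q * B * T \<le> (G Q N ^ 2) ^ 2" by simp
      moreover have "G Q N \<ge> 0" using C0 by (simp add: G_def)
      ultimately show ?thesis by (intro real_le_lsqrt) auto
    qed
    ultimately show ?thesis by (rule bilin_mono)
  qed
  have swap: "bilin (\<lambda>m n. of_int (jac (int n) m)) (oddsf Q) (oddsf N) (4 * G N Q)"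
    if QN: "1 \<le> N" "N \<le> Q" for Q N
  proof -
    \<comment> \<open>The sign is 1 minus twice a product of two indicators, whence the squared
      norms 1 + 4 and 1 + 1 below.\<close>
    define \<phi> where "\<phi> h m = (if h = (0::nat) then 1 else if m mod 4 = (3::nat) then -2 else (0::complex))" for h m
    define \<psi> where "\<psi> h n = (if h = (0::nat) then 1 else if n mod 4 = (3::nat) then 1 else (0::complex))" for h n
    define W where "W m n = (if m mod 4 = 3 \<and> n mod 4 = 3 then -1 else (1::complex))" for m n :: nat
    have G0: "G N Q \<ge> 0" using C0 by (simp add: G_def)
    have "bilin (\<lambda>m n. of_int (jac (int m) n)) (oddsf Q) (oddsf N) (G N Q)"
      using bilin_transpose[OF direct[OF QN]] .
    then have "bilin (\<lambda>m n. W m n * of_int (jac (int m) n)) (oddsf Q) (oddsf N) (G N Q * (sqrt 5 * sqrt 2))"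
    proof (rule bilin_schur[OF _ G0])
      show "W m n = (\<Sum>h\<in>{0, 1}. \<phi> h m * \<psi> h n)" for m n by (simp add: W_def \<phi>_def \<psi>_def)
      show "(\<Sum>h\<in>{0, 1}. cmod (\<phi> h m) ^ 2) \<le> 5" for m by (simp add: \<phi>_def)
      show "(\<Sum>h\<in>{0, 1}. cmod (\<psi> h n) ^ 2) \<le> 2" for n by (simp add: \<psi>_def)
    qed simp_all
    moreover have "W m n * of_int (jac (int m) n) = of_int (jac (int n) m)"
      if "m \<in> oddsf Q" "n \<in> oddsf N" for m n
    proof (cases "coprime m n")
      case True
      have r: "jac (int n) m * jac (int m) n = (if m mod 4 = 3 \<and> n mod 4 = 3 then -1 else 1)"
        using that True by (intro jac_reciprocity) (auto simp: oddsf_def)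
      then have "W m n = of_int (jac (int n) m * jac (int m) n)" by (simp add: W_def)
      moreover have "jac (int m) n * jac (int m) n = 1" using r jac_values[of "int m" n] by (auto split: if_splits)
      ultimately show ?thesis by (metis mult.assoc mult.right_neutral of_int_mult of_int_1)
    next
      case False
      then have "jac (int n) m = 0" "jac (int m) n = 0"
        using that jac_eq_0_iff[of m "int n"] jac_eq_0_iff[of n "int m"] by (auto simp: oddsf_def coprime_commute)
      then show ?thesis by simp
    qed
    ultimately have "bilin (\<lambda>m n. of_int (jac (int n) m)) (oddsf Q) (oddsf N) (G N Q * (sqrt 5 * sqrt 2))"
      by (rule bilin_cong)
    moreover have "sqrt 5 * sqrt 2 \<le> 4" by (simp add: real_sqrt_mult[symmetric] real_le_lsqrt)
    ultimately show ?thesis by (elim bilin_mono) (use G0 in \<open>simp add: mult.commute mult_left_mono\<close>)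
  qed
  show ?thesis
  proof (intro exI[of _ "4 * C0"] conjI allI impI)
    show "1 \<le> 4 * C0" using C0 by simp
    fix Q N :: nat assume "1 \<le> Q" "1 \<le> N"
    show "bilin (\<lambda>m n. of_int (jac (int n) m)) (oddsf Q) (oddsf N)
      (4 * C0 * (real Q * real N) powr (1 / 2 + \<epsilon>) * min (real Q) (real N) powr (- 1 / 4))"
    proof (cases "Q \<le> N")
      case True
      then show ?thesis using direct[OF \<open>1 \<le> Q\<close> True]
        by (elim bilin_mono) (use C0 in \<open>simp add: G_def\<close>)
    next
      case False
      then show ?thesis using swap[OF \<open>1 \<le> N\<close>, of Q] by (simp add: G_def mult_ac)
    qed
  qed
qed

section \<open>Schur multipliers\<close>

text \<open>Moebius inversion: the indicator of coprimality is the sum of (-1)^|S| over the sets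
  \<open>S\<close> of common primes. Being a set of common primes separates into a condition on
  \<open>f i\<close> and one on \<open>g j\<close>, and the number of admissible sets is at most the
  number of divisors.\<close>

lemma bilin_coprime_mult:
  fixes f :: "'i \<Rightarrow> nat" and g :: "'j \<Rightarrow> nat"
  assumes b: "bilin A I J c" "c \<ge> 0" and fin: "finite I" "finite J"
    and f: "\<And>i. i \<in> I \<Longrightarrow> f i \<ge> 1 \<and> real (card {d. d dvd f i}) \<le> K"
    and g: "\<And>j. j \<in> J \<Longrightarrow> g j \<ge> 1 \<and> real (card {d. d dvd g j}) \<le> L"
    and KL: "K \<ge> 0" "L \<ge> 0"
  shows "bilin (\<lambda>i j. of_bool (coprime (f i) (g j)) * A i j) I J (c * (sqrt K * sqrt L))"
proof -
  define P where "P = (\<Union>i\<in>I. prime_factors (f i)) \<union> (\<Union>j\<in>J. prime_factors (g j))"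
  have finP: "finite P" unfolding P_def using fin by auto
  define \<phi> where "\<phi> S i = (if S \<subseteq> prime_factors (f i) then (-1) ^ card S else (0::complex))" for S i
  define \<psi> where "\<psi> S j = (if S \<subseteq> prime_factors (g j) then 1 else (0::complex))" for S j
  \<comment> \<open>Distinct sets of primes have distinct products, and these are divisors of
    \<open>n\<close>.\<close>
  have cardle: "real (card {S\<in>Pow P. S \<subseteq> prime_factors n}) \<le> real (card {d. d dvd n})" if "n \<ge> 1" for n
  proof -
    have inj: "inj_on (\<lambda>S. \<Prod>S) {S\<in>Pow P. S \<subseteq> prime_factors n}"
    proof (rule inj_onI)
      fix S T assume ST: "S \<in> {S\<in>Pow P. S \<subseteq> prime_factors n}" "T \<in> {S\<in>Pow P. S \<subseteq> prime_factors n}" "\<Prod>S = \<Prod>T"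
      have pf: "prime_factors (\<Prod>S) = S" if "S \<subseteq> prime_factors n" for S
      proof -
        have fS: "finite S" using that finite_subset by blast
        have "q dvd \<Prod>S \<longleftrightarrow> q \<in> S" if q: "prime q" for q
        proof
          assume "q dvd \<Prod>S"
          then obtain r where "r \<in> S" "q dvd r" using prime_dvd_prod_iff[OF fS q, of "\<lambda>x. x"] by auto
          moreover have "prime r" using \<open>r \<in> S\<close> \<open>S \<subseteq> _\<close> by auto
          ultimately show "q \<in> S" using primes_dvd_imp_eq[OF q] by blast
        next
          assume "q \<in> S"
          then show "q dvd \<Prod>S" using dvd_prodI[OF fS, of q "\<lambda>x. x"] by simp
        qed
        moreover have "\<Prod>S \<noteq> 0" using fS that by (auto simp: prod_zero_iff)
        moreover have "prime q" if "q \<in> S" for q using that \<open>S \<subseteq> _\<close> by auto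
        ultimately show ?thesis unfolding set_eq_iff in_prime_factors_iff by blast
      qed
      have "S = prime_factors (\<Prod>S)" using pf[of S] ST(1) by simp
      also have "\<dots> = T" using pf[of T] ST(2,3) by simp
      finally show "S = T" .
    qed
    moreover have "(\<lambda>S. \<Prod>S) ` {S\<in>Pow P. S \<subseteq> prime_factors n} \<subseteq> {d. d dvd n}"
    proof safe
      fix S assume S: "S \<subseteq> prime_factors n"
      have "\<Prod>S dvd \<Prod>(prime_factors n)" by (intro prod_dvd_prod_subset S) simp
      also have "\<dots> dvd (\<Prod>p\<in>prime_factors n. p ^ multiplicity p n)"
        by (intro prod_dvd_prod) (auto simp: in_prime_factors_iff prime_multiplicity_gt_zero_iff intro!: dvd_power)
      also have "\<dots> = n" using that prime_factorization_nat[of n] by simp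
      finally show "\<Prod>S dvd n" .
    qed
    ultimately have "card {S\<in>Pow P. S \<subseteq> prime_factors n} \<le> card {d. d dvd n}"
      using that by (intro card_inj_on_le) auto
    then show ?thesis by simp
  qed
  show ?thesis
  proof (rule bilin_schur[OF b, where H = "Pow P" and \<phi> = \<phi> and \<psi> = \<psi>])
    fix i assume i: "i \<in> I"
    have "(\<Sum>S\<in>Pow P. cmod (\<phi> S i) ^ 2) = (\<Sum>S\<in>Pow P. if S \<subseteq> prime_factors (f i) then 1 else 0)"
      by (intro sum.cong refl) (simp add: \<phi>_def norm_power)
    also have "\<dots> = real (card {S\<in>Pow P. S \<subseteq> prime_factors (f i)})"
      using finP by (simp add: sum.If_cases Int_def)
    also have "\<dots> \<le> K" using cardle[of "f i"] f[OF i] by linarith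
    finally show "(\<Sum>S\<in>Pow P. cmod (\<phi> S i) ^ 2) \<le> K" .
  next
    fix j assume j: "j \<in> J"
    have "(\<Sum>S\<in>Pow P. cmod (\<psi> S j) ^ 2) = (\<Sum>S\<in>Pow P. if S \<subseteq> prime_factors (g j) then 1 else 0)"
      by (intro sum.cong refl) (simp add: \<psi>_def)
    also have "\<dots> = real (card {S\<in>Pow P. S \<subseteq> prime_factors (g j)})"
      using finP by (simp add: sum.If_cases Int_def)
    also have "\<dots> \<le> L" using cardle[of "g j"] g[OF j] by linarith
    finally show "(\<Sum>S\<in>Pow P. cmod (\<psi> S j) ^ 2) \<le> L" .
  next
    fix i j assume ij: "i \<in> I" "j \<in> J"
    define F where "F = prime_factors (f i) \<inter> prime_factors (g j)"
    have finF: "finite F" by (simp add: F_def)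
    have "(\<Sum>S\<in>Pow P. \<phi> S i * \<psi> S j) = (\<Sum>S\<in>Pow F. \<phi> S i * \<psi> S j)"
      using finP ij by (intro sum.mono_neutral_right) (auto simp: \<phi>_def \<psi>_def F_def P_def)
    also have "\<dots> = (\<Sum>S\<in>Pow F. (\<Prod>p\<in>S. -1) * (\<Prod>p\<in>F - S. 1))"
      by (intro sum.cong refl) (auto simp: \<phi>_def \<psi>_def F_def)
    also have "\<dots> = (\<Prod>p\<in>F. -1 + 1)" using finF by (rule prod_add[symmetric])
    also have "\<dots> = of_bool (F = {})" using finF by (cases "F = {}") (auto simp: prod_zero_iff)
    also have "F = {} \<longleftrightarrow> coprime (f i) (g j)"
    proof
      assume e: "F = {}"
      show "coprime (f i) (g j)"
      proof (rule ccontr)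
        assume "\<not> coprime (f i) (g j)"
        then have "gcd (f i) (g j) \<noteq> 1" using coprime_iff_gcd_eq_1 by blast
        then obtain p where "prime p" "p dvd gcd (f i) (g j)" using prime_factor_nat by blast
        then have "p \<in> F" using f[OF ij(1)] g[OF ij(2)] by (auto simp: F_def in_prime_factors_iff)
        then show False using e by simp
      qed
    next
      assume "coprime (f i) (g j)"
      then show "F = {}" by (auto simp: F_def in_prime_factors_iff dest: coprime_common_divisor)
    qed
    finally show "of_bool (coprime (f i) (g j)) = (\<Sum>S\<in>Pow P. \<phi> S i * \<psi> S j)" by simp
  qed (use KL in auto)
qed

text \<open>The binary expansions of \<open>a < b\<close> agree above a unique position \<open>k\<close> at which \<open>a\<close> has digit 0
  and \<open>b\<close> has digit 1.\<close>

lemma less_digit_sum: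
  fixes a b :: nat
  assumes "a < 2 ^ K" "b < 2 ^ K"
  shows "(\<Sum>k<K. of_bool (a div 2 ^ Suc k = b div 2 ^ Suc k \<and> even (a div 2 ^ k) \<and> odd (b div 2 ^ k)))
    = (of_bool (a < b) :: nat)"
  using assms
proof (induction K arbitrary: a b)
  case (Suc K)
  have sh: "x div 2 ^ Suc k = (x div 2) div 2 ^ k" for x k :: nat by (simp add: div_mult2_eq)
  have "(\<Sum>k<Suc K. of_bool (a div 2 ^ Suc k = b div 2 ^ Suc k \<and> even (a div 2 ^ k) \<and> odd (b div 2 ^ k)) :: nat)
    = of_bool (a div 2 = b div 2 \<and> even a \<and> odd b) +
      (\<Sum>k<K. of_bool ((a div 2) div 2 ^ Suc k = (b div 2) div 2 ^ Suc k \<and> even ((a div 2) div 2 ^ k) \<and> odd ((b div 2) div 2 ^ k)))"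
    by (simp only: sum.lessThan_Suc_shift sh) simp
  also have "\<dots> = of_bool (a div 2 = b div 2 \<and> even a \<and> odd b) + of_bool (a div 2 < b div 2)"
    using Suc.prems by (subst Suc.IH[of "a div 2" "b div 2"]) (auto simp: less_mult_imp_div_less mult.commute)
  also have "\<dots> = of_bool (a < b)"
  proof -
    obtain x r y s where "a = 2 * x + r" "b = 2 * y + s" "r < 2" "s < 2"
      by (metis mult_div_mod_eq mod_less_divisor pos2)
    then show ?thesis by (cases "r = 0"; cases "s = 0") auto
  qed
  finally show ?case by simp
qed simp

text \<open>The comparison splits into \<open>K\<close> pieces by the deciding digit. At position
  \<open>k\<close> the two sides must share the index \<open>l\<close> of their higher digits, so a
  piece is a sum over \<open>l\<close> of products of indicators. A row or column meets at most one
  \<open>l\<close> for each \<open>k\<close>; the cost is thus the number of binary digits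
  only.\<close>

lemma bilin_less_mult:
  fixes f :: "'i \<Rightarrow> nat" and g :: "'j \<Rightarrow> nat"
  assumes b: "bilin A I J c" "c \<ge> 0"
    and f: "\<And>i. i \<in> I \<Longrightarrow> f i < 2 ^ K"
  shows "bilin (\<lambda>i j. of_bool (g j < f i) * A i j) I J (c * real K)"
proof -
  \<comment> \<open>\<open>g\<close> is unbounded; capping it at the largest number with
    \<open>K\<close> digits does not alter its comparison with \<open>f i < 2 ^ K\<close>.\<close>
  define g' where "g' j = min (g j) (2 ^ K - 1)" for j
  have g': "g' j < 2 ^ K" for j
  proof -
    have "g' j \<le> 2 ^ K - 1" "(2::nat) ^ K > 0" by (simp_all add: g'_def)
    then show ?thesis by linarith
  qed
  define \<phi> where "\<phi> h i = (of_bool (f i div 2 ^ Suc (fst h) = snd h \<and> odd (f i div 2 ^ fst h)) :: complex)" for h :: "nat \<times> nat" and i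
  define \<psi> where "\<psi> h j = (of_bool (g' j div 2 ^ Suc (fst h) = snd h \<and> even (g' j div 2 ^ fst h)) :: complex)" for h :: "nat \<times> nat" and j
  let ?H = "{..<K} \<times> {..<2 ^ K}"
  have one: "(\<Sum>h\<in>?H. cmod (of_bool (x div 2 ^ Suc (fst h) = snd h \<and> P (fst h)) :: complex) ^ 2) \<le> real K"
    for x :: nat and P
  proof -
    have "(\<Sum>h\<in>?H. cmod (of_bool (x div 2 ^ Suc (fst h) = snd h \<and> P (fst h)) :: complex) ^ 2)
      \<le> (\<Sum>k<K. \<Sum>l<2 ^ K. if l = x div 2 ^ Suc k then 1 else 0)"
      unfolding sum.cartesian_product' by (intro sum_mono) auto
    also have "\<dots> \<le> (\<Sum>k<K. 1)" by (intro sum_mono) simp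
    finally show ?thesis by simp
  qed
  have "bilin (\<lambda>i j. of_bool (g j < f i) * A i j) I J (c * (sqrt (real K) * sqrt (real K)))"
  proof (rule bilin_schur[OF b, where H = ?H and \<phi> = \<phi> and \<psi> = \<psi>])
    fix i j assume i: "i \<in> I"
    have "(\<Sum>h\<in>?H. \<phi> h i * \<psi> h j) = (\<Sum>k<K. \<Sum>l<2 ^ K. if l = g' j div 2 ^ Suc k then
        of_bool (g' j div 2 ^ Suc k = f i div 2 ^ Suc k \<and> even (g' j div 2 ^ k) \<and> odd (f i div 2 ^ k)) else 0)"
      unfolding sum.cartesian_product' by (intro sum.cong refl) (auto simp: \<phi>_def \<psi>_def)
    also have "\<dots> = (\<Sum>k<K. of_bool (g' j div 2 ^ Suc k = f i div 2 ^ Suc k \<and> even (g' j div 2 ^ k) \<and> odd (f i div 2 ^ k)))"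
    proof (intro sum.cong refl)
      fix k
      have "g' j div 2 ^ Suc k \<le> g' j" by simp
      then have "g' j div 2 ^ Suc k < 2 ^ K" using g'[of j] by linarith
      then show "(\<Sum>l<2 ^ K. if l = g' j div 2 ^ Suc k then
        of_bool (g' j div 2 ^ Suc k = f i div 2 ^ Suc k \<and> even (g' j div 2 ^ k) \<and> odd (f i div 2 ^ k)) else 0) =
        (of_bool (g' j div 2 ^ Suc k = f i div 2 ^ Suc k \<and> even (g' j div 2 ^ k) \<and> odd (f i div 2 ^ k)) :: complex)"
        by (subst sum.delta) auto
    qed
    also have "\<dots> = of_nat (\<Sum>k<K. of_bool (g' j div 2 ^ Suc k = f i div 2 ^ Suc k \<and> even (g' j div 2 ^ k) \<and> odd (f i div 2 ^ k)))"
      by simp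
    also have "\<dots> = of_nat (of_bool (g' j < f i))" by (subst less_digit_sum[OF g' f[OF i]]) simp
    also have "g' j < f i \<longleftrightarrow> g j < f i" using f[OF i] by (auto simp: g'_def)
    finally show "of_bool (g j < f i) = (\<Sum>h\<in>?H. \<phi> h i * \<psi> h j)" by simp
  next
    show "(\<Sum>h\<in>?H. cmod (\<phi> h i) ^ 2) \<le> real K" for i unfolding \<phi>_def by (rule one)
    show "(\<Sum>h\<in>?H. cmod (\<psi> h j) ^ 2) \<le> real K" for j unfolding \<psi>_def by (rule one)
  qed auto
  then show ?thesis by simp
qed

text \<open>Indicators of the classes of \<open>f\<close> separate the variables, the values of
  \<open>w\<close> going to the columns.\<close>

lemma bilin_class_mult:
  assumes b: "bilin A I J c" "c \<ge> 0" and H: "finite H" "\<And>i. i \<in> I \<Longrightarrow> f i \<in> H"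
    and w: "\<And>x y. cmod (w x y) \<le> 1"
  shows "bilin (\<lambda>i j. w (f i) (g j) * A i j) I J (c * sqrt (real (card H)))"
proof -
  have "bilin (\<lambda>i j. w (f i) (g j) * A i j) I J (c * (sqrt 1 * sqrt (real (card H))))"
  proof (rule bilin_schur[OF b, where H = H and \<phi> = "\<lambda>h i. of_bool (f i = h)" and \<psi> = "\<lambda>h j. w h (g j)"])
    fix i j assume i: "i \<in> I"
    have "(\<Sum>h\<in>H. of_bool (f i = h) * w h (g j)) = (\<Sum>h\<in>H. if h = f i then w h (g j) else 0)"
      by (intro sum.cong refl) auto
    then show "w (f i) (g j) = (\<Sum>h\<in>H. of_bool (f i = h) * w h (g j))" using H i by simp
  next
    fix i assume i: "i \<in> I"
    have "(\<Sum>h\<in>H. cmod (of_bool (f i = h) :: complex) ^ 2) = (\<Sum>h\<in>H. if h = f i then 1 else 0)"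
      by (intro sum.cong refl) auto
    then show "(\<Sum>h\<in>H. cmod (of_bool (f i = h) :: complex) ^ 2) \<le> 1" using H i by simp
  next
    fix j
    have "(\<Sum>h\<in>H. cmod (w h (g j)) ^ 2) \<le> (\<Sum>h\<in>H. 1)"
      using w by (intro sum_mono) (simp add: power_le_one)
    then show "(\<Sum>h\<in>H. cmod (w h (g j)) ^ 2) \<le> real (card H)" by simp
  qed auto
  then show ?thesis by simp
qed

section \<open>Twisted bilinear Jacobi sums\<close>

text \<open>The powers of 2 up to \<open>2 ^ k\<close> all divide \<open>2 ^ k\<close>, so the
  divisor bound already contains a bound for the number of binary digits.\<close>

lemma binary_length:
  assumes C1: "\<And>n. n \<ge> 1 \<Longrightarrow> real (card {d. d dvd n}) \<le> C1 * real n powr \<epsilon>" "C1 \<ge> 1" and \<epsilon>: "\<epsilon> > 0"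
    and D: "D \<ge> 1"
  obtains K where "D < 2 ^ K" "real K \<le> C1 * real D powr \<epsilon>"
proof -
  define K where "K = (LEAST K. D < 2 ^ K)"
  have "D < 2 ^ D" by (rule less_exp)
  then have K: "D < 2 ^ K" unfolding K_def by (rule LeastI)
  have "K \<noteq> 0" using K D by (intro notI) simp
  then obtain k where k: "K = Suc k" using not0_implies_Suc by blast
  have "\<not> D < 2 ^ k" unfolding K_def[symmetric] using k K_def not_less_Least by (metis lessI)
  then have kD: "2 ^ k \<le> D" by simp
  have "inj_on (\<lambda>i. 2 ^ i :: nat) {..k}" by (auto intro!: inj_onI)
  then have "card {..k} \<le> card {d. d dvd (2::nat) ^ k}"
    by (intro card_inj_on_le[of "\<lambda>i. 2 ^ i"]) (auto simp: le_imp_power_dvd)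
  then have "real K \<le> real (card {d. d dvd (2::nat) ^ k})" by (simp add: k)
  also have "\<dots> \<le> C1 * real (2 ^ k) powr \<epsilon>" by (intro C1) simp
  also have "\<dots> \<le> C1 * real D powr \<epsilon>"
  proof -
    have "real (2 ^ k) \<le> real D" using kD by (simp only: of_nat_le_iff)
    then show ?thesis using C1(2) \<epsilon> by (intro mult_left_mono powr_mono2) auto
  qed
  finally show ?thesis using that K by blast
qed

text \<open>A row is \<open>(m1, n1)\<close> and a column \<open>(n2, m2)\<close>. The kernel is
  then the tensor product of two matrices of Jacobi symbols, one of them transposed. The multipliers
  insert the weight modulo 8, the two thresholds, and the coprimality of \<open>m1\<close> with
  \<open>m2\<close> and of \<open>n1\<close> with \<open>n2\<close>, which nonvanishing symbols do
  not enforce.\<close>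

theorem jacobi_bilinear_sum:
  assumes \<epsilon>: "\<epsilon> > 0"
  shows "\<exists>C\<ge>1. \<forall>D1\<ge>1. \<forall>E1\<ge>1. \<forall>D2\<ge>1. \<forall>E2\<ge>1. \<forall>I \<subseteq> oddsf D1 \<times> oddsf E1. \<forall>J \<subseteq> oddsf E2 \<times> oddsf D2.
    \<forall>u v q1 q2 w. (\<forall>i. cmod (u i) \<le> 1) \<longrightarrow> (\<forall>j. cmod (v j) \<le> 1) \<longrightarrow> (\<forall>x y. cmod (w x y) \<le> 1) \<longrightarrow>
      cmod (\<Sum>i\<in>I. \<Sum>j\<in>J. u i * v j *
        (of_bool (coprime (fst i) (snd j)) * (of_bool (coprime (snd i) (fst j)) *
         (of_bool (q1 j < fst i) * (of_bool (q2 j < snd i) *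
          (w (fst i mod 8, snd i mod 8) (fst j mod 8, snd j mod 8) *
           (of_int (jac (int (fst j)) (fst i)) * of_int (jac (int (snd i)) (snd j)))))))))
      \<le> C * (real D1 * real E1 * (real D2 * real E2)) powr (1 + \<epsilon>) *
        (min (real D1) (real E2) powr (- 1 / 4) * min (real D2) (real E1) powr (- 1 / 4))"
proof -
  \<comment> \<open>One \<open>\<delta>\<close> comes from the two sieve factors together and four
    from \<open>T ^ 4\<close>: two digit counts and two coprimality conditions.\<close>
  define \<delta> where "\<delta> = \<epsilon> / 5"
  have \<delta>: "\<delta> > 0" using \<epsilon> by (simp add: \<delta>_def)
  obtain C0 where C0: "C0 \<ge> 1" "\<And>Q N. 1 \<le> Q \<Longrightarrow> 1 \<le> N \<Longrightarrow> bilin (\<lambda>m n. of_int (jac (int n) m)) (oddsf Q) (oddsf N)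
    (C0 * (real Q * real N) powr (1 / 2 + \<delta>) * min (real Q) (real N) powr (- 1 / 4))"
    using bilin_jac[OF \<delta>] by auto
  obtain C1 where C1: "C1 \<ge> 1" "\<And>n. n \<ge> 1 \<Longrightarrow> real (card {d. d dvd n}) \<le> C1 * real n powr \<delta>"
    using divisor_bound[OF \<delta>] by auto
  have main: "cmod (\<Sum>i\<in>I. \<Sum>j\<in>J. u i * v j *
        (of_bool (coprime (fst i) (snd j)) * (of_bool (coprime (snd i) (fst j)) *
         (of_bool (q1 j < fst i) * (of_bool (q2 j < snd i) *
          (w (fst i mod 8, snd i mod 8) (fst j mod 8, snd j mod 8) *
           (of_int (jac (int (fst j)) (fst i)) * of_int (jac (int (snd i)) (snd j)))))))))
      \<le> 8 * C0 ^ 2 * C1 ^ 4 * (real D1 * real E1 * (real D2 * real E2)) powr (1 + \<epsilon>) *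
        (min (real D1) (real E2) powr (- 1 / 4) * min (real D2) (real E1) powr (- 1 / 4))"
    if D: "1 \<le> D1" "1 \<le> E1" "1 \<le> D2" "1 \<le> E2" and I: "I \<subseteq> oddsf D1 \<times> oddsf E1" and J: "J \<subseteq> oddsf E2 \<times> oddsf D2"
      and u: "\<forall>i. cmod (u i) \<le> 1" and v: "\<forall>j. cmod (v j) \<le> 1" and w: "\<forall>x y. cmod (w x y) \<le> 1"
    for D1 E1 D2 E2 I J u v q1 q2 w
  proof -
    define P where "P = real D1 * real E1 * (real D2 * real E2)"
    have r1: "real D1 \<ge> 1" "real E1 \<ge> 1" "real D2 \<ge> 1" "real E2 \<ge> 1" using D by auto
    have P: "P \<ge> 1" "real D1 \<le> P" "real E1 \<le> P" "real D2 \<le> P" "real E2 \<le> P"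
    proof -
      have ge: "1 \<le> x * y" "x \<le> x * y" "y \<le> x * y" if "1 \<le> x" "1 \<le> y" for x y :: real
        using that mult_mono[of 1 x 1 y] mult_left_mono[of 1 y x] mult_right_mono[of 1 x y] by auto
      have a: "1 \<le> real D1 * real E1" "1 \<le> real D2 * real E2" using r1 by (auto intro: ge)
      show "P \<ge> 1" unfolding P_def using a by (rule ge)
      have "real D1 * real E1 \<le> P" "real D2 * real E2 \<le> P" unfolding P_def using a by (auto intro: ge)
      then show "real D1 \<le> P" "real E1 \<le> P" "real D2 \<le> P" "real E2 \<le> P"
        using ge[OF r1(1,2)] ge[OF r1(3,4)] by linarith+
    qed
    define T where "T = C1 * P powr \<delta>"
    have "P powr \<delta> \<ge> 1" using P(1) \<delta> by (intro ge_one_powr_ge_zero) auto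
    then have T0: "T \<ge> 0" using C1(1) by (simp add: T_def)
    have mono: "C1 * real n powr \<delta> \<le> T" if "real n \<le> P" for n
      using that C1(1) \<delta> unfolding T_def by (intro mult_left_mono powr_mono2) auto
    have dv: "n \<ge> 1 \<and> real (card {d. d dvd n}) \<le> T" if "n \<in> oddsf D" "real D \<le> P" for n D
    proof -
      have "n \<ge> 1" "real n \<le> P" using that by (auto simp: oddsf_def)
      then show ?thesis using C1(2)[of n] mono[of n] by linarith
    qed
    obtain K1 where K1: "D1 < 2 ^ K1" "real K1 \<le> C1 * real D1 powr \<delta>"
      using binary_length[OF C1(2,1) \<delta> D(1)] by blast
    obtain K2 where K2: "E1 < 2 ^ K2" "real K2 \<le> C1 * real E1 powr \<delta>"
      using binary_length[OF C1(2,1) \<delta> D(2)] by blast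
    have KT: "real K1 \<le> T" "real K2 \<le> T" using K1 K2 mono[of D1] mono[of E1] P by linarith+
    define c1 where "c1 = C0 * (real D1 * real E2) powr (1 / 2 + \<delta>) * min (real D1) (real E2) powr (- 1 / 4)"
    define c2 where "c2 = C0 * (real D2 * real E1) powr (1 / 2 + \<delta>) * min (real D2) (real E1) powr (- 1 / 4)"
    have c0: "c1 \<ge> 0" "c2 \<ge> 0" using C0(1) by (simp_all add: c1_def c2_def)
    have fin: "finite I" "finite J" using I J by (meson finite_SigmaI finite_oddsf finite_subset)+
    have "bilin (\<lambda>i j. of_int (jac (int (fst j)) (fst i)) * of_int (jac (int (snd i)) (snd j)))
      (oddsf D1 \<times> oddsf E1) (oddsf E2 \<times> oddsf D2) (c1 * c2)"
      using bilin_tensor[OF C0(2)[OF D(1,4)] _ bilin_transpose[OF C0(2)[OF D(3,2)]]] c0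
      by (simp add: c1_def c2_def)
    from bilin_subset[OF this _ _ I J]
    have "bilin (\<lambda>i j. of_int (jac (int (fst j)) (fst i)) * of_int (jac (int (snd i)) (snd j))) I J (c1 * c2)"
      by simp
    \<comment> \<open>There are 64 pairs of residues, hence the factor 8 in what follows.\<close>
    then have "bilin (\<lambda>i j. w (fst i mod 8, snd i mod 8) (fst j mod 8, snd j mod 8) *
      (of_int (jac (int (fst j)) (fst i)) * of_int (jac (int (snd i)) (snd j)))) I J
      (c1 * c2 * sqrt (real (card ({..<8::nat} \<times> {..<8::nat}))))"
      using c0 w by (intro bilin_class_mult[where f = "\<lambda>i. (fst i mod 8, snd i mod 8)" and g = "\<lambda>j. (fst j mod 8, snd j mod 8)"]) auto
    then have "bilin (\<lambda>i j. w (fst i mod 8, snd i mod 8) (fst j mod 8, snd j mod 8) *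
      (of_int (jac (int (fst j)) (fst i)) * of_int (jac (int (snd i)) (snd j)))) I J (c1 * c2 * 8)"
      by (elim bilin_mono) (simp add: card_cartesian_product real_sqrt_unique[of 8])
    then have "bilin (\<lambda>i j. of_bool (q2 j < snd i) * (w (fst i mod 8, snd i mod 8) (fst j mod 8, snd j mod 8) *
      (of_int (jac (int (fst j)) (fst i)) * of_int (jac (int (snd i)) (snd j))))) I J (c1 * c2 * 8 * real K2)"
      using c0 I K2(1) by (elim bilin_less_mult[where f = "\<lambda>i. snd i" and g = q2]) (auto simp: oddsf_def)
    then have "bilin (\<lambda>i j. of_bool (q1 j < fst i) * (of_bool (q2 j < snd i) * (w (fst i mod 8, snd i mod 8) (fst j mod 8, snd j mod 8) *
      (of_int (jac (int (fst j)) (fst i)) * of_int (jac (int (snd i)) (snd j)))))) I J (c1 * c2 * 8 * real K2 * real K1)"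
      using c0 I K1(1) by (elim bilin_less_mult[where f = "\<lambda>i. fst i" and g = q1]) (auto simp: oddsf_def)
    then have "bilin (\<lambda>i j. of_bool (coprime (snd i) (fst j)) * (of_bool (q1 j < fst i) * (of_bool (q2 j < snd i) *
      (w (fst i mod 8, snd i mod 8) (fst j mod 8, snd j mod 8) *
      (of_int (jac (int (fst j)) (fst i)) * of_int (jac (int (snd i)) (snd j))))))) I J
      (c1 * c2 * 8 * real K2 * real K1 * (sqrt T * sqrt T))"
    proof (rule bilin_coprime_mult[where f = "\<lambda>i. snd i" and g = "\<lambda>j. fst j"])
      show "snd i \<ge> 1 \<and> real (card {d. d dvd snd i}) \<le> T" if "i \<in> I" for i
        using that I P(3) by (intro dv[of _ E1]) auto
      show "fst j \<ge> 1 \<and> real (card {d. d dvd fst j}) \<le> T" if "j \<in> J" for j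
        using that J P(5) by (intro dv[of _ E2]) auto
    qed (use c0 fin T0 in auto)
    then have "bilin (\<lambda>i j. of_bool (coprime (fst i) (snd j)) * (of_bool (coprime (snd i) (fst j)) *
      (of_bool (q1 j < fst i) * (of_bool (q2 j < snd i) *
      (w (fst i mod 8, snd i mod 8) (fst j mod 8, snd j mod 8) *
      (of_int (jac (int (fst j)) (fst i)) * of_int (jac (int (snd i)) (snd j)))))))) I J
      (c1 * c2 * 8 * real K2 * real K1 * (sqrt T * sqrt T) * (sqrt T * sqrt T))"
    proof (rule bilin_coprime_mult[where f = "\<lambda>i. fst i" and g = "\<lambda>j. snd j"])
      show "fst i \<ge> 1 \<and> real (card {d. d dvd fst i}) \<le> T" if "i \<in> I" for i
        using that I P(2) by (intro dv[of _ D1]) auto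
      show "snd j \<ge> 1 \<and> real (card {d. d dvd snd j}) \<le> T" if "j \<in> J" for j
        using that J P(4) by (intro dv[of _ D2]) auto
    qed (use c0 fin T0 in auto)
    note b = bilinD[OF this, of u v]
    have su: "sqrt (\<Sum>i\<in>I. cmod (u i) ^ 2) \<le> sqrt (real D1 * real E1)"
    proof (rule real_sqrt_le_mono)
      have "(\<Sum>i\<in>I. cmod (u i) ^ 2) \<le> (\<Sum>i\<in>I. 1)" by (intro sum_mono power_le_one) (simp_all add: u[THEN spec])
      also have "\<dots> = real (card I)" by simp
      also have "card I \<le> card ({1..D1} \<times> {1..E1})" using I by (intro card_mono) (auto simp: oddsf_def)
      finally show "(\<Sum>i\<in>I. cmod (u i) ^ 2) \<le> real D1 * real E1" by (simp add: card_cartesian_product)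
    qed
    have sv: "sqrt (\<Sum>j\<in>J. cmod (v j) ^ 2) \<le> sqrt (real D2 * real E2)"
    proof (rule real_sqrt_le_mono)
      have "(\<Sum>j\<in>J. cmod (v j) ^ 2) \<le> (\<Sum>j\<in>J. 1)" by (intro sum_mono power_le_one) (simp_all add: v[THEN spec])
      also have "\<dots> = real (card J)" by simp
      also have "card J \<le> card ({1..E2} \<times> {1..D2})" using J by (intro card_mono) (auto simp: oddsf_def)
      finally show "(\<Sum>j\<in>J. cmod (v j) ^ 2) \<le> real D2 * real E2" by (simp add: card_cartesian_product mult.commute)
    qed
    have k0: "c1 * c2 * 8 * real K2 * real K1 * (sqrt T * sqrt T) * (sqrt T * sqrt T) \<le> c1 * c2 * 8 * T ^ 4"
    proof -
      have "real K2 * real K1 \<le> T * T" using KT by (intro mult_mono) auto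
      then have "(c1 * c2 * 8 * (T * T)) * (real K2 * real K1) \<le> (c1 * c2 * 8 * (T * T)) * (T * T)"
        using c0 T0 by (intro mult_left_mono) auto
      then show ?thesis using T0 by (simp add: mult_ac power4_eq_xxxx)
    qed
    note b
    also have "c1 * c2 * 8 * real K2 * real K1 * (sqrt T * sqrt T) * (sqrt T * sqrt T) *
        sqrt (\<Sum>i\<in>I. cmod (u i) ^ 2) * sqrt (\<Sum>j\<in>J. cmod (v j) ^ 2)
      \<le> c1 * c2 * 8 * T ^ 4 * sqrt (real D1 * real E1) * sqrt (real D2 * real E2)"
      by (rule mult_mono[OF mult_mono[OF k0 su] sv]) (use c0 T0 in \<open>auto intro: sum_nonneg\<close>)
    also have "\<dots> = 8 * C0 ^ 2 * C1 ^ 4 * (sqrt P * (P powr (1 / 2 + \<delta>)) * (P powr \<delta>) ^ 4) *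
      (min (real D1) (real E2) powr (- 1 / 4) * min (real D2) (real E1) powr (- 1 / 4))"
    proof -
      have "(real D1 * real E2) powr (1 / 2 + \<delta>) * (real D2 * real E1) powr (1 / 2 + \<delta>) = P powr (1 / 2 + \<delta>)"
        unfolding P_def powr_mult[symmetric] by (simp add: mult_ac)
      moreover have "sqrt (real D1 * real E1) * sqrt (real D2 * real E2) = sqrt P"
        by (simp add: P_def real_sqrt_mult)
      ultimately show ?thesis
        unfolding c1_def c2_def T_def power_mult_distrib
        by (simp add: power2_eq_square)
    qed
    also have "sqrt P * (P powr (1 / 2 + \<delta>)) * (P powr \<delta>) ^ 4 = P powr (1 + \<epsilon>)"
    proof -
      have "(P powr \<delta>) ^ 4 = P powr (of_nat 4 * \<delta>)" using P by (intro powr_power) auto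
      moreover have "sqrt P = P powr (1 / 2)" using P by (simp add: powr_half_sqrt)
      moreover have "1 / 2 + (1 / 2 + \<delta>) + of_nat 4 * \<delta> = 1 + \<epsilon>" by (simp add: \<delta>_def)
      ultimately show ?thesis by (simp only: powr_add[symmetric])
    qed
    finally show ?thesis by (simp only: P_def)
  qed
  have "8 * C0 ^ 2 * C1 ^ 4 \<ge> 1"
    using C0(1) C1(1) one_le_power[of C0 2] one_le_power[of C1 4] mult_mono[of 1 "C0 ^ 2" 1 "C1 ^ 4"] by simp
  then show ?thesis using main by (intro exI[of _ "8 * C0 ^ 2 * C1 ^ 4"]) blast
qed

section \<open>Odd square classes\<close>

text \<open>The square class of \<open>n\<close> away from 2, kept as a set of primes: products
  become symmetric differences, and the combinatorics of \<open>S\<close>, \<open>T\<close>,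
  \<open>R\<close> becomes set algebra.\<close>

definition oddpr :: "nat \<Rightarrow> nat set" where
  "oddpr n = {p. prime p \<and> odd p \<and> odd (multiplicity p n)}"

lemma oddpr_subset: "n > 0 \<Longrightarrow> oddpr n \<subseteq> prime_factors n"
  proof
  fix p assume n: "n > 0" and p: "p \<in> oddpr n"
  then have "multiplicity p n \<noteq> 0" by (intro notI) (simp add: oddpr_def)
  then have "p dvd n" using not_dvd_imp_multiplicity_0[of p n] by linarith
  then show "p \<in> prime_factors n" using p n by (simp add: oddpr_def in_prime_factors_iff)
qed

lemma finite_oddpr [simp]: "n > 0 \<Longrightarrow> finite (oddpr n)"
  by (rule finite_subset[OF oddpr_subset]) simp_all

lemma oddpr_mult: "a > 0 \<Longrightarrow> b > 0 \<Longrightarrow>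
    p \<in> oddpr (a * b) \<longleftrightarrow> (p \<in> oddpr a \<and> p \<notin> oddpr b) \<or> (p \<notin> oddpr a \<and> p \<in> oddpr b)"
  proof -
  assume ab: "a > 0" "b > 0"
  have "multiplicity p (a * b) = multiplicity p a + multiplicity p b" if "prime p"
    using ab that by (intro prime_elem_multiplicity_mult_distrib) auto
  then show ?thesis unfolding oddpr_def by (cases "prime p") auto
qed

definition oddprimes :: "nat set \<Rightarrow> bool" where
  "oddprimes A \<longleftrightarrow> finite A \<and> (\<forall>p\<in>A. prime p \<and> odd p)"

lemma oddprimes_oddpr: "n > 0 \<Longrightarrow> oddprimes (oddpr n)"
  unfolding oddprimes_def by (intro conjI finite_oddpr) (simp_all add: oddpr_def)

lemma oddprimes_mono: "oddprimes B \<Longrightarrow> A \<subseteq> B \<Longrightarrow> oddprimes A"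
  unfolding oddprimes_def using finite_subset[of A B] by blast

lemma oddprimes_Un: "oddprimes A \<Longrightarrow> oddprimes B \<Longrightarrow> oddprimes (A \<union> B)"
  by (auto simp: oddprimes_def)

lemma prod_oddprimes_pos: "oddprimes A \<Longrightarrow> \<Prod>A > 0"
  unfolding oddprimes_def by (intro prod_pos) (simp add: prime_gt_0_nat)

lemma prime_factors_prod_primes:
  assumes "finite Q" "\<And>p. p \<in> Q \<Longrightarrow> prime (p :: nat)"
  shows "prime_factors (\<Prod>Q) = Q" "squarefree (\<Prod>Q)" "\<Prod>Q > 0"
proof -
  show pos: "\<Prod>Q > 0" using assms by (auto intro!: prod_pos prime_gt_0_nat)
  have "q dvd \<Prod>Q \<longleftrightarrow> q \<in> Q" if q: "prime q" for q
  proof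
    assume "q dvd \<Prod>Q"
    then obtain r where r: "r \<in> Q" "q dvd r" using prime_dvd_prod_iff[OF assms(1) q, of "\<lambda>x. x"] by auto
    then show "q \<in> Q" using primes_dvd_imp_eq[OF q assms(2)[OF r(1)]] by blast
  next
    assume "q \<in> Q"
    then show "q dvd \<Prod>Q" using dvd_prodI[OF assms(1), of q "\<lambda>x. x"] by simp
  qed
  then show "prime_factors (\<Prod>Q) = Q" unfolding set_eq_iff in_prime_factors_iff using assms(2) pos by blast
  show "squarefree (\<Prod>Q)"
    using assms by (intro squarefree_prod_coprime) (auto intro: primes_coprime squarefree_prime)
qed

lemma prime_factors_prod_oddprimes: "oddprimes A \<Longrightarrow> prime_factors (\<Prod>A) = A"
  by (rule prime_factors_prod_primes) (simp_all add: oddprimes_def)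

lemma prod_oddprimes_oddsf:
  assumes A: "oddprimes A"
  shows "odd (\<Prod>A)" "squarefree (\<Prod>A)"
proof -
  have fin: "finite A" using A by (simp add: oddprimes_def)
  show "odd (\<Prod>A)" using A fin by (auto simp: oddprimes_def even_prod_iff)
  show "squarefree (\<Prod>A)" by (rule prime_factors_prod_primes(2)) (use A in \<open>simp_all add: oddprimes_def\<close>)
qed

lemma squarefree_multiplicity:
  assumes "squarefree (m :: nat)" "prime p"
  shows "multiplicity p m = (if p \<in> prime_factors m then 1 else 0)"
proof -
  have "m \<noteq> 0" using assms(1) by (metis not_squarefree_0)
  then show ?thesis
    using assms squarefree_factorial_semiring'[of m] by (auto simp: in_prime_factors_iff not_dvd_imp_multiplicity_0)
qed

lemma oddpr_squarefree:
  assumes "squarefree m" "odd m"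
  shows "oddpr m = prime_factors m"
proof -
  have "m \<noteq> 0" using assms(1) by (metis not_squarefree_0)
  show ?thesis
  proof safe
    fix p assume "p \<in> oddpr m"
    then show "p \<in> prime_factors m" using oddpr_subset[of m] \<open>m \<noteq> 0\<close> by auto
  next
    fix p assume p: "p \<in> prime_factors m"
    then have "prime p" "odd p" "p dvd m" using odd_prime_factors[OF assms(2)] by auto
    then show "p \<in> oddpr m" using p squarefree_multiplicity[OF assms(1)] by (simp add: oddpr_def)
  qed
qed

lemma prod_prime_factors_squarefree:
  assumes "squarefree (m :: nat)"
  shows "\<Prod>(prime_factors m) = m"
proof -
  have "m \<noteq> 0" using assms by (metis not_squarefree_0)
  have "\<Prod>(prime_factors m) = (\<Prod>p\<in>prime_factors m. p ^ multiplicity p m)"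
  proof (intro prod.cong refl)
    fix p assume "p \<in> prime_factors m"
    then have "multiplicity p m = 1" using assms squarefree_factorial_semiring'[OF \<open>m \<noteq> 0\<close>] by blast
    then show "p = p ^ multiplicity p m" by simp
  qed
  also have "\<dots> = m" using \<open>m \<noteq> 0\<close> by (intro prime_factorization_nat[symmetric]) simp
  finally show ?thesis .
qed

lemma prod_dvd_of_subset_prime_factors:
  assumes "n > 0" "A \<subseteq> prime_factors n"
  shows "\<Prod>A dvd (n :: nat)"
proof -
  have "\<Prod>A dvd \<Prod>(prime_factors n)" by (intro prod_dvd_prod_subset assms) simp
  also have "\<dots> dvd (\<Prod>p\<in>prime_factors n. p ^ multiplicity p n)"
    by (intro prod_dvd_prod) (auto simp: in_prime_factors_iff prime_multiplicity_gt_zero_iff intro!: dvd_power)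
  also have "\<dots> = n" using assms(1) by (intro prime_factorization_nat[symmetric])
  finally show ?thesis .
qed

lemma oddpr_quotient:
  assumes "n > 0" "A \<subseteq> oddpr n"
  shows "n = (n div \<Prod>A) * \<Prod>A" "oddpr (n div \<Prod>A) = oddpr n - A" "n div \<Prod>A > 0"
proof -
  have A: "oddprimes A" using assms oddprimes_oddpr oddprimes_mono by blast
  have "\<Prod>A dvd n" using assms oddpr_subset by (intro prod_dvd_of_subset_prime_factors) auto
  then show e: "n = (n div \<Prod>A) * \<Prod>A" by simp
  then show pos: "n div \<Prod>A > 0" using assms(1) by (metis bot_nat_0.not_eq_extremum mult_0)
  have "oddpr (\<Prod>A) = A"
    using oddpr_squarefree prod_oddprimes_oddsf[OF A] prime_factors_prod_oddprimes[OF A] by simp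
  then have "p \<in> oddpr n \<longleftrightarrow> (p \<in> oddpr (n div \<Prod>A) \<and> p \<notin> A) \<or> (p \<notin> oddpr (n div \<Prod>A) \<and> p \<in> A)" for p
    using oddpr_mult[OF pos prod_oddprimes_pos[OF A], of p] e by simp
  then show "oddpr (n div \<Prod>A) = oddpr n - A" using assms(2) by blast
qed

text \<open>An odd prime lies outside this set exactly when \<open>S * R\<close> and
  \<open>T * R\<close> both have even exponent there, that is, when the modified symbol vanishes by
  definition.\<close>

definition npr :: "nat \<Rightarrow> nat \<Rightarrow> nat \<Rightarrow> nat set" where
  "npr S T R = (oddpr S \<union> oddpr T \<union> oddpr R) - (oddpr S \<inter> oddpr T \<inter> oddpr R)"

definition spr :: "nat \<Rightarrow> nat \<Rightarrow> nat \<Rightarrow> nat set" where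
  "spr S T R = oddpr S - oddpr T - oddpr R"

definition dpr :: "nat \<Rightarrow> nat \<Rightarrow> nat \<Rightarrow> nat set" where
  "dpr S T R = (oddpr S \<inter> oddpr T) - oddpr R"

section \<open>Dyadic boxes and their fibers over frozen data\<close>

type_synonym box = "(nat \<times> nat) \<times> (nat \<times> nat) \<times> (nat \<times> nat) \<times> nat \<times> nat \<times> nat"

text \<open>
  The odd primes at which exactly one of \<open>S\<close>, \<open>T\<close>, \<open>R\<close> has odd exponent are split according to
  membership in \<open>D\<close>; those at which exactly two exponents are odd are not split.
\<close>

definition boxof :: "nat \<Rightarrow> nat \<Rightarrow> nat \<Rightarrow> nat set \<Rightarrow> box" where
  "boxof S T R D =
    ((floor_log (\<Prod>(spr S T R \<inter> D)), floor_log (\<Prod>(spr S T R - D))),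
     (floor_log (\<Prod>(spr T S R \<inter> D)), floor_log (\<Prod>(spr T S R - D))),
     (floor_log (\<Prod>(spr R S T \<inter> D)), floor_log (\<Prod>(spr R S T - D))),
     floor_log (\<Prod>(dpr S T R)), floor_log (\<Prod>(dpr S R T)), floor_log (\<Prod>(dpr T R S)))"

definition Om :: "nat \<Rightarrow> nat \<Rightarrow> nat \<Rightarrow> box \<Rightarrow> (nat \<times> nat \<times> nat \<times> nat set) set" where
  "Om Nx Ny Nz b = {(S, T, R, D). S \<in> {1..Nx} \<and> T \<in> {1..Ny} \<and> R \<in> {1..Nz} \<and>
     D \<subseteq> npr S T R \<and> boxof S T R D = b}"

text \<open>The cofactors \<open>K\<close> and \<open>L\<close> retain the primes whose odd exponent
  is shared with another variable, the square parts and the powers of 2. \<open>D\<close> retains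
  only its frozen primes.\<close>

definition others :: "nat \<times> nat \<times> nat \<times> nat set \<Rightarrow> nat \<times> nat \<times> nat \<times> nat set" where
  "others = (\<lambda>(S, T, R, D). (R, S div \<Prod>(spr S T R), T div \<Prod>(spr T S R), D - spr S T R - spr T S R))"

text \<open>In the second pair the part outside \<open>D\<close> comes first, so that equal
  positions meet in the surviving symbols (n2 / m1) and (n1 / m2).\<close>

definition active :: "nat \<times> nat \<times> nat \<times> nat set \<Rightarrow> (nat \<times> nat) \<times> nat \<times> nat" where
  "active = (\<lambda>(S, T, R, D). ((\<Prod>(spr S T R \<inter> D), \<Prod>(spr S T R - D)), (\<Prod>(spr T S R - D), \<Prod>(spr T S R \<inter> D))))"

definition assemble :: "nat \<times> nat \<times> nat \<times> nat set \<Rightarrow> (nat \<times> nat) \<times> nat \<times> nat \<Rightarrow> nat \<times> nat \<times> nat \<times> nat set" where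
  "assemble = (\<lambda>(R, K, L, D) ((m1, n1), (n2, m2)).
     (K * (m1 * n1), L * (m2 * n2), R, D \<union> prime_factors m1 \<union> prime_factors m2))"

text \<open>Boolean identities kept apart from arithmetic. \<open>PK\<close>, \<open>PL\<close>,
  \<open>PR\<close> stand for the odd square classes of \<open>K\<close>, \<open>L\<close>,
  \<open>R\<close>, and \<open>A1\<close>, \<open>B1\<close>, \<open>A2\<close>, \<open>B2\<close>
  for the primes of \<open>m1\<close>, \<open>n1\<close>, \<open>m2\<close>,
  \<open>n2\<close>.\<close>

lemma fiber_sets:
  assumes "PK \<subseteq> PL \<union> PR" "PL \<subseteq> PK \<union> PR"
    and "(A1 \<union> B1) \<inter> (PK \<union> PL \<union> PR) = {}" "(A2 \<union> B2) \<inter> (PK \<union> PL \<union> PR) = {}"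
    and "A1 \<inter> B1 = {}" "A2 \<inter> B2 = {}" "A1 \<inter> A2 = {}" "B1 \<inter> B2 = {}" "A1 \<inter> B2 = {}" "B1 \<inter> A2 = {}"
    and "D \<subseteq> PK \<union> PL \<union> PR"
  shows "(PK \<union> A1 \<union> B1) - (PL \<union> A2 \<union> B2) - PR = A1 \<union> B1"
    "(PL \<union> A2 \<union> B2) - (PK \<union> A1 \<union> B1) - PR = A2 \<union> B2"
    "PR - (PK \<union> A1 \<union> B1) - (PL \<union> A2 \<union> B2) = PR - PK - PL"
    "(PK \<union> A1 \<union> B1) \<inter> (PL \<union> A2 \<union> B2) - PR = PK \<inter> PL - PR"
    "(PK \<union> A1 \<union> B1) \<inter> PR - (PL \<union> A2 \<union> B2) = PK \<inter> PR - PL"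
    "(PL \<union> A2 \<union> B2) \<inter> PR - (PK \<union> A1 \<union> B1) = PL \<inter> PR - PK"
    "(PK \<union> A1 \<union> B1) \<union> (PL \<union> A2 \<union> B2) \<union> PR - (PK \<union> A1 \<union> B1) \<inter> (PL \<union> A2 \<union> B2) \<inter> PR
      = (PK \<union> PL \<union> PR - PK \<inter> PL \<inter> PR) \<union> A1 \<union> B1 \<union> A2 \<union> B2"
    "(A1 \<union> B1) \<inter> (D \<union> A1 \<union> A2) = A1" "A1 \<union> B1 - (D \<union> A1 \<union> A2) = B1"
    "(A2 \<union> B2) \<inter> (D \<union> A1 \<union> A2) = A2" "A2 \<union> B2 - (D \<union> A1 \<union> A2) = B2"
    "(PR - PK - PL) \<inter> (D \<union> A1 \<union> A2) = (PR - PK - PL) \<inter> D" "(PR - PK - PL) - (D \<union> A1 \<union> A2) = PR - PK - PL - D"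
    "(PK \<union> PL \<union> PR - PK \<inter> PL \<inter> PR) \<union> A1 \<union> B1 \<union> A2 \<union> B2 - (D \<union> A1 \<union> A2)
      = (PK \<union> PL \<union> PR - PK \<inter> PL \<inter> PR - D) \<union> B1 \<union> B2"
    "(D \<union> A1 \<union> A2) - (A1 \<union> B1) - (A2 \<union> B2) = D"
proof -
  show "(PK \<union> A1 \<union> B1) - (PL \<union> A2 \<union> B2) - PR = A1 \<union> B1" using assms(1,3,7-10) by fast
  show "(PL \<union> A2 \<union> B2) - (PK \<union> A1 \<union> B1) - PR = A2 \<union> B2" using assms(2,4,7-10) by fast
  show "PR - (PK \<union> A1 \<union> B1) - (PL \<union> A2 \<union> B2) = PR - PK - PL" using assms(3,4) by fast
  show "(PK \<union> A1 \<union> B1) \<inter> (PL \<union> A2 \<union> B2) - PR = PK \<inter> PL - PR" using assms(3,4,7-10) by fast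
  show "(PK \<union> A1 \<union> B1) \<inter> PR - (PL \<union> A2 \<union> B2) = PK \<inter> PR - PL" using assms(3,4) by fast
  show "(PL \<union> A2 \<union> B2) \<inter> PR - (PK \<union> A1 \<union> B1) = PL \<inter> PR - PK" using assms(3,4) by fast
  show "(PK \<union> A1 \<union> B1) \<union> (PL \<union> A2 \<union> B2) \<union> PR - (PK \<union> A1 \<union> B1) \<inter> (PL \<union> A2 \<union> B2) \<inter> PR
      = (PK \<union> PL \<union> PR - PK \<inter> PL \<inter> PR) \<union> A1 \<union> B1 \<union> A2 \<union> B2" using assms(3,4) by fast
  show "(A1 \<union> B1) \<inter> (D \<union> A1 \<union> A2) = A1" using assms(3,5,10,11) by fast
  show "A1 \<union> B1 - (D \<union> A1 \<union> A2) = B1" using assms(3,5,10,11) by fast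
  show "(A2 \<union> B2) \<inter> (D \<union> A1 \<union> A2) = A2" using assms(4,6,9,11) by fast
  show "A2 \<union> B2 - (D \<union> A1 \<union> A2) = B2" using assms(4,6,9,11) by fast
  show "(PR - PK - PL) \<inter> (D \<union> A1 \<union> A2) = (PR - PK - PL) \<inter> D" using assms(3,4) by fast
  show "(PR - PK - PL) - (D \<union> A1 \<union> A2) = PR - PK - PL - D" using assms(3,4) by fast
  show "(PK \<union> PL \<union> PR - PK \<inter> PL \<inter> PR) \<union> A1 \<union> B1 \<union> A2 \<union> B2 - (D \<union> A1 \<union> A2)
      = (PK \<union> PL \<union> PR - PK \<inter> PL \<inter> PR - D) \<union> B1 \<union> B2" using assms(3-11) by fast
  show "(D \<union> A1 \<union> A2) - (A1 \<union> B1) - (A2 \<union> B2) = D" using assms(3,4,11) by fast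
qed

lemma finite_npr [simp]: "S > 0 \<Longrightarrow> T > 0 \<Longrightarrow> R > 0 \<Longrightarrow> finite (npr S T R)"
  by (simp add: npr_def)

lemma finite_Om [simp]: "finite (Om Nx Ny Nz b)"
proof -
  have "Om Nx Ny Nz b \<subseteq> {1..Nx} \<times> {1..Ny} \<times> {1..Nz} \<times> (\<Union>S\<in>{1..Nx}. \<Union>T\<in>{1..Ny}. \<Union>R\<in>{1..Nz}. Pow (npr S T R))"
    by (force simp: Om_def)
  moreover have "finite ({1..Nx} \<times> {1..Ny} \<times> {1..Nz} \<times> (\<Union>S\<in>{1..Nx}. \<Union>T\<in>{1..Ny}. \<Union>R\<in>{1..Nz}. Pow (npr S T R)))"
    by (intro finite_SigmaI finite_UN_I) auto
  ultimately show ?thesis using finite_subset by blast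
qed

text \<open>
  Within a box everything is frozen except the primes \<open>p\<close> with odd exponent in \<open>S\<close> only or in \<open>T\<close> only:
  \<open>S = K m1 n1\<close> and \<open>T = L m2 n2\<close>, where \<open>m1\<close>, \<open>m2\<close> collect the primes in \<open>D\<close> and
  \<open>n1\<close>, \<open>n2\<close> those outside.
\<close>

locale fiber =
  fixes Nx Ny Nz :: nat and b :: box and R K L :: nat and D :: "nat set"
  assumes o: "(R, K, L, D) \<in> others ` Om Nx Ny Nz b"
begin

definition U where "U = oddpr K \<union> oddpr L \<union> oddpr R"

text \<open>Removing the primes private to \<open>S\<close> leaves in \<open>oddpr K\<close> only
  primes shared with \<open>T\<close> or \<open>R\<close>, and likewise for \<open>L\<close>. The
  facts are phrased without the element of the box from which they are derived, so that any
  compatible row and column can be assembled over the same frozen data.\<close>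

lemma consistent:
  "K > 0" "L > 0" "R > 0" "oddpr K \<subseteq> oddpr L \<union> oddpr R" "oddpr L \<subseteq> oddpr K \<union> oddpr R"
  "D \<subseteq> U - (oddpr K \<inter> oddpr L \<inter> oddpr R)" "R \<le> Nz"
  "floor_log (\<Prod>((oddpr R - oddpr K - oddpr L) \<inter> D)) = fst (fst (snd (snd b)))"
  "floor_log (\<Prod>((oddpr R - oddpr K - oddpr L) - D)) = snd (fst (snd (snd b)))"
  "(floor_log (\<Prod>((oddpr K \<inter> oddpr L) - oddpr R)), floor_log (\<Prod>((oddpr K \<inter> oddpr R) - oddpr L)),
    floor_log (\<Prod>((oddpr L \<inter> oddpr R) - oddpr K))) = snd (snd (snd b))"
proof -
  obtain S T D0 where x: "(S, T, R, D0) \<in> Om Nx Ny Nz b" and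
    K: "K = S div \<Prod>(spr S T R)" and L: "L = T div \<Prod>(spr T S R)" and D: "D = D0 - spr S T R - spr T S R"
    using o by (auto simp: others_def)
  have pos: "S > 0" "T > 0" "R > 0" "R \<le> Nz" "D0 \<subseteq> npr S T R" "boxof S T R D0 = b" using x by (auto simp: Om_def)
  have oK: "oddpr K = oddpr S \<inter> (oddpr T \<union> oddpr R)" "K > 0"
    using oddpr_quotient[OF pos(1), of "spr S T R"] by (auto simp: K spr_def)
  have oL: "oddpr L = oddpr T \<inter> (oddpr S \<union> oddpr R)" "L > 0"
    using oddpr_quotient[OF pos(2), of "spr T S R"] by (auto simp: L spr_def)
  show "K > 0" "L > 0" "R > 0" "R \<le> Nz" using oK oL pos by auto
  show "oddpr K \<subseteq> oddpr L \<union> oddpr R" "oddpr L \<subseteq> oddpr K \<union> oddpr R" using oK oL by auto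
  show "D \<subseteq> U - (oddpr K \<inter> oddpr L \<inter> oddpr R)"
    using pos(5) unfolding D U_def oK(1) oL(1) npr_def spr_def by blast
  have r: "oddpr R - oddpr K - oddpr L = spr R S T" unfolding oK(1) oL(1) spr_def by blast
  have r1: "spr R S T \<inter> D = spr R S T \<inter> D0" "spr R S T - D = spr R S T - D0" unfolding D spr_def by blast+
  have g: "(oddpr K \<inter> oddpr L) - oddpr R = dpr S T R" "(oddpr K \<inter> oddpr R) - oddpr L = dpr S R T"
    "(oddpr L \<inter> oddpr R) - oddpr K = dpr T R S" unfolding oK(1) oL(1) dpr_def by blast+
  show "floor_log (\<Prod>((oddpr R - oddpr K - oddpr L) \<inter> D)) = fst (fst (snd (snd b)))"
    "floor_log (\<Prod>((oddpr R - oddpr K - oddpr L) - D)) = snd (fst (snd (snd b)))"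
    "(floor_log (\<Prod>((oddpr K \<inter> oddpr L) - oddpr R)), floor_log (\<Prod>((oddpr K \<inter> oddpr R) - oddpr L)),
      floor_log (\<Prod>((oddpr L \<inter> oddpr R) - oddpr K))) = snd (snd (snd b))"
    unfolding r r1 g pos(6)[symmetric] boxof_def by simp_all
qed

definition rows where
  "rows = {(m1, n1). m1 \<in> oddsf (2 * 2 ^ fst (fst b)) \<and> n1 \<in> oddsf (2 * 2 ^ snd (fst b)) \<and> coprime m1 n1 \<and>
     floor_log m1 = fst (fst b) \<and> floor_log n1 = snd (fst b) \<and>
     (prime_factors m1 \<union> prime_factors n1) \<inter> U = {} \<and> K * (m1 * n1) \<le> Nx}"

definition cols where
  "cols = {(n2, m2). n2 \<in> oddsf (2 * 2 ^ snd (fst (snd b))) \<and> m2 \<in> oddsf (2 * 2 ^ fst (fst (snd b))) \<and> coprime m2 n2 \<and>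
     floor_log m2 = fst (fst (snd b)) \<and> floor_log n2 = snd (fst (snd b)) \<and>
     (prime_factors m2 \<union> prime_factors n2) \<inter> U = {} \<and> L * (m2 * n2) \<le> Ny}"

text \<open>Apart from these coprimality conditions, membership in the fiber splits into a condition
  on the row and one on the column.\<close>

definition cross :: "(nat \<times> nat) \<times> nat \<times> nat \<Rightarrow> bool" where
  "cross = (\<lambda>((m1, n1), (n2, m2)). coprime m1 m2 \<and> coprime n1 n2 \<and> coprime m1 n2 \<and> coprime n1 m2)"

lemma coprime_prime_factors: "m > 0 \<Longrightarrow> n > 0 \<Longrightarrow> coprime m n \<longleftrightarrow> prime_factors m \<inter> prime_factors n = {}"
  for m n :: nat
proof
  assume m: "m > 0" "n > 0" "prime_factors m \<inter> prime_factors n = {}"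
  show "coprime m n"
  proof (rule ccontr)
    assume "\<not> coprime m n"
    then have "gcd m n \<noteq> 1" using coprime_iff_gcd_eq_1 by blast
    then obtain p where "prime p" "p dvd gcd m n" using prime_factor_nat by blast
    then have "p \<in> prime_factors m \<inter> prime_factors n" using m by (auto simp: in_prime_factors_iff)
    then show False using m by simp
  qed
next
  assume "coprime m n"
  then show "prime_factors m \<inter> prime_factors n = {}"
    by (auto simp: in_prime_factors_iff dest: coprime_common_divisor)
qed

text \<open>The active primes avoid \<open>U\<close> and one another, so the parity pattern of
  \<open>(S, T, R)\<close> at each odd prime is known and all coordinates of the box follow by set
  algebra.\<close>

lemma assembled:
  assumes i: "(m1, n1) \<in> rows" and j: "(n2, m2) \<in> cols" and c: "cross ((m1, n1), (n2, m2))"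
  defines "S \<equiv> K * (m1 * n1)" and "T \<equiv> L * (m2 * n2)"
  defines "D0 \<equiv> D \<union> prime_factors m1 \<union> prime_factors m2"
  shows "oddpr S = oddpr K \<union> prime_factors m1 \<union> prime_factors n1"
    "oddpr T = oddpr L \<union> prime_factors m2 \<union> prime_factors n2"
    "spr S T R = prime_factors m1 \<union> prime_factors n1" "spr T S R = prime_factors m2 \<union> prime_factors n2"
    "spr S T R \<inter> D0 = prime_factors m1" "spr S T R - D0 = prime_factors n1"
    "spr T S R \<inter> D0 = prime_factors m2" "spr T S R - D0 = prime_factors n2"
    "npr S T R - D0 = (U - (oddpr K \<inter> oddpr L \<inter> oddpr R) - D) \<union> prime_factors n1 \<union> prime_factors n2"
    "(S, T, R, D0) \<in> Om Nx Ny Nz b" "others (S, T, R, D0) = (R, K, L, D)"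
    "active (S, T, R, D0) = ((m1, n1), (n2, m2))"
proof -
  have odd: "odd m1" "odd n1" "odd m2" "odd n2" "squarefree m1" "squarefree n1" "squarefree m2" "squarefree n2"
    and pos: "m1 > 0" "n1 > 0" "m2 > 0" "n2 > 0"
    and ci: "coprime m1 n1" "coprime m2 n2"
    and dU: "(prime_factors m1 \<union> prime_factors n1) \<inter> U = {}" "(prime_factors m2 \<union> prime_factors n2) \<inter> U = {}"
    and le: "S \<le> Nx" "T \<le> Ny"
    and lg: "floor_log m1 = fst (fst b)" "floor_log n1 = snd (fst b)" "floor_log m2 = fst (fst (snd b))" "floor_log n2 = snd (fst (snd b))"
    using i j by (auto simp: rows_def cols_def oddsf_def S_def T_def)
  have cc: "coprime m1 m2" "coprime n1 n2" "coprime m1 n2" "coprime n1 m2" using c by (auto simp: cross_def)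
  note cp = coprime_prime_factors
  have dis: "prime_factors m1 \<inter> prime_factors n1 = {}" "prime_factors m2 \<inter> prime_factors n2 = {}"
    "prime_factors m1 \<inter> prime_factors m2 = {}" "prime_factors n1 \<inter> prime_factors n2 = {}"
    "prime_factors m1 \<inter> prime_factors n2 = {}" "prime_factors n1 \<inter> prime_factors m2 = {}"
    using cp[OF pos(1,2)] cp[OF pos(3,4)] cp[OF pos(1,3)] cp[OF pos(2,4)] cp[OF pos(1,4)] cp[OF pos(2,3)] ci cc by blast+
  have sf: "squarefree (m1 * n1)" "squarefree (m2 * n2)" using odd ci by (auto intro: squarefree_mult_coprime)
  have o1: "oddpr (m1 * n1) = prime_factors m1 \<union> prime_factors n1"
    using oddpr_squarefree[OF sf(1)] odd pos by (simp add: prime_factors_product)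
  have o2: "oddpr (m2 * n2) = prime_factors m2 \<union> prime_factors n2"
    using oddpr_squarefree[OF sf(2)] odd pos by (simp add: prime_factors_product)
  have mn: "m1 * n1 > 0" "m2 * n2 > 0" using pos by auto
  show oS: "oddpr S = oddpr K \<union> prime_factors m1 \<union> prime_factors n1"
    using oddpr_mult[OF consistent(1) mn(1)] dU(1) unfolding S_def o1 U_def by blast
  show oT: "oddpr T = oddpr L \<union> prime_factors m2 \<union> prime_factors n2"
    using oddpr_mult[OF consistent(2) mn(2)] dU(2) unfolding T_def o2 U_def by blast
  have DU: "D \<subseteq> U" using consistent(6) by blast
  note fs = fiber_sets[OF consistent(4,5) dU[unfolded U_def] dis DU[unfolded U_def]]
  show s1: "spr S T R = prime_factors m1 \<union> prime_factors n1"
    unfolding spr_def oS oT by (rule fs)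
  show s2: "spr T S R = prime_factors m2 \<union> prime_factors n2"
    unfolding spr_def oS oT by (rule fs)
  show d: "spr S T R \<inter> D0 = prime_factors m1" "spr S T R - D0 = prime_factors n1"
    "spr T S R \<inter> D0 = prime_factors m2" "spr T S R - D0 = prime_factors n2"
    unfolding s1 s2 D0_def by (rule fs)+
  have np: "npr S T R = (U - (oddpr K \<inter> oddpr L \<inter> oddpr R)) \<union> prime_factors m1 \<union> prime_factors n1 \<union> prime_factors m2 \<union> prime_factors n2"
    unfolding npr_def oS oT U_def by (rule fs)
  show "npr S T R - D0 = (U - (oddpr K \<inter> oddpr L \<inter> oddpr R) - D) \<union> prime_factors n1 \<union> prime_factors n2"
    unfolding np D0_def unfolding U_def by (rule fs)
  have s3: "spr R S T = oddpr R - oddpr K - oddpr L"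
    unfolding spr_def oS oT by (rule fs)
  have d3: "spr R S T \<inter> D0 = (oddpr R - oddpr K - oddpr L) \<inter> D" "spr R S T - D0 = (oddpr R - oddpr K - oddpr L) - D"
    unfolding s3 D0_def by (rule fs)+
  have g: "dpr S T R = (oddpr K \<inter> oddpr L) - oddpr R" "dpr S R T = (oddpr K \<inter> oddpr R) - oddpr L"
    "dpr T R S = (oddpr L \<inter> oddpr R) - oddpr K"
    unfolding dpr_def oS oT by (rule fs)+
  have pr: "\<Prod>(prime_factors m1) = m1" "\<Prod>(prime_factors n1) = n1" "\<Prod>(prime_factors m2) = m2" "\<Prod>(prime_factors n2) = n2"
    using odd by (auto intro: prod_prime_factors_squarefree)
  have "boxof S T R D0 = b"
    unfolding boxof_def d d3 g pr lg consistent(8,9,10) by simp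
  moreover have "D0 \<subseteq> npr S T R" unfolding np D0_def using consistent(6) by blast
  moreover have "S > 0" "T > 0" using consistent mn by (auto simp: S_def T_def)
  ultimately show "(S, T, R, D0) \<in> Om Nx Ny Nz b" using le consistent(3,7) by (auto simp: Om_def)
  show "active (S, T, R, D0) = ((m1, n1), (n2, m2))" by (simp add: active_def d pr)
  have pp: "\<Prod>(prime_factors m1 \<union> prime_factors n1) = m1 * n1" "\<Prod>(prime_factors m2 \<union> prime_factors n2) = m2 * n2"
    using dis pr by (simp_all add: prod.union_disjoint)
  have "D0 - spr S T R - spr T S R = D" unfolding s1 s2 D0_def by (rule fs)
  then show "others (S, T, R, D0) = (R, K, L, D)"
    unfolding others_def prod.case s1 s2 pp using mn by (simp add: S_def T_def)
qed

lemma disassembled: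
  assumes x: "(S, T, R', D0) \<in> Om Nx Ny Nz b" and o: "others (S, T, R', D0) = (R, K, L, D)"
  shows "fst (active (S, T, R', D0)) \<in> rows" "snd (active (S, T, R', D0)) \<in> cols"
    "cross (active (S, T, R', D0))" "assemble (R, K, L, D) (active (S, T, R', D0)) = (S, T, R', D0)"
proof -
  have R: "R' = R" and K: "K = S div \<Prod>(spr S T R)" and L: "L = T div \<Prod>(spr T S R)"
    and D: "D = D0 - spr S T R - spr T S R" using o by (auto simp: others_def)
  have pos: "S > 0" "T > 0" "R > 0" "D0 \<subseteq> npr S T R" "boxof S T R D0 = b" "S \<le> Nx" "T \<le> Ny" using x R by (auto simp: Om_def)
  note qS = oddpr_quotient[OF pos(1), of "spr S T R", folded K]
  note qT = oddpr_quotient[OF pos(2), of "spr T S R", folded L]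
  have sub: "spr S T R \<subseteq> oddpr S" "spr T S R \<subseteq> oddpr T" by (auto simp: spr_def)
  have oS: "oddprimes (oddpr S)" "oddprimes (oddpr T)" using pos oddprimes_oddpr by auto
  have oA: "oddprimes (spr S T R \<inter> D0)" "oddprimes (spr S T R - D0)" "oddprimes (spr T S R \<inter> D0)" "oddprimes (spr T S R - D0)"
    by (rule oddprimes_mono[OF oS(1)], use sub in blast)+ (rule oddprimes_mono[OF oS(2)], use sub in blast)+
  define m1 n1 m2 n2 where "m1 = \<Prod>(spr S T R \<inter> D0)" and "n1 = \<Prod>(spr S T R - D0)"
    and "m2 = \<Prod>(spr T S R \<inter> D0)" and "n2 = \<Prod>(spr T S R - D0)"
  have pf: "prime_factors m1 = spr S T R \<inter> D0" "prime_factors n1 = spr S T R - D0"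
    "prime_factors m2 = spr T S R \<inter> D0" "prime_factors n2 = spr T S R - D0"
    unfolding m1_def n1_def m2_def n2_def using oA by (auto intro!: prime_factors_prod_oddprimes)
  have p0: "m1 > 0" "n1 > 0" "m2 > 0" "n2 > 0"
    unfolding m1_def n1_def m2_def n2_def using oA prod_oddprimes_pos by blast+
  have os: "odd m1" "odd n1" "odd m2" "odd n2" "squarefree m1" "squarefree n1" "squarefree m2" "squarefree n2"
    unfolding m1_def n1_def m2_def n2_def using oA prod_oddprimes_oddsf by blast+
  have lg: "floor_log m1 = fst (fst b)" "floor_log n1 = snd (fst b)" "floor_log m2 = fst (fst (snd b))" "floor_log n2 = snd (fst (snd b))"
    unfolding m1_def n1_def m2_def n2_def pos(5)[symmetric] boxof_def by simp_all
  have "2 * 2 ^ floor_log n > n" if "n > 0" for n using floor_log_exp2_gt[of n] by simp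
  then have osf: "m1 \<in> oddsf (2 * 2 ^ fst (fst b))" "n1 \<in> oddsf (2 * 2 ^ snd (fst b))"
    "m2 \<in> oddsf (2 * 2 ^ fst (fst (snd b)))" "n2 \<in> oddsf (2 * 2 ^ snd (fst (snd b)))"
    using p0 os lg unfolding oddsf_def by (metis (mono_tags, lifting) less_imp_le mem_Collect_eq)+
  have oKL: "oddpr K = oddpr S - spr S T R" "oddpr L = oddpr T - spr T S R" using qS(2) qT(2) sub by auto
  have dU: "(prime_factors m1 \<union> prime_factors n1) \<inter> U = {}" "(prime_factors m2 \<union> prime_factors n2) \<inter> U = {}"
    unfolding U_def pf oKL spr_def by blast+
  have mn: "m1 * n1 = \<Prod>(spr S T R)" "m2 * n2 = \<Prod>(spr T S R)"
  proof -
    have f: "finite (spr S T R)" "finite (spr T S R)" using pos by (simp_all add: spr_def)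
    then show "m1 * n1 = \<Prod>(spr S T R)" "m2 * n2 = \<Prod>(spr T S R)"
      unfolding m1_def n1_def m2_def n2_def
      using prod.Int_Diff[OF f(1), of "\<lambda>x. x" D0] prod.Int_Diff[OF f(2), of "\<lambda>x. x" D0] by simp_all
  qed
  have ST: "S = K * (m1 * n1)" "T = L * (m2 * n2)" unfolding mn by (rule qS(1)[OF sub(1)], rule qT(1)[OF sub(2)])
  have act: "active (S, T, R', D0) = ((m1, n1), (n2, m2))"
    by (simp add: active_def R m1_def n1_def m2_def n2_def)
  note cp = coprime_prime_factors
  have co: "coprime m1 n1" "coprime m2 n2" "coprime m1 m2" "coprime n1 n2" "coprime m1 n2" "coprime n1 m2"
    unfolding cp[OF p0(1,2)] cp[OF p0(3,4)] cp[OF p0(1,3)] cp[OF p0(2,4)] cp[OF p0(1,4)] cp[OF p0(2,3)] pf spr_def by blast+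
  show "fst (active (S, T, R', D0)) \<in> rows" unfolding act rows_def using osf lg dU ST pos co by auto
  show "snd (active (S, T, R', D0)) \<in> cols" unfolding act cols_def using osf lg dU ST pos co by auto
  show "cross (active (S, T, R', D0))" unfolding act cross_def using co by simp
  have "D0 = D \<union> (spr S T R \<inter> D0) \<union> (spr T S R \<inter> D0)" unfolding D by blast
  then show "assemble (R, K, L, D) (active (S, T, R', D0)) = (S, T, R', D0)"
    unfolding act assemble_def prod.case pf using ST R by simp
qed

text \<open>\<open>active\<close> and \<open>assemble\<close> are mutually inverse between the fiber
  and the compatible pairs of a row and a column.\<close>

lemma sum_fiber:
  fixes f :: "nat \<times> nat \<times> nat \<times> nat set \<Rightarrow> complex"
  shows "(\<Sum>x | x \<in> Om Nx Ny Nz b \<and> others x = (R, K, L, D). f x)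
    = (\<Sum>i\<in>rows. \<Sum>j\<in>cols. of_bool (cross (i, j)) * f (assemble (R, K, L, D) (i, j)))"
proof -
  have fin: "finite rows" "finite cols"
    by (rule finite_subset[of _ "oddsf (2 * 2 ^ fst (fst b)) \<times> oddsf (2 * 2 ^ snd (fst b))"], auto simp: rows_def)
       (rule finite_subset[of _ "oddsf (2 * 2 ^ snd (fst (snd b))) \<times> oddsf (2 * 2 ^ fst (fst (snd b)))"], auto simp: cols_def)
  have "(\<Sum>x | x \<in> Om Nx Ny Nz b \<and> others x = (R, K, L, D). f x)
    = (\<Sum>ij\<in>{ij \<in> rows \<times> cols. cross ij}. f (assemble (R, K, L, D) ij))"
  proof (rule sum.reindex_bij_witness[of _ "assemble (R, K, L, D)" active])
    fix x assume x: "x \<in> {x. x \<in> Om Nx Ny Nz b \<and> others x = (R, K, L, D)}"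
    obtain S T R' D0 where e: "x = (S, T, R', D0)" by (cases x) auto
    show "assemble (R, K, L, D) (active x) = x" "active x \<in> {ij \<in> rows \<times> cols. cross ij}"
      using disassembled[of S T R' D0] x unfolding e by (auto simp: mem_Times_iff)
    then show "f (assemble (R, K, L, D) (active x)) = f x" by simp
  next
    fix ij assume ij: "ij \<in> {ij \<in> rows \<times> cols. cross ij}"
    obtain m1 n1 n2 m2 where e: "ij = ((m1, n1), (n2, m2))" by (cases ij) auto
    show "active (assemble (R, K, L, D) ij) = ij" "assemble (R, K, L, D) ij \<in> {x. x \<in> Om Nx Ny Nz b \<and> others x = (R, K, L, D)}"
      using assembled(10,11,12)[of m1 n1 n2 m2] ij unfolding e by (auto simp: assemble_def)
  qed
  also have "\<dots> = (\<Sum>ij\<in>rows \<times> cols. of_bool (cross ij) * f (assemble (R, K, L, D) ij))"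
    using fin by (intro sum.mono_neutral_cong_left) auto
  also have "\<dots> = (\<Sum>i\<in>rows. \<Sum>j\<in>cols. of_bool (cross (i, j)) * f (assemble (R, K, L, D) (i, j)))"
    by (simp add: sum.cartesian_product')
  finally show ?thesis .
qed

end

section \<open>Box sums for one pair of variables\<close>

lemma multiplicity_int:
  assumes "prime p" "n > 0"
  shows "multiplicity (int p) (int n) = multiplicity p n"
proof (rule multiplicity_eqI)
  have "p ^ multiplicity p n dvd n" by (rule multiplicity_dvd)
  then show "int p ^ multiplicity p n dvd int n" by (metis int_dvd_int_iff of_nat_power)
  show "\<not> int p ^ Suc (multiplicity p n) dvd int n"
  proof
    assume "int p ^ Suc (multiplicity p n) dvd int n"
    then have "p ^ Suc (multiplicity p n) dvd n" by (metis int_dvd_int_iff of_nat_power)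
    moreover have "\<not> is_unit p" using assms(1) by auto
    ultimately show False using assms(2) multiplicity_geI[of n p "Suc (multiplicity p n)"] by simp
  qed
qed

lemma multiplicity_signed:
  assumes p: "prime p" and \<sigma>: "\<sigma> \<in> {-1, 1}" and "A > 0" "B > 0"
  shows "multiplicity (int p) (\<sigma> * int A * int B) = multiplicity p A + multiplicity p B"
proof -
  have "\<not> int p dvd \<sigma>" using prime_gt_1_nat[OF p] \<sigma> by auto
  then have "multiplicity (int p) \<sigma> = 0" by (rule not_dvd_imp_multiplicity_0)
  moreover have "\<sigma> \<noteq> 0" using \<sigma> by auto
  ultimately show ?thesis using upart_mult(1)[OF p, of "\<sigma> * int A" "int B"] upart_mult(1)[OF p, of \<sigma> "int A"]
      multiplicity_int[OF p] assms(3,4) by simp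
qed

context fiber
begin

lemma chi_assembled:
  assumes i: "(m1, n1) \<in> rows" and j: "(n2, m2) \<in> cols" and c: "cross ((m1, n1), (n2, m2))"
    and \<sigma>: "\<sigma>1 \<in> {-1, 1}" "\<sigma>2 \<in> {-1, 1}"
  defines "o1 \<equiv> \<sigma>1 * int K * int R" and "o2 \<equiv> \<sigma>2 * int L * int R"
  shows "(\<Prod>p\<in>D \<union> prime_factors m1 \<union> prime_factors m2. local_sym p (\<sigma>1 * int (K * (m1 * n1)) * int R) (\<sigma>2 * int (L * (m2 * n2)) * int R))
    = (\<Prod>p\<in>D. local_sym p o1 o2)
      * ((\<Prod>p\<in>D. local_sym p (int (m1 * n1)) o2) * (\<Prod>p\<in>prime_factors m1. local_sym p (int (m1 * n1)) o2))
      * ((\<Prod>p\<in>D. local_sym p o1 (int (n2 * m2))) * (\<Prod>p\<in>prime_factors m2. local_sym p o1 (int (n2 * m2))))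
      * ((if m1 mod 4 = 3 \<and> m2 mod 4 = 3 then -1 else 1) * (jac (int n2) m1 * jac (int n1) m2))"
proof -
  have odd: "odd m1" "odd n1" "odd m2" "odd n2" "squarefree m1" "squarefree n1" "squarefree m2" "squarefree n2"
    and pos: "m1 > 0" "n1 > 0" "m2 > 0" "n2 > 0"
    and ci: "coprime m1 n1" "coprime m2 n2"
    and dU: "(prime_factors m1 \<union> prime_factors n1) \<inter> U = {}" "(prime_factors m2 \<union> prime_factors n2) \<inter> U = {}"
    using i j by (auto simp: rows_def cols_def oddsf_def)
  have cc: "coprime m1 m2" "coprime n1 n2" "coprime m1 n2" "coprime n1 m2" using c by (auto simp: cross_def)
  define t1 t2 where "t1 = int (m1 * n1)" and "t2 = int (n2 * m2)"
  have nz: "o1 \<noteq> 0" "o2 \<noteq> 0" "t1 \<noteq> 0" "t2 \<noteq> 0"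
    using \<sigma> consistent(1-3) pos by (auto simp: o1_def o2_def t1_def t2_def)
  have dv: "p dvd a * b \<longleftrightarrow> p \<in> prime_factors a \<or> p \<in> prime_factors b" if "prime p" "a > 0" "b > 0" for p a b :: nat
    using that by (auto simp: in_prime_factors_iff prime_dvd_mult_iff)
  have eq: "\<sigma>1 * int (K * (m1 * n1)) * int R = o1 * t1" "\<sigma>2 * int (L * (m2 * n2)) * int R = o2 * t2"
    by (simp_all add: o1_def o2_def t1_def t2_def mult_ac)
  have four: "local_sym p (o1 * t1) (o2 * t2) = local_sym p o1 o2 * local_sym p t1 o2 * local_sym p o1 t2 * local_sym p t1 t2"
    if "prime p" for p
    using nz local_sym_mult[OF that, of o1 t1 "o2 * t2"] local_sym_mult_right[OF that, of o2 t2 o1] local_sym_mult_right[OF that, of o2 t2 t1]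
    by simp
  have DU: "D \<subseteq> U" using consistent(6) by blast
  have pU: "prime p" "odd p" if "p \<in> U" for p using that by (auto simp: U_def oddpr_def)
  have nd: "\<not> int p dvd t1" "\<not> int p dvd t2" if "p \<in> U" for p
    using dv[OF pU(1)[OF that] pos(1,2)] dv[OF pU(1)[OF that] pos(4,3)] dU that
    unfolding t1_def t2_def int_dvd_int_iff by blast+
  have ev: "even (multiplicity (int p) o1)" "even (multiplicity (int p) o2)" if "prime p" "odd p" "p \<notin> U" for p
    using that consistent(1-3) multiplicity_signed[OF that(1) \<sigma>(1), of K R] multiplicity_signed[OF that(1) \<sigma>(2), of L R]
    by (auto simp: U_def oddpr_def o1_def o2_def)
  have fin: "finite D" by (rule finite_subset[OF DU]) (use consistent(1-3) in \<open>simp add: U_def\<close>)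
  have pm: "prime p" "odd p" "p \<noteq> 2" "p \<notin> U" if "p \<in> prime_factors m1 \<union> prime_factors m2" for p
    proof -
    have "prime p \<and> odd p" using that odd_prime_factors[OF odd(1), of p] odd_prime_factors[OF odd(3), of p] by (elim UnE) simp_all
    then show "prime p" "odd p" "p \<noteq> 2" by auto
    show "p \<notin> U" using that dU(1)[unfolded disjoint_iff] dU(2)[unfolded disjoint_iff] by (elim UnE) simp_all
  qed
  have "local_sym p (o1 * t1) (o2 * t2) = local_sym p o1 o2 * local_sym p t1 o2 * local_sym p o1 t2" if "p \<in> D" for p
  proof -
    have "p \<in> U" using that DU by blast
    then have "p \<noteq> 2" using pU(2) by fastforce
    then have "local_sym p t1 t2 = 1" using nd[OF \<open>p \<in> U\<close>] local_sym_even[of p t1 t2] by (simp add: not_dvd_imp_multiplicity_0)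
    then show ?thesis using four pU \<open>p \<in> U\<close> by simp
  qed
  then have P1: "(\<Prod>p\<in>D. local_sym p (o1 * t1) (o2 * t2)) = (\<Prod>p\<in>D. local_sym p o1 o2) * (\<Prod>p\<in>D. local_sym p t1 o2) * (\<Prod>p\<in>D. local_sym p o1 t2)"
    by (simp add: prod.distrib)
  note cp = coprime_prime_factors
  have dis: "prime_factors m1 \<inter> prime_factors n1 = {}" "prime_factors m2 \<inter> prime_factors n2 = {}"
    "prime_factors m1 \<inter> prime_factors m2 = {}" "prime_factors n1 \<inter> prime_factors n2 = {}"
    "prime_factors m1 \<inter> prime_factors n2 = {}" "prime_factors n1 \<inter> prime_factors m2 = {}"
    using cp[OF pos(1,2)] cp[OF pos(3,4)] cp[OF pos(1,3)] cp[OF pos(2,4)] cp[OF pos(1,4)] cp[OF pos(2,3)] ci cc by blast+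
  have sf: "squarefree (m1 * n1)" "squarefree (n2 * m2)"
    using odd ci by (auto intro!: squarefree_mult_coprime simp: coprime_commute)
  have mt: "multiplicity (int p) t1 = (if p \<in> prime_factors m1 \<union> prime_factors n1 then 1 else 0)"
    "multiplicity (int p) t2 = (if p \<in> prime_factors m2 \<union> prime_factors n2 then 1 else 0)" if "prime p" for p
    unfolding t1_def t2_def using multiplicity_int[OF that, of "m1 * n1"] multiplicity_int[OF that, of "n2 * m2"] squarefree_multiplicity[OF sf(1) that] squarefree_multiplicity[OF sf(2) that] pos
    by (simp_all add: prime_factors_product Un_commute del: of_nat_mult)
  have "local_sym p (o1 * t1) (o2 * t2) = local_sym p t1 o2 * Legendre t2 (int p)" if p: "p \<in> prime_factors m1" for p
  proof -
    note q = pm[of p, OF UnI1[OF p]]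
    have n2: "p \<notin> prime_factors m2 \<union> prime_factors n2" using p dis(3,5)[unfolded disjoint_iff] by simp
    have a: "multiplicity (int p) t2 = 0" "multiplicity (int p) t1 = 1" using mt[OF q(1)] n2 p by simp_all
    have nd2: "\<not> int p dvd t2" unfolding t2_def int_dvd_int_iff using dv[OF q(1) pos(4,3)] n2 by simp
    have "local_sym p o1 o2 = 1" "local_sym p o1 t2 = 1" using ev[OF q(1,2,4)] a local_sym_even[OF q(3)] by auto
    moreover have "local_sym p t1 t2 = Legendre t2 (int p)"
      unfolding local_sym_commute[of p t1] using local_sym_unit_left[OF q(1,3) nd2, of t1] a by simp
    ultimately show ?thesis using four[OF q(1)] by simp
  qed
  then have P2: "(\<Prod>p\<in>prime_factors m1. local_sym p (o1 * t1) (o2 * t2)) = (\<Prod>p\<in>prime_factors m1. local_sym p t1 o2) * jac t2 m1"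
    by (simp add: prod.distrib jac_def)
  have "local_sym p (o1 * t1) (o2 * t2) = local_sym p o1 t2 * Legendre t1 (int p)" if p: "p \<in> prime_factors m2" for p
  proof -
    note q = pm[of p, OF UnI2[OF p]]
    have n2: "p \<notin> prime_factors m1 \<union> prime_factors n1" using p dis(3,6)[unfolded disjoint_iff] by auto
    have a: "multiplicity (int p) t1 = 0" "multiplicity (int p) t2 = 1" using mt[OF q(1)] n2 p by simp_all
    have nd2: "\<not> int p dvd t1" unfolding t1_def int_dvd_int_iff using dv[OF q(1) pos(1,2)] n2 by simp
    have "local_sym p o1 o2 = 1" "local_sym p t1 o2 = 1" using ev[OF q(1,2,4)] a local_sym_even[OF q(3)] by auto
    moreover have "local_sym p t1 t2 = Legendre t1 (int p)"
      using local_sym_unit_left[OF q(1,3) nd2, of t2] a by simp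
    ultimately show ?thesis using four[OF q(1)] by simp
  qed
  then have P3: "(\<Prod>p\<in>prime_factors m2. local_sym p (o1 * t1) (o2 * t2)) = (\<Prod>p\<in>prime_factors m2. local_sym p o1 t2) * jac t1 m2"
    by (simp add: prod.distrib jac_def)
  have j2: "jac t2 m1 = jac (int n2) m1 * jac (int m2) m1" "jac t1 m2 = jac (int m1) m2 * jac (int n1) m2"
    unfolding t1_def t2_def of_nat_mult by (rule jac_mult_left, rule odd)+
  have rec: "jac (int m2) m1 * jac (int m1) m2 = (if m1 mod 4 = 3 \<and> m2 mod 4 = 3 then -1 else 1)"
    by (rule jac_reciprocity[OF odd(1,5,3,7) cc(1)])
  have dD: "D \<inter> prime_factors m1 = {}" "(D \<union> prime_factors m1) \<inter> prime_factors m2 = {}" using DU dU dis(3) by fast+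
  have "(\<Prod>p\<in>D \<union> prime_factors m1 \<union> prime_factors m2. local_sym p (o1 * t1) (o2 * t2))
    = (\<Prod>p\<in>D. local_sym p (o1 * t1) (o2 * t2)) * (\<Prod>p\<in>prime_factors m1. local_sym p (o1 * t1) (o2 * t2))
      * (\<Prod>p\<in>prime_factors m2. local_sym p (o1 * t1) (o2 * t2))"
    using fin dD by (simp add: prod.union_disjoint)
  also have "\<dots> = (\<Prod>p\<in>D. local_sym p o1 o2)
      * ((\<Prod>p\<in>D. local_sym p t1 o2) * (\<Prod>p\<in>prime_factors m1. local_sym p t1 o2))
      * ((\<Prod>p\<in>D. local_sym p o1 t2) * (\<Prod>p\<in>prime_factors m2. local_sym p o1 t2))
      * ((jac (int m2) m1 * jac (int m1) m2) * (jac (int n2) m1 * jac (int n1) m2))"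
    unfolding P1 P2 P3 j2 by (simp add: mult_ac)
  finally show ?thesis unfolding eq rec unfolding t1_def t2_def .
qed

end

text \<open>The weight \<open>om\<close> below carries the dependence on the symbol at 2.\<close>

definition mod8_inv :: "(nat \<Rightarrow> nat \<Rightarrow> nat \<Rightarrow> complex) \<Rightarrow> bool" where
  "mod8_inv om \<longleftrightarrow> (\<forall>S T R. cmod (om S T R) \<le> 1) \<and>
     (\<forall>S T R m m'. odd m \<longrightarrow> odd m' \<longrightarrow> m mod 8 = m' mod 8 \<longrightarrow>
       om (S * m) T R = om (S * m') T R \<and> om S (T * m) R = om S (T * m') R \<and> om S T (R * m) = om S T (R * m'))"

text \<open>A term with both divisors large. The two thresholds are separate parameters because the
  prime 2 can shift one of them by a factor of two.\<close>

definition summand where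
  "summand \<sigma>1 \<sigma>2 a b c om z1 z2 = (\<lambda>(S, T, R, D). a S * b T * c R * om S T R *
     (of_bool (z1 < \<Prod>D) * of_bool (z2 < \<Prod>(npr S T R - D)) *
      of_int (\<Prod>p\<in>D. local_sym p (\<sigma>1 * int S * int R) (\<sigma>2 * int T * int R)) :: complex))"

lemma cmod_prod_local_sym:
  assumes "\<And>p. p \<in> A \<Longrightarrow> prime p" "s \<noteq> 0" "t \<noteq> 0"
  shows "cmod (of_int (\<Prod>p\<in>A. local_sym p s t)) = 1"
proof -
  have "cmod (of_int (local_sym p s t)) = 1" if "p \<in> A" for p
    using local_sym_values[OF assms(1)[OF that] assms(2,3)] by auto
  then show ?thesis by (simp add: of_int_prod prod_norm[symmetric])
qed

text \<open>On each fiber the summand is a row weight times a column weight times the twisted Jacobi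
  kernel. Summing the fiberwise bound costs the number of fibers, which is estimated
  separately.\<close>

theorem pair_bound:
  assumes \<epsilon>: "\<epsilon> > 0"
  shows "\<exists>C\<ge>1. \<forall>Nx Ny Nz i1 i2 i3 i4 r \<sigma>1 \<sigma>2 a b c om z1 z2.
    \<sigma>1 \<in> {-1, 1} \<longrightarrow> \<sigma>2 \<in> {-1, 1} \<longrightarrow> (\<forall>n. cmod (a n) \<le> 1) \<longrightarrow> (\<forall>n. cmod (b n) \<le> 1) \<longrightarrow> (\<forall>n. cmod (c n) \<le> 1) \<longrightarrow>
    mod8_inv om \<longrightarrow>
    cmod (\<Sum>x\<in>Om Nx Ny Nz ((i1, i2), (i3, i4), r). summand \<sigma>1 \<sigma>2 a b c om z1 z2 x)
    \<le> C * (2 ^ i1 * 2 ^ i2 * (2 ^ i3 * 2 ^ i4)) powr (1 + \<epsilon>) * card (others ` Om Nx Ny Nz ((i1, i2), (i3, i4), r))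
      * (min (2 ^ i1) (2 ^ i4) powr (- 1 / 4) * min (2 ^ i3) (2 ^ i2) powr (- 1 / 4))"
proof -
  obtain C where C: "C \<ge> 1" and B: "\<And>D1 E1 D2 E2 I J u v q1 q2 w. 1 \<le> D1 \<Longrightarrow> 1 \<le> E1 \<Longrightarrow> 1 \<le> D2 \<Longrightarrow> 1 \<le> E2 \<Longrightarrow>
    I \<subseteq> oddsf D1 \<times> oddsf E1 \<Longrightarrow> J \<subseteq> oddsf E2 \<times> oddsf D2 \<Longrightarrow>
    (\<forall>i. cmod (u i) \<le> 1) \<Longrightarrow> (\<forall>j. cmod (v j) \<le> 1) \<Longrightarrow> (\<forall>x y. cmod (w x y) \<le> 1) \<Longrightarrow>
      cmod (\<Sum>i\<in>I. \<Sum>j\<in>J. u i * v j *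
        (of_bool (coprime (fst i) (snd j)) * (of_bool (coprime (snd i) (fst j)) *
         (of_bool (q1 j < fst i) * (of_bool (q2 j < snd i) *
          (w (fst i mod 8, snd i mod 8) (fst j mod 8, snd j mod 8) *
           (of_int (jac (int (fst j)) (fst i)) * of_int (jac (int (snd i)) (snd j)))))))))
      \<le> C * (real D1 * real E1 * (real D2 * real E2)) powr (1 + \<epsilon>) *
        (min (real D1) (real E2) powr (- 1 / 4) * min (real D2) (real E1) powr (- 1 / 4))"
    using jacobi_bilinear_sum[OF \<epsilon>] by meson
  \<comment> \<open>Each of the four active variables ranges up to twice its dyadic lower bound,
    hence 16.\<close>
  define C' where "C' = C * 16 powr (1 + \<epsilon>)"
  have "1 \<le> (16::real) powr (1 + \<epsilon>)" using \<epsilon> by (intro ge_one_powr_ge_zero) auto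
  then have C': "C' \<ge> 1" using mult_mono[of 1 C 1 "16 powr (1 + \<epsilon>)"] C by (simp add: C'_def)
  show ?thesis
  proof (intro exI[of _ C'] conjI C' allI impI)
    fix Nx Ny Nz i1 i2 i3 i4 :: nat and r and \<sigma>1 \<sigma>2 :: int and a b c :: "nat \<Rightarrow> complex" and om z1 z2
    assume \<sigma>: "\<sigma>1 \<in> {-1, 1}" "\<sigma>2 \<in> {-1, 1}" and abc: "\<forall>n. cmod (a n) \<le> 1" "\<forall>n. cmod (b n) \<le> 1" "\<forall>n. cmod (c n) \<le> 1"
      and om: "mod8_inv om"
    define bx :: box where "bx = ((i1, i2), (i3, i4), r)"
    define Q where "Q = C' * (2 ^ i1 * 2 ^ i2 * (2 ^ i3 * 2 ^ i4)) powr (1 + \<epsilon>) * (min (2 ^ i1) (2 ^ i4) powr (- 1 / 4) * min (2 ^ i3) (2 ^ i2) powr (- 1 / 4))"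
    let ?f = "summand \<sigma>1 \<sigma>2 a b c om z1 z2"
    have fib: "cmod (\<Sum>x | x \<in> Om Nx Ny Nz bx \<and> others x = o'. ?f x) \<le> Q" if o': "o' \<in> others ` Om Nx Ny Nz bx" for o'
    proof -
      obtain R K L D where oe: "o' = (R, K, L, D)" by (cases o') auto
      interpret fiber Nx Ny Nz bx R K L D by unfold_locales (use o' oe in simp)
      define o1 o2 where "o1 = \<sigma>1 * int K * int R" and "o2 = \<sigma>2 * int L * int R"
      define UD where "UD = U - (oddpr K \<inter> oddpr L \<inter> oddpr R) - D"
      \<comment> \<open>Zero outside the rows, since the sieve bound asks for weights bounded by 1
        on all pairs.\<close>
      define u where "u = (\<lambda>i. if i \<in> rows then a (K * (fst i * snd i)) * c R * of_int (\<Prod>p\<in>D. local_sym p o1 o2) *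
         of_int ((\<Prod>p\<in>D. local_sym p (int (fst i * snd i)) o2) * (\<Prod>p\<in>prime_factors (fst i). local_sym p (int (fst i * snd i)) o2)) else 0)"
      define v where "v = (\<lambda>j. if j \<in> cols then b (L * (snd j * fst j)) *
         of_int ((\<Prod>p\<in>D. local_sym p o1 (int (fst j * snd j))) * (\<Prod>p\<in>prime_factors (snd j). local_sym p o1 (int (fst j * snd j)))) else 0)"
      define w where "w = (\<lambda>(x :: nat \<times> nat) (y :: nat \<times> nat). om (K * (fst x * snd x)) (L * (snd y * fst y)) R * (if fst x mod 4 = 3 \<and> snd y mod 4 = 3 then -1 else 1))"
      \<comment> \<open>\<open>z1 < \<Prod>D * m1 * m2\<close> is equivalent to
        \<open>z1 div (\<Prod>D * m2) < m1\<close>, a comparison of a column quantity with a row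
        quantity.\<close>
      define q1 where "q1 = (\<lambda>j :: nat \<times> nat. z1 div (\<Prod>D * snd j))"
      define q2 where "q2 = (\<lambda>j :: nat \<times> nat. z2 div (\<Prod>UD * fst j))"
      have nz: "o1 \<noteq> 0" "o2 \<noteq> 0" using \<sigma> consistent(1-3) by (auto simp: o1_def o2_def)
      have oU: "oddprimes U" unfolding U_def using consistent(1-3) by (intro oddprimes_Un oddprimes_oddpr)
      have oD: "oddprimes D" by (rule oddprimes_mono[OF oU]) (use consistent(6) in blast)
      have oUD: "oddprimes UD" by (rule oddprimes_mono[OF oU]) (auto simp: UD_def)
      have pD: "\<And>p. p \<in> D \<Longrightarrow> prime p" using oD by (auto simp: oddprimes_def)
      have pf: "\<And>p m. p \<in> prime_factors m \<Longrightarrow> prime (p::nat)" by (simp add: in_prime_factors_iff)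
      have rp: "fst i > 0" "snd i > 0" "odd (fst i)" "odd (snd i)" "squarefree (fst i)" "squarefree (snd i)" if "i \<in> rows" for i
        using that by (auto simp: rows_def oddsf_def)
      have cp: "fst i > 0" "snd i > 0" "odd (fst i)" "odd (snd i)" "squarefree (fst i)" "squarefree (snd i)" if "i \<in> cols" for i
        using that by (auto simp: cols_def oddsf_def)
      have u1: "cmod (u i) \<le> 1" for i
      proof (cases "i \<in> rows")
        case True
        then have nzi: "int (fst i * snd i) \<noteq> 0" using rp[OF True] by simp
        have "cmod (u i) = cmod (a (K * (fst i * snd i))) * cmod (c R)"
          using cmod_prod_local_sym[OF pD nz] cmod_prod_local_sym[OF pD nzi nz(2)] cmod_prod_local_sym[OF pf nzi nz(2)]
          unfolding u_def of_int_mult norm_mult if_P[OF True] by (simp del: of_int_prod of_nat_mult)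
        also have "\<dots> \<le> 1 * 1" using abc by (intro mult_mono) auto
        finally show ?thesis by simp
      qed (simp add: u_def)
      have v1: "cmod (v j) \<le> 1" for j
      proof (cases "j \<in> cols")
        case True
        then have nzi: "int (fst j * snd j) \<noteq> 0" using cp[OF True] by simp
        have "cmod (v j) = cmod (b (L * (snd j * fst j)))"
          using cmod_prod_local_sym[OF pD nz(1) nzi] cmod_prod_local_sym[OF pf nz(1) nzi]
          unfolding v_def of_int_mult norm_mult if_P[OF True] by (simp del: of_int_prod of_nat_mult)
        also have "\<dots> \<le> 1" using abc by simp
        finally show ?thesis .
      qed (simp add: v_def)
      have w1: "cmod (w x y) \<le> 1" for x y
        using om unfolding w_def mod8_inv_def norm_mult by simp
      have tm: "of_bool (cross (i, j)) * ?f (assemble (R, K, L, D) (i, j)) = u i * v j *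
        (of_bool (coprime (fst i) (snd j)) * (of_bool (coprime (snd i) (fst j)) *
         (of_bool (q1 j < fst i) * (of_bool (q2 j < snd i) *
          (w (fst i mod 8, snd i mod 8) (fst j mod 8, snd j mod 8) *
           (of_int (jac (int (fst j)) (fst i)) * of_int (jac (int (snd i)) (snd j))))))))"
        if ij: "i \<in> rows" "j \<in> cols" for i j
      proof -
        obtain m1 n1 where i: "i = (m1, n1)" by (cases i)
        obtain n2 m2 where j: "j = (n2, m2)" by (cases j)
        have p1: "m1 > 0" "n1 > 0" "odd m1" "odd n1" "squarefree m1" "squarefree n1" using rp[OF ij(1)] i by auto
        have p2: "n2 > 0" "m2 > 0" "odd n2" "odd m2" "squarefree n2" "squarefree m2" using cp[OF ij(2)] j by auto
        show ?thesis
        proof (cases "cross (i, j)")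
          case False
          \<comment> \<open>A failure of coprimality is matched on the right by a coprimality
            indicator or by a vanishing Jacobi symbol.\<close>
          then consider "\<not> coprime m1 m2" | "\<not> coprime n1 n2" | "jac (int n2) m1 = 0" | "jac (int n1) m2 = 0"
            using jac_eq_0_iff[OF p1(1), of "int n2"] jac_eq_0_iff[OF p2(2), of "int n1"]
            by (auto simp: cross_def i j coprime_commute)
          then show ?thesis using False by cases (auto simp: i j)
        next
          case True
          note asm = assembled[OF ij[unfolded i j] True[unfolded i j]]
          note chi = chi_assembled[OF ij[unfolded i j] True[unfolded i j] \<sigma>]
          define D0 where "D0 = D \<union> prime_factors m1 \<union> prime_factors m2"
          have co: "coprime m1 m2" "coprime n1 n2" "coprime m1 n2" "coprime n1 m2" using True by (auto simp: cross_def i j)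
          have dU: "(prime_factors m1 \<union> prime_factors n1) \<inter> U = {}" "(prime_factors m2 \<union> prime_factors n2) \<inter> U = {}"
            using ij by (auto simp: rows_def cols_def i j)
          have pp: "\<Prod>(prime_factors m1) = m1" "\<Prod>(prime_factors n1) = n1" "\<Prod>(prime_factors m2) = m2" "\<Prod>(prime_factors n2) = n2"
            using p1 p2 by (auto intro: prod_prime_factors_squarefree)
          have dd: "D \<inter> prime_factors m1 = {}" "(D \<union> prime_factors m1) \<inter> prime_factors m2 = {}"
            "UD \<inter> prime_factors n1 = {}" "(UD \<union> prime_factors n1) \<inter> prime_factors n2 = {}"
            using dU consistent(6) coprime_prime_factors[OF p1(1) p2(2)] coprime_prime_factors[OF p1(2) p2(1)] co
            unfolding UD_def by blast+
          have fD: "finite D" "finite UD" using oD oUD by (auto simp: oddprimes_def)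
          have "\<Prod>D0 = \<Prod>D * m1 * m2" unfolding D0_def using dd fD pp by (simp add: prod.union_disjoint)
          then have th1: "z1 < \<Prod>D0 \<longleftrightarrow> q1 j < m1"
            using div_less_iff_less_mult[of "\<Prod>D * m2" z1 m1] p2 prod_oddprimes_pos[OF oD] by (simp add: q1_def j mult_ac)
          have "\<Prod>(npr (K * (m1 * n1)) (L * (m2 * n2)) R - D0) = \<Prod>UD * n1 * n2"
            unfolding D0_def asm(9) UD_def[symmetric] using dd fD pp by (simp add: prod.union_disjoint)
          then have th2: "z2 < \<Prod>(npr (K * (m1 * n1)) (L * (m2 * n2)) R - D0) \<longleftrightarrow> q2 j < n1"
            using div_less_iff_less_mult[of "\<Prod>UD * n2" z2 n1] p2 prod_oddprimes_pos[OF oUD] by (simp add: q2_def j mult_ac)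
          have omi: "om (S * m) T R' = om (S * m') T R'" "om S (T * m) R' = om S (T * m') R'"
            if "odd m" "odd m'" "m mod 8 = m' mod 8" for S T R' m m'
            using om that unfolding mod8_inv_def by blast+
          have "even (x mod 8) \<longleftrightarrow> even x" for x :: nat by (simp add: dvd_mod_iff)
          then have "odd (m1 mod 8 * (n1 mod 8))" "odd (m2 mod 8 * (n2 mod 8))" "odd (m1 * n1)" "odd (m2 * n2)"
            using p1 p2 by simp_all
          then have ome: "om (K * (m1 * n1)) (L * (m2 * n2)) R = om (K * (m1 mod 8 * (n1 mod 8))) (L * (m2 mod 8 * (n2 mod 8))) R"
            using omi(1)[of "m1 * n1" "m1 mod 8 * (n1 mod 8)"] omi(2)[of "m2 * n2" "m2 mod 8 * (n2 mod 8)"] by (simp add: mod_mult_eq)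
          have m48: "x mod 8 mod 4 = x mod 4" for x :: nat by (simp add: mod_mod_cancel)
          have lhs: "of_bool (cross (i, j)) * ?f (assemble (R, K, L, D) (i, j)) = a (K * (m1 * n1)) * b (L * (m2 * n2)) * c R * om (K * (m1 * n1)) (L * (m2 * n2)) R *
            (of_bool (q1 j < m1) * of_bool (q2 j < n1) * of_int (\<Prod>p\<in>D0. local_sym p (\<sigma>1 * int (K * (m1 * n1)) * int R) (\<sigma>2 * int (L * (m2 * n2)) * int R)))"
            using True unfolding th1[symmetric] th2[symmetric] by (simp add: i j assemble_def summand_def D0_def)
          have rhsw: "w (fst i mod 8, snd i mod 8) (fst j mod 8, snd j mod 8) = om (K * (m1 * n1)) (L * (m2 * n2)) R * (if m1 mod 4 = 3 \<and> m2 mod 4 = 3 then -1 else 1)"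
            unfolding w_def by (simp add: i j ome m48)
          show ?thesis unfolding lhs rhsw unfolding D0_def chi u_def v_def if_P[OF ij(1)] if_P[OF ij(2)]
            using co by (simp add: i j o1_def o2_def mult_ac)
        qed
      qed
      have "cmod (\<Sum>x | x \<in> Om Nx Ny Nz bx \<and> others x = o'. ?f x) = cmod (\<Sum>i\<in>rows. \<Sum>j\<in>cols. of_bool (cross (i, j)) * ?f (assemble (R, K, L, D) (i, j)))"
        unfolding oe by (subst sum_fiber) simp
      also have "(\<Sum>i\<in>rows. \<Sum>j\<in>cols. of_bool (cross (i, j)) * ?f (assemble (R, K, L, D) (i, j))) = (\<Sum>i\<in>rows. \<Sum>j\<in>cols. u i * v j *
        (of_bool (coprime (fst i) (snd j)) * (of_bool (coprime (snd i) (fst j)) *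
         (of_bool (q1 j < fst i) * (of_bool (q2 j < snd i) *
          (w (fst i mod 8, snd i mod 8) (fst j mod 8, snd j mod 8) *
           (of_int (jac (int (fst j)) (fst i)) * of_int (jac (int (snd i)) (snd j)))))))))"
        by (intro sum.cong refl tm)
      also have "cmod \<dots> \<le> C * (real (2 * 2 ^ i1) * real (2 * 2 ^ i2) * (real (2 * 2 ^ i3) * real (2 * 2 ^ i4))) powr (1 + \<epsilon>) *
        (min (real (2 * 2 ^ i1)) (real (2 * 2 ^ i4)) powr (- 1 / 4) * min (real (2 * 2 ^ i3)) (real (2 * 2 ^ i2)) powr (- 1 / 4))"
        proof -
        have "rows \<subseteq> oddsf (2 * 2 ^ i1) \<times> oddsf (2 * 2 ^ i2)" "cols \<subseteq> oddsf (2 * 2 ^ i4) \<times> oddsf (2 * 2 ^ i3)"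
          unfolding rows_def cols_def by (auto simp: bx_def)
        then show ?thesis by (intro B allI u1 v1 w1) simp_all
      qed
      also have "\<dots> \<le> C * (16 powr (1 + \<epsilon>) * (2 ^ i1 * 2 ^ i2 * (2 ^ i3 * 2 ^ i4)) powr (1 + \<epsilon>)) *
        (min (2 ^ i1) (2 ^ i4) powr (- 1 / 4) * min (2 ^ i3) (2 ^ i2) powr (- 1 / 4))"
      proof (intro mult_mono mult_left_mono)
        have "(real (2 * 2 ^ i1) * real (2 * 2 ^ i2) * (real (2 * 2 ^ i3) * real (2 * 2 ^ i4))) = 16 * (2 ^ i1 * 2 ^ i2 * (2 ^ i3 * 2 ^ i4))"
          by simp
        then show "(real (2 * 2 ^ i1) * real (2 * 2 ^ i2) * (real (2 * 2 ^ i3) * real (2 * 2 ^ i4))) powr (1 + \<epsilon>) \<le> 16 powr (1 + \<epsilon>) * (2 ^ i1 * 2 ^ i2 * (2 ^ i3 * 2 ^ i4)) powr (1 + \<epsilon>)"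
          by (simp only: powr_mult)
        have mn: "min (real (2 * 2 ^ k)) (real (2 * 2 ^ l)) powr (- 1 / 4) \<le> min (2 ^ k) (2 ^ l) powr (- 1 / 4)" for k l :: nat
          by (rule powr_mono2') (auto simp: min_def)
        show "min (real (2 * 2 ^ i1)) (real (2 * 2 ^ i4)) powr (- 1 / 4) \<le> min (2 ^ i1) (2 ^ i4) powr (- 1 / 4)"
          "min (real (2 * 2 ^ i3)) (real (2 * 2 ^ i2)) powr (- 1 / 4) \<le> min (2 ^ i3) (2 ^ i2) powr (- 1 / 4)" by (rule mn)+
      qed (use C in auto)
      also have "\<dots> = Q" by (simp add: Q_def C'_def mult_ac)
      finally show ?thesis .
    qed
    have "(\<Sum>x\<in>Om Nx Ny Nz bx. ?f x) = (\<Sum>o'\<in>others ` Om Nx Ny Nz bx. \<Sum>x | x \<in> Om Nx Ny Nz bx \<and> others x = o'. ?f x)"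
      by (rule sum.image_gen) simp
    also have "cmod \<dots> \<le> (\<Sum>o'\<in>others ` Om Nx Ny Nz bx. Q)" by (rule order.trans[OF norm_sum sum_mono[OF fib]])
    also have "\<dots> = Q * card (others ` Om Nx Ny Nz bx)" by simp
    finally show "cmod (\<Sum>x\<in>Om Nx Ny Nz ((i1, i2), (i3, i4), r). ?f x)
    \<le> C' * (2 ^ i1 * 2 ^ i2 * (2 ^ i3 * 2 ^ i4)) powr (1 + \<epsilon>) * card (others ` Om Nx Ny Nz ((i1, i2), (i3, i4), r))
      * (min (2 ^ i1) (2 ^ i4) powr (- 1 / 4) * min (2 ^ i3) (2 ^ i2) powr (- 1 / 4))"
      unfolding bx_def Q_def by (simp add: mult_ac)
  qed
qed

section \<open>Counting a box\<close>

text \<open>All odd primes have even exponent, so at most a factor 2 separates \<open>q\<close> from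
  a square.\<close>

lemma square_or_twice_square:
  assumes "q > 0" "oddpr q = {}"
  shows "\<exists>f\<in>{0, 1}. \<exists>a. q = 2 ^ f * a ^ 2"
proof -
  define f where "f = multiplicity 2 q mod 2"
  define q' where "q' = q div 2 ^ f"
  have "(2::nat) ^ f dvd 2 ^ multiplicity 2 q" unfolding f_def by (intro le_imp_power_dvd) simp
  then have "2 ^ f dvd q" using multiplicity_dvd[of 2 q] dvd_trans by blast
  then have q: "q = 2 ^ f * q'" by (simp add: q'_def)
  then have q'0: "q' > 0" using assms(1) by (auto intro: Nat.gr0I)
  have f01: "f \<in> {0, 1}" by (auto simp: f_def)
  have mq: "multiplicity p q = multiplicity p (2 ^ f) + multiplicity p q'" if "prime p" for p
    unfolding q using that q'0 by (intro prime_elem_multiplicity_mult_distrib) auto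
  have "2 dvd multiplicity p q'" if p: "prime p" for p
  proof (cases "p = 2")
    case True
    have "multiplicity 2 ((2::nat) ^ f) = f" by (simp add: multiplicity_same_power)
    then have "multiplicity 2 q = f + multiplicity 2 q'" using mq[OF p] True by simp
    then show ?thesis unfolding True f_def by presburger
  next
    case False
    then have "odd p" using primes_dvd_imp_eq[OF two_is_prime_nat p] by auto
    have "\<not> p dvd 2 ^ f" using False p primes_dvd_imp_eq[OF p two_is_prime_nat] prime_dvd_power by blast
    then have "multiplicity p (2 ^ f) = 0" by (rule not_dvd_imp_multiplicity_0)
    moreover have "even (multiplicity p q)" using assms(2) p \<open>odd p\<close> by (auto simp: oddpr_def)
    ultimately show ?thesis using mq[OF p] by simp
  qed
  then have "is_nth_power 2 q'" by (simp add: is_nth_power_conv_multiplicity_nat)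
  then obtain a where "q' = a ^ 2" unfolding is_nth_power_def by blast
  then show ?thesis using q f01 by blast
qed

lemma floor_log_bounds: "n > 0 \<Longrightarrow> 2 ^ floor_log n \<le> n" "n < 2 * 2 ^ floor_log n"
  using floor_log_exp2_le[of n] floor_log_exp2_gt[of n] by auto

lemma floor_log_prod_split:
  assumes "oddprimes A"
  shows "2 ^ floor_log (\<Prod>(A \<inter> D)) * 2 ^ floor_log (\<Prod>(A - D)) \<le> \<Prod>A"
    "\<Prod>A < 4 * (2 ^ floor_log (\<Prod>(A \<inter> D)) * 2 ^ floor_log (\<Prod>(A - D)))"
proof -
  have o: "oddprimes (A \<inter> D)" "oddprimes (A - D)" by (rule oddprimes_mono[OF assms], blast)+
  have e: "\<Prod>A = \<Prod>(A \<inter> D) * \<Prod>(A - D)" using assms by (simp add: oddprimes_def prod.Int_Diff[of A "\<lambda>x. x" D])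
  note p = o[THEN prod_oddprimes_pos]
  show "2 ^ floor_log (\<Prod>(A \<inter> D)) * 2 ^ floor_log (\<Prod>(A - D)) \<le> \<Prod>A"
    unfolding e using p by (intro mult_mono floor_log_bounds) auto
  have "\<Prod>(A \<inter> D) * \<Prod>(A - D) < (2 * 2 ^ floor_log (\<Prod>(A \<inter> D))) * (2 * 2 ^ floor_log (\<Prod>(A - D)))"
    using p by (intro mult_strict_mono floor_log_bounds) auto
  then show "\<Prod>A < 4 * (2 ^ floor_log (\<Prod>(A \<inter> D)) * 2 ^ floor_log (\<Prod>(A - D)))" unfolding e by simp
qed

context fiber
begin

lemma size:
  "K * (2 ^ fst (fst b) * 2 ^ snd (fst b)) \<le> Nx" "L * (2 ^ fst (fst (snd b)) * 2 ^ snd (fst (snd b))) \<le> Ny"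
proof -
  obtain S T D0 where x: "(S, T, R, D0) \<in> Om Nx Ny Nz b" and
    K: "K = S div \<Prod>(spr S T R)" and L: "L = T div \<Prod>(spr T S R)"
    using o by (auto simp: others_def)
  have pos: "S > 0" "T > 0" "S \<le> Nx" "T \<le> Ny" "boxof S T R D0 = b" using x by (auto simp: Om_def)
  have sub: "spr S T R \<subseteq> oddpr S" "spr T S R \<subseteq> oddpr T" by (auto simp: spr_def)
  have o: "oddprimes (spr S T R)" "oddprimes (spr T S R)" using sub pos oddprimes_oddpr oddprimes_mono by blast+
  have "K * (2 ^ fst (fst b) * 2 ^ snd (fst b)) \<le> K * \<Prod>(spr S T R)"
    using floor_log_prod_split(1)[OF o(1), of D0] pos(5) by (intro mult_left_mono) (auto simp: boxof_def)
  also have "\<dots> = S" using oddpr_quotient(1)[OF pos(1) sub(1)] K by simp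
  finally show "K * (2 ^ fst (fst b) * 2 ^ snd (fst b)) \<le> Nx" using pos by simp
  have "L * (2 ^ fst (fst (snd b)) * 2 ^ snd (fst (snd b))) \<le> L * \<Prod>(spr T S R)"
    using floor_log_prod_split(1)[OF o(2), of D0] pos(5) by (intro mult_left_mono) (auto simp: boxof_def)
  also have "\<dots> = T" using oddpr_quotient(1)[OF pos(2) sub(2)] L by simp
  finally show "L * (2 ^ fst (fst (snd b)) * 2 ^ snd (fst (snd b))) \<le> Ny" using pos by simp
qed

text \<open>A prime with odd exponent in exactly two of \<open>K\<close>, \<open>L\<close>,
  \<open>R\<close> has even exponent in the product. As none is private to \<open>K\<close> or to
  \<open>L\<close>, odd exponents come from \<open>A\<close>, shared by all three, and from
  \<open>B\<close>, private to \<open>R\<close>. Splitting off \<open>g ^ 3\<close> and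
  \<open>\<rho>\<close> leaves a square or twice a square. The range of \<open>\<rho>\<close> is
  prescribed by the box, which is what makes the products sparse.\<close>

lemma product_shape:
  "\<exists>f\<in>{0, 1}. \<exists>a>0. \<exists>g>0. \<exists>\<rho>. K * L * R = 2 ^ f * (a ^ 2 * g ^ 3 * \<rho>) \<and>
    2 ^ fst (fst (snd (snd b))) * 2 ^ snd (fst (snd (snd b))) \<le> \<rho> \<and>
    \<rho> < 4 * (2 ^ fst (fst (snd (snd b))) * 2 ^ snd (fst (snd (snd b))))"
proof -
  define A where "A = oddpr K \<inter> oddpr L \<inter> oddpr R"
  define B where "B = oddpr R - oddpr K - oddpr L"
  have pos: "K > 0" "L > 0" "R > 0" using consistent by auto
  have oR: "oddprimes (oddpr R)" using pos oddprimes_oddpr by auto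
  have oA: "oddprimes A" and oB: "oddprimes B" by (rule oddprimes_mono[OF oR], auto simp: A_def B_def)+
  have s: "A \<subseteq> oddpr K" "A \<subseteq> oddpr L" "A \<union> B \<subseteq> oddpr R" by (auto simp: A_def B_def)
  note qK = oddpr_quotient[OF pos(1) s(1)] and qL = oddpr_quotient[OF pos(2) s(2)] and qR = oddpr_quotient[OF pos(3) s(3)]
  define K' L' R' where "K' = K div \<Prod>A" and "L' = L div \<Prod>A" and "R' = R div \<Prod>(A \<union> B)"
  define g where "g = \<Prod>A"
  define \<rho> where "\<rho> = \<Prod>B"
  have "A \<inter> B = {}" by (auto simp: A_def B_def)
  then have AB: "\<Prod>(A \<union> B) = g * \<rho>" using oA oB by (simp add: prod.union_disjoint oddprimes_def g_def \<rho>_def)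
  have e: "K = K' * g" "L = L' * g" "R = R' * (g * \<rho>)"
    using qK(1) qL(1) qR(1) unfolding AB[unfolded g_def] K'_def L'_def R'_def g_def by auto
  have p': "K' > 0" "L' > 0" "R' > 0" using qK(3) qL(3) qR(3) by (simp_all add: K'_def L'_def R'_def)
  have o': "oddpr K' = oddpr K - A" "oddpr L' = oddpr L - A" "oddpr R' = oddpr R - (A \<union> B)"
    using qK(2) qL(2) qR(2) by (simp_all add: K'_def L'_def R'_def)
  have KL: "K' * L' > 0" using p' by simp
  have "p \<notin> oddpr (K' * L' * R')" for p
    unfolding oddpr_mult[OF KL p'(3)] oddpr_mult[OF p'(1,2)] o' using consistent(4,5) by (auto simp: A_def B_def)
  then have "oddpr (K' * L' * R') = {}" by blast
  then obtain f a where fa: "f \<in> {0, 1}" "K' * L' * R' = 2 ^ f * a ^ 2"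
    using square_or_twice_square[of "K' * L' * R'"] mult_pos_pos[OF KL p'(3)] by blast
  have "a > 0" using fa p' by (intro Nat.gr0I) auto
  moreover have "g > 0" using prod_oddprimes_pos[OF oA] by (simp add: g_def)
  moreover have "K * L * R = (K' * L' * R') * (g ^ 3 * \<rho>)"
    by (subst e(1), subst e(2), subst e(3)) (simp add: power3_eq_cube mult_ac)
  then have "K * L * R = 2 ^ f * (a ^ 2 * g ^ 3 * \<rho>)" unfolding fa(2) by (simp add: mult_ac)
  moreover have "2 ^ fst (fst (snd (snd b))) * 2 ^ snd (fst (snd (snd b))) \<le> \<rho>"
    "\<rho> < 4 * (2 ^ fst (fst (snd (snd b))) * 2 ^ snd (fst (snd (snd b))))"
    using floor_log_prod_split[OF oB, of D] consistent(8,9) by (auto simp: B_def \<rho>_def)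
  ultimately show ?thesis using fa(1) by blast
qed

end

text \<open>\<open>D\<close> is recovered from its product, so a tuple amounts to four divisors of
  \<open>M\<close>.\<close>

lemma card_divisor_tuples:
  fixes M :: nat
  assumes "M > 0"
    and "\<And>o'. o' \<in> A \<Longrightarrow> (case o' of (R, K, L, D) \<Rightarrow> oddprimes D \<and> K * L * R = M \<and> D \<subseteq> prime_factors M)"
  shows "card A \<le> card {d. d dvd M} ^ 4"
proof -
  let ?d = "{d. d dvd M}"
  let ?\<phi> = "\<lambda>(R, K, L, D). (R, K, L, \<Prod>D)"
  have fin: "finite ?d" using assms(1) by simp
  have "inj_on ?\<phi> A"
  proof (rule inj_onI)
    fix x y assume "x \<in> A" "y \<in> A" "?\<phi> x = ?\<phi> y"
    then show "x = y" using assms(2)[of x] assms(2)[of y]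
      by (cases x; cases y) (auto dest: prime_factors_prod_oddprimes, (metis prime_factors_prod_oddprimes)+)
  qed
  moreover have "?\<phi> ` A \<subseteq> ?d \<times> ?d \<times> ?d \<times> ?d"
  proof
    fix y assume "y \<in> ?\<phi> ` A"
    then obtain R K L D where x: "(R, K, L, D) \<in> A" "y = (R, K, L, \<Prod>D)" by auto
    have e: "K * L * R = M" "D \<subseteq> prime_factors M" using assms(2)[OF x(1)] by auto
    have "\<Prod>D dvd M" by (rule prod_dvd_of_subset_prime_factors[OF assms(1) e(2)])
    then show "y \<in> ?d \<times> ?d \<times> ?d \<times> ?d" using e(1) x(2) by auto
  qed
  ultimately have "card A \<le> card (?d \<times> ?d \<times> ?d \<times> ?d)" using fin by (intro card_inj_on_le[of ?\<phi>]) auto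
  also have "\<dots> = card ?d ^ 4" by (simp add: card_cartesian_product power4_eq_xxxx mult_ac)
  finally show ?thesis .
qed

text \<open>The products \<open>M = K * L * R\<close> are at most \<open>N / Q\<close> and have the
  sparse shape of \<open>product_shape\<close>, with \<open>\<rho>\<close> of size about
  \<open>P\<close>. Rankin's trick with exponent 1/2 counts about \<open>sqrt (N * P / Q)\<close> of
  them, and each \<open>M\<close> arises from few tuples. This square root is the density that later
  offsets a poor sieve saving.\<close>

lemma count_others:
  assumes \<epsilon>: "\<epsilon> > 0"
  shows "\<exists>C\<ge>1. \<forall>Nx\<ge>1. \<forall>Ny\<ge>1. \<forall>Nz\<ge>1. \<forall>i1 i2 i3 i4 i5 i6 r.
    2 ^ i1 * 2 ^ i2 * (2 ^ i3 * 2 ^ i4) * real (card (others ` Om Nx Ny Nz ((i1, i2), (i3, i4), (i5, i6), r)))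
    \<le> C * (real Nx * real Ny * real Nz) powr \<epsilon> * sqrt (real Nx * real Ny * real Nz * (2 ^ i1 * 2 ^ i2 * (2 ^ i3 * 2 ^ i4) * (2 ^ i5 * 2 ^ i6)))"
proof -
  \<comment> \<open>Four for the divisors that encode a tuple, two for the harmonic sums over
    \<open>a\<close> and \<open>g\<close>.\<close>
  define \<delta> where "\<delta> = \<epsilon> / 6"
  have \<delta>: "\<delta> > 0" using \<epsilon> by (simp add: \<delta>_def)
  obtain C1 where C1: "C1 \<ge> 1" "\<And>n. n \<ge> 1 \<Longrightarrow> real (card {d. d dvd n}) \<le> C1 * real n powr \<delta>"
    using divisor_bound[OF \<delta>] by auto
  define H where "H = 1 + 1 / \<delta>"
  have H: "H \<ge> 1" using \<delta> by (simp add: H_def)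
  define C where "C = 8 * (C1 ^ 4 * H ^ 2)"
  have "1 * 1 \<le> C1 ^ 4 * H ^ 2" using C1(1) H by (intro mult_mono one_le_power) auto
  then have C: "C \<ge> 1" by (simp add: C_def)
  show ?thesis
  proof (intro exI[of _ C] conjI C allI impI)
    fix Nx Ny Nz i1 i2 i3 i4 i5 i6 :: nat and r
    assume N1: "1 \<le> Nx" "1 \<le> Ny" "1 \<le> Nz"
    define bx :: box where "bx = ((i1, i2), (i3, i4), (i5, i6), r)"
    define N where "N = Nx * Ny * Nz"
    define Q where "Q = (2::nat) ^ i1 * 2 ^ i2 * (2 ^ i3 * 2 ^ i4)"
    define P where "P = (2::nat) ^ i5 * 2 ^ i6"
    have NQP: "N \<ge> 1" "Q \<ge> 1" "P \<ge> 1" using N1 by (simp_all add: N_def Q_def P_def)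
    define Ot where "Ot = others ` Om Nx Ny Nz bx"
    define pr where "pr = (\<lambda>(R, K, L, D :: nat set). K * L * R :: nat)"
    have finO: "finite Ot" unfolding Ot_def by simp
    define h where "h = (\<lambda>(f, a, g, \<rho>). (2::nat) ^ f * (a ^ 2 * g ^ 3 * \<rho>))"
    define I where "I = {0, 1 :: nat} \<times> {1..N} \<times> {1..N} \<times> {P..<4 * P}"
    have finI: "finite I" by (simp add: I_def)
    have one: "pr o' > 0 \<and> pr o' * Q \<le> N \<and> pr o' \<in> h ` I" if "o' \<in> Ot" for o'
    proof -
      obtain R K L D where oe: "o' = (R, K, L, D)" by (cases o')
      interpret fiber Nx Ny Nz bx R K L D by unfold_locales (use that oe in \<open>simp add: Ot_def\<close>)
      have pos: "K > 0" "L > 0" "R > 0" "R \<le> Nz" using consistent by auto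
      have le: "K * (2 ^ i1 * 2 ^ i2) \<le> Nx" "L * (2 ^ i3 * 2 ^ i4) \<le> Ny" using size by (simp_all add: bx_def)
      have p0: "pr o' > 0" using pos by (simp add: pr_def oe)
      have "(K * (2 ^ i1 * 2 ^ i2)) * (L * (2 ^ i3 * 2 ^ i4)) * R \<le> Nx * Ny * Nz"
        using le pos by (intro mult_le_mono) auto
      then have pQ: "pr o' * Q \<le> N" by (simp add: pr_def oe Q_def N_def mult_ac)
      then have pN: "pr o' \<le> N" using NQP by (metis le_trans mult_le_mono2 mult.right_neutral)
      obtain f a g \<rho> where s: "f \<in> {0, 1}" "a > 0" "g > 0" "K * L * R = 2 ^ f * (a ^ 2 * g ^ 3 * \<rho>)" "P \<le> \<rho>" "\<rho> < 4 * P"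
        using product_shape unfolding bx_def P_def fst_conv snd_conv by blast
      have "pr o' = h (f, a, g, \<rho>)" using s by (simp add: pr_def oe h_def)
      have \<rho>0: "\<rho> > 0" using s NQP by simp
      have "a dvd K * L * R" "g dvd K * L * R" unfolding s(4) by (simp_all add: power2_eq_square power3_eq_cube)
      then have "a \<le> K * L * R" "g \<le> K * L * R" using pos by (auto intro!: dvd_imp_le)
      then have "(f, a, g, \<rho>) \<in> I" using s pN by (auto simp: I_def pr_def oe)
      then show ?thesis using p0 pQ \<open>pr o' = h (f, a, g, \<rho>)\<close> by auto
    qed
    have fibre: "real (card {o' \<in> Ot. pr o' = M}) \<le> C1 ^ 4 * real N powr (4 * \<delta>)" if Mi: "M \<in> pr ` Ot" for M
    proof -
      have M: "M > 0" "M \<le> N"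
      proof -
        obtain o' where o': "M = pr o'" "o' \<in> Ot" using Mi by (rule imageE)
        have "M > 0" "M * Q \<le> N" using one[OF o'(2)] unfolding o'(1) by blast+
        moreover have "M \<le> M * Q" using NQP(2) by simp
        ultimately show "M > 0" "M \<le> N" using order_trans by blast+
      qed
      have "card {o' \<in> Ot. pr o' = M} \<le> card {d. d dvd M} ^ 4"
      proof (rule card_divisor_tuples[OF M(1)])
        fix o' assume o': "o' \<in> {o' \<in> Ot. pr o' = M}"
        obtain R K L D where oe: "o' = (R, K, L, D)" by (cases o')
        interpret fiber Nx Ny Nz bx R K L D by unfold_locales (use o' oe in \<open>simp add: Ot_def\<close>)
        have pos: "K > 0" "L > 0" "R > 0" using consistent by auto
        have e: "K * L * R = M" using o' by (simp add: oe pr_def)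
        have "oddprimes U" unfolding U_def using pos by (intro oddprimes_Un oddprimes_oddpr)
        then have "oddprimes D" using consistent(6) oddprimes_mono[of U D] by blast
        moreover have "D \<subseteq> prime_factors M"
        proof
          fix p assume "p \<in> D"
          then have "p \<in> oddpr K \<union> oddpr L \<union> oddpr R" using consistent(6) by (auto simp: U_def)
          then have "p \<in> prime_factors K \<union> prime_factors L \<union> prime_factors R" using oddpr_subset pos by blast
          then show "p \<in> prime_factors M" unfolding e[symmetric] using pos by (simp add: prime_factors_product)
        qed
        ultimately show "case o' of (R, K, L, D) \<Rightarrow> oddprimes D \<and> K * L * R = M \<and> D \<subseteq> prime_factors M"
          using e by (simp add: oe)
      qed
      then have "real (card {o' \<in> Ot. pr o' = M}) \<le> real (card {d. d dvd M}) ^ 4"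
        unfolding of_nat_power[symmetric] of_nat_le_iff .
      also have "\<dots> \<le> (C1 * real M powr \<delta>) ^ 4" using C1(2)[of M] M by (intro power_mono) auto
      also have "(C1 * real M powr \<delta>) ^ 4 = C1 ^ 4 * real M powr (4 * \<delta>)"
        unfolding power_mult_distrib by (simp add: power4_eq_xxxx powr_add[symmetric])
      also have "\<dots> \<le> C1 ^ 4 * real N powr (4 * \<delta>)" using M C1(1) \<delta> by (intro mult_left_mono powr_mono2) auto
      finally show ?thesis .
    qed
    have "real (card (pr ` Ot)) = (\<Sum>M\<in>pr ` Ot. 1)" by simp
    \<comment> \<open>Rankin's trick: \<open>M \<le> N / Q\<close> makes each weight at least 1,
      after which the range of \<open>M\<close> may be enlarged to all numbers of the given
      shape.\<close>
    also have "\<dots> \<le> (\<Sum>M\<in>pr ` Ot. sqrt (N / Q) / sqrt M)"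
    proof (rule sum_mono)
      fix M assume "M \<in> pr ` Ot"
      then obtain o' where o': "M = pr o'" "o' \<in> Ot" by (rule imageE)
      have M: "M > 0" "M * Q \<le> N" using one[OF o'(2)] unfolding o'(1) by blast+
      have "real M * real Q \<le> real N" using M(2) unfolding of_nat_mult[symmetric] of_nat_le_iff .
      then have "real M \<le> N / Q" using NQP by (simp add: field_simps)
      then show "1 \<le> sqrt (N / Q) / sqrt M" using M(1) by simp
    qed
    also have "\<dots> \<le> (\<Sum>M\<in>h ` I. sqrt (N / Q) / sqrt M)"
      proof (rule sum_mono2)
      show "pr ` Ot \<subseteq> h ` I" using one by blast
      show "finite (h ` I)" by (simp add: I_def)
    qed simp
    also have "\<dots> \<le> (\<Sum>x\<in>I. sqrt (N / Q) / sqrt (h x))"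
      using sum_image_le[of I "\<lambda>M. sqrt (N / Q) / sqrt (real M)" h] finI by (simp add: o_def)
    \<comment> \<open>Using \<open>g ^ 3 \<ge> g ^ 2\<close> and \<open>\<rho> \<ge> P\<close>, the
      square root of \<open>M\<close> is at least \<open>a * g * sqrt P\<close>, so the sums over
      \<open>a\<close> and \<open>g\<close> are harmonic.\<close>
    also have "\<dots> \<le> (\<Sum>(f, a, g, \<rho>)\<in>I. sqrt (N / Q) * (1 / sqrt P) * (inverse (real a) * inverse (real g)))"
    proof (intro sum_mono)
      fix x assume x: "x \<in> I"
      obtain f a g \<rho> where xe: "x = (f, a, g, \<rho>)" by (cases x)
      have p: "a > 0" "g > 0" "P \<le> \<rho>" using x by (auto simp: I_def xe)
      have "(a * g)\<^sup>2 * P \<le> 2 ^ f * (a ^ 2 * g ^ 3 * \<rho>)"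
      proof -
        have "(a * g)\<^sup>2 * P \<le> a ^ 2 * g ^ 3 * \<rho>"
          using p by (intro mult_le_mono) (auto simp: power_mult_distrib intro!: mult_le_mono2 power_increasing)
        also have "\<dots> \<le> 2 ^ f * (a ^ 2 * g ^ 3 * \<rho>)" by simp
        finally show ?thesis .
      qed
      then have "real ((a * g)\<^sup>2 * P) \<le> real (h x)" by (simp only: xe h_def prod.case of_nat_le_iff)
      then have "sqrt (real ((a * g)\<^sup>2 * P)) \<le> sqrt (h x)" by (rule real_sqrt_le_mono)
      also have "sqrt (real ((a * g)\<^sup>2 * P)) = real a * real g * sqrt P" by (simp add: real_sqrt_mult)
      finally have le: "real a * real g * sqrt P \<le> sqrt (h x)" .
      have gt: "real a * real g * sqrt P > 0" using p NQP by simp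
      have "sqrt (N / Q) / sqrt (h x) \<le> sqrt (N / Q) / (real a * real g * sqrt P)"
        by (intro divide_left_mono le mult_pos_pos[OF order.strict_trans2[OF gt le] gt]) simp
      then show "sqrt (N / Q) / sqrt (h x) \<le> (case x of (f, a, g, \<rho>) \<Rightarrow> sqrt (N / Q) * (1 / sqrt P) * (inverse (real a) * inverse (real g)))"
        by (simp add: xe field_simps)
    qed
    \<comment> \<open>Two values of \<open>f\<close> and \<open>3 * P\<close> values of
      \<open>\<rho>\<close>.\<close>
    also have "\<dots> = sqrt (N / Q) * (1 / sqrt P) * (2 * (harm N * (harm N * (3 * real P))))"
    proof -
      have "(\<Sum>(f, a, g, \<rho>)\<in>I. sqrt (N / Q) * (1 / sqrt P) * (inverse (real a) * inverse (real g)))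
        = (\<Sum>f\<in>{0, 1 :: nat}. \<Sum>a\<in>{1..N}. \<Sum>g\<in>{1..N}. \<Sum>\<rho>\<in>{P..<4 * P}. sqrt (N / Q) * (1 / sqrt P) * (inverse (real a) * inverse (real g)))"
        unfolding I_def by (simp only: sum.cartesian_product[symmetric] prod.case case_prod_beta fst_conv snd_conv)
      also have "\<dots> = sqrt (N / Q) * (1 / sqrt P) * (2 * (\<Sum>a\<in>{1..N}. inverse (real a) * (\<Sum>g\<in>{1..N}. inverse (real g) * (3 * real P))))"
        by (simp add: sum_distrib_left sum_distrib_right mult_ac)
      also have "\<dots> = sqrt (N / Q) * (1 / sqrt P) * (2 * (harm N * (harm N * (3 * real P))))"
        by (simp add: harm_def sum_distrib_right[symmetric] del: One_nat_def)
      finally show ?thesis .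
    qed
    also have "\<dots> = 6 * harm N ^ 2 * (sqrt (N / Q) * sqrt P)"
      using NQP by (simp add: power2_eq_square field_simps)
    also have "\<dots> \<le> 8 * (H * real N powr \<delta>) ^ 2 * (sqrt (N / Q) * sqrt P)"
      using harm_le_powr[OF \<delta> NQP(1)] harm_nonneg by (intro mult_mono mult_right_mono power_mono) (auto simp: H_def)
    finally have im: "real (card (pr ` Ot)) \<le> 8 * (H * real N powr \<delta>) ^ 2 * (sqrt (N / Q) * sqrt P)" .
    have "real (card Ot) = (\<Sum>o'\<in>Ot. 1)" by simp
    also have "\<dots> = (\<Sum>M\<in>pr ` Ot. \<Sum>o' | o' \<in> Ot \<and> pr o' = M. 1)" by (rule sum.image_gen[OF finO])
    also have "\<dots> = (\<Sum>M\<in>pr ` Ot. real (card {o' \<in> Ot. pr o' = M}))" by simp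
    also have "\<dots> \<le> (\<Sum>M\<in>pr ` Ot. C1 ^ 4 * real N powr (4 * \<delta>))" by (intro sum_mono fibre)
    also have "\<dots> = real (card (pr ` Ot)) * (C1 ^ 4 * real N powr (4 * \<delta>))" by simp
    also have "\<dots> \<le> (8 * (H * real N powr \<delta>) ^ 2 * (sqrt (N / Q) * sqrt P)) * (C1 ^ 4 * real N powr (4 * \<delta>))"
      using C1(1) by (intro mult_right_mono[OF im]) auto
    also have "\<dots> = C * ((real N powr \<delta>) ^ 2 * real N powr (4 * \<delta>)) * (sqrt (N / Q) * sqrt P)"
      by (simp add: C_def power_mult_distrib mult_ac)
    also have "(real N powr \<delta>) ^ 2 * real N powr (4 * \<delta>) = real N powr \<epsilon>"
      by (simp add: power2_eq_square powr_add[symmetric] \<delta>_def)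
    finally have "real Q * real (card Ot) \<le> real Q * (C * real N powr \<epsilon> * (sqrt (N / Q) * sqrt P))"
      by (intro mult_left_mono) auto
    also have "\<dots> = C * real N powr \<epsilon> * (real Q * sqrt (N / Q) * sqrt P)" by (simp add: mult_ac)
    also have "real Q * sqrt (N / Q) * sqrt P = sqrt (real N * (real Q * real P))"
    proof -
      have "real Q * sqrt (N / Q) = sqrt N * sqrt Q" proof -
        have "real Q * sqrt (N / Q) = sqrt N * (real Q / sqrt Q)" by (simp add: real_sqrt_divide)
        then show ?thesis by (simp only: real_div_sqrt of_nat_0_le_iff)
      qed
      then show ?thesis by (simp add: real_sqrt_mult mult_ac)
    qed
    finally show "2 ^ i1 * 2 ^ i2 * (2 ^ i3 * 2 ^ i4) * real (card (others ` Om Nx Ny Nz ((i1, i2), (i3, i4), (i5, i6), r)))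
    \<le> C * (real Nx * real Ny * real Nz) powr \<epsilon> * sqrt (real Nx * real Ny * real Nz * (2 ^ i1 * 2 ^ i2 * (2 ^ i3 * 2 ^ i4) * (2 ^ i5 * 2 ^ i6)))"
      unfolding N_def Q_def P_def Ot_def bx_def by simp
  qed
qed

text \<open>Over fixed frozen data an element is determined by its four active variables, each at
  most twice its dyadic size.\<close>

lemma card_Om:
  "card (Om Nx Ny Nz ((i1, i2), (i3, i4), r)) \<le> 16 * (2 ^ i1 * 2 ^ i2 * (2 ^ i3 * 2 ^ i4)) * card (others ` Om Nx Ny Nz ((i1, i2), (i3, i4), r))"
proof -
  define bx :: box where "bx = ((i1, i2), (i3, i4), r)"
  have sf: "finite (oddsf Q) \<and> card (oddsf Q) \<le> Q" for Q
    proof -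
    have "oddsf Q \<subseteq> {1..Q}" by (auto simp: oddsf_def)
    then show ?thesis using card_mono[of "{1..Q}" "oddsf Q"] finite_subset[of "oddsf Q" "{1..Q}"] by simp
  qed
  have fib: "card {x \<in> Om Nx Ny Nz bx. others x = o'} \<le> 16 * (2 ^ i1 * 2 ^ i2 * (2 ^ i3 * 2 ^ i4))"
    if o': "o' \<in> others ` Om Nx Ny Nz bx" for o'
  proof -
    obtain R K L D where oe: "o' = (R, K, L, D)" by (cases o') auto
    interpret fiber Nx Ny Nz bx R K L D by unfold_locales (use o' oe in simp)
    have "inj_on active {x \<in> Om Nx Ny Nz bx. others x = o'}"
      by (rule inj_on_inverseI[of _ "assemble (R, K, L, D)"]) (use disassembled(4) oe in auto)
    moreover have "active ` {x \<in> Om Nx Ny Nz bx. others x = o'} \<subseteq> rows \<times> cols"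
      proof
      fix y assume "y \<in> active ` {x \<in> Om Nx Ny Nz bx. others x = o'}"
      then obtain x where x: "x \<in> Om Nx Ny Nz bx" "others x = (R, K, L, D)" "y = active x" using oe by auto
      obtain S T R' D0 where "x = (S, T, R', D0)" by (cases x)
      then show "y \<in> rows \<times> cols" using x disassembled(1,2)[of S T R' D0] by (simp add: mem_Times_iff)
    qed
    moreover have sub: "rows \<times> cols \<subseteq> (oddsf (2 * 2 ^ i1) \<times> oddsf (2 * 2 ^ i2)) \<times> (oddsf (2 * 2 ^ i4) \<times> oddsf (2 * 2 ^ i3))"
      unfolding rows_def cols_def by (auto simp: bx_def)
    ultimately have "card {x \<in> Om Nx Ny Nz bx. others x = o'} \<le> card ((oddsf (2 * 2 ^ i1) \<times> oddsf (2 * 2 ^ i2)) \<times> (oddsf (2 * 2 ^ i4) \<times> oddsf (2 * 2 ^ i3)))"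
      using sf by (intro card_inj_on_le[of active]) auto
    also have "\<dots> \<le> (2 * 2 ^ i1 * (2 * 2 ^ i2)) * (2 * 2 ^ i4 * (2 * 2 ^ i3))"
      unfolding card_cartesian_product using sf by (intro mult_le_mono) blast+
    finally show ?thesis by (simp add: mult_ac)
  qed
  have "card (Om Nx Ny Nz bx) = (\<Sum>x\<in>Om Nx Ny Nz bx. 1)" by simp
  also have "\<dots> = (\<Sum>o'\<in>others ` Om Nx Ny Nz bx. \<Sum>x | x \<in> Om Nx Ny Nz bx \<and> others x = o'. 1)" by (rule sum.image_gen) simp
  also have "\<dots> = (\<Sum>o'\<in>others ` Om Nx Ny Nz bx. card {x \<in> Om Nx Ny Nz bx. others x = o'})" by simp
  also have "\<dots> \<le> (\<Sum>o'\<in>others ` Om Nx Ny Nz bx. 16 * (2 ^ i1 * 2 ^ i2 * (2 ^ i3 * 2 ^ i4)))" by (intro sum_mono fib)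
  finally show ?thesis by (simp add: bx_def mult_ac)
qed

section \<open>Symmetry and the bound for one box\<close>

text \<open>The underlying conic has the point (1, 1, 0). The check uses the closed formula, which
  also covers even exponents at odd primes.\<close>

lemma local_sym_neg_self:
  assumes p: "prime p" and b: "b \<noteq> 0"
  shows "local_sym p (- b) b = 1"
proof -
  have p2: "p = 2 \<or> odd p" using p prime_odd_nat[of p] prime_ge_2_nat[of p] by force
  define u where "u = upart p b"
  have u: "\<not> int p dvd u" using upart(2)[OF p b] by (simp add: u_def)
  have "b = int p ^ multiplicity (int p) b * u" using upart(1)[OF p b] by (simp add: u_def)
  moreover have "int p ^ multiplicity (int p) b \<noteq> 0" using prime_gt_0_nat[OF p] by simp
  ultimately have um: "upart p (- b) = - u" unfolding upart_def multiplicity_uminus_right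
    by (metis mult_minus_right nonzero_mult_div_cancel_left)
  show ?thesis
  proof (cases "p = 2")
    case True
    then have "odd u" using u by simp
    then show ?thesis using sign_uminus[of u] sign_values[of u]
      unfolding local_sym_def Let_def um u_def[symmetric] multiplicity_uminus_right by (auto simp: True)
  next
    case False
    then have odd: "odd p" using p2 by simp
    have "Legendre (- u) (int p) = Legendre (-1) (int p) * Legendre u (int p)" using Legendre_mult[OF p odd, of "-1" u] by simp
    moreover have "Legendre u (int p) = 1 \<or> Legendre u (int p) = -1" using Legendre_unit[OF u] by auto
    moreover have "\<not> int p dvd -1" using prime_gt_1_nat[OF p] by auto
    then have "Legendre (-1) (int p) = 1 \<or> Legendre (-1) (int p) = -1" using Legendre_unit[of p "-1"] by auto
    ultimately show ?thesis
      unfolding local_sym_def Let_def um u_def[symmetric] multiplicity_uminus_right by (auto simp: False)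
  qed
qed

text \<open>
  The identity \<open>(a, b) = (- a b, b)\<close> makes the symbol symmetric, up to signs, in the three variables,
  so that a bound exploiting oscillation in \<open>S\<close> and \<open>T\<close> is available for each of the three pairs.
\<close>

lemma local_sym_swap:
  assumes p: "prime p" and nz: "\<sigma>1 \<noteq> 0" "\<sigma>2 \<noteq> 0" "S \<noteq> 0" "T \<noteq> 0" "R \<noteq> 0"
  shows "local_sym p (\<sigma>1 * S * R) (\<sigma>2 * T * R) = local_sym p (- (\<sigma>1 * \<sigma>2) * S * T) (\<sigma>2 * R * T)"
proof -
  define a b c where "a = \<sigma>1 * S * R" and "b = \<sigma>2 * R * T" and "c = - (\<sigma>1 * \<sigma>2) * S * T"
  have n: "a \<noteq> 0" "b \<noteq> 0" "- b \<noteq> 0" "c \<noteq> 0" "c * R \<noteq> 0" using nz by (auto simp: a_def b_def c_def)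
  have "local_sym p a b = local_sym p (a * - b) b"
    using local_sym_mult[OF p n(1,3,2)] local_sym_neg_self[OF p n(2)] by simp
  also have "a * - b = c * R * R" by (simp add: a_def b_def c_def mult_ac)
  also have "local_sym p (c * R * R) b = local_sym p c b * (local_sym p R b * local_sym p R b)"
    using local_sym_mult[OF p n(5) nz(5) n(2)] local_sym_mult[OF p n(4) nz(5) n(2)] by simp
  also have "\<dots> = local_sym p c b" using local_sym_values[OF p nz(5) n(2)] by auto
  finally show ?thesis by (simp add: a_def b_def c_def mult_ac)
qed

lemma npr_commute: "npr S R T = npr S T R" "npr T S R = npr S T R"
  by (auto simp: npr_def)

lemma npr_primes: "D \<subseteq> npr S T R \<Longrightarrow> p \<in> D \<Longrightarrow> prime p"
  by (auto simp: npr_def oddpr_def)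

lemma boxof_swap:
  "boxof S T R D = (p1, p2, p3, g1, g2, g3) \<Longrightarrow> boxof S R T D = (p1, p3, p2, g2, g1, g3)"
  "boxof S T R D = (p1, p2, p3, g1, g2, g3) \<Longrightarrow> boxof T S R D = (p2, p1, p3, g1, g3, g2)"
proof -
  have s: "spr S R T = spr S T R" "spr T R S = spr T S R" "spr R T S = spr R S T"
    "dpr R T S = dpr T R S" "dpr T S R = dpr S T R" by (auto simp: spr_def dpr_def)
  show "boxof S T R D = (p1, p2, p3, g1, g2, g3) \<Longrightarrow> boxof S R T D = (p1, p3, p2, g2, g1, g3)"
    "boxof S T R D = (p1, p2, p3, g1, g2, g3) \<Longrightarrow> boxof T S R D = (p2, p1, p3, g1, g3, g2)"
    unfolding boxof_def s by auto
qed

lemma mod8_inv_permute: "mod8_inv om \<Longrightarrow> mod8_inv (\<lambda>S R T. om S T R)" "mod8_inv om \<Longrightarrow> mod8_inv (\<lambda>T S R. om S T R)"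
  unfolding mod8_inv_def by blast+

text \<open>Termwise this is \<open>local_sym_swap\<close>. The set \<open>npr\<close> and both
  thresholds are symmetric in the three variables, so only signs, weights and box coordinates are
  permuted.\<close>

lemma sum_Om_swap23:
  assumes \<sigma>: "\<sigma>1 \<noteq> 0" "\<sigma>2 \<noteq> 0"
  shows "(\<Sum>x\<in>Om Nx Ny Nz (p1, p2, p3, g1, g2, g3). summand \<sigma>1 \<sigma>2 a b c om z1 z2 x)
    = (\<Sum>x\<in>Om Nx Nz Ny (p1, p3, p2, g2, g1, g3). summand (- (\<sigma>1 * \<sigma>2)) \<sigma>2 a c b (\<lambda>S R T. om S T R) z1 z2 x)"
proof (rule sum.reindex_bij_witness[of _ "\<lambda>(S, R, T, D). (S, T, R, D)" "\<lambda>(S, T, R, D). (S, R, T, D)"])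
  fix x assume x: "x \<in> Om Nx Ny Nz (p1, p2, p3, g1, g2, g3)"
  obtain S T R D where xe: "x = (S, T, R, D)" by (cases x)
  have pos: "S > 0" "T > 0" "R > 0" and D: "D \<subseteq> npr S T R" using x by (auto simp: Om_def xe)
  have "(\<Prod>p\<in>D. local_sym p (\<sigma>1 * int S * int R) (\<sigma>2 * int T * int R)) = (\<Prod>p\<in>D. local_sym p (- (\<sigma>1 * \<sigma>2) * int S * int T) (\<sigma>2 * int R * int T))"
    by (intro prod.cong refl local_sym_swap \<sigma> npr_primes[OF D]) (use pos in auto)
  then show "summand (- (\<sigma>1 * \<sigma>2)) \<sigma>2 a c b (\<lambda>S R T. om S T R) z1 z2 (case x of (S, T, R, D) \<Rightarrow> (S, R, T, D)) = summand \<sigma>1 \<sigma>2 a b c om z1 z2 x"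
    unfolding summand_def xe prod.case npr_commute(1)[of S R T] by (simp only: mult_ac)
  show "(case x of (S, T, R, D) \<Rightarrow> (S, R, T, D)) \<in> Om Nx Nz Ny (p1, p3, p2, g2, g1, g3)"
    using x boxof_swap(1)[of S T R D] by (simp add: xe Om_def npr_commute(1))
next
  fix x assume x: "x \<in> Om Nx Nz Ny (p1, p3, p2, g2, g1, g3)"
  obtain S R T D where xe: "x = (S, R, T, D)" by (cases x)
  show "(case x of (S, R, T, D) \<Rightarrow> (S, T, R, D)) \<in> Om Nx Ny Nz (p1, p2, p3, g1, g2, g3)"
    using x boxof_swap(1)[of S R T D] by (simp add: xe Om_def npr_commute(1))
qed auto

lemma sum_Om_swap12:
  shows "(\<Sum>x\<in>Om Nx Ny Nz (p1, p2, p3, g1, g2, g3). summand \<sigma>1 \<sigma>2 a b c om z1 z2 x)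
    = (\<Sum>x\<in>Om Ny Nx Nz (p2, p1, p3, g1, g3, g2). summand \<sigma>2 \<sigma>1 b a c (\<lambda>T S R. om S T R) z1 z2 x)"
proof (rule sum.reindex_bij_witness[of _ "\<lambda>(T, S, R, D). (S, T, R, D)" "\<lambda>(S, T, R, D). (T, S, R, D)"])
  fix x assume x: "x \<in> Om Nx Ny Nz (p1, p2, p3, g1, g2, g3)"
  obtain S T R D where xe: "x = (S, T, R, D)" by (cases x)
  have "(\<Prod>p\<in>D. local_sym p (\<sigma>1 * int S * int R) (\<sigma>2 * int T * int R)) = (\<Prod>p\<in>D. local_sym p (\<sigma>2 * int T * int R) (\<sigma>1 * int S * int R))"
    by (intro prod.cong refl local_sym_commute)
  then show "summand \<sigma>2 \<sigma>1 b a c (\<lambda>T S R. om S T R) z1 z2 (case x of (S, T, R, D) \<Rightarrow> (T, S, R, D)) = summand \<sigma>1 \<sigma>2 a b c om z1 z2 x"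
    unfolding summand_def xe prod.case npr_commute(2)[of T S R] by (simp only: mult_ac)
  show "(case x of (S, T, R, D) \<Rightarrow> (T, S, R, D)) \<in> Om Ny Nx Nz (p2, p1, p3, g1, g3, g2)"
    using x boxof_swap(2)[of S T R D] by (simp add: xe Om_def npr_commute(2))
next
  fix x assume x: "x \<in> Om Ny Nx Nz (p2, p1, p3, g1, g3, g2)"
  obtain T S R D where xe: "x = (T, S, R, D)" by (cases x)
  show "(case x of (T, S, R, D) \<Rightarrow> (S, T, R, D)) \<in> Om Nx Ny Nz (p1, p2, p3, g1, g2, g3)"
    using x boxof_swap(2)[of T S R D] by (simp add: xe Om_def npr_commute(2))
qed auto

lemma disjoint_prod6:
  assumes "finite D" "D \<subseteq> A1 \<union> A2 \<union> A3 \<union> A4 \<union> A5 \<union> A6"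
    and "A1 \<inter> (A2 \<union> A3 \<union> A4 \<union> A5 \<union> A6) = {}" "A2 \<inter> (A3 \<union> A4 \<union> A5 \<union> A6) = {}" "A3 \<inter> (A4 \<union> A5 \<union> A6) = {}"
      "A4 \<inter> (A5 \<union> A6) = {}" "A5 \<inter> A6 = {}"
  shows "\<Prod>D = (\<Prod>(A1 \<inter> D) * \<Prod>(A2 \<inter> D) * \<Prod>(A3 \<inter> D)) * (\<Prod>(A4 \<inter> D) * \<Prod>(A5 \<inter> D) * \<Prod>(A6 \<inter> D) :: nat)"
proof -
  have "D = (A1 \<inter> D) \<union> ((A2 \<inter> D) \<union> ((A3 \<inter> D) \<union> ((A4 \<inter> D) \<union> ((A5 \<inter> D) \<union> (A6 \<inter> D)))))" using assms(2) by blast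
  then have "\<Prod>D = \<Prod>((A1 \<inter> D) \<union> ((A2 \<inter> D) \<union> ((A3 \<inter> D) \<union> ((A4 \<inter> D) \<union> ((A5 \<inter> D) \<union> (A6 \<inter> D))))))" by simp
  also have "\<dots> = \<Prod>(A1 \<inter> D) * \<Prod>((A2 \<inter> D) \<union> ((A3 \<inter> D) \<union> ((A4 \<inter> D) \<union> ((A5 \<inter> D) \<union> (A6 \<inter> D)))))"
    by (rule prod.union_disjoint) (use assms in auto)
  also have "\<Prod>((A2 \<inter> D) \<union> ((A3 \<inter> D) \<union> ((A4 \<inter> D) \<union> ((A5 \<inter> D) \<union> (A6 \<inter> D))))) = \<Prod>(A2 \<inter> D) * \<Prod>((A3 \<inter> D) \<union> ((A4 \<inter> D) \<union> ((A5 \<inter> D) \<union> (A6 \<inter> D))))"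
    by (rule prod.union_disjoint) (use assms in auto)
  also have "\<Prod>((A3 \<inter> D) \<union> ((A4 \<inter> D) \<union> ((A5 \<inter> D) \<union> (A6 \<inter> D)))) = \<Prod>(A3 \<inter> D) * \<Prod>((A4 \<inter> D) \<union> ((A5 \<inter> D) \<union> (A6 \<inter> D)))"
    by (rule prod.union_disjoint) (use assms in auto)
  also have "\<Prod>((A4 \<inter> D) \<union> ((A5 \<inter> D) \<union> (A6 \<inter> D))) = \<Prod>(A4 \<inter> D) * \<Prod>((A5 \<inter> D) \<union> (A6 \<inter> D))"
    by (rule prod.union_disjoint) (use assms in auto)
  also have "\<Prod>((A5 \<inter> D) \<union> (A6 \<inter> D)) = \<Prod>(A5 \<inter> D) * \<Prod>(A6 \<inter> D)"
    by (rule prod.union_disjoint) (use assms in auto)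
  finally show ?thesis by (simp add: mult_ac)
qed

text \<open>\<open>g1\<close>, \<open>g2\<close>, \<open>g3\<close> measure the primes shared by
  \<open>S\<close> and \<open>T\<close>, by \<open>S\<close> and \<open>R\<close>, by
  \<open>T\<close> and \<open>R\<close>. Private and shared parts divide the variable they belong
  to, which gives the size constraints. Shared primes may fall on either side of \<open>D\<close>,
  so both upper bounds include all of them; 64 is a factor 2 for each of six parts.\<close>

lemma box_geometry:
  assumes x: "(S, T, R, D) \<in> Om Nx Ny Nz ((i1, i2), (i3, i4), (i5, i6), g1, g2, g3)"
  shows "2 ^ i1 * 2 ^ i2 * (2 ^ g1 * 2 ^ g2) \<le> Nx" "2 ^ i3 * 2 ^ i4 * (2 ^ g1 * 2 ^ g3) \<le> Ny" "2 ^ i5 * 2 ^ i6 * (2 ^ g2 * 2 ^ g3) \<le> Nz"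
    "\<Prod>D < 64 * (2 ^ i1 * 2 ^ i3 * 2 ^ i5 * (2 ^ g1 * 2 ^ g2 * 2 ^ g3))"
    "\<Prod>(npr S T R - D) < 64 * (2 ^ i2 * 2 ^ i4 * 2 ^ i6 * (2 ^ g1 * 2 ^ g2 * 2 ^ g3))"
    "2 ^ i1 * 2 ^ i3 * 2 ^ i5 \<le> \<Prod>D" "2 ^ i2 * 2 ^ i4 * 2 ^ i6 \<le> \<Prod>(npr S T R - D)"
proof -
  have pos: "S > 0" "T > 0" "R > 0" "S \<le> Nx" "T \<le> Ny" "R \<le> Nz" and D: "D \<subseteq> npr S T R"
    and b: "boxof S T R D = ((i1, i2), (i3, i4), (i5, i6), g1, g2, g3)" using x by (auto simp: Om_def)
  define A1 A2 A3 A4 A5 A6 where "A1 = spr S T R" and "A2 = spr T S R" and "A3 = spr R S T"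
    and "A4 = dpr S T R" and "A5 = dpr S R T" and "A6 = dpr T R S"
  note Ad = A1_def A2_def A3_def A4_def A5_def A6_def
  have i: "i1 = floor_log (\<Prod>(A1 \<inter> D))" "i2 = floor_log (\<Prod>(A1 - D))" "i3 = floor_log (\<Prod>(A2 \<inter> D))" "i4 = floor_log (\<Prod>(A2 - D))"
    "i5 = floor_log (\<Prod>(A3 \<inter> D))" "i6 = floor_log (\<Prod>(A3 - D))" "g1 = floor_log (\<Prod>A4)" "g2 = floor_log (\<Prod>A5)" "g3 = floor_log (\<Prod>A6)"
    using b by (auto simp: boxof_def Ad)
  have op: "oddprimes (oddpr S)" "oddprimes (oddpr T)" "oddprimes (oddpr R)" using pos oddprimes_oddpr by auto
  have sub: "A1 \<subseteq> oddpr S" "A2 \<subseteq> oddpr T" "A3 \<subseteq> oddpr R" "A4 \<subseteq> oddpr S" "A5 \<subseteq> oddpr S" "A6 \<subseteq> oddpr T"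
    "A1 \<union> A4 \<union> A5 \<subseteq> oddpr S" "A2 \<union> A4 \<union> A6 \<subseteq> oddpr T" "A3 \<union> A5 \<union> A6 \<subseteq> oddpr R"
    unfolding Ad spr_def dpr_def by blast+
  have dj: "A1 \<inter> (A2 \<union> A3 \<union> A4 \<union> A5 \<union> A6) = {}" "A2 \<inter> (A3 \<union> A4 \<union> A5 \<union> A6) = {}" "A3 \<inter> (A4 \<union> A5 \<union> A6) = {}"
      "A4 \<inter> (A5 \<union> A6) = {}" "A5 \<inter> A6 = {}" unfolding Ad spr_def dpr_def by blast+
  have cover: "npr S T R \<subseteq> A1 \<union> A2 \<union> A3 \<union> A4 \<union> A5 \<union> A6" unfolding Ad spr_def dpr_def npr_def by blast
  have oA: "oddprimes A1" "oddprimes A2" "oddprimes A3" "oddprimes A4" "oddprimes A5" "oddprimes A6"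
    using op sub(1-6) oddprimes_mono by blast+
  have oI: "\<Prod>(A1 \<inter> E) > 0" "\<Prod>(A2 \<inter> E) > 0" "\<Prod>(A3 \<inter> E) > 0" "\<Prod>(A4 \<inter> E) > 0" "\<Prod>(A5 \<inter> E) > 0" "\<Prod>(A6 \<inter> E) > 0" for E
    by (rule prod_oddprimes_pos, rule oddprimes_mono, rule oA, blast)+
  have op3: "\<Prod>A1 > 0" "\<Prod>A2 > 0" "\<Prod>A3 > 0" "\<Prod>A4 > 0" "\<Prod>A5 > 0" "\<Prod>A6 > 0" using oA prod_oddprimes_pos by auto
  have fA: "finite A1" "finite A2" "finite A3" "finite A4" "finite A5" "finite A6" using oA by (auto simp: oddprimes_def)
  have subprod: "\<Prod>A \<le> n" if "n > 0" "A \<subseteq> oddpr n" for A n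
    using that prod_dvd_of_subset_prime_factors[OF that(1), of A] oddpr_subset[OF that(1)] by (intro dvd_imp_le) auto
  have "2 ^ i1 * 2 ^ i2 * (2 ^ g1 * 2 ^ g2) \<le> \<Prod>A1 * (\<Prod>A4 * \<Prod>A5)"
    unfolding i using op3 floor_log_prod_split(1)[OF oA(1), of D] by (intro mult_le_mono floor_log_bounds)
  also have "\<dots> = \<Prod>(A1 \<union> A4 \<union> A5)" using dj fA by (subst prod.union_disjoint; (subst prod.union_disjoint)?; auto)
  also have "\<dots> \<le> Nx" using subprod[OF pos(1) sub(7)] pos by simp
  finally show "2 ^ i1 * 2 ^ i2 * (2 ^ g1 * 2 ^ g2) \<le> Nx" .
  have "2 ^ i3 * 2 ^ i4 * (2 ^ g1 * 2 ^ g3) \<le> \<Prod>A2 * (\<Prod>A4 * \<Prod>A6)"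
    unfolding i using op3 floor_log_prod_split(1)[OF oA(2), of D] by (intro mult_le_mono floor_log_bounds)
  also have "\<dots> = \<Prod>(A2 \<union> A4 \<union> A6)" using dj fA by (subst prod.union_disjoint; (subst prod.union_disjoint)?; auto)
  also have "\<dots> \<le> Ny" using subprod[OF pos(2) sub(8)] pos by simp
  finally show "2 ^ i3 * 2 ^ i4 * (2 ^ g1 * 2 ^ g3) \<le> Ny" .
  have "2 ^ i5 * 2 ^ i6 * (2 ^ g2 * 2 ^ g3) \<le> \<Prod>A3 * (\<Prod>A5 * \<Prod>A6)"
    unfolding i using op3 floor_log_prod_split(1)[OF oA(3), of D] by (intro mult_le_mono floor_log_bounds)
  also have "\<dots> = \<Prod>(A3 \<union> A5 \<union> A6)" using dj fA by (subst prod.union_disjoint; (subst prod.union_disjoint)?; auto)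
  also have "\<dots> \<le> Nz" using subprod[OF pos(3) sub(9)] pos by simp
  finally show "2 ^ i5 * 2 ^ i6 * (2 ^ g2 * 2 ^ g3) \<le> Nz" .
  have gen: "\<Prod>E < 64 * (2 ^ floor_log (\<Prod>(A1 \<inter> E)) * 2 ^ floor_log (\<Prod>(A2 \<inter> E)) * 2 ^ floor_log (\<Prod>(A3 \<inter> E)) * (2 ^ g1 * 2 ^ g2 * 2 ^ g3))"
     "2 ^ floor_log (\<Prod>(A1 \<inter> E)) * 2 ^ floor_log (\<Prod>(A2 \<inter> E)) * 2 ^ floor_log (\<Prod>(A3 \<inter> E)) \<le> \<Prod>E" if E: "E \<subseteq> npr S T R" for E
  proof -
    have "finite E" using E finite_subset finite_npr[OF pos(1-3)] by blast
    then have e: "\<Prod>E = (\<Prod>(A1 \<inter> E) * \<Prod>(A2 \<inter> E) * \<Prod>(A3 \<inter> E)) * (\<Prod>(A4 \<inter> E) * \<Prod>(A5 \<inter> E) * \<Prod>(A6 \<inter> E))"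
      using E cover by (intro disjoint_prod6 dj) auto
    have "\<Prod>(A4 \<inter> E) \<le> \<Prod>A4" "\<Prod>(A5 \<inter> E) \<le> \<Prod>A5" "\<Prod>(A6 \<inter> E) \<le> \<Prod>A6"
      using fA op3 by (auto intro!: dvd_imp_le prod_dvd_prod_subset)
    then have l: "\<Prod>(A4 \<inter> E) < 2 * 2 ^ g1" "\<Prod>(A5 \<inter> E) < 2 * 2 ^ g2" "\<Prod>(A6 \<inter> E) < 2 * 2 ^ g3"
      using floor_log_bounds(2)[of "\<Prod>A4"] floor_log_bounds(2)[of "\<Prod>A5"] floor_log_bounds(2)[of "\<Prod>A6"] unfolding i by linarith+
    have "\<Prod>E < ((2 * 2 ^ floor_log (\<Prod>(A1 \<inter> E))) * (2 * 2 ^ floor_log (\<Prod>(A2 \<inter> E))) * (2 * 2 ^ floor_log (\<Prod>(A3 \<inter> E)))) * ((2 * 2 ^ g1) * (2 * 2 ^ g2) * (2 * 2 ^ g3))"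
      unfolding e by (intro mult_strict_mono floor_log_bounds l oI) auto
    then show "\<Prod>E < 64 * (2 ^ floor_log (\<Prod>(A1 \<inter> E)) * 2 ^ floor_log (\<Prod>(A2 \<inter> E)) * 2 ^ floor_log (\<Prod>(A3 \<inter> E)) * (2 ^ g1 * 2 ^ g2 * 2 ^ g3))"
      by (simp add: mult_ac)
    have "2 ^ floor_log (\<Prod>(A1 \<inter> E)) * 2 ^ floor_log (\<Prod>(A2 \<inter> E)) * 2 ^ floor_log (\<Prod>(A3 \<inter> E)) * 1 \<le> \<Prod>E"
      unfolding e using oI(4-6)[of E] by (intro mult_le_mono floor_log_bounds oI) (simp add: Suc_leI)
    then show "2 ^ floor_log (\<Prod>(A1 \<inter> E)) * 2 ^ floor_log (\<Prod>(A2 \<inter> E)) * 2 ^ floor_log (\<Prod>(A3 \<inter> E)) \<le> \<Prod>E" by simp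
  qed
  show "\<Prod>D < 64 * (2 ^ i1 * 2 ^ i3 * 2 ^ i5 * (2 ^ g1 * 2 ^ g2 * 2 ^ g3))" "2 ^ i1 * 2 ^ i3 * 2 ^ i5 \<le> \<Prod>D"
    unfolding i(1,3,5) by (rule gen[OF D])+
  have "A1 \<subseteq> npr S T R" "A2 \<subseteq> npr S T R" "A3 \<subseteq> npr S T R" unfolding Ad spr_def npr_def by blast+
  then have d: "A1 - D = A1 \<inter> (npr S T R - D)" "A2 - D = A2 \<inter> (npr S T R - D)" "A3 - D = A3 \<inter> (npr S T R - D)" by blast+
  show "\<Prod>(npr S T R - D) < 64 * (2 ^ i2 * 2 ^ i4 * 2 ^ i6 * (2 ^ g1 * 2 ^ g2 * 2 ^ g3))" "2 ^ i2 * 2 ^ i4 * 2 ^ i6 \<le> \<Prod>(npr S T R - D)"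
    unfolding i(2,4,6) d by (rule gen, blast)+
qed

text \<open>Each product of two minima is some \<open>d * e\<close>, or two of the \<open>d\<close>,
  or two of the \<open>e\<close>. If none is at least a \<open>d * e\<close>, two of the three pairs
  choose the same side by pigeonhole, say \<open>d1 * d2\<close> and \<open>d1 * d3\<close>. Their
  product is at least \<open>d1 * d2 * d3 \<ge> \<kappa>\<close>, so the larger one has square at
  least \<open>\<kappa>\<close>.\<close>

lemma pair_cases:
  fixes d1 :: real
  assumes "d1 \<ge> 1" "e1 \<ge> 1" "d2 \<ge> 1" "e2 \<ge> 1" "d3 \<ge> 1" "e3 \<ge> 1" "\<kappa> \<le> d1 * d2 * d3" "\<kappa> \<le> e1 * e2 * e3"
  defines "P \<equiv> {min d1 e2 * min d2 e1, min d1 e3 * min d3 e1, min d2 e3 * min d3 e2}"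
  shows "\<exists>p\<in>P. p \<ge> d1 * e1 \<or> p \<ge> d2 * e2 \<or> p \<ge> d3 * e3 \<or> \<kappa> \<le> p\<^sup>2"
proof -
  have c: "min d e' * min d' e = d * d' \<or> min d e' * min d' e = d * e \<or> min d e' * min d' e = d' * e' \<or> min d e' * min d' e = e * e'" for d e d' e' :: real
    by (auto simp: min_def)
  have two: "\<kappa> \<le> (x * y)\<^sup>2 \<or> \<kappa> \<le> (x * w)\<^sup>2" if "x \<ge> 1" "y \<ge> 1" "w \<ge> 1" "\<kappa> \<le> x * y * w" for x y w :: real
  proof -
    have "\<kappa> \<le> 1 * (x * y * w)" using that by simp
    also have "\<dots> \<le> x * (x * y * w)" using that by (intro mult_right_mono) auto
    also have "\<dots> = (x * y) * (x * w)" by (simp add: mult_ac)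
    finally have k: "\<kappa> \<le> (x * y) * (x * w)" .
    have "0 \<le> x * y" "0 \<le> x * w" using that by auto
    then show ?thesis using k mult_left_mono[of "x * w" "x * y" "x * y"] mult_right_mono[of "x * y" "x * w" "x * w"]
      by (cases "x * w \<le> x * y") (auto simp: power2_eq_square)
  qed
  let ?p = "min d1 e2 * min d2 e1" and ?q = "min d1 e3 * min d3 e1" and ?r = "min d2 e3 * min d3 e2"
  have "(?p \<ge> d1 * e1 \<or> ?p \<ge> d2 * e2 \<or> ?p = d1 * d2 \<or> ?p = e1 * e2)" using c[of d1 e2 d2 e1] by auto
  moreover have "(?q \<ge> d1 * e1 \<or> ?q \<ge> d3 * e3 \<or> ?q = d1 * d3 \<or> ?q = e1 * e3)" using c[of d1 e3 d3 e1] by auto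
  moreover have "(?r \<ge> d2 * e2 \<or> ?r \<ge> d3 * e3 \<or> ?r = d2 * d3 \<or> ?r = e2 * e3)" using c[of d2 e3 d3 e2] by auto
  moreover have "?p = d1 * d2 \<Longrightarrow> ?q = d1 * d3 \<Longrightarrow> \<kappa> \<le> ?p\<^sup>2 \<or> \<kappa> \<le> ?q\<^sup>2" using two[of d1 d2 d3] assms(1-8) by simp
  moreover have "?p = d1 * d2 \<Longrightarrow> ?r = d2 * d3 \<Longrightarrow> \<kappa> \<le> ?p\<^sup>2 \<or> \<kappa> \<le> ?r\<^sup>2" using two[of d2 d1 d3] assms(1-8) by (simp add: mult_ac)
  moreover have "?q = d1 * d3 \<Longrightarrow> ?r = d2 * d3 \<Longrightarrow> \<kappa> \<le> ?q\<^sup>2 \<or> \<kappa> \<le> ?r\<^sup>2" using two[of d3 d1 d2] assms(1-8) by (simp add: mult_ac)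
  moreover have "?p = e1 * e2 \<Longrightarrow> ?q = e1 * e3 \<Longrightarrow> \<kappa> \<le> ?p\<^sup>2 \<or> \<kappa> \<le> ?q\<^sup>2" using two[of e1 e2 e3] assms(1-8) by simp
  moreover have "?p = e1 * e2 \<Longrightarrow> ?r = e2 * e3 \<Longrightarrow> \<kappa> \<le> ?p\<^sup>2 \<or> \<kappa> \<le> ?r\<^sup>2" using two[of e2 e1 e3] assms(1-8) by (simp add: mult_ac)
  moreover have "?q = e1 * e3 \<Longrightarrow> ?r = e2 * e3 \<Longrightarrow> \<kappa> \<le> ?q\<^sup>2 \<or> \<kappa> \<le> ?r\<^sup>2" using two[of e3 e1 e2] assms(1-8) by (simp add: mult_ac)
  ultimately show ?thesis unfolding P_def bex_simps by argo
qed

text \<open>The case split at \<open>t = z powr (4 / 9)\<close> balances the trivial bound against the saving.\<close>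

lemma saving_bound:
  fixes z :: real
  assumes z: "z \<ge> 1" and G: "G \<ge> 1" and P: "P \<ge> 1" and M: "M \<ge> 1" and q: "0 \<le> q" "q \<le> 1 / G"
    and dj: "(\<exists>t\<ge>1. \<exists>n\<ge>M. t \<le> P \<and> q \<le> sqrt (t / n)) \<or> z / (128 * G) \<le> P\<^sup>2"
  shows "q * P powr (- 1 / 4) \<le> 2 * (z powr (- 1 / 9) + z powr (1 / 9) / sqrt M)"
  using dj
proof
  assume "\<exists>t\<ge>1. \<exists>n\<ge>M. t \<le> P \<and> q \<le> sqrt (t / n)"
  then obtain t n where t: "t \<ge> 1" "n \<ge> M" "t \<le> P" "q \<le> sqrt (t / n)" by auto
  have p: "P powr (- 1 / 4) \<le> t powr (- 1 / 4)" using t by (intro powr_mono2') auto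
  have q1: "q \<le> 1" using q G by (smt (verit) divide_le_eq_1)
  show ?thesis
  proof (cases "t \<ge> z powr (4 / 9)")
    case True
    have "q * P powr (- 1 / 4) \<le> 1 * (z powr (4 / 9)) powr (- 1 / 4)"
      using q q1 True z order.trans[OF p powr_mono2'[OF _ _ True, of "- 1 / 4"]] by (intro mult_mono) auto
    also have "\<dots> = z powr (- 1 / 9)" by (simp add: powr_powr)
    also have "\<dots> \<le> 2 * (z powr (- 1 / 9) + z powr (1 / 9) / sqrt M)"
      using M by (smt (verit) divide_nonneg_nonneg powr_ge_zero real_sqrt_ge_zero)
    finally show ?thesis .
  next
    case False
    have "q * P powr (- 1 / 4) \<le> sqrt (t / n) * t powr (- 1 / 4)"
      using q t p M by (intro mult_mono) auto
    also have "\<dots> = t powr (1 / 4) / sqrt n"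
    proof -
      have "sqrt t * t powr (- 1 / 4) = t powr (1 / 4)" using t by (simp add: powr_half_sqrt[symmetric] powr_add[symmetric])
      then show ?thesis by (simp add: real_sqrt_divide field_simps)
    qed
    also have "\<dots> \<le> (z powr (4 / 9)) powr (1 / 4) / sqrt M"
      using False t M by (intro frac_le powr_mono2) auto
    also have "\<dots> = z powr (1 / 9) / sqrt M" by (simp add: powr_powr)
    also have "\<dots> \<le> 2 * (z powr (- 1 / 9) + z powr (1 / 9) / sqrt M)"
      using M by (smt (verit) divide_nonneg_nonneg powr_ge_zero real_sqrt_ge_zero)
    finally show ?thesis .
  qed
next
  assume k: "z / (128 * G) \<le> P\<^sup>2"
  have P2: "P\<^sup>2 = P powr 2" using P by simp
  have "P powr (- 1 / 4) = (P\<^sup>2) powr (- 1 / 8)" unfolding P2 powr_powr by simp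
  also have "\<dots> \<le> (z / (128 * G)) powr (- 1 / 8)" using k z G by (intro powr_mono2') auto
  also have "\<dots> = (128 * G) powr (1 / 8) * z powr (- 1 / 8)"
    proof -
    have "(z / (128 * G)) powr (- 1 / 8) = z powr (- 1 / 8) / (128 * G) powr (- 1 / 8)" by (rule powr_divide)
    moreover have "(128 * G) powr (- 1 / 8) = inverse ((128 * G) powr (1 / 8))" using powr_minus[of "128 * G" "1 / 8"] by simp
    ultimately show ?thesis by (simp add: field_simps)
  qed
  \<comment> \<open>\<open>128 \<le> 2 ^ 8\<close> and \<open>G \<le> G ^ 8\<close> absorb the
    constant; the factor \<open>G\<close> is cancelled by \<open>q \<le> 1 / G\<close>.\<close>
  also have "\<dots> \<le> (2 * G) * z powr (- 1 / 9)"
  proof (intro mult_mono)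
    have "(128 * G) powr (1 / 8) \<le> (256 * G ^ 8) powr (1 / 8)"
      using G power_increasing[of 1 8 G] by (intro powr_mono2) auto
    also have "256 * G ^ 8 = (2 * G) ^ 8" by (simp add: power_mult_distrib)
    also have "(2 * G) ^ 8 = (2 * G) powr 8" using G by simp
    also have "\<dots> powr (1 / 8) = 2 * G" unfolding powr_powr using G by simp
    finally show "(128 * G) powr (1 / 8) \<le> 2 * G" .
  qed (use z G in \<open>auto intro: powr_mono\<close>)
  finally have "q * P powr (- 1 / 4) \<le> (1 / G) * ((2 * G) * z powr (- 1 / 9))"
    using q G by (intro mult_mono) auto
  also have "\<dots> = 2 * z powr (- 1 / 9)" using G by simp
  also have "\<dots> \<le> 2 * (z powr (- 1 / 9) + z powr (1 / 9) / sqrt M)" using M by simp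
  finally show ?thesis .
qed

text \<open>One power of \<open>Q\<close> from the sieve bound is spent on the count of fibers. The
  remaining \<open>Q powr (\<epsilon> / 2)\<close> is harmless, since a nonempty box has
  \<open>Q\<close> at most \<open>Nx * Ny * Nz\<close>.\<close>

lemma st_bound:
  assumes \<epsilon>: "\<epsilon> > 0"
  shows "\<exists>C\<ge>1. \<forall>Nx\<ge>1. \<forall>Ny\<ge>1. \<forall>Nz\<ge>1. \<forall>i1 i2 i3 i4 i5 i6 g \<sigma>1 \<sigma>2 a b c om z1 z2.
    \<sigma>1 \<in> {-1, 1} \<longrightarrow> \<sigma>2 \<in> {-1, 1} \<longrightarrow> (\<forall>n. cmod (a n) \<le> 1) \<longrightarrow> (\<forall>n. cmod (b n) \<le> 1) \<longrightarrow> (\<forall>n. cmod (c n) \<le> 1) \<longrightarrow>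
    mod8_inv om \<longrightarrow>
    cmod (\<Sum>x\<in>Om Nx Ny Nz ((i1, i2), (i3, i4), (i5, i6), g). summand \<sigma>1 \<sigma>2 a b c om z1 z2 x)
    \<le> C * (real Nx * real Ny * real Nz) powr \<epsilon> * sqrt (real Nx * real Ny * real Nz * (2 ^ i1 * 2 ^ i2 * (2 ^ i3 * 2 ^ i4) * (2 ^ i5 * 2 ^ i6)))
      * (min (2 ^ i1) (2 ^ i4) * min (2 ^ i3) (2 ^ i2)) powr (- 1 / 4)"
proof -
  have e2: "\<epsilon> / 2 > 0" using \<epsilon> by simp
  obtain C1 where C1: "C1 \<ge> 1" and B1: "\<And>Nx Ny Nz i1 i2 i3 i4 r \<sigma>1 \<sigma>2 a b c om z1 z2.
    \<sigma>1 \<in> {-1, 1} \<Longrightarrow> \<sigma>2 \<in> {-1, 1} \<Longrightarrow> (\<forall>n. cmod (a n) \<le> 1) \<Longrightarrow> (\<forall>n. cmod (b n) \<le> 1) \<Longrightarrow> (\<forall>n. cmod (c n) \<le> 1) \<Longrightarrow>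
    mod8_inv om \<Longrightarrow>
    cmod (\<Sum>x\<in>Om Nx Ny Nz ((i1, i2), (i3, i4), r). summand \<sigma>1 \<sigma>2 a b c om z1 z2 x)
    \<le> C1 * (2 ^ i1 * 2 ^ i2 * (2 ^ i3 * 2 ^ i4)) powr (1 + \<epsilon> / 2) * card (others ` Om Nx Ny Nz ((i1, i2), (i3, i4), r))
      * (min (2 ^ i1) (2 ^ i4) powr (- 1 / 4) * min (2 ^ i3) (2 ^ i2) powr (- 1 / 4))"
    using pair_bound[OF e2] by meson
  obtain C2 where C2: "C2 \<ge> 1" and B2: "\<And>Nx Ny Nz i1 i2 i3 i4 i5 i6 r. Nx \<ge> 1 \<Longrightarrow> Ny \<ge> 1 \<Longrightarrow> Nz \<ge> 1 \<Longrightarrow>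
    2 ^ i1 * 2 ^ i2 * (2 ^ i3 * 2 ^ i4) * real (card (others ` Om Nx Ny Nz ((i1, i2), (i3, i4), (i5, i6), r)))
    \<le> C2 * (real Nx * real Ny * real Nz) powr (\<epsilon> / 2) * sqrt (real Nx * real Ny * real Nz * (2 ^ i1 * 2 ^ i2 * (2 ^ i3 * 2 ^ i4) * (2 ^ i5 * 2 ^ i6)))"
    using count_others[OF e2] by meson
  have C: "1 \<le> C1 * C2" using mult_mono[of 1 C1 1 C2] C1 C2 by simp
  show ?thesis
  proof (intro exI[of _ "C1 * C2"] conjI C allI impI)
    fix Nx Ny Nz i1 i2 i3 i4 i5 i6 :: nat and g and \<sigma>1 \<sigma>2 :: int and a b c :: "nat \<Rightarrow> complex" and om z1 z2
    assume N1: "1 \<le> Nx" "1 \<le> Ny" "1 \<le> Nz"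
      and asm: "\<sigma>1 \<in> {-1, 1}" "\<sigma>2 \<in> {-1, 1}" "\<forall>n. cmod (a n) \<le> 1" "\<forall>n. cmod (b n) \<le> 1" "\<forall>n. cmod (c n) \<le> 1" "mod8_inv om"
    define N where "N = real Nx * real Ny * real Nz"
    define Q :: real where "Q = 2 ^ i1 * 2 ^ i2 * (2 ^ i3 * 2 ^ i4)"
    define W :: real where "W = sqrt (N * (Q * (2 ^ i5 * 2 ^ i6)))"
    define s :: real where "s = (min (2 ^ i1) (2 ^ i4) * min (2 ^ i3) (2 ^ i2)) powr (- 1 / 4)"
    define A where "A = Om Nx Ny Nz ((i1, i2), (i3, i4), (i5, i6), g)"
    have NQ: "N \<ge> 1" "Q \<ge> 1" using N1 by (auto simp: N_def Q_def intro!: mult_ge1_I)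
    have s: "s = min (2 ^ i1) (2 ^ i4) powr (- 1 / 4) * min (2 ^ i3) (2 ^ i2) powr (- 1 / 4)" "s \<ge> 0"
      by (simp_all add: s_def powr_mult)
    have "cmod (\<Sum>x\<in>A. summand \<sigma>1 \<sigma>2 a b c om z1 z2 x) \<le> C1 * C2 * N powr \<epsilon> * W * s"
    proof (cases "A = {}")
      case True
      then show "cmod (\<Sum>x\<in>A. summand \<sigma>1 \<sigma>2 a b c om z1 z2 x) \<le> C1 * C2 * N powr \<epsilon> * W * s"
        using C1 C2 NQ s by (simp add: W_def)
    next
      case False
      then obtain x where x: "x \<in> A" by blast
      obtain S T R D where xe: "x = (S, T, R, D)" by (cases x)
      note geo = box_geometry[of S T R D Nx Ny Nz i1 i2 i3 i4 i5 i6 "fst g" "fst (snd g)" "snd (snd g)"]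
      have xy: "2 ^ i1 * 2 ^ i2 * (2 ^ fst g * 2 ^ fst (snd g)) \<le> Nx" "2 ^ i3 * 2 ^ i4 * (2 ^ fst g * 2 ^ snd (snd g)) \<le> Ny"
        using geo(1,2) x by (simp_all add: A_def xe)
      have "2 ^ i1 * 2 ^ i2 * 1 \<le> Nx" "2 ^ i3 * 2 ^ i4 * 1 \<le> Ny"
        by (rule order.trans[OF mult_le_mono2 xy(1)], simp, rule order.trans[OF mult_le_mono2 xy(2)], simp)
      then have "2 ^ i1 * 2 ^ i2 * (2 ^ i3 * 2 ^ i4) * 1 \<le> Nx * Ny * Nz" using N1 by (intro mult_le_mono) auto
      then have "real (2 ^ i1 * 2 ^ i2 * (2 ^ i3 * 2 ^ i4)) \<le> real (Nx * Ny * Nz)" unfolding of_nat_le_iff by simp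
      then have QN: "Q \<le> N" by (simp add: Q_def N_def)
      have "cmod (\<Sum>x\<in>A. summand \<sigma>1 \<sigma>2 a b c om z1 z2 x) \<le> C1 * Q powr (1 + \<epsilon> / 2) * card (others ` A) * s"
        unfolding A_def Q_def s(1) by (rule B1[OF asm])
      also have "\<dots> = C1 * Q powr (\<epsilon> / 2) * (Q * card (others ` A)) * s" using NQ by (simp add: powr_add)
      also have "\<dots> \<le> C1 * N powr (\<epsilon> / 2) * (C2 * N powr (\<epsilon> / 2) * W) * s"
      proof -
        have a: "Q powr (\<epsilon> / 2) \<le> N powr (\<epsilon> / 2)" using QN NQ \<epsilon> by (intro powr_mono2) auto
        have b: "Q * card (others ` A) \<le> C2 * N powr (\<epsilon> / 2) * W"
          unfolding A_def Q_def W_def N_def by (rule B2[OF N1])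
        show ?thesis
          by (rule mult_right_mono[OF mult_mono[OF mult_left_mono[OF a] b]]) (use C1 NQ s in auto)
      qed
      also have "\<dots> = C1 * C2 * (N powr (\<epsilon> / 2) * N powr (\<epsilon> / 2)) * W * s" by (simp add: mult_ac)
      also have "N powr (\<epsilon> / 2) * N powr (\<epsilon> / 2) = N powr \<epsilon>" by (simp add: powr_add[symmetric])
      finally show "cmod (\<Sum>x\<in>A. summand \<sigma>1 \<sigma>2 a b c om z1 z2 x) \<le> C1 * C2 * N powr \<epsilon> * W * s" .
    qed
    then show "cmod (\<Sum>x\<in>Om Nx Ny Nz ((i1, i2), (i3, i4), (i5, i6), g). summand \<sigma>1 \<sigma>2 a b c om z1 z2 x)
    \<le> C1 * C2 * (real Nx * real Ny * real Nz) powr \<epsilon> * sqrt (real Nx * real Ny * real Nz * (2 ^ i1 * 2 ^ i2 * (2 ^ i3 * 2 ^ i4) * (2 ^ i5 * 2 ^ i6)))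
      * (min (2 ^ i1) (2 ^ i4) * min (2 ^ i3) (2 ^ i2)) powr (- 1 / 4)"
      unfolding N_def Q_def W_def s_def A_def .
  qed
qed

text \<open>\<open>Nz = 1\<close> covers the case \<open>m3 = 0\<close>, in which the empty tuple has product 1.\<close>

definition Mmin :: "nat \<Rightarrow> nat \<Rightarrow> nat \<Rightarrow> real" where
  "Mmin Nx Ny Nz = (if Nz = 1 then min (real Nx) (real Ny) else min (real Nx) (min (real Ny) (real Nz)))"

text \<open>The density \<open>q\<close> of the box is multiplied by the saving of the best of the
  three pairs. Only inequalities between dyadic parameters remain: \<open>q\<close> is small if the
  box is thin in one variable or has large shared parts, and the thresholds force the parts inside
  and outside \<open>D\<close> to be large.\<close>

theorem main_box:
  assumes \<epsilon>: "\<epsilon> > 0"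
  shows "\<exists>C\<ge>1. \<forall>Nx\<ge>1. \<forall>Ny\<ge>1. \<forall>Nz\<ge>1. \<forall>bx \<sigma>1 \<sigma>2 a b c om z1 z2 z.
    \<sigma>1 \<in> {-1, 1} \<longrightarrow> \<sigma>2 \<in> {-1, 1} \<longrightarrow> (\<forall>n. cmod (a n) \<le> 1) \<longrightarrow> (\<forall>n. cmod (b n) \<le> 1) \<longrightarrow> (\<forall>n. cmod (c n) \<le> 1) \<longrightarrow>
    mod8_inv om \<longrightarrow> 1 \<le> z \<longrightarrow> z / 2 \<le> real (Suc z1) \<longrightarrow> z / 2 \<le> real (Suc z2) \<longrightarrow>
    cmod (\<Sum>x\<in>Om Nx Ny Nz bx. summand \<sigma>1 \<sigma>2 a b c om z1 z2 x)
    \<le> C * (real Nx * real Ny * real Nz) powr (1 + \<epsilon>) * (z powr (- 1 / 9) + z powr (1 / 9) / sqrt (Mmin Nx Ny Nz))"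
proof -
  obtain C1 where C1: "C1 \<ge> 1" and B: "\<And>Nx Ny Nz i1 i2 i3 i4 i5 i6 g \<sigma>1 \<sigma>2 a b c om z1 z2.
    1 \<le> Nx \<Longrightarrow> 1 \<le> Ny \<Longrightarrow> 1 \<le> Nz \<Longrightarrow>
    \<sigma>1 \<in> {-1, 1} \<Longrightarrow> \<sigma>2 \<in> {-1, 1} \<Longrightarrow> (\<forall>n. cmod (a n) \<le> 1) \<Longrightarrow> (\<forall>n. cmod (b n) \<le> 1) \<Longrightarrow> (\<forall>n. cmod (c n) \<le> 1) \<Longrightarrow>
    mod8_inv om \<Longrightarrow>
    cmod (\<Sum>x\<in>Om Nx Ny Nz ((i1, i2), (i3, i4), (i5, i6), g). summand \<sigma>1 \<sigma>2 a b c om z1 z2 x)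
    \<le> C1 * (real Nx * real Ny * real Nz) powr \<epsilon> * sqrt (real Nx * real Ny * real Nz * (2 ^ i1 * 2 ^ i2 * (2 ^ i3 * 2 ^ i4) * (2 ^ i5 * 2 ^ i6)))
      * (min (2 ^ i1) (2 ^ i4) * min (2 ^ i3) (2 ^ i2)) powr (- 1 / 4)"
    using st_bound[OF \<epsilon>] by meson
  have C: "1 \<le> C1 * 2" using C1 by simp
  show ?thesis
  proof (intro exI[of _ "C1 * 2"] conjI C allI impI)
    fix Nx Ny Nz :: nat and bx :: box and \<sigma>1 \<sigma>2 :: int and a b c :: "nat \<Rightarrow> complex" and om z1 z2 and z :: real
    assume N1: "1 \<le> Nx" "1 \<le> Ny" "1 \<le> Nz"
      and asm: "\<sigma>1 \<in> {-1, 1}" "\<sigma>2 \<in> {-1, 1}" "\<forall>n. cmod (a n) \<le> 1" "\<forall>n. cmod (b n) \<le> 1" "\<forall>n. cmod (c n) \<le> 1" "mod8_inv om"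
      and z: "1 \<le> z" "z / 2 \<le> real (Suc z1)" "z / 2 \<le> real (Suc z2)"
    define N where "N = real Nx * real Ny * real Nz"
    define M where "M = Mmin Nx Ny Nz"
    let ?s = "\<Sum>x\<in>Om Nx Ny Nz bx. summand \<sigma>1 \<sigma>2 a b c om z1 z2 x"
    have NM: "N \<ge> 1" "M \<ge> 1" using N1 by (auto simp: N_def M_def Mmin_def intro!: mult_ge1_I)
    have "cmod ?s \<le> C1 * 2 * N powr (1 + \<epsilon>) * (z powr (- 1 / 9) + z powr (1 / 9) / sqrt M)"
    \<comment> \<open>A single nonzero term certifies the thresholds for the dyadic parameters of
      the whole box; without one the sum vanishes.\<close>
    proof (cases "\<forall>x\<in>Om Nx Ny Nz bx. summand \<sigma>1 \<sigma>2 a b c om z1 z2 x = 0")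
      case True
      then show ?thesis using C1 NM z by simp
    next
      case False
      then obtain x where x: "x \<in> Om Nx Ny Nz bx" "summand \<sigma>1 \<sigma>2 a b c om z1 z2 x \<noteq> 0" by blast
      obtain i1 i2 i3 i4 i5 i6 g1 g2 g3 where bx: "bx = ((i1, i2), (i3, i4), (i5, i6), g1, g2, g3)" by (metis prod.exhaust)
      obtain S T R D where xe: "x = (S, T, R, D)" by (cases x)
      note geo = box_geometry[OF x(1)[unfolded xe bx]]
      have th: "z1 < \<Prod>D" "z2 < \<Prod>(npr S T R - D)" using x(2) by (auto simp: xe summand_def split: if_splits)
      define d1 d2 d3 e1 e2 e3 :: real where "d1 = 2 ^ i1" and "d2 = 2 ^ i3" and "d3 = 2 ^ i5" and "e1 = 2 ^ i2" and "e2 = 2 ^ i4" and "e3 = 2 ^ i6"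
      define G12 G13 G23 :: real where "G12 = 2 ^ g1" and "G13 = 2 ^ g2" and "G23 = 2 ^ g3"
      note ds = d1_def d2_def d3_def e1_def e2_def e3_def G12_def G13_def G23_def
      define G where "G = G12 * G13 * G23"
      have one: "1 \<le> d1" "1 \<le> d2" "1 \<le> d3" "1 \<le> e1" "1 \<le> e2" "1 \<le> e3" "1 \<le> G12" "1 \<le> G13" "1 \<le> G23" by (simp_all add: ds)
      have pos: "0 < d1" "0 < d2" "0 < d3" "0 < e1" "0 < e2" "0 < e3" "0 < G12" "0 < G13" "0 < G23" using one by linarith+
      have G: "G \<ge> 1" using one by (auto simp: G_def intro!: mult_ge1_I)
      have gx: "d1 * e1 * (G12 * G13) \<le> real Nx" "d2 * e2 * (G12 * G23) \<le> real Ny" "d3 * e3 * (G13 * G23) \<le> real Nz"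
        using geo(1-3)[folded of_nat_le_iff[where 'a = real]] by (simp_all add: ds)
      have gD: "z / 2 < 64 * (d1 * d2 * d3 * G)" "z / 2 < 64 * (e1 * e2 * e3 * G)"
      proof -
        have "Suc z1 < 64 * (2 ^ i1 * 2 ^ i3 * 2 ^ i5 * (2 ^ g1 * 2 ^ g2 * 2 ^ g3))" "Suc z2 < 64 * (2 ^ i2 * 2 ^ i4 * 2 ^ i6 * (2 ^ g1 * 2 ^ g2 * 2 ^ g3))"
          using geo(4,5) th by linarith+
        from this[folded of_nat_less_iff[where 'a = real]] show "z / 2 < 64 * (d1 * d2 * d3 * G)" "z / 2 < 64 * (e1 * e2 * e3 * G)"
          using z by (simp_all add: ds G_def)
      qed
      \<comment> \<open>128 is the 64 of \<open>box_geometry\<close> times the 2 in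
        \<open>z / 2\<close>.\<close>
      define \<kappa> where "\<kappa> = z / (128 * G)"
      have k: "\<kappa> \<le> d1 * d2 * d3" "\<kappa> \<le> e1 * e2 * e3" using gD G by (simp_all add: \<kappa>_def field_simps)
      define W where "W = d1 * e1 * (d2 * e2) * (d3 * e3)"
      define q where "q = sqrt (W / N)"
      have N0: "N > 0" "real Nx > 0" "real Ny > 0" "real Nz > 0" using NM N1 by auto
      have W0: "W > 0" using pos by (simp add: W_def)
      have q0: "q \<ge> 0" using W0 N0 by (simp add: q_def)
      have sq: "sqrt (N * W) = N * q"
      proof -
        have "N * W = N\<^sup>2 * (W / N)" using N0 by (simp add: power2_eq_square)
        then have "sqrt (N * W) = sqrt (N\<^sup>2) * sqrt (W / N)" by (simp only: real_sqrt_mult)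
        then show ?thesis using N0 by (simp add: q_def)
      qed
      have s1: "1 \<le> d1 * e1" "1 \<le> d2 * e2" "1 \<le> d3 * e3" using one by (auto intro!: mult_ge1_I)
      have G2: "1 \<le> G12 * G13" "1 \<le> G12 * G23" "1 \<le> G13 * G23" using one by (auto intro!: mult_ge1_I)
      have le: "d1 * e1 \<le> Nx" "d2 * e2 \<le> Ny" "d3 * e3 \<le> Nz"
        using gx mult_left_mono[OF G2(1), of "d1 * e1"] mult_left_mono[OF G2(2), of "d2 * e2"] mult_left_mono[OF G2(3), of "d3 * e3"] s1 by linarith+
      \<comment> \<open>Each shared part occurs in two of the three size constraints, so their
        product contains \<open>G\<close> squared.\<close>
      have qG: "q \<le> 1 / G"
      proof -
        have "(d1 * e1 * (G12 * G13)) * (d2 * e2 * (G12 * G23)) * (d3 * e3 * (G13 * G23)) \<le> N"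
          unfolding N_def using pos by (intro mult_mono gx) auto
        then have "W * G\<^sup>2 \<le> N" by (simp add: W_def G_def power2_eq_square mult_ac)
        then have "W / N \<le> 1 / G\<^sup>2" using N0 G by (simp add: field_simps)
        then have "q \<le> sqrt (1 / G\<^sup>2)" by (simp add: q_def)
        also have "\<dots> = 1 / G" using G by (simp add: real_sqrt_divide)
        finally show ?thesis .
      qed
      have qx: "q \<le> sqrt (d1 * e1 / Nx)" "q \<le> sqrt (d2 * e2 / Ny)" "q \<le> sqrt (d3 * e3 / Nz)"
      proof -
        have f: "(d1 * e1) / Nx \<le> 1" "(d2 * e2) / Ny \<le> 1" "(d3 * e3) / Nz \<le> 1" using le N0 by auto
        have WN: "W / N = (d1 * e1) / Nx * ((d2 * e2) / Ny) * ((d3 * e3) / Nz)" by (simp add: W_def N_def)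
        have p: "(d1 * e1) / Nx \<ge> 0" "(d2 * e2) / Ny \<ge> 0" "(d3 * e3) / Nz \<ge> 0" using pos N0 by auto
        have "W / N \<le> (d1 * e1) / Nx * 1 * 1" unfolding WN using f p by (intro mult_mono) auto
        then show "q \<le> sqrt (d1 * e1 / Nx)" by (simp add: q_def)
        have "W / N \<le> 1 * ((d2 * e2) / Ny) * 1" unfolding WN using f p by (intro mult_mono) auto
        then show "q \<le> sqrt (d2 * e2 / Ny)" by (simp add: q_def)
        have "W / N \<le> 1 * 1 * ((d3 * e3) / Nz)" unfolding WN using f p by (intro mult_mono) auto
        then show "q \<le> sqrt (d3 * e3 / Nz)" by (simp add: q_def)
      qed
      define P1 P2 P3 where "P1 = min d1 e2 * min d2 e1" and "P2 = min d1 e3 * min d3 e1" and "P3 = min d2 e3 * min d3 e2"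
      have P: "1 \<le> P1" "1 \<le> P2" "1 \<le> P3" using one by (auto simp: P1_def P2_def P3_def intro!: mult_ge1_I)
      have s\<sigma>: "\<sigma>1 \<noteq> 0" "\<sigma>2 \<noteq> 0" "- (\<sigma>1 * \<sigma>2) \<in> {-1, 1}" "- (\<sigma>2 * \<sigma>1) \<in> {-1, 1}" using asm by auto
      have b1: "cmod ?s \<le> C1 * N powr \<epsilon> * (N * q) * P1 powr (- 1 / 4)"
        proof -
        have "cmod ?s \<le> C1 * (real Nx * real Ny * real Nz) powr \<epsilon> * sqrt (real Nx * real Ny * real Nz * (2 ^ i1 * 2 ^ i2 * (2 ^ i3 * 2 ^ i4) * (2 ^ i5 * 2 ^ i6)))
      * (min (2 ^ i1) (2 ^ i4) * min (2 ^ i3) (2 ^ i2)) powr (- 1 / 4)"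
          unfolding bx by (rule B[OF N1 asm])
        also have "real Nx * real Ny * real Nz = N" by (simp add: N_def)
        also have "(2 ^ i1 * 2 ^ i2 * (2 ^ i3 * 2 ^ i4) * (2 ^ i5 * 2 ^ i6)) = W" by (simp add: W_def ds)
        finally show ?thesis unfolding sq[symmetric] P1_def ds .
      qed
      \<comment> \<open>Exchanging \<open>T\<close> and \<open>R\<close> puts \<open>S\<close> and
        \<open>R\<close> in the leading positions.\<close>
      have b2: "cmod ?s \<le> C1 * N powr \<epsilon> * (N * q) * P2 powr (- 1 / 4)"
      proof -
        have "cmod ?s \<le> C1 * (real Nx * real Nz * real Ny) powr \<epsilon> * sqrt (real Nx * real Nz * real Ny * (2 ^ i1 * 2 ^ i2 * (2 ^ i5 * 2 ^ i6) * (2 ^ i3 * 2 ^ i4)))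
      * (min (2 ^ i1) (2 ^ i6) * min (2 ^ i5) (2 ^ i2)) powr (- 1 / 4)"
          unfolding bx sum_Om_swap23[OF s\<sigma>(1,2)]
          by (rule B[OF N1(1,3,2) s\<sigma>(3) asm(2,3,5,4) mod8_inv_permute(1)[OF asm(6)]])
        also have "real Nx * real Nz * real Ny = N" by (simp add: N_def)
        also have "(2 ^ i1 * 2 ^ i2 * (2 ^ i5 * 2 ^ i6) * (2 ^ i3 * 2 ^ i4)) = W" by (simp add: W_def ds)
        finally show ?thesis unfolding sq[symmetric] P2_def ds .
      qed
      \<comment> \<open>Exchanging \<open>S\<close> with \<open>T\<close> and then \<open>S\<close>
        with \<open>R\<close> puts \<open>T\<close> and \<open>R\<close> in the leading
        positions.\<close>
      have b3: "cmod ?s \<le> C1 * N powr \<epsilon> * (N * q) * P3 powr (- 1 / 4)"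
      proof -
        have "cmod ?s \<le> C1 * (real Ny * real Nz * real Nx) powr \<epsilon> * sqrt (real Ny * real Nz * real Nx * (2 ^ i3 * 2 ^ i4 * (2 ^ i5 * 2 ^ i6) * (2 ^ i1 * 2 ^ i2)))
      * (min (2 ^ i3) (2 ^ i6) * min (2 ^ i5) (2 ^ i4)) powr (- 1 / 4)"
          unfolding bx sum_Om_swap12[where Nx = Nx and Ny = Ny and ?\<sigma>1.0 = \<sigma>1 and ?\<sigma>2.0 = \<sigma>2 and a = a and om = om and ?p1.0 = "(i1, i2)"] sum_Om_swap23[OF s\<sigma>(2,1)]
          by (rule B[OF N1(2,3,1) s\<sigma>(4) asm(1,4,5,3) mod8_inv_permute(1)[OF mod8_inv_permute(2)[OF asm(6)]]])
        also have "real Ny * real Nz * real Nx = N" by (simp add: N_def)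
        also have "(2 ^ i3 * 2 ^ i4 * (2 ^ i5 * 2 ^ i6) * (2 ^ i1 * 2 ^ i2)) = W" by (simp add: W_def ds)
        finally show ?thesis unfolding sq[symmetric] P3_def ds .
      qed
      have "\<exists>p\<in>{P1, P2, P3}. (\<exists>t\<ge>1. \<exists>n\<ge>M. t \<le> p \<and> q \<le> sqrt (t / n)) \<or> \<kappa> \<le> p\<^sup>2"
      proof (cases "Nz = 1")
        case True
        \<comment> \<open>With \<open>R = 1\<close> there are no primes in the third variable, and
          the pair \<open>S\<close>, \<open>T\<close> decides alone: \<open>\<kappa>\<close> is at
          most \<open>d1 * d2\<close> and at most \<open>e1 * e2\<close>.\<close>
        have "d3 * e3 \<le> 1" using le(3) True by simp
        moreover have "d3 \<le> d3 * e3" "e3 \<le> d3 * e3" using one by auto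
        ultimately have "d3 = 1" "e3 = 1" using one by linarith+
        then have k': "\<kappa> \<le> d1 * d2" "\<kappa> \<le> e1 * e2" using k by auto
        have MN: "M \<le> Nx" "M \<le> Ny" by (auto simp: M_def Mmin_def True)
        have "P1 \<le> P1\<^sup>2" using P(1) by (simp add: power2_eq_square)
        moreover have "P1 = d1 * e1 \<or> P1 = d2 * e2 \<or> P1 = d1 * d2 \<or> P1 = e1 * e2" by (auto simp: P1_def min_def)
        ultimately have "d1 * e1 \<le> P1 \<or> d2 * e2 \<le> P1 \<or> \<kappa> \<le> P1\<^sup>2" using k' by auto
        then show ?thesis using s1 qx MN by blast
      next
        case False
        have MN: "M \<le> Nx" "M \<le> Ny" "M \<le> Nz" using False by (auto simp: M_def Mmin_def)
        obtain p where "p \<in> {P1, P2, P3}" "p \<ge> d1 * e1 \<or> p \<ge> d2 * e2 \<or> p \<ge> d3 * e3 \<or> \<kappa> \<le> p\<^sup>2"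
          using pair_cases[OF one(1,4,2,5,3,6) k] unfolding P1_def P2_def P3_def by blast
        then show ?thesis using s1 qx MN by blast
      qed
      then obtain p where p: "p \<in> {P1, P2, P3}" "(\<exists>t\<ge>1. \<exists>n\<ge>M. t \<le> p \<and> q \<le> sqrt (t / n)) \<or> \<kappa> \<le> p\<^sup>2" by blast
      have p1: "p \<ge> 1" using p(1) P by auto
      have "cmod ?s \<le> C1 * N powr \<epsilon> * (N * q) * p powr (- 1 / 4)" using p(1) b1 b2 b3 by auto
      also have "\<dots> = C1 * N powr \<epsilon> * N * (q * p powr (- 1 / 4))" by (simp add: mult_ac)
      also have "\<dots> \<le> C1 * N powr \<epsilon> * N * (2 * (z powr (- 1 / 9) + z powr (1 / 9) / sqrt M))"
        using saving_bound[OF z(1) G p1 NM(2) q0 qG p(2)[unfolded \<kappa>_def]] C1 N0 by (intro mult_left_mono) auto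
      also have "\<dots> = C1 * 2 * N powr (1 + \<epsilon>) * (z powr (- 1 / 9) + z powr (1 / 9) / sqrt M)"
        using N0 by (simp add: powr_add)
      finally show ?thesis .
    qed
    then show "cmod ?s \<le> C1 * 2 * (real Nx * real Ny * real Nz) powr (1 + \<epsilon>) * (z powr (- 1 / 9) + z powr (1 / 9) / sqrt (Mmin Nx Ny Nz))"
      unfolding N_def M_def .
  qed
qed

text \<open>One element with both divisors at most \<open>z\<close> bounds the private parts of the
  whole box by \<open>W \<le> z ^ 2\<close>. Counting gives about \<open>sqrt (N * W)\<close>
  elements.\<close>

theorem small_box:
  assumes \<epsilon>: "\<epsilon> > 0"
  shows "\<exists>C\<ge>1. \<forall>Nx\<ge>1. \<forall>Ny\<ge>1. \<forall>Nz\<ge>1. \<forall>bx z. \<forall>(S, T, R, D)\<in>Om Nx Ny Nz bx.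
    1 \<le> z \<longrightarrow> real (\<Prod>D) \<le> z \<longrightarrow> real (\<Prod>(npr S T R - D)) \<le> z \<longrightarrow>
    real (card (Om Nx Ny Nz bx)) \<le> C * (real Nx * real Ny * real Nz) powr (1 / 2 + \<epsilon>) * z"
proof -
  obtain C2 where C2: "C2 \<ge> 1" and B2: "\<And>Nx Ny Nz i1 i2 i3 i4 i5 i6 r. Nx \<ge> 1 \<Longrightarrow> Ny \<ge> 1 \<Longrightarrow> Nz \<ge> 1 \<Longrightarrow>
    2 ^ i1 * 2 ^ i2 * (2 ^ i3 * 2 ^ i4) * real (card (others ` Om Nx Ny Nz ((i1, i2), (i3, i4), (i5, i6), r)))
    \<le> C2 * (real Nx * real Ny * real Nz) powr \<epsilon> * sqrt (real Nx * real Ny * real Nz * (2 ^ i1 * 2 ^ i2 * (2 ^ i3 * 2 ^ i4) * (2 ^ i5 * 2 ^ i6)))"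
    using count_others[OF \<epsilon>] by meson
  have main: "real (card (Om Nx Ny Nz bx)) \<le> (16 * C2) * (real Nx * real Ny * real Nz) powr (1 / 2 + \<epsilon>) * z"
    if N1: "1 \<le> Nx" "1 \<le> Ny" "1 \<le> Nz" and x: "(S, T, R, D) \<in> Om Nx Ny Nz bx" and z: "1 \<le> z" "real (\<Prod>D) \<le> z" "real (\<Prod>(npr S T R - D)) \<le> z"
    for Nx Ny Nz S T R D bx z
  proof -
    obtain i1 i2 i3 i4 i5 i6 g1 g2 g3 where bx: "bx = ((i1, i2), (i3, i4), (i5, i6), g1, g2, g3)" by (metis prod.exhaust)
    note geo = box_geometry[OF x[unfolded bx]]
    define N where "N = real Nx * real Ny * real Nz"
    define W :: real where "W = 2 ^ i1 * 2 ^ i2 * (2 ^ i3 * 2 ^ i4) * (2 ^ i5 * 2 ^ i6)"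
    have N0: "N > 0" using N1 by (simp add: N_def)
    have "W = real (2 ^ i1 * 2 ^ i3 * 2 ^ i5) * real (2 ^ i2 * 2 ^ i4 * 2 ^ i6)" by (simp add: W_def)
    also have "\<dots> \<le> z * z" using geo(6,7)[folded of_nat_le_iff[where 'a = real]] z by (intro mult_mono) auto
    finally have W: "W \<le> z\<^sup>2" by (simp add: power2_eq_square)
    have "real (card (Om Nx Ny Nz bx)) \<le> real (16 * (2 ^ i1 * 2 ^ i2 * (2 ^ i3 * 2 ^ i4)) * card (others ` Om Nx Ny Nz bx))"
      unfolding of_nat_le_iff bx by (rule card_Om)
    also have "\<dots> = 16 * (2 ^ i1 * 2 ^ i2 * (2 ^ i3 * 2 ^ i4) * real (card (others ` Om Nx Ny Nz bx)))" by simp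
    also have "\<dots> \<le> 16 * (C2 * N powr \<epsilon> * sqrt (N * W))"
      unfolding bx N_def W_def by (intro mult_left_mono B2[OF N1]) simp
    also have "\<dots> \<le> 16 * (C2 * N powr \<epsilon> * sqrt (N * z\<^sup>2))"
      using W N0 C2 by (intro mult_left_mono) auto
    also have "sqrt (N * z\<^sup>2) = N powr (1 / 2) * z" using N0 z by (simp add: real_sqrt_mult powr_half_sqrt)
    also have "16 * (C2 * N powr \<epsilon> * (N powr (1 / 2) * z)) = (16 * C2) * N powr (1 / 2 + \<epsilon>) * z" by (simp add: powr_add)
    finally show ?thesis unfolding N_def .
  qed
  have "16 * C2 \<ge> 1" using C2 by simp
  then show ?thesis using main by (intro exI[of _ "16 * C2"]) blast
qed

section \<open>The random part as a divisor sum\<close>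

lemma hilbert'_infty_eq_infty_sym:
  assumes "a \<noteq> 0" "b \<noteq> 0"
  shows "hilbert'_infty a b = infty_sym a b"
proof -
  let ?K = "ring_of_type_algebra :: real ring"
  have pw: "x [^]\<^bsub>?K\<^esub> (2::nat) = x * x" for x
    by (simp add: nat_pow_def numeral_2_eq_2 ring_of_type_algebra_def)
  have eq: "(\<exists>x\<in>carrier ?K. \<exists>y\<in>carrier ?K. \<exists>z\<in>carrier ?K.
           (x, y, z) \<noteq> (\<zero>\<^bsub>?K\<^esub>, \<zero>\<^bsub>?K\<^esub>, \<zero>\<^bsub>?K\<^esub>) \<and>
           z [^]\<^bsub>?K\<^esub> (2::nat) = (of_int a \<otimes>\<^bsub>?K\<^esub> x [^]\<^bsub>?K\<^esub> (2::nat)) \<oplus>\<^bsub>?K\<^esub> (of_int b \<otimes>\<^bsub>?K\<^esub> y [^]\<^bsub>?K\<^esub> (2::nat)))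
     \<longleftrightarrow> (\<exists>x y z :: real. (x, y, z) \<noteq> (0, 0, 0) \<and> z * z = of_int a * (x * x) + of_int b * (y * y))"
    unfolding pw by (simp add: ring_of_type_algebra_def)
  have "(\<exists>x y z :: real. (x, y, z) \<noteq> (0, 0, 0) \<and> z * z = of_int a * (x * x) + of_int b * (y * y)) \<longleftrightarrow> \<not> (a < 0 \<and> b < 0)"
  proof
    assume "\<exists>x y z :: real. (x, y, z) \<noteq> (0, 0, 0) \<and> z * z = of_int a * (x * x) + of_int b * (y * y)"
    then obtain x y z :: real where h: "(x, y, z) \<noteq> (0, 0, 0)" "z * z = of_int a * (x * x) + of_int b * (y * y)" by blast
    show "\<not> (a < 0 \<and> b < 0)"
    proof
      assume ab: "a < 0 \<and> b < 0"
      have 1: "real_of_int a * (x * x) \<le> 0" "real_of_int b * (y * y) \<le> 0" "z * z \<ge> 0"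
        using ab by (auto intro!: mult_nonpos_nonneg)
      then have "real_of_int a * (x * x) = 0" "real_of_int b * (y * y) = 0" "z * z = 0" using h(2) by linarith+
      then show False using ab h(1) by auto
    qed
  next
    assume "\<not> (a < 0 \<and> b < 0)"
    then consider "a > 0" | "b > 0" using assms by linarith
    then show "\<exists>x y z :: real. (x, y, z) \<noteq> (0, 0, 0) \<and> z * z = of_int a * (x * x) + of_int b * (y * y)"
    proof cases
      case 1
      then show ?thesis by (intro exI[of _ 1] exI[of _ 0] exI[of _ "sqrt (real_of_int a)"]) simp
    next
      case 2
      then show ?thesis by (intro exI[of _ 0] exI[of _ 1] exI[of _ "sqrt (real_of_int b)"]) simp
    qed
  qed
  then show ?thesis using assms unfolding hilbert'_infty_def hilbert_symbol_def eq infty_sym_def by auto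
qed

text \<open>A squarefree \<open>s\<close> is the product of its set of primes, and a prime outside
  \<open>F\<close> annihilates its term.\<close>

lemma sum_squarefree_primes:
  fixes h :: "nat \<Rightarrow> int"
  assumes F: "finite F" "\<And>p. p \<in> F \<Longrightarrow> prime p" and h: "\<And>p. prime p \<Longrightarrow> p \<notin> F \<Longrightarrow> h p = 0" and z: "z \<ge> 0"
  shows "(\<Sum>s | 1 \<le> s \<and> real s \<le> z \<and> squarefree s. \<Prod>p | prime p \<and> p dvd s. h p)
    = (\<Sum>Q\<in>Pow F. of_bool (real (\<Prod>Q) \<le> z) * (\<Prod>p\<in>Q. h p))"
proof -
  let ?A = "{s. 1 \<le> s \<and> real s \<le> z \<and> squarefree s}"
  have "?A \<subseteq> {..nat \<lfloor>z\<rfloor>}" by (auto simp: le_nat_floor)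
  then have finA: "finite ?A" by (rule finite_subset) simp
  have pf: "{p. prime p \<and> p dvd s} = prime_factors s" if "s \<ge> 1" for s :: nat
    using that by (auto simp: in_prime_factors_iff)
  have "(\<Sum>s\<in>?A. \<Prod>p | prime p \<and> p dvd s. h p) = (\<Sum>s\<in>{s \<in> ?A. prime_factors s \<subseteq> F}. \<Prod>p | prime p \<and> p dvd s. h p)"
  proof (rule sum.mono_neutral_right[OF finA])
    show "\<forall>s\<in>?A - {s \<in> ?A. prime_factors s \<subseteq> F}. (\<Prod>p | prime p \<and> p dvd s. h p) = 0"
    proof
      fix s assume s: "s \<in> ?A - {s \<in> ?A. prime_factors s \<subseteq> F}"
      then obtain p where p: "p \<in> prime_factors s" "p \<notin> F" by blast
      then have "h p = 0" by (intro h) (auto simp: in_prime_factors_iff)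
      then have "(\<Prod>p\<in>prime_factors s. h p) = 0" using p(1) by (meson finite_set_mset prod_zero)
      then show "(\<Prod>p | prime p \<and> p dvd s. h p) = 0" using pf[of s] s by simp
    qed
  qed blast
  also have "\<dots> = (\<Sum>Q\<in>{Q \<in> Pow F. real (\<Prod>Q) \<le> z}. \<Prod>p\<in>Q. h p)"
  proof (rule sum.reindex_bij_witness[of _ "\<lambda>Q. \<Prod>Q" prime_factors])
    fix s assume s: "s \<in> {s \<in> ?A. prime_factors s \<subseteq> F}"
    then have e: "\<Prod>(prime_factors s) = s" by (intro prod_prime_factors_squarefree) simp
    show "\<Prod>(prime_factors s) = s" by (rule e)
    show "prime_factors s \<in> {Q \<in> Pow F. real (\<Prod>Q) \<le> z}" unfolding mem_Collect_eq e using s by simp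
    show "(\<Prod>p\<in>prime_factors s. h p) = (\<Prod>p | prime p \<and> p dvd s. h p)" using pf[of s] s by simp
  next
    fix Q assume "Q \<in> {Q \<in> Pow F. real (\<Prod>Q) \<le> z}"
    then have Q: "Q \<subseteq> F" "real (\<Prod>Q) \<le> z" by auto
    have "finite Q" using Q(1) F(1) finite_subset by blast
    note pq = prime_factors_prod_primes[OF this, OF F(2)[OF subsetD[OF Q(1)]]]
    show "prime_factors (\<Prod>Q) = Q" by (rule pq)
    show "\<Prod>Q \<in> {s \<in> ?A. prime_factors s \<subseteq> F}" using pq Q by (simp add: Suc_leI)
  qed
  also have "\<dots> = (\<Sum>Q\<in>Pow F. of_bool (real (\<Prod>Q) \<le> z) * (\<Prod>p\<in>Q. h p))"
    using F(1) by (intro sum.mono_neutral_cong_left) auto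
  finally show ?thesis .
qed

lemma sum_Pow_insert:
  fixes G :: "'a set \<Rightarrow> int"
  assumes "finite A" "a \<notin> A"
  shows "(\<Sum>Q\<in>Pow (insert a A). G Q) = (\<Sum>D\<in>Pow A. G D + G (insert a D))"
proof -
  have "(\<Sum>Q\<in>Pow (insert a A). G Q) = (\<Sum>Q\<in>Pow A. G Q) + (\<Sum>Q\<in>insert a ` Pow A. G Q)"
    unfolding Pow_insert using assms by (intro sum.union_disjoint) auto
  also have "(\<Sum>Q\<in>insert a ` Pow A. G Q) = (\<Sum>D\<in>Pow A. G (insert a D))"
    proof -
    have "inj_on (insert a) (Pow A)"
    proof (rule inj_onI)
      fix D D' assume h: "D \<in> Pow A" "D' \<in> Pow A" "insert a D = insert a D'"
      have "a \<notin> D" "a \<notin> D'" using h(1,2) assms(2) by blast+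
      then show "D = D'" using h(3) by (simp add: insert_ident)
    qed
    then show ?thesis by (simp add: sum.reindex)
  qed
  finally show ?thesis by (simp add: sum.distrib)
qed

lemma sum_Pow_compl:
  assumes "finite A"
  shows "(\<Sum>D\<in>Pow A. G D) = (\<Sum>D\<in>Pow A. G (A - D))"
  by (rule sum.reindex_bij_witness[of _ "\<lambda>D. A - D" "\<lambda>D. A - D"]) (auto simp: double_diff)

text \<open>This is \<open>[d > z and e > z] - [d \<le> z and e \<le> z]\<close>.\<close>

definition tail_weight :: "real \<Rightarrow> real \<Rightarrow> real \<Rightarrow> int" where
  "tail_weight z d e = 1 - of_bool (d \<le> z) - of_bool (e \<le> z)"

text \<open>Let \<open>\<xi> D\<close> be the product of the symbols over \<open>D\<close>.
  Reciprocity makes the real symbol equal to the symbol at 2 times \<open>\<xi> n\<close>, and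
  \<open>\<xi> n * \<xi> D\<close> is \<open>\<xi> (n - D)\<close>; so the real part of
  \<open>delta_det\<close> truncates the complementary divisor. The prime 2 is kept apart, because
  its modified symbol \<open>\<eta>\<close> may be 0 although 2 is a place of reciprocity. An even
  \<open>s\<close> accounts for the thresholds on \<open>2 * \<Prod>D\<close>.\<close>

lemma delta_rand_eq:
  assumes \<sigma>: "\<sigma>1 \<in> {-1, 1}" "\<sigma>2 \<in> {-1, 1}" and pos: "S > 0" "T > 0" "R > 0" and z: "z \<ge> 0"
  defines "t1 \<equiv> \<sigma>1 * int S * int R" and "t2 \<equiv> \<sigma>2 * int T * int R"
  defines "n \<equiv> npr S T R" and "\<eta> \<equiv> hilbert' 2 t1 t2"
  shows "delta_rand z t1 t2 = (\<Sum>D\<in>Pow n. (\<Prod>p\<in>D. local_sym p t1 t2) *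
    (if \<eta> = 0 then tail_weight z (\<Prod>D) (\<Prod>(n - D))
     else tail_weight z (\<Prod>D) (2 * \<Prod>(n - D)) + \<eta> * tail_weight z (2 * \<Prod>D) (\<Prod>(n - D))))"
proof -
  have nz: "t1 \<noteq> 0" "t2 \<noteq> 0" using \<sigma> pos by (auto simp: t1_def t2_def)
  have fin: "finite n" using pos by (simp add: n_def)
  have npr: "prime p \<and> odd p" if "p \<in> n" for p using that by (auto simp: n_def npr_def oddpr_def)
  have two: "2 \<notin> n"
  proof
    assume "2 \<in> n"
    from npr[OF this] show False by simp
  qed
  have m: "multiplicity (int p) t1 = multiplicity p S + multiplicity p R" "multiplicity (int p) t2 = multiplicity p T + multiplicity p R" if "prime p" for p
    unfolding t1_def t2_def using multiplicity_signed[OF that] \<sigma> pos by auto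
  have hn: "hilbert' p t1 t2 = local_sym p t1 t2" if "p \<in> n" for p
  proof -
    have "prime p" "odd p" "odd (multiplicity (int p) t1) \<or> odd (multiplicity (int p) t2)"
      using npr[OF that] that m[of p] by (auto simp: n_def npr_def oddpr_def)
    then show ?thesis using hilbert'_eq_local_sym[of p t1 t2] nz by auto
  qed
  have h0: "hilbert' p t1 t2 = 0" if "prime p" "p \<notin> insert 2 n" for p
  proof -
    have "odd p" using that prime_odd_nat[of p] prime_ge_2_nat[of p] by force
    then have "even (multiplicity (int p) t1)" "even (multiplicity (int p) t2)"
      using that m[of p] by (auto simp: n_def npr_def oddpr_def)
    then show ?thesis using hilbert'_eq_local_sym[of p t1 t2] nz that \<open>odd p\<close> by auto
  qed
  define \<xi> where "\<xi> D = (\<Prod>p\<in>D. local_sym p t1 t2)" for D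
  have lv: "local_sym p t1 t2 = 1 \<or> local_sym p t1 t2 = -1" if "prime p" for p using local_sym_values[OF that nz] .
  have \<xi>h: "(\<Prod>p\<in>D. hilbert' p t1 t2) = \<xi> D" if "D \<subseteq> n" for D
    unfolding \<xi>_def
  proof (intro prod.cong refl)
    fix p assume "p \<in> D"
    then show "hilbert' p t1 t2 = local_sym p t1 t2" by (intro hn subsetD[OF that])
  qed
  have \<xi>i: "(\<Prod>p\<in>insert 2 D. hilbert' p t1 t2) = \<eta> * \<xi> D" if "D \<subseteq> n" for D
    using that two \<xi>h[OF that] finite_subset[OF that fin] by (subst prod.insert) (auto simp: \<eta>_def)
  have "\<xi> n * \<xi> D = \<xi> (n - D)" if "D \<subseteq> n" for D
  proof -
    have "\<xi> n = \<xi> (n - D) * \<xi> D" unfolding \<xi>_def by (rule prod.subset_diff[OF that fin])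
    moreover have "\<xi> D * \<xi> D = 1"
      unfolding \<xi>_def prod.distrib[symmetric]
    proof (intro prod.neutral ballI)
      fix p assume "p \<in> D"
      then have "prime p" using that npr by blast
      then show "local_sym p t1 t2 * local_sym p t1 t2 = 1" using lv[of p] by auto
    qed
    ultimately show ?thesis by (simp add: mult.assoc)
  qed
  note \<xi>c = this
  have delta: "delta t1 t2 = (1 + \<eta>) * (\<Sum>D\<in>Pow n. \<xi> D)"
  proof -
    have "delta t1 t2 = (\<Prod>p\<in>insert 2 n. 1 + hilbert' p t1 t2)"
      unfolding delta_def
    proof (rule prod.mono_neutral_left)
      show "{p. prime p \<and> hilbert' p t1 t2 \<noteq> 0} \<subseteq> insert 2 n" using h0 by blast
      show "\<forall>p\<in>insert 2 n - {p. prime p \<and> hilbert' p t1 t2 \<noteq> 0}. 1 + hilbert' p t1 t2 = 1"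
        using npr by auto
    qed (use fin in simp)
    also have "\<dots> = (1 + \<eta>) * (\<Prod>p\<in>n. hilbert' p t1 t2 + 1)" using two fin by (simp add: \<eta>_def add.commute)
    also have "(\<Prod>p\<in>n. hilbert' p t1 t2 + 1) = (\<Sum>D\<in>Pow n. \<xi> D)"
      unfolding prod_add[OF fin] by (intro sum.cong refl) (simp add: \<xi>h)
    finally show ?thesis .
  qed
  define th where "th d = (of_bool (real d \<le> z) :: int)" for d :: nat
  have det: "delta_det z t1 t2 = (1 + infty_sym t1 t2) * (\<Sum>D\<in>Pow n. \<xi> D * (th (\<Prod>D) + \<eta> * th (2 * \<Prod>D)))"
  proof -
    have "(\<Sum>s | 1 \<le> s \<and> real s \<le> z \<and> squarefree s. \<Prod>p | prime p \<and> p dvd s. hilbert' p t1 t2)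
       = (\<Sum>Q\<in>Pow (insert 2 n). of_bool (real (\<Prod>Q) \<le> z) * (\<Prod>p\<in>Q. hilbert' p t1 t2))"
      by (rule sum_squarefree_primes) (use fin npr h0 z in auto)
    also have "\<dots> = (\<Sum>D\<in>Pow n. of_bool (real (\<Prod>D) \<le> z) * (\<Prod>p\<in>D. hilbert' p t1 t2)
        + of_bool (real (\<Prod>(insert 2 D)) \<le> z) * (\<Prod>p\<in>insert 2 D. hilbert' p t1 t2))"
      by (rule sum_Pow_insert[OF fin two])
    also have "\<dots> = (\<Sum>D\<in>Pow n. \<xi> D * (th (\<Prod>D) + \<eta> * th (2 * \<Prod>D)))"
    proof (intro sum.cong refl)
      fix D assume "D \<in> Pow n"
      then have D: "D \<subseteq> n" by simp
      have "\<Prod>(insert 2 D) = 2 * \<Prod>D" using D two finite_subset[OF D fin] by (subst prod.insert) auto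
      then show "of_bool (real (\<Prod>D) \<le> z) * (\<Prod>p\<in>D. hilbert' p t1 t2)
        + of_bool (real (\<Prod>(insert 2 D)) \<le> z) * (\<Prod>p\<in>insert 2 D. hilbert' p t1 t2) = \<xi> D * (th (\<Prod>D) + \<eta> * th (2 * \<Prod>D))"
        unfolding \<xi>h[OF D] \<xi>i[OF D] th_def by (simp add: algebra_simps)
    qed
    finally show ?thesis unfolding delta_det_def hilbert'_infty_eq_infty_sym[OF nz] by (rule arg_cong)
  qed
  have rec: "local_sym 2 t1 t2 * \<xi> n * infty_sym t1 t2 = 1"
  proof -
    define m where "m = S * T * R"
    have m0: "m > 0" using pos by (simp add: m_def)
    \<comment> \<open>Reciprocity involves all primes dividing the arguments; those outside
      \<open>insert 2 n\<close> have even exponents in both and contribute 1.\<close>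
    define P where "P = prime_factors m \<union> insert 2 n"
    have finP: "finite P" using fin by (simp add: P_def)
    have pP: "prime p" if "p \<in> P" for p using that npr two_is_prime_nat unfolding P_def in_prime_factors_iff by blast
    have dv: "p \<in> P" if "prime p" "int p dvd \<sigma> * int A * int B" "\<sigma> \<in> {-1, 1}" "A * B dvd m" for p \<sigma> A B
    proof -
      have "\<sigma> * int A * int B = int (A * B) \<or> \<sigma> * int A * int B = - int (A * B)" using that(3) by auto
      then have "int p dvd int (A * B)" using that(2) by (metis dvd_minus_iff)
      then have "p dvd A * B" by (simp only: int_dvd_int_iff)
      then have "p dvd m" using that(4) by (rule dvd_trans)
      then show ?thesis using that(1) m0 by (simp add: P_def in_prime_factors_iff)
    qed
    have "(\<Prod>p\<in>P. local_sym p t1 t2) * infty_sym t1 t2 = 1"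
      proof (rule hilbert_reciprocity_local_sym[OF finP pP _ nz])
      show "2 \<in> P" by (simp add: P_def)
      have "S * R dvd m" "T * R dvd m" unfolding m_def by (rule dvdI[of _ _ T] dvdI[of _ _ S], simp add: mult_ac)+
      then show "p \<in> P" if "prime p" "int p dvd t1" for p
        using dv[OF that(1) that(2)[unfolded t1_def] \<sigma>(1)] by blast
      show "p \<in> P" if "prime p" "int p dvd t2" for p
        using dv[OF that(1) that(2)[unfolded t2_def] \<sigma>(2)] \<open>T * R dvd m\<close> by blast
    qed
    moreover have "(\<Prod>p\<in>P. local_sym p t1 t2) = (\<Prod>p\<in>insert 2 n. local_sym p t1 t2)"
    proof (rule prod.mono_neutral_right[OF finP])
      show "\<forall>p\<in>P - insert 2 n. local_sym p t1 t2 = 1"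
      proof
        fix p assume p: "p \<in> P - insert 2 n"
        then have "prime p" "odd p" using pP[of p] prime_odd_nat[of p] prime_ge_2_nat[of p] by force+
        then show "local_sym p t1 t2 = 1" using p m[of p]
          by (intro local_sym_even) (auto simp: n_def npr_def oddpr_def)
      qed
    qed (auto simp: P_def)
    ultimately show ?thesis using two fin by (simp add: \<xi>_def)
  qed
  have l2: "local_sym 2 t1 t2 = 1 \<or> local_sym 2 t1 t2 = -1" by (rule lv) simp
  have in1: "infty_sym t1 t2 = local_sym 2 t1 t2 * \<xi> n"
    using rec l2 by (auto simp: infty_sym_def split: if_splits)
  have dvs: "delta_rand z t1 t2 = (\<Sum>D\<in>Pow n. \<xi> D * ((1 + \<eta>) - (th (\<Prod>D) + \<eta> * th (2 * \<Prod>D))))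
      - local_sym 2 t1 t2 * (\<Sum>D\<in>Pow n. \<xi> D * (th (\<Prod>(n - D)) + \<eta> * th (2 * \<Prod>(n - D))))"
  proof -
    have "infty_sym t1 t2 * (\<Sum>D\<in>Pow n. \<xi> D * (th (\<Prod>D) + \<eta> * th (2 * \<Prod>D)))
      = local_sym 2 t1 t2 * (\<Sum>D\<in>Pow n. \<xi> (n - D) * (th (\<Prod>D) + \<eta> * th (2 * \<Prod>D)))"
      unfolding in1 sum_distrib_left by (intro sum.cong refl) (simp add: \<xi>c[symmetric] mult_ac)
    also have "(\<Sum>D\<in>Pow n. \<xi> (n - D) * (th (\<Prod>D) + \<eta> * th (2 * \<Prod>D)))
      = (\<Sum>D\<in>Pow n. \<xi> D * (th (\<Prod>(n - D)) + \<eta> * th (2 * \<Prod>(n - D))))"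
      by (subst sum_Pow_compl[OF fin]) (intro sum.cong refl, simp add: double_diff)
    finally have hA: "infty_sym t1 t2 * (\<Sum>D\<in>Pow n. \<xi> D * (th (\<Prod>D) + \<eta> * th (2 * \<Prod>D)))
      = local_sym 2 t1 t2 * (\<Sum>D\<in>Pow n. \<xi> D * (th (\<Prod>(n - D)) + \<eta> * th (2 * \<Prod>(n - D))))" .
    have "(\<Sum>D\<in>Pow n. \<xi> D * ((1 + \<eta>) - (th (\<Prod>D) + \<eta> * th (2 * \<Prod>D))))
      = (1 + \<eta>) * (\<Sum>D\<in>Pow n. \<xi> D) - (\<Sum>D\<in>Pow n. \<xi> D * (th (\<Prod>D) + \<eta> * th (2 * \<Prod>D)))"
      unfolding right_diff_distrib sum_subtractf by (simp add: sum_distrib_left mult.commute)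
    then show ?thesis unfolding delta_rand_def delta det hA[symmetric] by (simp add: distrib_right)
  qed
  show ?thesis
  proof (cases "\<eta> = 0")
    case True
    \<comment> \<open>\<open>\<eta> = 0\<close> means even exponents and unit parts that differ
      modulo 4. Then not both are 3 modulo 4, and the true symbol at 2 is 1.\<close>
    then have "local_sym 2 t1 t2 = 1"
    proof -
      have h: "(if even (multiplicity 2 t1) \<and> even (multiplicity 2 t2) \<and> \<not> [upart 2 t1 = upart 2 t2] (mod 4) then 0 else local_sym 2 t1 t2) = 0"
        using hilbert'_eq_local_sym[OF two_is_prime_nat nz] True by (simp add: \<eta>_def)
      then have ev: "even (multiplicity 2 t1)" "even (multiplicity 2 t2)" "\<not> [upart 2 t1 = upart 2 t2] (mod 4)"
        using l2 by (auto split: if_splits)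
      have "odd (upart 2 t1)" "odd (upart 2 t2)" using upart(2)[OF two_is_prime_nat] nz by auto
      then have "\<not> (sign4 (upart 2 t1) = -1 \<and> sign4 (upart 2 t2) = -1)"
        proof -
        have three: "u mod 4 = 3" if "odd u" "sign4 u = -1" for u
          using that unfolding sign4_def by (cases "u mod 4 = 1") (simp, presburger)
        show ?thesis using ev(3) three \<open>odd (upart 2 t1)\<close> \<open>odd (upart 2 t2)\<close> unfolding cong_def by metis
      qed
      then show ?thesis using ev by (simp add: local_sym_def)
    qed
    then show ?thesis unfolding dvs using True
      by (simp add: sum_subtractf[symmetric] tail_weight_def th_def \<xi>_def[symmetric] algebra_simps)
  next
    case False
    then have l: "local_sym 2 t1 t2 = \<eta>"
      using hilbert'_eq_local_sym[OF two_is_prime_nat nz] by (auto simp: \<eta>_def split: if_splits)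
    \<comment> \<open>The square removes \<open>\<eta>\<close> from the threshold on
      \<open>2 * \<Prod>(n - D)\<close>, which therefore pairs with the one on
      \<open>\<Prod>D\<close>.\<close>
    have "\<eta> * \<eta> = 1" using l l2 by auto
    then have e: "\<eta> * (\<eta> * x) = x" for x by (simp add: mult.assoc[symmetric])
    show ?thesis unfolding dvs l sum_distrib_left using False
      by (simp add: sum_subtractf[symmetric] tail_weight_def th_def \<xi>_def[symmetric] algebra_simps e)
  qed
qed

section \<open>Dependence of the symbol at 2 on residues modulo 8\<close>

lemma upart_odd_mult:
  assumes "a \<noteq> 0" "odd m"
  shows "multiplicity 2 (a * int m) = multiplicity 2 a" "upart 2 (a * int m) = upart 2 a * int m"
proof -
  have m0: "int m \<noteq> 0" using assms(2) by (auto intro: Nat.gr0I)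
  have "multiplicity (int 2) (int m) = 0" using assms(2) by (intro not_dvd_imp_multiplicity_0) simp
  then have "multiplicity 2 (int m) = 0" "upart 2 (int m) = int m" by (simp_all add: upart_def)
  then show "multiplicity 2 (a * int m) = multiplicity 2 a" "upart 2 (a * int m) = upart 2 a * int m"
    using upart_mult[OF two_is_prime_nat assms(1) m0] by simp_all
qed

text \<open>An odd factor affects only the unit parts, and the formula at 2 sees these modulo
  8.\<close>

lemma hilbert'_2_odd_cong:
  assumes "odd m" "odd m'" "m mod 8 = m' mod 8" "odd k" "odd k'" "k mod 8 = k' mod 8"
  shows "hilbert' 2 (a * int m) (b * int k) = hilbert' 2 (a * int m') (b * int k')"
proof (cases "a = 0 \<or> b = 0")
  case True
  then show ?thesis by (auto simp: hilbert'_def Let_def)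
next
  case False
  then have ab: "a \<noteq> 0" "b \<noteq> 0" by auto
  have nz: "a * int m \<noteq> 0" "b * int k \<noteq> 0" "a * int m' \<noteq> 0" "b * int k' \<noteq> 0"
    using ab assms by (auto intro: Nat.gr0I)
  have i8: "int m mod 8 = int m' mod 8" "int k mod 8 = int k' mod 8"
    using assms(3,6) by (metis of_nat_mod of_nat_numeral)+
  have u8: "(upart 2 a * int m) mod 8 = (upart 2 a * int m') mod 8" "(upart 2 b * int k) mod 8 = (upart 2 b * int k') mod 8"
    using i8 by (auto intro: mod_mult_cong)
  have m48: "x mod 8 mod 4 = x mod 4" for x :: int by (simp add: mod_mod_cancel)
  have u4: "(upart 2 a * int m) mod 4 = (upart 2 a * int m') mod 4" "(upart 2 b * int k) mod 4 = (upart 2 b * int k') mod 4"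
    using u8 by (metis m48)+
  show ?thesis
    unfolding hilbert'_eq_local_sym[OF two_is_prime_nat nz(1,2)] hilbert'_eq_local_sym[OF two_is_prime_nat nz(3,4)]
    by (simp add: upart_odd_mult ab assms local_sym_def sign4_def sign8_def cong_def u4 u8)
qed

text \<open>\<open>f\<close> selects a case of the symbol at 2 or multiplies by its value, so one
  lemma makes all the weights arising from \<open>delta_rand_eq\<close> admissible.\<close>

definition eta_weight :: "int \<Rightarrow> int \<Rightarrow> (int \<Rightarrow> complex) \<Rightarrow> nat \<Rightarrow> nat \<Rightarrow> nat \<Rightarrow> complex" where
  "eta_weight \<sigma>1 \<sigma>2 f S T R = f (hilbert' 2 (\<sigma>1 * int S * int R) (\<sigma>2 * int T * int R))"

lemma hilbert'_values: "hilbert' p a b \<in> {-1, 0, 1}"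
  by (simp add: hilbert'_def hilbert_symbol_def Let_def)

lemma mod8_inv_eta_weight:
  assumes "\<And>h. h \<in> {-1, 0, 1} \<Longrightarrow> cmod (f h) \<le> 1"
  shows "mod8_inv (eta_weight \<sigma>1 \<sigma>2 f)"
  unfolding mod8_inv_def
proof (intro conjI allI impI)
  show "cmod (eta_weight \<sigma>1 \<sigma>2 f S T R) \<le> 1" for S T R
    unfolding eta_weight_def by (rule assms[OF hilbert'_values])
  fix S T R m m' :: nat
  assume m: "odd m" "odd m'" "m mod 8 = m' mod 8"
  have r: "\<sigma> * int (A * k) * int B = (\<sigma> * int A * int B) * int k" "\<sigma> * int A * int (B * k) = (\<sigma> * int A * int B) * int k" for \<sigma> A B k
    by (simp_all add: mult_ac)
  have o1: "odd (1::nat)" by simp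
  show "eta_weight \<sigma>1 \<sigma>2 f (S * m) T R = eta_weight \<sigma>1 \<sigma>2 f (S * m') T R"
    unfolding eta_weight_def r using hilbert'_2_odd_cong[OF m o1 o1 refl, of "\<sigma>1 * int S * int R" "\<sigma>2 * int T * int R"] by simp
  show "eta_weight \<sigma>1 \<sigma>2 f S (T * m) R = eta_weight \<sigma>1 \<sigma>2 f S (T * m') R"
    unfolding eta_weight_def r using hilbert'_2_odd_cong[OF o1 o1 refl m, of "\<sigma>1 * int S * int R" "\<sigma>2 * int T * int R"] by simp
  show "eta_weight \<sigma>1 \<sigma>2 f S T (R * m) = eta_weight \<sigma>1 \<sigma>2 f S T (R * m')"
    unfolding eta_weight_def r using hilbert'_2_odd_cong[OF m m] by simp
qed

section \<open>Summing over the boxes\<close>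

definition OmAll :: "nat \<Rightarrow> nat \<Rightarrow> nat \<Rightarrow> (nat \<times> nat \<times> nat \<times> nat set) set" where
  "OmAll Nx Ny Nz = {(S, T, R, D). S \<in> {1..Nx} \<and> T \<in> {1..Ny} \<and> R \<in> {1..Nz} \<and> D \<subseteq> npr S T R}"

abbreviation "boxfun \<equiv> (\<lambda>(S, T, R, D). boxof S T R D)"

lemma sum_OmAll:
  fixes f :: "nat \<times> nat \<times> nat \<times> nat set \<Rightarrow> 'a :: comm_monoid_add"
  shows "(\<Sum>S\<in>{1..Nx}. \<Sum>T\<in>{1..Ny}. \<Sum>R\<in>{1..Nz}. \<Sum>D\<in>Pow (npr S T R). f (S, T, R, D)) = (\<Sum>x\<in>OmAll Nx Ny Nz. f x)"
    and "finite (OmAll Nx Ny Nz)"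
proof -
  have e: "OmAll Nx Ny Nz = (SIGMA S:{1..Nx}. SIGMA T:{1..Ny}. SIGMA R:{1..Nz}. Pow (npr S T R))"
    by (auto simp: OmAll_def)
  have f4: "finite (Pow (npr S T R))" if "S \<in> {1..Nx}" "T \<in> {1..Ny}" "R \<in> {1..Nz}" for S T R
    using that by simp
  have f3: "finite (SIGMA R:{1..Nz}. Pow (npr S T R))" if "S \<in> {1..Nx}" "T \<in> {1..Ny}" for S T
    using that f4 by (intro finite_SigmaI) auto
  have f2: "finite (SIGMA T:{1..Ny}. SIGMA R:{1..Nz}. Pow (npr S T R))" if "S \<in> {1..Nx}" for S
    using that f3 by (intro finite_SigmaI) auto
  show "finite (OmAll Nx Ny Nz)" unfolding e using f2 by (intro finite_SigmaI) auto
  have "(\<Sum>S\<in>{1..Nx}. \<Sum>T\<in>{1..Ny}. \<Sum>R\<in>{1..Nz}. \<Sum>D\<in>Pow (npr S T R). f (S, T, R, D))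
    = (\<Sum>S\<in>{1..Nx}. \<Sum>T\<in>{1..Ny}. \<Sum>y\<in>(SIGMA R:{1..Nz}. Pow (npr S T R)). f (S, T, y))"
    using f4 by (intro sum.cong refl) (subst sum.Sigma, auto)
  also have "\<dots> = (\<Sum>S\<in>{1..Nx}. \<Sum>y\<in>(SIGMA T:{1..Ny}. SIGMA R:{1..Nz}. Pow (npr S T R)). f (S, y))"
    using f3 by (intro sum.cong refl) (subst sum.Sigma, auto)
  also have "\<dots> = (\<Sum>x\<in>OmAll Nx Ny Nz. f x)"
    unfolding e using f2 by (subst sum.Sigma) auto
  finally show "(\<Sum>S\<in>{1..Nx}. \<Sum>T\<in>{1..Ny}. \<Sum>R\<in>{1..Nz}. \<Sum>D\<in>Pow (npr S T R). f (S, T, R, D)) = (\<Sum>x\<in>OmAll Nx Ny Nz. f x)" .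
qed

lemma Om_eq_OmAll: "Om Nx Ny Nz b = {x \<in> OmAll Nx Ny Nz. boxfun x = b}"
  by (auto simp: Om_def OmAll_def)

lemma floor_log_le_powr:
  assumes "\<delta> > 0" "n \<ge> 1"
  shows "real (Suc (floor_log n)) \<le> (1 + 1 / (\<delta> * ln 2)) * real n powr \<delta>"
proof -
  have "real (2 ^ floor_log n) \<le> real n" using floor_log_exp2_le[of n] assms(2) unfolding of_nat_le_iff by simp
  then have "ln ((2::real) ^ floor_log n) \<le> ln (real n)" using assms(2) by simp
  then have "floor_log n * ln 2 \<le> ln (real n)" by (simp add: ln_realpow)
  also have "\<dots> \<le> real n powr \<delta> / \<delta>" using assms by (intro ln_powr_bound) auto
  finally have "floor_log n \<le> 1 / (\<delta> * ln 2) * real n powr \<delta>" using assms(1) by (simp add: field_simps)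
  moreover have "1 \<le> real n powr \<delta>" using assms by (intro ge_one_powr_ge_zero) auto
  ultimately show ?thesis by (simp add: algebra_simps)
qed

lemma card_boxes:
  assumes \<epsilon>: "\<epsilon> > 0"
  shows "\<exists>C\<ge>1. \<forall>Nx\<ge>1. \<forall>Ny\<ge>1. \<forall>Nz\<ge>1. real (card (boxfun ` OmAll Nx Ny Nz)) \<le> C * (real Nx * real Ny * real Nz) powr \<epsilon>"
proof -
  \<comment> \<open>A box has nine dyadic indices, each taking logarithmically many values.\<close>
  define \<delta> where "\<delta> = \<epsilon> / 9"
  have \<delta>: "\<delta> > 0" using \<epsilon> by (simp add: \<delta>_def)
  define K where "K = 1 + 1 / (\<delta> * ln 2)"
  have K: "K \<ge> 1" using \<delta> by (simp add: K_def)
  show ?thesis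
  proof (intro exI[of _ "K ^ 9"] conjI allI impI)
    show "K ^ 9 \<ge> 1" using K by simp
    fix Nx Ny Nz :: nat assume N1: "1 \<le> Nx" "1 \<le> Ny" "1 \<le> Nz"
    define N where "N = Nx * Ny * Nz"
    have N: "N \<ge> 1" "Nx \<le> N" "Ny \<le> N" "Nz \<le> N" using N1 by (auto simp: N_def)
    define A where "A = {..floor_log N}"
    have le: "k \<in> A" if "2 ^ k * m \<le> N'" "m \<ge> 1" "N' \<le> N" for k m N' :: nat
    proof -
      have "2 ^ k \<le> 2 ^ k * m" using mult_le_mono2[OF that(2), of "2 ^ k"] unfolding mult_1_right .
      then have "2 ^ k \<le> N" using order.trans[OF that(1,3)] by (rule order.trans)
      then have "floor_log (2 ^ k) \<le> floor_log N" by (rule floor_log_le_iff)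
      then show ?thesis by (simp add: A_def)
    qed
    have "boxfun ` OmAll Nx Ny Nz \<subseteq> (A \<times> A) \<times> (A \<times> A) \<times> (A \<times> A) \<times> A \<times> A \<times> A"
    proof
      fix bx assume "bx \<in> boxfun ` OmAll Nx Ny Nz"
      then obtain x where x: "x \<in> Om Nx Ny Nz bx" unfolding Om_eq_OmAll by blast
      obtain i1 i2 i3 i4 i5 i6 g1 g2 g3 where bx: "bx = ((i1, i2), (i3, i4), (i5, i6), g1, g2, g3)" by (metis prod.exhaust)
      obtain S T R D where xe: "x = (S, T, R, D)" by (cases x)
      note geo = box_geometry[OF x[unfolded xe bx]]
      have "i1 \<in> A" by (rule le[OF _ _ N(2), of _ "2 ^ i2 * (2 ^ g1 * 2 ^ g2)"]) (use geo(1) in \<open>simp_all add: mult_ac\<close>)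
      moreover have "i2 \<in> A" by (rule le[OF _ _ N(2), of _ "2 ^ i1 * (2 ^ g1 * 2 ^ g2)"]) (use geo(1) in \<open>simp_all add: mult_ac\<close>)
      moreover have "i3 \<in> A" by (rule le[OF _ _ N(3), of _ "2 ^ i4 * (2 ^ g1 * 2 ^ g3)"]) (use geo(2) in \<open>simp_all add: mult_ac\<close>)
      moreover have "i4 \<in> A" by (rule le[OF _ _ N(3), of _ "2 ^ i3 * (2 ^ g1 * 2 ^ g3)"]) (use geo(2) in \<open>simp_all add: mult_ac\<close>)
      moreover have "i5 \<in> A" by (rule le[OF _ _ N(4), of _ "2 ^ i6 * (2 ^ g2 * 2 ^ g3)"]) (use geo(3) in \<open>simp_all add: mult_ac\<close>)
      moreover have "i6 \<in> A" by (rule le[OF _ _ N(4), of _ "2 ^ i5 * (2 ^ g2 * 2 ^ g3)"]) (use geo(3) in \<open>simp_all add: mult_ac\<close>)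
      moreover have "g1 \<in> A" by (rule le[OF _ _ N(2), of _ "2 ^ i1 * (2 ^ i2 * 2 ^ g2)"]) (use geo(1) in \<open>simp_all add: mult_ac\<close>)
      moreover have "g2 \<in> A" by (rule le[OF _ _ N(2), of _ "2 ^ i1 * (2 ^ i2 * 2 ^ g1)"]) (use geo(1) in \<open>simp_all add: mult_ac\<close>)
      moreover have "g3 \<in> A" by (rule le[OF _ _ N(3), of _ "2 ^ i3 * (2 ^ i4 * 2 ^ g1)"]) (use geo(2) in \<open>simp_all add: mult_ac\<close>)
      ultimately show "bx \<in> (A \<times> A) \<times> (A \<times> A) \<times> (A \<times> A) \<times> A \<times> A \<times> A" unfolding bx by blast
    qed
    then have "card (boxfun ` OmAll Nx Ny Nz) \<le> card ((A \<times> A) \<times> (A \<times> A) \<times> (A \<times> A) \<times> A \<times> A \<times> A)"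
      by (intro card_mono) (simp_all add: A_def)
    also have "\<dots> = card A ^ 9" by (simp add: card_cartesian_product eval_nat_numeral mult_ac)
    also have "card A = Suc (floor_log N)" by (simp add: A_def)
    finally have "real (card (boxfun ` OmAll Nx Ny Nz)) \<le> real (Suc (floor_log N)) ^ 9"
      by (simp only: of_nat_power[symmetric] of_nat_le_iff)
    also have "\<dots> \<le> (K * real N powr \<delta>) ^ 9"
      using floor_log_le_powr[OF \<delta> N(1)] by (intro power_mono) (simp_all add: K_def)
    also have "\<dots> = K ^ 9 * (real N powr \<delta>) ^ 9" by (rule power_mult_distrib)
    also have "(real N powr \<delta>) ^ 9 = real N powr \<epsilon>"
    proof -
      have "(real N powr \<delta>) ^ 9 = (real N powr \<delta>) powr 9" using N by simp
      then show ?thesis by (simp add: powr_powr \<delta>_def)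
    qed
    finally show "real (card (boxfun ` OmAll Nx Ny Nz)) \<le> K ^ 9 * (real Nx * real Ny * real Nz) powr \<epsilon>"
      by (simp add: N_def)
  qed
qed

text \<open>Up to an error supported where both divisors are at most \<open>z\<close>, each term is
  a sum of three functions of the form \<open>summand\<close>: the case of vanishing symbol at 2 and
  the two halves of the other case. There are so few boxes that bounding them one by one
  suffices.\<close>

theorem core_sum:
  assumes \<epsilon>: "\<epsilon> > 0"
  shows "\<exists>C\<ge>1. \<forall>Nx\<ge>1. \<forall>Ny\<ge>1. \<forall>Nz\<ge>1. \<forall>\<sigma>1 \<sigma>2 a b c z.
    \<sigma>1 \<in> {-1, 1} \<longrightarrow> \<sigma>2 \<in> {-1, 1} \<longrightarrow> (\<forall>n. cmod (a n) \<le> 1) \<longrightarrow> (\<forall>n. cmod (b n) \<le> 1) \<longrightarrow> (\<forall>n. cmod (c n) \<le> 1) \<longrightarrow> 1 \<le> z \<longrightarrow>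
    cmod (\<Sum>S\<in>{1..Nx}. \<Sum>T\<in>{1..Ny}. \<Sum>R\<in>{1..Nz}. a S * b T * c R * of_int (delta_rand z (\<sigma>1 * int S * int R) (\<sigma>2 * int T * int R)))
    \<le> C * ((real Nx * real Ny * real Nz) powr (1 + \<epsilon>) * (z powr (- 1 / 9) + z powr (1 / 9) / sqrt (Mmin Nx Ny Nz))
        + (real Nx * real Ny * real Nz) powr (1 / 2 + \<epsilon>) * z)"
proof -
  have e2: "\<epsilon> / 2 > 0" using \<epsilon> by simp
  obtain C1 where C1: "C1 \<ge> 1" and B1: "\<And>Nx Ny Nz bx \<sigma>1 \<sigma>2 a b c om z1 z2 z. 1 \<le> Nx \<Longrightarrow> 1 \<le> Ny \<Longrightarrow> 1 \<le> Nz \<Longrightarrow>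
    \<sigma>1 \<in> {-1, 1} \<Longrightarrow> \<sigma>2 \<in> {-1, 1} \<Longrightarrow> (\<forall>n. cmod (a n) \<le> 1) \<Longrightarrow> (\<forall>n. cmod (b n) \<le> 1) \<Longrightarrow> (\<forall>n. cmod (c n) \<le> 1) \<Longrightarrow>
    mod8_inv om \<Longrightarrow> 1 \<le> z \<Longrightarrow> z / 2 \<le> real (Suc z1) \<Longrightarrow> z / 2 \<le> real (Suc z2) \<Longrightarrow>
    cmod (\<Sum>x\<in>Om Nx Ny Nz bx. summand \<sigma>1 \<sigma>2 a b c om z1 z2 x)
    \<le> C1 * (real Nx * real Ny * real Nz) powr (1 + \<epsilon> / 2) * (z powr (- 1 / 9) + z powr (1 / 9) / sqrt (Mmin Nx Ny Nz))"
    using main_box[OF e2] by meson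
  obtain C2 where C2: "C2 \<ge> 1" and B2': "\<forall>Nx\<ge>1. \<forall>Ny\<ge>1. \<forall>Nz\<ge>1. \<forall>bx z. \<forall>(S, T, R, D)\<in>Om Nx Ny Nz bx.
    1 \<le> z \<longrightarrow> real (\<Prod>D) \<le> z \<longrightarrow> real (\<Prod>(npr S T R - D)) \<le> z \<longrightarrow>
    real (card (Om Nx Ny Nz bx)) \<le> C2 * (real Nx * real Ny * real Nz) powr (1 / 2 + \<epsilon> / 2) * z"
    using small_box[OF e2] by blast
  obtain C3 where C3: "C3 \<ge> 1" and B3: "\<And>Nx Ny Nz. 1 \<le> Nx \<Longrightarrow> 1 \<le> Ny \<Longrightarrow> 1 \<le> Nz \<Longrightarrow>
    real (card (boxfun ` OmAll Nx Ny Nz)) \<le> C3 * (real Nx * real Ny * real Nz) powr (\<epsilon> / 2)"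
    using card_boxes[OF e2] by blast
  define C where "C = C3 * (3 * C1 + 2 * C2)"
  have "1 * 1 \<le> C" unfolding C_def using C1 C2 C3 by (intro mult_mono) auto
  then have C: "C \<ge> 1" by simp
  show ?thesis
  proof (intro exI[of _ C] conjI C allI impI)
    fix Nx Ny Nz :: nat and \<sigma>1 \<sigma>2 :: int and a b c :: "nat \<Rightarrow> complex" and z :: real
    assume N1: "1 \<le> Nx" "1 \<le> Ny" "1 \<le> Nz"
      and asm: "\<sigma>1 \<in> {-1, 1}" "\<sigma>2 \<in> {-1, 1}" "\<forall>n. cmod (a n) \<le> 1" "\<forall>n. cmod (b n) \<le> 1" "\<forall>n. cmod (c n) \<le> 1"
      and z: "1 \<le> z"
    define N where "N = real Nx * real Ny * real Nz"
    have N: "N \<ge> 1" using N1 by (auto simp: N_def intro!: mult_ge1_I)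
    define Z1 where "Z1 = z powr (- 1 / 9) + z powr (1 / 9) / sqrt (Mmin Nx Ny Nz)"
    have Z1: "Z1 \<ge> 0" by (simp add: Z1_def Mmin_def)
    define A where "A = OmAll Nx Ny Nz"
    define Bs where "Bs = boxfun ` A"
    have finA: "finite A" unfolding A_def by (rule sum_OmAll(2))
    have cB: "real (card Bs) \<le> C3 * N powr (\<epsilon> / 2)" unfolding Bs_def A_def N_def by (rule B3[OF N1])
    \<comment> \<open>In order: the symbol at 2 vanishes; it does not vanish; the part multiplied by
      it.\<close>
    define f0 f1 f2 :: "int \<Rightarrow> complex" where "f0 = (\<lambda>h. of_bool (h = 0))" and "f1 = (\<lambda>h. of_bool (h \<noteq> 0))" and "f2 = of_int"
    \<comment> \<open>Integer thresholds: \<open>z < n\<close> is \<open>k1 < n\<close>, and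
      \<open>z < 2 * n\<close> is \<open>k2 < n\<close>. Both satisfy
      \<open>z / 2 \<le> real (Suc k)\<close>, as the bound for a box requires.\<close>
    define k1 k2 where "k1 = nat \<lfloor>z\<rfloor>" and "k2 = nat \<lfloor>z / 2\<rfloor>"
    define F where "F f y1 y2 = summand \<sigma>1 \<sigma>2 a b c (eta_weight \<sigma>1 \<sigma>2 f) y1 y2" for f y1 y2
    have group: "(\<Sum>x\<in>A. G x) = (\<Sum>bx\<in>Bs. \<Sum>x\<in>Om Nx Ny Nz bx. G x)" for G :: "_ \<Rightarrow> 'z :: comm_monoid_add"
      unfolding Bs_def Om_eq_OmAll A_def[symmetric] by (rule sum.image_gen[OF finA])
    have Fb: "cmod (\<Sum>x\<in>A. F f y1 y2 x) \<le> real (card Bs) * (C1 * N powr (1 + \<epsilon> / 2) * Z1)"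
      if f: "\<And>h. h \<in> {-1, 0, 1} \<Longrightarrow> cmod (f h) \<le> 1" and y: "z / 2 \<le> real (Suc y1)" "z / 2 \<le> real (Suc y2)" for f y1 y2
    proof -
      have "cmod (\<Sum>x\<in>A. F f y1 y2 x) \<le> (\<Sum>bx\<in>Bs. cmod (\<Sum>x\<in>Om Nx Ny Nz bx. F f y1 y2 x))"
        unfolding group by (rule norm_sum)
      also have "\<dots> \<le> (\<Sum>bx\<in>Bs. C1 * N powr (1 + \<epsilon> / 2) * Z1)"
        unfolding F_def N_def Z1_def by (intro sum_mono B1 N1 asm z y mod8_inv_eta_weight f)
      finally show ?thesis by simp
    qed
    define sm :: "nat \<times> nat \<times> nat \<times> nat set \<Rightarrow> bool" where "sm = (\<lambda>(S, T, R, D). real (\<Prod>D) \<le> z \<and> real (\<Prod>(npr S T R - D)) \<le> z)"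
    have Sb: "(\<Sum>x\<in>A. of_bool (sm x)) \<le> real (card Bs) * (C2 * N powr (1 / 2 + \<epsilon> / 2) * z)"
    proof -
      have "(\<Sum>x\<in>Om Nx Ny Nz bx. of_bool (sm x)) \<le> C2 * N powr (1 / 2 + \<epsilon> / 2) * z" for bx
      proof (cases "\<exists>x\<in>Om Nx Ny Nz bx. sm x")
        case True
        then obtain x where x: "x \<in> Om Nx Ny Nz bx" "sm x" by blast
        have "(\<Sum>x\<in>Om Nx Ny Nz bx. of_bool (sm x) :: real) \<le> (\<Sum>x\<in>Om Nx Ny Nz bx. 1)" by (intro sum_mono) auto
        also have "\<dots> = real (card (Om Nx Ny Nz bx))" by simp
        also have "\<dots> \<le> C2 * N powr (1 / 2 + \<epsilon> / 2) * z"
        proof -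
          obtain S T R D where xe: "x = (S, T, R, D)" by (cases x)
          note h = B2'[rule_format, OF N1 x(1), of z]
          show ?thesis using h x(2) z by (simp add: xe sm_def N_def)
        qed
        finally show ?thesis .
      next
        case False
        then have "(\<Sum>x\<in>Om Nx Ny Nz bx. of_bool (sm x) :: real) = 0" by (intro sum.neutral) auto
        then show ?thesis using C2 z by simp
      qed
      then have "(\<Sum>bx\<in>Bs. \<Sum>x\<in>Om Nx Ny Nz bx. of_bool (sm x)) \<le> (\<Sum>bx\<in>Bs. C2 * N powr (1 / 2 + \<epsilon> / 2) * z)" by (rule sum_mono)
      then show ?thesis unfolding group by simp
    qed
    define wt where "wt S T R D = (let \<eta> = hilbert' 2 (\<sigma>1 * int S * int R) (\<sigma>2 * int T * int R) in
      if \<eta> = 0 then tail_weight z (\<Prod>D) (\<Prod>(npr S T R - D))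
      else tail_weight z (\<Prod>D) (2 * \<Prod>(npr S T R - D)) + \<eta> * tail_weight z (2 * \<Prod>D) (\<Prod>(npr S T R - D)))" for S T R D
    define G :: "nat \<times> nat \<times> nat \<times> nat set \<Rightarrow> complex" where "G = (\<lambda>(S, T, R, D). a S * b T * c R * of_int ((\<Prod>p\<in>D. local_sym p (\<sigma>1 * int S * int R) (\<sigma>2 * int T * int R)) * wt S T R D))"
    have Gd: "cmod (G x - (F f0 k1 k1 x + F f1 k1 k2 x + F f2 k2 k1 x)) \<le> 2 * of_bool (sm x)" if x: "x \<in> A" for x
    proof -
      obtain S T R D where xe: "x = (S, T, R, D)" by (cases x)
      have pos: "S > 0" "T > 0" "R > 0" and D: "D \<subseteq> npr S T R" using x by (auto simp: A_def OmAll_def xe)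
      define t1 t2 where "t1 = \<sigma>1 * int S * int R" and "t2 = \<sigma>2 * int T * int R"
      have nz: "t1 \<noteq> 0" "t2 \<noteq> 0" using asm(1,2) pos by (auto simp: t1_def t2_def)
      define \<eta> where "\<eta> = hilbert' 2 t1 t2"
      have \<eta>: "\<eta> = -1 \<or> \<eta> = 0 \<or> \<eta> = 1" using hilbert'_values[of 2 t1 t2] by (auto simp: \<eta>_def)
      define d e where "d = \<Prod>D" and "e = \<Prod>(npr S T R - D)"
      define y where "y = a S * b T * c R * of_int (\<Prod>p\<in>D. local_sym p t1 t2)"
      have "cmod y = cmod (a S) * cmod (b T) * cmod (c R)"
        unfolding y_def norm_mult using cmod_prod_local_sym[OF npr_primes[OF D] nz] by (simp del: of_int_prod)
      also have "\<dots> \<le> 1 * 1 * 1" using asm by (intro mult_mono) auto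
      finally have y1: "cmod y \<le> 1" by simp
      have k: "k1 < n \<longleftrightarrow> z < real n" "k2 < n \<longleftrightarrow> z < 2 * real n" for n
        using z unfolding k1_def k2_def by (auto simp: nat_less_iff floor_less_iff)
      have Fe: "F f y1 y2 x = y * (f \<eta> * (of_bool (y1 < d) * of_bool (y2 < e)))" for f y1 y2
        by (simp add: F_def summand_def xe eta_weight_def t1_def t2_def \<eta>_def d_def e_def y_def)
      have Ge: "G x = y * of_int (if \<eta> = 0 then tail_weight z d e else tail_weight z d (2 * real e) + \<eta> * tail_weight z (2 * real d) e)"
        by (simp add: G_def wt_def Let_def xe t1_def t2_def \<eta>_def d_def e_def y_def)
      define u :: int where "u = (if \<eta> = 0 then tail_weight z d e else tail_weight z d (2 * real e) + \<eta> * tail_weight z (2 * real d) e)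
        - (of_bool (\<eta> = 0) * (of_bool (k1 < d) * of_bool (k1 < e)) + of_bool (\<eta> \<noteq> 0) * (of_bool (k1 < d) * of_bool (k2 < e)) + \<eta> * (of_bool (k2 < d) * of_bool (k1 < e)))"
      \<comment> \<open>The three summands remove the part of each \<open>tail_weight\<close> with
        both divisors large. At most two negative parts remain, and \<open>2 * e \<le> z\<close> or
        \<open>2 * d \<le> z\<close> still implies that both divisors are at most
        \<open>z\<close>.\<close>
      have "\<bar>u\<bar> \<le> 2 * of_bool (sm x)"
        using \<eta> unfolding u_def k tail_weight_def sm_def xe prod.case d_def[symmetric] e_def[symmetric]
        by (elim disjE; cases "z < real d"; cases "z < real e"; cases "z < 2 * real d"; cases "z < 2 * real e") (auto simp: not_less)
      then have "real_of_int \<bar>u\<bar> \<le> 2 * of_bool (sm x)" by (cases "sm x") simp_all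
      moreover have "G x - (F f0 k1 k1 x + F f1 k1 k2 x + F f2 k2 k1 x) = y * of_int u"
        unfolding Ge Fe u_def f0_def f1_def f2_def by (simp add: algebra_simps)
      then have "cmod (G x - (F f0 k1 k1 x + F f1 k1 k2 x + F f2 k2 k1 x)) = cmod y * real_of_int \<bar>u\<bar>"
        by (simp add: norm_mult)
      moreover have "cmod y * real_of_int \<bar>u\<bar> \<le> 1 * real_of_int \<bar>u\<bar>" by (rule mult_right_mono[OF y1]) simp
      ultimately show ?thesis by linarith
    qed
    have eq: "(\<Sum>S\<in>{1..Nx}. \<Sum>T\<in>{1..Ny}. \<Sum>R\<in>{1..Nz}. a S * b T * c R * of_int (delta_rand z (\<sigma>1 * int S * int R) (\<sigma>2 * int T * int R))) = (\<Sum>x\<in>A. G x)"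
    proof -
      have "(\<Sum>S\<in>{1..Nx}. \<Sum>T\<in>{1..Ny}. \<Sum>R\<in>{1..Nz}. a S * b T * c R * of_int (delta_rand z (\<sigma>1 * int S * int R) (\<sigma>2 * int T * int R)))
        = (\<Sum>S\<in>{1..Nx}. \<Sum>T\<in>{1..Ny}. \<Sum>R\<in>{1..Nz}. \<Sum>D\<in>Pow (npr S T R). G (S, T, R, D))"
      proof (intro sum.cong refl)
        fix S T R assume "S \<in> {1..Nx}" "T \<in> {1..Ny}" "R \<in> {1..Nz}"
        then have "delta_rand z (\<sigma>1 * int S * int R) (\<sigma>2 * int T * int R)
          = (\<Sum>D\<in>Pow (npr S T R). (\<Prod>p\<in>D. local_sym p (\<sigma>1 * int S * int R) (\<sigma>2 * int T * int R)) * wt S T R D)"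
          unfolding wt_def Let_def using asm z by (intro delta_rand_eq) auto
        then show "a S * b T * c R * of_int (delta_rand z (\<sigma>1 * int S * int R) (\<sigma>2 * int T * int R)) = (\<Sum>D\<in>Pow (npr S T R). G (S, T, R, D))"
          by (simp add: G_def sum_distrib_left)
      qed
      then show ?thesis unfolding sum_OmAll(1) A_def .
    qed
    have tri: "cmod (p + (q + r + s)) \<le> cmod p + (cmod q + cmod r + cmod s)" for p q r s
      using norm_triangle_ineq[of p "q + r + s"] norm_triangle_ineq[of "q + r" s] norm_triangle_ineq[of q r] by linarith
    let ?X = "real (card Bs) * (C1 * N powr (1 + \<epsilon> / 2) * Z1)"
    have "(\<Sum>x\<in>A. G x) = (\<Sum>x\<in>A. G x - (F f0 k1 k1 x + F f1 k1 k2 x + F f2 k2 k1 x)) + ((\<Sum>x\<in>A. F f0 k1 k1 x) + (\<Sum>x\<in>A. F f1 k1 k2 x) + (\<Sum>x\<in>A. F f2 k2 k1 x))"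
      by (simp add: sum_subtractf sum.distrib)
    then have "cmod (\<Sum>x\<in>A. G x) \<le> cmod (\<Sum>x\<in>A. G x - (F f0 k1 k1 x + F f1 k1 k2 x + F f2 k2 k1 x))
       + (cmod (\<Sum>x\<in>A. F f0 k1 k1 x) + cmod (\<Sum>x\<in>A. F f1 k1 k2 x) + cmod (\<Sum>x\<in>A. F f2 k2 k1 x))"
      using tri by simp
    also have "\<dots> \<le> (\<Sum>x\<in>A. 2 * of_bool (sm x)) + (?X + ?X + ?X)"
    proof (intro add_mono)
      show "cmod (\<Sum>x\<in>A. G x - (F f0 k1 k1 x + F f1 k1 k2 x + F f2 k2 k1 x)) \<le> (\<Sum>x\<in>A. 2 * of_bool (sm x))"
        by (rule order.trans[OF norm_sum sum_mono[OF Gd]])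
      have y: "z / 2 \<le> real (Suc k1)" "z / 2 \<le> real (Suc k2)" using z unfolding k1_def k2_def by linarith+
      show "cmod (\<Sum>x\<in>A. F f0 k1 k1 x) \<le> ?X" by (rule Fb[OF _ y(1) y(1)]) (auto simp: f0_def)
      show "cmod (\<Sum>x\<in>A. F f1 k1 k2 x) \<le> ?X" by (rule Fb[OF _ y(1) y(2)]) (auto simp: f1_def)
      show "cmod (\<Sum>x\<in>A. F f2 k2 k1 x) \<le> ?X" by (rule Fb[OF _ y(2) y(1)]) (auto simp: f2_def)
    qed
    also have "\<dots> \<le> 2 * (real (card Bs) * (C2 * N powr (1 / 2 + \<epsilon> / 2) * z)) + 3 * ?X"
      using Sb by (simp add: sum_distrib_left[symmetric])
    also have "\<dots> = real (card Bs) * (2 * C2 * (N powr (1 / 2 + \<epsilon> / 2) * z) + 3 * C1 * (N powr (1 + \<epsilon> / 2) * Z1))"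
      by (simp add: algebra_simps)
    also have "\<dots> \<le> (C3 * N powr (\<epsilon> / 2)) * (2 * C2 * (N powr (1 / 2 + \<epsilon> / 2) * z) + 3 * C1 * (N powr (1 + \<epsilon> / 2) * Z1))"
      using cB C1 C2 Z1 z by (intro mult_right_mono add_nonneg_nonneg mult_nonneg_nonneg) auto
    also have "\<dots> = C3 * (2 * C2 * (N powr (1 / 2 + \<epsilon>) * z) + 3 * C1 * (N powr (1 + \<epsilon>) * Z1))"
    proof -
      have p: "N powr (\<epsilon> / 2) * N powr (1 / 2 + \<epsilon> / 2) = N powr (1 / 2 + \<epsilon>)" "N powr (\<epsilon> / 2) * N powr (1 + \<epsilon> / 2) = N powr (1 + \<epsilon>)"
        by (simp_all add: powr_add[symmetric] add.commute)
      show ?thesis unfolding p[symmetric] by (simp add: algebra_simps)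
    qed
    also have "\<dots> \<le> C3 * ((3 * C1 + 2 * C2) * (N powr (1 / 2 + \<epsilon>) * z) + (3 * C1 + 2 * C2) * (N powr (1 + \<epsilon>) * Z1))"
      using C1 C2 C3 Z1 z by (intro mult_left_mono add_mono mult_right_mono) auto
    also have "\<dots> = C * (N powr (1 + \<epsilon>) * Z1 + N powr (1 / 2 + \<epsilon>) * z)" by (simp add: C_def algebra_simps)
    finally show "cmod (\<Sum>S\<in>{1..Nx}. \<Sum>T\<in>{1..Ny}. \<Sum>R\<in>{1..Nz}. a S * b T * c R * of_int (delta_rand z (\<sigma>1 * int S * int R) (\<sigma>2 * int T * int R)))
    \<le> C * ((real Nx * real Ny * real Nz) powr (1 + \<epsilon>) * (z powr (- 1 / 9) + z powr (1 / 9) / sqrt (Mmin Nx Ny Nz))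
        + (real Nx * real Ny * real Nz) powr (1 / 2 + \<epsilon>) * z)"
      unfolding eq N_def Z1_def .
  qed
qed

section \<open>Sums over tuples\<close>

lemma finite_tuples_upto: "finite (tuples_upto m x)"
proof -
  have "tuples_upto m x \<subseteq> (\<Pi>\<^sub>E i\<in>{..<m}. {..nat \<lfloor>x i\<rfloor>})"
    unfolding tuples_upto_def nat_tuples_def PiE_def Pi_def by (auto simp: le_nat_floor)
  then show ?thesis by (rule finite_subset) (intro finite_PiE; simp)
qed

lemma tuples_upto_prod:
  assumes "s \<in> tuples_upto m x"
  shows "(\<Prod>i<m. s i) \<in> {1..nat \<lfloor>\<Prod>i<m. x i\<rfloor>}"
proof -
  have s: "1 \<le> s i" "real (s i) \<le> x i" if "i < m" for i
    using assms that by (auto simp: tuples_upto_def nat_tuples_def PiE_def Pi_def)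
  have "real (\<Prod>i<m. s i) = (\<Prod>i<m. real (s i))" by simp
  also have "\<dots> \<le> (\<Prod>i<m. x i)" using s by (intro prod_mono) auto
  finally have "(\<Prod>i<m. s i) \<le> nat \<lfloor>\<Prod>i<m. x i\<rfloor>" by (rule le_nat_floor)
  moreover have "(\<Prod>i<m. s i) \<ge> 1" using s by (intro prod_ge_1) auto
  ultimately show ?thesis by simp
qed

lemma card_tuples_prod:
  assumes "S \<ge> 1"
  shows "card {s \<in> tuples_upto m x. (\<Prod>i<m. s i) = S} \<le> card {d. d dvd S} ^ m"
proof -
  have fin: "finite {d. d dvd S}" using assms by simp
  have "{s \<in> tuples_upto m x. (\<Prod>i<m. s i) = S} \<subseteq> (\<Pi>\<^sub>E i\<in>{..<m}. {d. d dvd S})"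
  proof
    fix s assume s: "s \<in> {s \<in> tuples_upto m x. (\<Prod>i<m. s i) = S}"
    then have "s i dvd S" if "i < m" for i using that dvd_prodI[of "{..<m}" i s] by auto
    moreover have "s \<in> extensional {..<m}" using s by (auto simp: tuples_upto_def nat_tuples_def PiE_def)
    ultimately show "s \<in> (\<Pi>\<^sub>E i\<in>{..<m}. {d. d dvd S})" by (auto simp: PiE_def)
  qed
  then have "card {s \<in> tuples_upto m x. (\<Prod>i<m. s i) = S} \<le> card (\<Pi>\<^sub>E i\<in>{..<m}. {d. d dvd S})"
    using fin by (intro card_mono finite_PiE) auto
  also have "\<dots> = card {d. d dvd S} ^ m" by (simp add: card_PiE)
  finally show ?thesis .
qed

text \<open>Tuples are grouped by their product \<open>S\<close>. All entries divide
  \<open>S\<close>, so a group has at most the \<open>m\<close>-th power of the divisor count of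
  \<open>S\<close> elements; dividing by a uniform bound gives coefficients \<open>\<alpha>\<close>
  of modulus at most 1. For \<open>m = 0\<close> the only product is 1.\<close>

lemma tuple_sum_reduction:
  assumes \<epsilon>: "\<epsilon> > 0"
  shows "\<exists>C\<ge>1. \<forall>x a. (\<forall>i<m. x i \<ge> 1) \<longrightarrow> (\<forall>s\<in>nat_tuples m. cmod (a s) \<le> 1) \<longrightarrow>
    (\<exists>\<alpha>. (\<forall>n. cmod (\<alpha> n) \<le> 1) \<and> (\<forall>G :: nat \<Rightarrow> complex.
      (\<Sum>s\<in>tuples_upto m x. a s * G (\<Prod>i<m. s i))
        = of_real (C * (\<Prod>i<m. x i) powr \<epsilon>) * (\<Sum>S\<in>{1..nat \<lfloor>\<Prod>i<m. x i\<rfloor>}. \<alpha> S * G S)))"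
proof -
  \<comment> \<open>\<open>Suc m\<close> instead of \<open>m\<close> keeps \<open>\<delta>\<close>
    positive when \<open>m = 0\<close>.\<close>
  define \<delta> where "\<delta> = \<epsilon> / Suc m"
  have \<delta>: "\<delta> > 0" using \<epsilon> by (simp add: \<delta>_def)
  have "real m * \<delta> = \<epsilon> * (real m / real (Suc m))" by (simp add: \<delta>_def)
  also have "\<dots> \<le> \<epsilon> * 1" using \<epsilon> by (intro mult_left_mono) auto
  finally have m\<delta>: "real m * \<delta> \<le> \<epsilon>" by simp
  obtain C1 where C1: "C1 \<ge> 1" "\<And>n. n \<ge> 1 \<Longrightarrow> real (card {d. d dvd n}) \<le> C1 * real n powr \<delta>"
    using divisor_bound[OF \<delta>] by auto
  define C where "C = C1 ^ m"
  have C: "C \<ge> 1" using C1(1) by (simp add: C_def)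
  show ?thesis
  proof (intro exI[of _ C] conjI C allI impI)
    fix x :: "nat \<Rightarrow> real" and a :: "(nat \<Rightarrow> nat) \<Rightarrow> complex"
    assume x: "\<forall>i<m. x i \<ge> 1" and a: "\<forall>s\<in>nat_tuples m. cmod (a s) \<le> 1"
    define Xp where "Xp = (\<Prod>i<m. x i)"
    have Xp: "Xp \<ge> 1" unfolding Xp_def using x by (intro prod_ge_1) auto
    define K where "K = C * Xp powr \<epsilon>"
    have K: "K > 0" using C Xp by (simp add: K_def)
    define I where "I = {1..nat \<lfloor>Xp\<rfloor>}"
    define A where "A S = (\<Sum>s | s \<in> tuples_upto m x \<and> (\<Prod>i<m. s i) = S. a s)" for S
    have AK: "cmod (A S) \<le> K" if "S \<in> I" for S
    proof -
      have S: "S \<ge> 1" "S \<le> nat \<lfloor>Xp\<rfloor>" using that by (auto simp: I_def)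
      then have SX: "real S \<le> Xp" using Xp by linarith
      have "cmod (A S) \<le> (\<Sum>s | s \<in> tuples_upto m x \<and> (\<Prod>i<m. s i) = S. 1)"
        unfolding A_def by (rule order.trans[OF norm_sum sum_mono]) (use a in \<open>auto simp: tuples_upto_def\<close>)
      also have "\<dots> = real (card {s \<in> tuples_upto m x. (\<Prod>i<m. s i) = S})" by simp
      also have "\<dots> \<le> real (card {d. d dvd S}) ^ m"
        using card_tuples_prod[OF S(1), of m x] by (simp only: of_nat_power[symmetric] of_nat_le_iff)
      also have "\<dots> \<le> (C1 * real S powr \<delta>) ^ m" using C1(2)[OF S(1)] by (intro power_mono) auto
      also have "\<dots> = C * (real S powr \<delta>) ^ m" by (simp add: C_def power_mult_distrib)
      also have "(real S powr \<delta>) ^ m = (real S powr \<delta>) powr real m" using S by (simp add: powr_realpow)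
      also have "\<dots> = real S powr (real m * \<delta>)" by (simp add: powr_powr mult.commute)
      also have "C * \<dots> \<le> C * real S powr \<epsilon>" using S C m\<delta> by (intro mult_left_mono powr_mono) auto
      also have "\<dots> \<le> K" unfolding K_def using SX C \<epsilon> by (intro mult_left_mono powr_mono2) auto
      finally show ?thesis .
    qed
    define \<alpha> where "\<alpha> S = (if S \<in> I then A S / of_real K else 0)" for S
    have "cmod (\<alpha> n) \<le> 1" for n using AK[of n] K by (auto simp: \<alpha>_def norm_divide)
    moreover have "(\<Sum>s\<in>tuples_upto m x. a s * G (\<Prod>i<m. s i)) = of_real K * (\<Sum>S\<in>I. \<alpha> S * G S)" for G :: "nat \<Rightarrow> complex"
    proof -
      have "(\<Sum>s\<in>tuples_upto m x. a s * G (\<Prod>i<m. s i))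
        = (\<Sum>S\<in>I. \<Sum>s | s \<in> tuples_upto m x \<and> (\<Prod>i<m. s i) = S. a s * G (\<Prod>i<m. s i))"
        by (rule sum.group[symmetric, OF finite_tuples_upto])
          (use tuples_upto_prod in \<open>auto simp: I_def Xp_def\<close>)
      also have "\<dots> = (\<Sum>S\<in>I. A S * G S)"
        unfolding A_def sum_distrib_right by (intro sum.cong) auto
      also have "\<dots> = (\<Sum>S\<in>I. of_real K * (\<alpha> S * G S))"
        using K by (intro sum.cong) (auto simp: \<alpha>_def)
      finally show ?thesis by (simp add: sum_distrib_left)
    qed
    ultimately show "\<exists>\<alpha>. (\<forall>n. cmod (\<alpha> n) \<le> 1) \<and> (\<forall>G :: nat \<Rightarrow> complex.
      (\<Sum>s\<in>tuples_upto m x. a s * G (\<Prod>i<m. s i))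
        = of_real (C * (\<Prod>i<m. x i) powr \<epsilon>) * (\<Sum>S\<in>{1..nat \<lfloor>\<Prod>i<m. x i\<rfloor>}. \<alpha> S * G S))"
      unfolding K_def I_def Xp_def by blast
  qed
qed

theorem theorem1p13:
  fixes m1 m2 m3 :: nat and \<epsilon> :: real
  assumes "m1 > 0" and "m2 > 0" and "\<epsilon> > 0"
  shows "\<exists>C::real. \<forall>(\<sigma>1::int) (\<sigma>2::int)
      (a :: (nat \<Rightarrow> nat) \<Rightarrow> complex) (b :: (nat \<Rightarrow> nat) \<Rightarrow> complex) (c :: (nat \<Rightarrow> nat) \<Rightarrow> complex)
      (x :: nat \<Rightarrow> real) (y :: nat \<Rightarrow> real) (w :: nat \<Rightarrow> real) (z :: real).
    \<sigma>1 \<in> {-1, 1} \<longrightarrow> \<sigma>2 \<in> {-1, 1} \<longrightarrow>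
    (\<forall>s\<in>nat_tuples m1. cmod (a s) \<le> 1) \<longrightarrow>
    (\<forall>t\<in>nat_tuples m2. cmod (b t) \<le> 1) \<longrightarrow>
    (\<forall>r\<in>nat_tuples m3. cmod (c r) \<le> 1) \<longrightarrow>
    (\<forall>i<m1. x i \<ge> 1) \<longrightarrow> (\<forall>i<m2. y i \<ge> 1) \<longrightarrow> (\<forall>i<m3. w i \<ge> 1) \<longrightarrow> z \<ge> 1 \<longrightarrow>
    (let Xp = (\<Prod>i<m1. x i); Yp = (\<Prod>i<m2. y i); Zp = (\<Prod>i<m3. w i);
         M = (if m3 = 0 then min Xp Yp else min Xp (min Yp Zp))
     in cmod (\<Sum>s\<in>tuples_upto m1 x. \<Sum>t\<in>tuples_upto m2 y. \<Sum>r\<in>tuples_upto m3 w.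
              of_int (delta_rand z (\<sigma>1 * int (\<Prod>i<m1. s i) * int (\<Prod>i<m3. r i))
                                   (\<sigma>2 * int (\<Prod>i<m2. t i) * int (\<Prod>i<m3. r i)))
              * a s * b t * c r)
        \<le> C * ((Xp * Yp * Zp) powr (1 + \<epsilon>)
             * (1 / z powr (1/9) + z powr (1/9) / sqrt M + z / sqrt (Xp * Yp * Zp)
                + (if m3 = 0 then z powr (4/9) / min Xp Yp else 0))))"
proof -
  \<comment> \<open>Half of \<open>\<epsilon>\<close> pays for collapsing tuples to products, half
    for the core sum.\<close>
  define e where "e = \<epsilon> / 2"
  have e: "e > 0" using assms by (simp add: e_def)
  obtain C1 where C1: "C1 \<ge> 1" and R1: "\<And>x a. (\<forall>i<m1. x i \<ge> 1) \<Longrightarrow> (\<forall>s\<in>nat_tuples m1. cmod (a s) \<le> 1) \<Longrightarrow>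
    \<exists>\<alpha>. (\<forall>n. cmod (\<alpha> n) \<le> 1) \<and> (\<forall>G :: nat \<Rightarrow> complex. (\<Sum>s\<in>tuples_upto m1 x. a s * G (\<Prod>i<m1. s i))
        = of_real (C1 * (\<Prod>i<m1. x i) powr e) * (\<Sum>S\<in>{1..nat \<lfloor>\<Prod>i<m1. x i\<rfloor>}. \<alpha> S * G S))"
    using tuple_sum_reduction[OF e, of m1] by blast
  obtain C2 where C2: "C2 \<ge> 1" and R2: "\<And>x a. (\<forall>i<m2. x i \<ge> 1) \<Longrightarrow> (\<forall>s\<in>nat_tuples m2. cmod (a s) \<le> 1) \<Longrightarrow>
    \<exists>\<alpha>. (\<forall>n. cmod (\<alpha> n) \<le> 1) \<and> (\<forall>G :: nat \<Rightarrow> complex. (\<Sum>s\<in>tuples_upto m2 x. a s * G (\<Prod>i<m2. s i))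
        = of_real (C2 * (\<Prod>i<m2. x i) powr e) * (\<Sum>S\<in>{1..nat \<lfloor>\<Prod>i<m2. x i\<rfloor>}. \<alpha> S * G S))"
    using tuple_sum_reduction[OF e, of m2] by blast
  obtain C3 where C3: "C3 \<ge> 1" and R3: "\<And>x a. (\<forall>i<m3. x i \<ge> 1) \<Longrightarrow> (\<forall>s\<in>nat_tuples m3. cmod (a s) \<le> 1) \<Longrightarrow>
    \<exists>\<alpha>. (\<forall>n. cmod (\<alpha> n) \<le> 1) \<and> (\<forall>G :: nat \<Rightarrow> complex. (\<Sum>s\<in>tuples_upto m3 x. a s * G (\<Prod>i<m3. s i))
        = of_real (C3 * (\<Prod>i<m3. x i) powr e) * (\<Sum>S\<in>{1..nat \<lfloor>\<Prod>i<m3. x i\<rfloor>}. \<alpha> S * G S))"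
    using tuple_sum_reduction[OF e, of m3] by blast
  obtain C0 where C0: "C0 \<ge> 1" and core: "\<And>Nx Ny Nz \<sigma>1 \<sigma>2 a b c z. 1 \<le> Nx \<Longrightarrow> 1 \<le> Ny \<Longrightarrow> 1 \<le> Nz \<Longrightarrow>
    \<sigma>1 \<in> {-1, 1} \<Longrightarrow> \<sigma>2 \<in> {-1, 1} \<Longrightarrow> (\<forall>n. cmod (a n) \<le> 1) \<Longrightarrow> (\<forall>n. cmod (b n) \<le> 1) \<Longrightarrow> (\<forall>n. cmod (c n) \<le> 1) \<Longrightarrow> 1 \<le> z \<Longrightarrow>
    cmod (\<Sum>S\<in>{1..Nx}. \<Sum>T\<in>{1..Ny}. \<Sum>R\<in>{1..Nz}. a S * b T * c R * of_int (delta_rand z (\<sigma>1 * int S * int R) (\<sigma>2 * int T * int R)))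
    \<le> C0 * ((real Nx * real Ny * real Nz) powr (1 + e) * (z powr (- 1 / 9) + z powr (1 / 9) / sqrt (Mmin Nx Ny Nz))
        + (real Nx * real Ny * real Nz) powr (1 / 2 + e) * z)"
    using core_sum[OF e] by meson
  define C where "C = C1 * C2 * C3 * (C0 * 2)"
  show ?thesis
  proof (intro exI[of _ C] allI impI)
    fix \<sigma>1 \<sigma>2 :: int and a b c :: "(nat \<Rightarrow> nat) \<Rightarrow> complex" and x y w :: "nat \<Rightarrow> real" and z :: real
    assume \<sigma>: "\<sigma>1 \<in> {-1, 1}" "\<sigma>2 \<in> {-1, 1}"
      and abc: "\<forall>s\<in>nat_tuples m1. cmod (a s) \<le> 1" "\<forall>t\<in>nat_tuples m2. cmod (b t) \<le> 1" "\<forall>r\<in>nat_tuples m3. cmod (c r) \<le> 1"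
      and xyw: "\<forall>i<m1. x i \<ge> 1" "\<forall>i<m2. y i \<ge> 1" "\<forall>i<m3. w i \<ge> 1" and z: "z \<ge> 1"
    define Xp Yp Zp where "Xp = (\<Prod>i<m1. x i)" and "Yp = (\<Prod>i<m2. y i)" and "Zp = (\<Prod>i<m3. w i)"
    define Nx Ny Nz where "Nx = nat \<lfloor>Xp\<rfloor>" and "Ny = nat \<lfloor>Yp\<rfloor>" and "Nz = nat \<lfloor>Zp\<rfloor>"
    define M where "M = (if m3 = 0 then min Xp Yp else min Xp (min Yp Zp))"
    define V where "V = Xp * Yp * Zp"
    have p1: "Xp \<ge> 1" "Yp \<ge> 1" "Zp \<ge> 1" unfolding Xp_def Yp_def Zp_def using xyw by (auto intro!: prod_ge_1)
    have V1: "V \<ge> 1" using p1 by (auto simp: V_def intro!: mult_ge1_I)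
    have M1: "M \<ge> 1" using p1 by (auto simp: M_def)
    have N1: "1 \<le> Nx" "1 \<le> Ny" "1 \<le> Nz" using p1 unfolding Nx_def Ny_def Nz_def by linarith+
    have Nle: "real Nx \<le> Xp" "real Ny \<le> Yp" "real Nz \<le> Zp" using p1 unfolding Nx_def Ny_def Nz_def by linarith+
    have Nge: "Xp / 2 \<le> real Nx" "Yp / 2 \<le> real Ny" "Zp / 2 \<le> real Nz" proof -
      have half: "t / 2 \<le> real (nat \<lfloor>t\<rfloor>)" if "t \<ge> 1" for t :: real
      proof -
        have "1 \<le> \<lfloor>t\<rfloor>" using that by (simp add: le_floor_iff)
        then have "real (nat \<lfloor>t\<rfloor>) = of_int \<lfloor>t\<rfloor>" "(1::real) \<le> of_int \<lfloor>t\<rfloor>" by simp_all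
        then show ?thesis using real_of_int_floor_add_one_gt[of t] by linarith
      qed
      show "Xp / 2 \<le> real Nx" "Yp / 2 \<le> real Ny" "Zp / 2 \<le> real Nz" unfolding Nx_def Ny_def Nz_def by (intro half p1)+
    qed
    obtain \<alpha> where \<alpha>: "\<forall>n. cmod (\<alpha> n) \<le> 1" "\<And>G :: nat \<Rightarrow> complex. (\<Sum>s\<in>tuples_upto m1 x. a s * G (\<Prod>i<m1. s i))
        = of_real (C1 * Xp powr e) * (\<Sum>S\<in>{1..Nx}. \<alpha> S * G S)"
      using R1[OF xyw(1) abc(1)] unfolding Xp_def[symmetric] Nx_def[symmetric] by blast
    obtain \<beta> where \<beta>: "\<forall>n. cmod (\<beta> n) \<le> 1" "\<And>G :: nat \<Rightarrow> complex. (\<Sum>t\<in>tuples_upto m2 y. b t * G (\<Prod>i<m2. t i))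
        = of_real (C2 * Yp powr e) * (\<Sum>T\<in>{1..Ny}. \<beta> T * G T)"
      using R2[OF xyw(2) abc(2)] unfolding Yp_def[symmetric] Ny_def[symmetric] by blast
    obtain \<gamma> where \<gamma>: "\<forall>n. cmod (\<gamma> n) \<le> 1" "\<And>G :: nat \<Rightarrow> complex. (\<Sum>r\<in>tuples_upto m3 w. c r * G (\<Prod>i<m3. r i))
        = of_real (C3 * Zp powr e) * (\<Sum>R\<in>{1..Nz}. \<gamma> R * G R)"
      using R3[OF xyw(3) abc(3)] unfolding Zp_def[symmetric] Nz_def[symmetric] by blast
    define d :: "nat \<Rightarrow> nat \<Rightarrow> nat \<Rightarrow> complex" where "d S T R = of_int (delta_rand z (\<sigma>1 * int S * int R) (\<sigma>2 * int T * int R))" for S T R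
    define K where "K = C1 * Xp powr e * (C2 * Yp powr e) * (C3 * Zp powr e)"
    have K: "K = C1 * C2 * C3 * V powr e" using p1 by (simp add: K_def V_def powr_mult)
    let ?L = "\<Sum>s\<in>tuples_upto m1 x. \<Sum>t\<in>tuples_upto m2 y. \<Sum>r\<in>tuples_upto m3 w.
       d (\<Prod>i<m1. s i) (\<Prod>i<m2. t i) (\<Prod>i<m3. r i) * a s * b t * c r"
    have "?L = (\<Sum>s\<in>tuples_upto m1 x. a s * (\<Sum>t\<in>tuples_upto m2 y. b t * (\<Sum>r\<in>tuples_upto m3 w. c r * d (\<Prod>i<m1. s i) (\<Prod>i<m2. t i) (\<Prod>i<m3. r i))))"
      unfolding sum_distrib_left by (intro sum.cong refl) (simp only: mult_ac)
    also have "\<dots> = of_real (C1 * Xp powr e) * (\<Sum>S\<in>{1..Nx}. \<alpha> S * (of_real (C2 * Yp powr e) * (\<Sum>T\<in>{1..Ny}. \<beta> T *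
        (of_real (C3 * Zp powr e) * (\<Sum>R\<in>{1..Nz}. \<gamma> R * d S T R)))))"
      unfolding \<gamma>(2)[of "d _ _"]
      unfolding \<beta>(2)[of "\<lambda>T. of_real (C3 * Zp powr e) * (\<Sum>R\<in>{1..Nz}. \<gamma> R * d _ T R)"]
      by (rule \<alpha>(2))
    also have "\<dots> = of_real K * (\<Sum>S\<in>{1..Nx}. \<Sum>T\<in>{1..Ny}. \<Sum>R\<in>{1..Nz}. \<alpha> S * \<beta> T * \<gamma> R * d S T R)"
      unfolding K_def sum_distrib_left of_real_mult by (intro sum.cong refl) (simp only: mult_ac)
    finally have L: "?L = of_real K * (\<Sum>S\<in>{1..Nx}. \<Sum>T\<in>{1..Ny}. \<Sum>R\<in>{1..Nz}. \<alpha> S * \<beta> T * \<gamma> R * d S T R)" .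
    define N where "N = real Nx * real Ny * real Nz"
    have NV: "0 \<le> N" "N \<le> V" unfolding N_def V_def using Nle p1 by (auto intro!: mult_mono)
    \<comment> \<open>Rounding the ranges down to integers at most halves them. With
      \<open>m3 = 0\<close> the empty product gives \<open>Nz = 1\<close>, the case singled out in
      \<open>Mmin\<close>.\<close>
    have M2: "M / 2 \<le> Mmin Nx Ny Nz"
    proof -
      have l: "min (real Nx) (min (real Ny) (real Nz)) \<le> Mmin Nx Ny Nz" by (auto simp: Mmin_def min_def)
      show ?thesis
      proof (cases "m3 = 0")
        case True
        then have "Mmin Nx Ny Nz = min (real Nx) (real Ny)" by (simp add: Mmin_def Nz_def Zp_def)
        moreover have "M = min Xp Yp" using True by (simp add: M_def)
        ultimately show ?thesis using Nge by linarith
      next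
        case False
        then have "M = min Xp (min Yp Zp)" by (simp add: M_def)
        then show ?thesis using Nge l by linarith
      qed
    qed
    have Mm0: "Mmin Nx Ny Nz > 0" using M1 M2 by linarith
    have "sqrt M / 2 = sqrt (M / 4)" by (simp add: real_sqrt_divide)
    also have "\<dots> \<le> sqrt (Mmin Nx Ny Nz)" using M2 M1 by simp
    finally have sM: "sqrt M / 2 \<le> sqrt (Mmin Nx Ny Nz)" .
    define Z1 where "Z1 = 1 / z powr (1 / 9)"
    define Z2 where "Z2 = z powr (1 / 9) / sqrt M"
    define Z3 where "Z3 = z / sqrt V"
    define Z4 where "Z4 = (if m3 = 0 then z powr (4 / 9) / min Xp Yp else 0)"
    have Zpos: "0 \<le> Z1" "0 \<le> Z2" "0 \<le> Z3" "0 \<le> Z4" using z p1 M1 V1 by (auto simp: Z1_def Z2_def Z3_def Z4_def)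
    have z1: "z powr (- 1 / 9) = Z1" using powr_minus_divide[of z "1 / 9"] by (simp add: Z1_def)
    have z2: "z powr (1 / 9) / sqrt (Mmin Nx Ny Nz) \<le> 2 * Z2"
    proof -
      have "z powr (1 / 9) / sqrt (Mmin Nx Ny Nz) \<le> z powr (1 / 9) / (sqrt M / 2)" using sM M1 Mm0 by (intro divide_left_mono mult_pos_pos) auto
      then show ?thesis by (simp add: Z2_def mult.commute)
    qed
    have z3: "V powr (1 / 2 + e) * z = V powr (1 + e) * Z3"
    proof -
      have "V powr (1 + e) = V powr (1 / 2 + e) * V powr (1 / 2)" unfolding powr_add[symmetric] by (simp add: add.commute)
      then have "V powr (1 + e) = V powr (1 / 2 + e) * sqrt V" using V1 by (simp add: powr_half_sqrt)
      then show ?thesis using V1 by (simp add: Z3_def)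
    qed
    have "cmod (\<Sum>S\<in>{1..Nx}. \<Sum>T\<in>{1..Ny}. \<Sum>R\<in>{1..Nz}. \<alpha> S * \<beta> T * \<gamma> R * d S T R)
      \<le> C0 * (N powr (1 + e) * (z powr (- 1 / 9) + z powr (1 / 9) / sqrt (Mmin Nx Ny Nz)) + N powr (1 / 2 + e) * z)"
      unfolding d_def N_def by (rule core[OF N1 \<sigma> \<alpha>(1) \<beta>(1) \<gamma>(1) z])
    also have "\<dots> \<le> C0 * (V powr (1 + e) * (Z1 + 2 * Z2) + V powr (1 / 2 + e) * z)"
      proof -
      have a: "N powr (1 + e) \<le> V powr (1 + e)" "N powr (1 / 2 + e) \<le> V powr (1 / 2 + e)" using NV e by (auto intro!: powr_mono2)
      have b: "Z1 + z powr (1 / 9) / sqrt (Mmin Nx Ny Nz) \<le> Z1 + 2 * Z2" using z2 by simp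
      show ?thesis unfolding z1
        by (rule mult_left_mono[OF add_mono[OF mult_mono[OF a(1) b] mult_right_mono[OF a(2)]]]) (use C0 z Zpos Mm0 in auto)
    qed
    also have "\<dots> \<le> (C0 * 2) * (V powr (1 + e) * (Z1 + Z2 + Z3 + Z4))"
    proof -
      have "V powr (1 + e) * (Z1 + 2 * Z2) + V powr (1 / 2 + e) * z = V powr (1 + e) * (Z1 + 2 * Z2 + Z3)"
        unfolding z3 by (simp add: algebra_simps)
      also have "\<dots> \<le> V powr (1 + e) * (2 * (Z1 + Z2 + Z3 + Z4))" using Zpos by (intro mult_left_mono) auto
      finally have "C0 * (V powr (1 + e) * (Z1 + 2 * Z2) + V powr (1 / 2 + e) * z) \<le> C0 * (V powr (1 + e) * (2 * (Z1 + Z2 + Z3 + Z4)))"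
        using C0 by (intro mult_left_mono) auto
      then show ?thesis by (simp only: mult_ac)
    qed
    finally have S: "cmod (\<Sum>S\<in>{1..Nx}. \<Sum>T\<in>{1..Ny}. \<Sum>R\<in>{1..Nz}. \<alpha> S * \<beta> T * \<gamma> R * d S T R)
      \<le> (C0 * 2) * (V powr (1 + e) * (Z1 + Z2 + Z3 + Z4))" .
    have K0: "K \<ge> 0" unfolding K using C1 C2 C3 by simp
    have "cmod ?L = K * cmod (\<Sum>S\<in>{1..Nx}. \<Sum>T\<in>{1..Ny}. \<Sum>R\<in>{1..Nz}. \<alpha> S * \<beta> T * \<gamma> R * d S T R)"
      unfolding L norm_mult using K0 by simp
    also have "\<dots> \<le> K * ((C0 * 2) * (V powr (1 + e) * (Z1 + Z2 + Z3 + Z4)))" by (rule mult_left_mono[OF S K0])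
    also have "\<dots> = C * ((V powr e * V powr (1 + e)) * (Z1 + Z2 + Z3 + Z4))" unfolding K C_def by (simp only: mult_ac)
    also have "V powr e * V powr (1 + e) = V powr (1 + \<epsilon>)" by (simp add: powr_add[symmetric] e_def add.commute)
    finally have fin: "cmod ?L \<le> C * (V powr (1 + \<epsilon>) * (Z1 + Z2 + Z3 + Z4))" .
    show "let Xp = \<Prod>i<m1. x i; Yp = \<Prod>i<m2. y i; Zp = \<Prod>i<m3. w i;
         M = if m3 = 0 then min Xp Yp else min Xp (min Yp Zp)
     in cmod (\<Sum>s\<in>tuples_upto m1 x. \<Sum>t\<in>tuples_upto m2 y. \<Sum>r\<in>tuples_upto m3 w.
              of_int (delta_rand z (\<sigma>1 * int (\<Prod>i<m1. s i) * int (\<Prod>i<m3. r i))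
                                   (\<sigma>2 * int (\<Prod>i<m2. t i) * int (\<Prod>i<m3. r i)))
              * a s * b t * c r)
        \<le> C * ((Xp * Yp * Zp) powr (1 + \<epsilon>)
             * (1 / z powr (1/9) + z powr (1/9) / sqrt M + z / sqrt (Xp * Yp * Zp)
                + (if m3 = 0 then z powr (4/9) / min Xp Yp else 0)))"
      using fin unfolding Let_def d_def V_def Z1_def Z2_def Z3_def Z4_def M_def Xp_def Yp_def Zp_def .
  qed
qed

end
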